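(* Let $\mathcal{C}$ be a connected cogroupoid such that $S_{X,Y}$ is bijective for all $X,Y\in \mathrm{ob}(\mathcal{C})$. Let $X$ be an object in $\mathcal{C}$ such that $\mathcal{C}(X,X)$ is a twisted Calabi-Yau algebra of dimension $d$ with homological integral $\int^l_{\mathcal{C}(X,X)}=\Bbbk_\xi$, where $\xi:\mathcal{C}(X,X)\to \Bbbk$ is an algebra homomorphism. Then for any $Y\in \mathrm{ob}(\mathcal{C})$, the algebra $\mathcal{C}(X,Y)$ is twisted Calabi-Yau of dimension $d$ with Nakayama automorphism $\mu$ defined by $$\mu(x)=\xi(x_1^{X,X})\,S_{Y,X}(S_{X,Y}(x_2^{X,Y}))$$ for any $x\in \mathcal{C}(X,Y)$.
   Context: $\Bbbk$ is a fixed field; all algebras are unital associative $\Bbbk$-algebras, and $\otimes=\otimes_\Bbbk$. Cogroupoids. A cocategory $\mathcal{C}$ consists of a set of objects $\mathrm{ob}(\mathcal{C})$; for any objects $X,Y$ an algebra $\mathcal{C}(X,Y)$; and for any objects $X,Y,Z$ algebra homomorphisms $\Delta^Z_{X,Y}:\mathcal{C}(X,Y)\to \mathcal{C}(X,Z)\otimes \mathcal{C}(Z,Y)$ and $\varepsilon_X:\mathcal{C}(X,X)\to \Bbbk$, such that for all objects $X,Y,Z,T$: $(\Delta^T_{X,Z}\otimes 1)\circ\Delta^Z_{X,Y}=(1\otimes \Delta^Z_{T,Y})\circ\Delta^T_{X,Y}$, $(1\otimes\varepsilon_Y)\circ\Delta^Y_{X,Y}=\mathrm{id}$ and $(\varepsilon_X\otimes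 1)\circ\Delta^X_{X,Y}=\mathrm{id}$. It is connected if $\mathcal{C}(X,Y)\neq 0$ for all objects $X,Y$. A cogroupoid is a cocategory together with linear maps $S_{X,Y}:\mathcal{C}(X,Y)\to\mathcal{C}(Y,X)$ for all objects $X,Y$ such that, writing (Sweedler notation) $\Delta^Z_{X,Y}(a)=a_1^{X,Z}\otimes a_2^{Z,Y}$, for all $a\in\mathcal{C}(X,X)$: $a_1^{X,Y}S_{Y,X}(a_2^{Y,X})=\varepsilon_X(a)1$ in $\mathcal{C}(X,Y)$ and $S_{X,Y}(a_1^{X,Y})a_2^{Y,X}=\varepsilon_X(a)1$ in $\mathcal{C}(Y,X)$. Each $\mathcal{C}(X,X)$ is a Hopf algebra, with counit $\varepsilon_X$ and antipode $S_{X,X}$. Twisted Calabi-Yau algebras. For an algebra $A$ let $A^e=A\otimes A^{op}$; $A$-bimodules are identified with $A^e$-modules. For an automorphism $\mu$ of $A$, $A^\mu$ is the bimodule with underlying space $A$ and $a\cdot m\cdot b=am\mu(b)$. $A$ is twisted Calabi-Yau (CY) of dimension $d$ if (i) $A$ is homologically smooth, i.e. $A$ has a bounded resolution by finitely generated projective $A^e$-modules, and (ii) there is an algebra automorphism $\mu$ of $A$ such that $\mathrm{Ext}^i_{A^e}(A,A^e)=0$ for $i\ne d$ and $\mathrm{Ext}^d_{A^e}(A,A^e)\cong A^\mu$ as $A^e$-modules, where Ext is computed with the left $A^e$-module structure $(a\otimes b)\cdot(x\otimes y)=ax\otimes yb$ on $A^e$ and the bimodule structure on Ext comes from the right structure $(x\otimes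 y)\cdot(a\otimes b)=xa\otimes by$. Such $\mu$ is unique up to inner automorphisms and is called the Nakayama automorphism. Homological integral. If $A$ is a twisted CY algebra of dimension $d$ with augmentation $\varepsilon:A\to\Bbbk$ (e.g. a Hopf algebra with its counit), then $\int^l_A$ denotes the one-dimensional right $A$-module $\mathrm{Ext}^d_A({}_A\Bbbk,{}_AA)$. For an algebra homomorphism $\xi:A\to\Bbbk$, $\Bbbk_\xi$ is the one-dimensional right module on which $A$ acts through $\xi$; $\int^l_A=\Bbbk_\xi$ means isomorphism of right $A$-modules. *)

theory Defs
  imports "HOL-Algebra.Module" "HOL-Algebra.AbelCoset"
begin

section \<open>Algebras over a field\<close>

text \<open>
  The record \<^type>\<open>module\<close> carries both a ring structure and a scalar multiplication, so it serves
  for \<open>k\<close>-algebras as well as for modules.  For modules the fields \<^const>\<open>mult\<close> and \<^const>\<open>one\<close> are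
  irrelevant.
\<close>

definition unital_algebra :: "'k ring \<Rightarrow> ('k, 'a) module \<Rightarrow> bool" where
  "unital_algebra k A \<longleftrightarrow> module k A \<and> ring A \<and>
     (\<forall>c\<in>carrier k. \<forall>x\<in>carrier A. \<forall>y\<in>carrier A.
        (c \<odot>\<^bsub>A\<^esub> x) \<otimes>\<^bsub>A\<^esub> y = c \<odot>\<^bsub>A\<^esub> (x \<otimes>\<^bsub>A\<^esub> y) \<and>
        x \<otimes>\<^bsub>A\<^esub> (c \<odot>\<^bsub>A\<^esub> y) = c \<odot>\<^bsub>A\<^esub> (x \<otimes>\<^bsub>A\<^esub> y))"

definition with_action :: "('a, 'm) ring_scheme \<Rightarrow> ('r \<Rightarrow> 'a \<Rightarrow> 'a) \<Rightarrow> ('r, 'a) module" where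
  "with_action G act =
     \<lparr>carrier = carrier G, mult = mult G, one = one G, zero = zero G, add = add G, smult = act\<rparr>"

definition ground :: "'k ring \<Rightarrow> ('k, 'k) module" where
  "ground k = with_action k (mult k)"

definition linear_maps ::
    "('r, 'x) ring_scheme \<Rightarrow> ('r, 'm) module \<Rightarrow> ('r, 'n) module \<Rightarrow> ('m \<Rightarrow> 'n) set" where
  "linear_maps R M N = {f \<in> carrier M \<rightarrow> carrier N.
     (\<forall>x\<in>carrier M. \<forall>y\<in>carrier M. f (x \<oplus>\<^bsub>M\<^esub> y) = f x \<oplus>\<^bsub>N\<^esub> f y) \<and>
     (\<forall>r\<in>carrier R. \<forall>x\<in>carrier M. f (r \<odot>\<^bsub>M\<^esub> x) = r \<odot>\<^bsub>N\<^esub> f x)}"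

definition module_iso ::
    "('r, 'x) ring_scheme \<Rightarrow> ('r, 'm) module \<Rightarrow> ('r, 'n) module \<Rightarrow> bool" where
  "module_iso R M N \<longleftrightarrow> (\<exists>f\<in>linear_maps R M N. bij_betw f (carrier M) (carrier N))"

definition algebra_homs ::
    "'k ring \<Rightarrow> ('k, 'a) module \<Rightarrow> ('k, 'b) module \<Rightarrow> ('a \<Rightarrow> 'b) set" where
  "algebra_homs k A B = ring_hom A B \<inter> linear_maps k A B"

definition opposite :: "('k, 'a) module \<Rightarrow> ('k, 'a) module" where
  "opposite A = A\<lparr>mult := (\<lambda>x y. y \<otimes>\<^bsub>A\<^esub> x)\<rparr>"


section \<open>Tensor products\<close>

text \<open>
  \<open>V \<otimes> W\<close> is presented by generators and relations: a list \<open>[(v\<^sub>1,w\<^sub>1),\<dots>,(v\<^sub>n,w\<^sub>n)]\<close> stands for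
  \<open>v\<^sub>1 \<otimes> w\<^sub>1 + \<dots> + v\<^sub>n \<otimes> w\<^sub>n\<close>, and tensors are classes of lists for the congruence generated by
  bilinearity.
\<close>

inductive tensor_eq ::
    "'k ring \<Rightarrow> ('k, 'v) module \<Rightarrow> ('k, 'w) module \<Rightarrow> ('v \<times> 'w) list \<Rightarrow> ('v \<times> 'w) list \<Rightarrow> bool"
  for k V W where
  refl: "ps \<in> lists (carrier V \<times> carrier W) \<Longrightarrow> tensor_eq k V W ps ps"
| sym: "tensor_eq k V W ps qs \<Longrightarrow> tensor_eq k V W qs ps"
| trans: "tensor_eq k V W ps qs \<Longrightarrow> tensor_eq k V W qs rs \<Longrightarrow> tensor_eq k V W ps rs"
| append: "tensor_eq k V W ps ps' \<Longrightarrow> tensor_eq k V W qs qs' \<Longrightarrow>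
    tensor_eq k V W (ps @ qs) (ps' @ qs')"
| commute: "ps \<in> lists (carrier V \<times> carrier W) \<Longrightarrow> qs \<in> lists (carrier V \<times> carrier W) \<Longrightarrow>
    tensor_eq k V W (ps @ qs) (qs @ ps)"
| zero: "w \<in> carrier W \<Longrightarrow> tensor_eq k V W [(\<zero>\<^bsub>V\<^esub>, w)] []"
| add_left: "v \<in> carrier V \<Longrightarrow> v' \<in> carrier V \<Longrightarrow> w \<in> carrier W \<Longrightarrow>
    tensor_eq k V W [(v \<oplus>\<^bsub>V\<^esub> v', w)] [(v, w), (v', w)]"
| add_right: "v \<in> carrier V \<Longrightarrow> w \<in> carrier W \<Longrightarrow> w' \<in> carrier W \<Longrightarrow>
    tensor_eq k V W [(v, w \<oplus>\<^bsub>W\<^esub> w')] [(v, w), (v, w')]"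
| scale: "c \<in> carrier k \<Longrightarrow> v \<in> carrier V \<Longrightarrow> w \<in> carrier W \<Longrightarrow>
    tensor_eq k V W [(c \<odot>\<^bsub>V\<^esub> v, w)] [(v, c \<odot>\<^bsub>W\<^esub> w)]"

definition tensor_class ::
    "'k ring \<Rightarrow> ('k, 'v) module \<Rightarrow> ('k, 'w) module \<Rightarrow> ('v \<times> 'w) list \<Rightarrow> ('v \<times> 'w) list set" where
  "tensor_class k V W ps = {qs. tensor_eq k V W ps qs}"

definition tensor ::
    "'k ring \<Rightarrow> ('k, 'v) module \<Rightarrow> ('k, 'w) module \<Rightarrow> ('k, ('v \<times> 'w) list set) module" where
  "tensor k V W =
     \<lparr>carrier = tensor_class k V W ` lists (carrier V \<times> carrier W),
      mult = (\<lambda>s t. \<Union>ps\<in>s. \<Union>qs\<in>t.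
        tensor_class k V W [(v \<otimes>\<^bsub>V\<^esub> v', w \<otimes>\<^bsub>W\<^esub> w'). (v, w) \<leftarrow> ps, (v', w') \<leftarrow> qs]),
      one = tensor_class k V W [(\<one>\<^bsub>V\<^esub>, \<one>\<^bsub>W\<^esub>)],
      zero = tensor_class k V W [],
      add = (\<lambda>s t. \<Union>ps\<in>s. \<Union>qs\<in>t. tensor_class k V W (ps @ qs)),
      smult = (\<lambda>c t. \<Union>ps\<in>t. tensor_class k V W [(c \<odot>\<^bsub>V\<^esub> v, w). (v, w) \<leftarrow> ps])\<rparr>"

text \<open>
  The linear map on \<open>V \<otimes> W\<close> induced by a bilinear map \<open>f\<close>.  In Sweedler notation, if
  \<open>t = \<Sum> t\<^sub>1 \<otimes> t\<^sub>2\<close> then \<open>tensor_lift N f t = \<Sum> f t\<^sub>1 t\<^sub>2\<close>; for bilinear \<open>f\<close> the representative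
  of \<open>t\<close> that is summed over does not matter.
\<close>

definition tensor_lift ::
    "('r, 'n) module \<Rightarrow> ('v \<Rightarrow> 'w \<Rightarrow> 'n) \<Rightarrow> ('v \<times> 'w) list set \<Rightarrow> 'n" where
  "tensor_lift N f t = foldr (\<lambda>(v, w) s. f v w \<oplus>\<^bsub>N\<^esub> s) (SOME ps. ps \<in> t) \<zero>\<^bsub>N\<^esub>"

definition pure_tensor ::
    "'k ring \<Rightarrow> ('k, 'v) module \<Rightarrow> ('k, 'w) module \<Rightarrow> 'v \<Rightarrow> 'w \<Rightarrow> ('v \<times> 'w) list set" where
  "pure_tensor k V W v w = tensor_class k V W [(v, w)]"

definition tensor_map ::
    "'k ring \<Rightarrow> ('k, 'v) module \<Rightarrow> ('k, 'w) module \<Rightarrow> ('a \<Rightarrow> 'v) \<Rightarrow> ('b \<Rightarrow> 'w) \<Rightarrow>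
     ('a \<times> 'b) list set \<Rightarrow> ('v \<times> 'w) list set" where
  "tensor_map k V W f g = tensor_lift (tensor k V W) (\<lambda>a b. pure_tensor k V W (f a) (g b))"

definition tensor_assoc ::
    "'k ring \<Rightarrow> ('k, 'u) module \<Rightarrow> ('k, 'v) module \<Rightarrow> ('k, 'w) module \<Rightarrow>
     (('u \<times> 'v) list set \<times> 'w) list set \<Rightarrow> ('u \<times> ('v \<times> 'w) list set) list set" where
  "tensor_assoc k U V W =
     tensor_lift (tensor k U (tensor k V W))
       (\<lambda>t w. tensor_lift (tensor k U (tensor k V W))
          (\<lambda>u v. pure_tensor k U (tensor k V W) u (pure_tensor k V W v w)) t)"


section \<open>Cogroupoids\<close>

text \<open>\<open>\<Delta> X Z Y\<close> is \<open>\<Delta>\<^sup>Z\<close> with lower indices \<open>X\<close>, \<open>Y\<close>, i.e. \<open>C X Y \<rightarrow> C X Z \<otimes> C Z Y\<close>.\<close>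

locale cocategory =
  fixes k :: "'k ring"
    and Ob :: "'o set"
    and C :: "'o \<Rightarrow> 'o \<Rightarrow> ('k, 'a) module"
    and \<Delta> :: "'o \<Rightarrow> 'o \<Rightarrow> 'o \<Rightarrow> 'a \<Rightarrow> ('a \<times> 'a) list set"
    and \<epsilon> :: "'o \<Rightarrow> 'a \<Rightarrow> 'k"
  assumes ground_field: "field k"
    and algebra: "\<lbrakk>X \<in> Ob; Y \<in> Ob\<rbrakk> \<Longrightarrow> unital_algebra k (C X Y)"
    and comult_hom: "\<lbrakk>X \<in> Ob; Y \<in> Ob; Z \<in> Ob\<rbrakk> \<Longrightarrow>
      \<Delta> X Z Y \<in> algebra_homs k (C X Y) (tensor k (C X Z) (C Z Y))"
    and counit_hom: "X \<in> Ob \<Longrightarrow> \<epsilon> X \<in> algebra_homs k (C X X) (ground k)"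
    and coassoc: "\<lbrakk>X \<in> Ob; Y \<in> Ob; Z \<in> Ob; T \<in> Ob; x \<in> carrier (C X Y)\<rbrakk> \<Longrightarrow>
      tensor_assoc k (C X T) (C T Z) (C Z Y)
        (tensor_map k (tensor k (C X T) (C T Z)) (C Z Y) (\<Delta> X T Z) id (\<Delta> X Z Y x)) =
      tensor_map k (C X T) (tensor k (C T Z) (C Z Y)) id (\<Delta> T Z Y) (\<Delta> X T Y x)"
    and counit_right: "\<lbrakk>X \<in> Ob; Y \<in> Ob; x \<in> carrier (C X Y)\<rbrakk> \<Longrightarrow>
      tensor_lift (C X Y) (\<lambda>a b. \<epsilon> Y b \<odot>\<^bsub>C X Y\<^esub> a) (\<Delta> X Y Y x) = x"
    and counit_left: "\<lbrakk>X \<in> Ob; Y \<in> Ob; x \<in> carrier (C X Y)\<rbrakk> \<Longrightarrow>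
      tensor_lift (C X Y) (\<lambda>a b. \<epsilon> X a \<odot>\<^bsub>C X Y\<^esub> b) (\<Delta> X X Y x) = x"

definition connected_cocategory :: "'o set \<Rightarrow> ('o \<Rightarrow> 'o \<Rightarrow> ('k, 'a) module) \<Rightarrow> bool" where
  "connected_cocategory Ob C \<longleftrightarrow> (\<forall>X\<in>Ob. \<forall>Y\<in>Ob. carrier (C X Y) \<noteq> {\<zero>\<^bsub>C X Y\<^esub>})"

locale cogroupoid = cocategory k Ob C \<Delta> \<epsilon>
  for k :: "'k ring"
    and Ob :: "'o set"
    and C :: "'o \<Rightarrow> 'o \<Rightarrow> ('k, 'a) module"
    and \<Delta> :: "'o \<Rightarrow> 'o \<Rightarrow> 'o \<Rightarrow> 'a \<Rightarrow> ('a \<times> 'a) list set"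
    and \<epsilon> :: "'o \<Rightarrow> 'a \<Rightarrow> 'k" +
  fixes S :: "'o \<Rightarrow> 'o \<Rightarrow> 'a \<Rightarrow> 'a"
  assumes antipode_linear: "\<lbrakk>X \<in> Ob; Y \<in> Ob\<rbrakk> \<Longrightarrow> S X Y \<in> linear_maps k (C X Y) (C Y X)"
    and antipode_right: "\<lbrakk>X \<in> Ob; Y \<in> Ob; a \<in> carrier (C X X)\<rbrakk> \<Longrightarrow>
      tensor_lift (C X Y) (\<lambda>a\<^sub>1 a\<^sub>2. a\<^sub>1 \<otimes>\<^bsub>C X Y\<^esub> S Y X a\<^sub>2) (\<Delta> X Y X a) = \<epsilon> X a \<odot>\<^bsub>C X Y\<^esub> \<one>\<^bsub>C X Y\<^esub>"
    and antipode_left: "\<lbrakk>X \<in> Ob; Y \<in> Ob; a \<in> carrier (C X X)\<rbrakk> \<Longrightarrow>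
      tensor_lift (C Y X) (\<lambda>a\<^sub>1 a\<^sub>2. S X Y a\<^sub>1 \<otimes>\<^bsub>C Y X\<^esub> a\<^sub>2) (\<Delta> X Y X a) = \<epsilon> X a \<odot>\<^bsub>C Y X\<^esub> \<one>\<^bsub>C Y X\<^esub>"


section \<open>Projective resolutions\<close>

locale left_module = R?: ring R + M?: abelian_group M
  for R (structure) and M :: "('r, 'm) module" (structure) +
  assumes smult_closed: "\<lbrakk>a \<in> carrier R; x \<in> carrier M\<rbrakk> \<Longrightarrow> a \<odot>\<^bsub>M\<^esub> x \<in> carrier M"
    and smult_l_distr: "\<lbrakk>a \<in> carrier R; b \<in> carrier R; x \<in> carrier M\<rbrakk> \<Longrightarrow>
      (a \<oplus>\<^bsub>R\<^esub> b) \<odot>\<^bsub>M\<^esub> x = a \<odot>\<^bsub>M\<^esub> x \<oplus>\<^bsub>M\<^esub> b \<odot>\<^bsub>M\<^esub> x"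
    and smult_r_distr: "\<lbrakk>a \<in> carrier R; x \<in> carrier M; y \<in> carrier M\<rbrakk> \<Longrightarrow>
      a \<odot>\<^bsub>M\<^esub> (x \<oplus>\<^bsub>M\<^esub> y) = a \<odot>\<^bsub>M\<^esub> x \<oplus>\<^bsub>M\<^esub> a \<odot>\<^bsub>M\<^esub> y"
    and smult_assoc: "\<lbrakk>a \<in> carrier R; b \<in> carrier R; x \<in> carrier M\<rbrakk> \<Longrightarrow>
      (a \<otimes>\<^bsub>R\<^esub> b) \<odot>\<^bsub>M\<^esub> x = a \<odot>\<^bsub>M\<^esub> (b \<odot>\<^bsub>M\<^esub> x)"
    and smult_one: "x \<in> carrier M \<Longrightarrow> \<one>\<^bsub>R\<^esub> \<odot>\<^bsub>M\<^esub> x = x"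

definition free_module :: "('r, 'x) ring_scheme \<Rightarrow> 'i set \<Rightarrow> ('r, 'i \<Rightarrow> 'r) module" where
  "free_module R I =
     \<lparr>carrier = {f. (\<forall>i\<in>I. f i \<in> carrier R) \<and> (\<forall>i. i \<notin> I \<longrightarrow> f i = \<zero>\<^bsub>R\<^esub>) \<and> finite {i. f i \<noteq> \<zero>\<^bsub>R\<^esub>}},
      mult = undefined, one = undefined,
      zero = (\<lambda>i. \<zero>\<^bsub>R\<^esub>), add = (\<lambda>f g i. f i \<oplus>\<^bsub>R\<^esub> g i), smult = (\<lambda>r f i. r \<otimes>\<^bsub>R\<^esub> f i)\<rparr>"

text \<open>
  Projective means direct summand of a free module.  Elements of \<open>P\<close> suffice as indices, because
  \<open>P\<close> is a quotient of the free module on \<open>carrier P\<close>.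
\<close>

definition projective_module :: "('r, 'x) ring_scheme \<Rightarrow> ('r, 'p) module \<Rightarrow> bool" where
  "projective_module R P \<longleftrightarrow> left_module R P \<and>
     (\<exists>I :: 'p set. \<exists>s\<in>linear_maps R P (free_module R I). \<exists>p\<in>linear_maps R (free_module R I) P.
        \<forall>x\<in>carrier P. p (s x) = x)"

definition fin_gen_module :: "('r, 'x) ring_scheme \<Rightarrow> ('r, 'p) module \<Rightarrow> bool" where
  "fin_gen_module R P \<longleftrightarrow> (\<exists>G. finite G \<and> G \<subseteq> carrier P \<and>
     (\<forall>x\<in>carrier P. \<exists>c\<in>G \<rightarrow> carrier R. x = (\<Oplus>\<^bsub>P\<^esub>g\<in>G. c g \<odot>\<^bsub>P\<^esub> g)))"

definition projective_resolution ::
    "('r, 'x) ring_scheme \<Rightarrow> ('r, 'm) module \<Rightarrow>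
     (nat \<Rightarrow> ('r, 'p) module) \<Rightarrow> (nat \<Rightarrow> 'p \<Rightarrow> 'p) \<Rightarrow> ('p \<Rightarrow> 'm) \<Rightarrow> bool" where
  "projective_resolution R M P d e \<longleftrightarrow>
     (\<forall>n. projective_module R (P n)) \<and>
     (\<forall>n. d n \<in> linear_maps R (P (Suc n)) (P n)) \<and>
     e \<in> linear_maps R (P 0) M \<and>
     e ` carrier (P 0) = carrier M \<and>
     d 0 ` carrier (P (Suc 0)) = {x \<in> carrier (P 0). e x = \<zero>\<^bsub>M\<^esub>} \<and>
     (\<forall>n. d (Suc n) ` carrier (P (Suc (Suc n))) = {x \<in> carrier (P (Suc n)). d n x = \<zero>\<^bsub>P n\<^esub>})"

text \<open>
  Resolutions are looked for among modules whose elements are finitely supported functions from the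
  following type to \<open>R\<close>.  It is large enough to index a free resolution of any module \<open>M\<close>:
  \<open>Gen m\<close> is the generator mapped to \<open>m\<close>, and \<open>Rel [(r\<^sub>1,g\<^sub>1),\<dots>]\<close> the generator mapped to the
  syzygy \<open>r\<^sub>1 g\<^sub>1 + \<dots>\<close> of the generators in the previous degree.  Being infinite, it also indexes
  every finitely generated free, hence contains every finitely generated projective, module up to
  isomorphism.
\<close>

datatype ('r, 'm) syzygy = Gen 'm | Rel "('r \<times> ('r, 'm) syzygy) list"

type_synonym ('r, 'm) res_modules = "nat \<Rightarrow> ('r, ('r, 'm) syzygy \<Rightarrow> 'r) module"
type_synonym ('r, 'm) res_maps = "nat \<Rightarrow> (('r, 'm) syzygy \<Rightarrow> 'r) \<Rightarrow> ('r, 'm) syzygy \<Rightarrow> 'r"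

definition chosen_resolution ::
    "('r, 'x) ring_scheme \<Rightarrow> ('r, 'm) module \<Rightarrow> ('r, 'm) res_modules \<times> ('r, 'm) res_maps" where
  "chosen_resolution R M = (SOME (P, d). \<exists>e. projective_resolution R M P d e)"


section \<open>Ext with values in the regular bimodule\<close>

text \<open>
  \<open>Hom\<^sub>R(P, R)\<close> for a left module \<open>P\<close>, as a right \<open>R\<close>-module: the right action
  \<open>(f \<cdot> r)(p) = f(p) r\<close> is recorded in the field \<^const>\<open>smult\<close> with the scalar as first argument.
\<close>

definition dual_module :: "('r, 'x) ring_scheme \<Rightarrow> ('r, 'p) module \<Rightarrow> ('r, 'p \<Rightarrow> 'r) module" where
  "dual_module R P =
     \<lparr>carrier = linear_maps R P (with_action R (mult R)) \<inter> extensional (carrier P),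
      mult = undefined, one = undefined,
      zero = (\<lambda>p\<in>carrier P. \<zero>\<^bsub>R\<^esub>),
      add = (\<lambda>f g. \<lambda>p\<in>carrier P. f p \<oplus>\<^bsub>R\<^esub> g p),
      smult = (\<lambda>r f. \<lambda>p\<in>carrier P. f p \<otimes>\<^bsub>R\<^esub> r)\<rparr>"

definition quotient_module :: "('r, 'm) module \<Rightarrow> 'm set \<Rightarrow> ('r, 'm set) module" where
  "quotient_module M B =
     \<lparr>carrier = a_rcosets\<^bsub>M\<^esub> B, mult = undefined, one = undefined,
      zero = B, add = set_add M, smult = (\<lambda>r U. \<Union>x\<in>U. B +>\<^bsub>M\<^esub> (r \<odot>\<^bsub>M\<^esub> x))\<rparr>"

definition dual_cocycles ::
    "('r, 'x) ring_scheme \<Rightarrow> (nat \<Rightarrow> ('r, 'p) module) \<Rightarrow> (nat \<Rightarrow> 'p \<Rightarrow> 'p) \<Rightarrow> nat \<Rightarrow> ('p \<Rightarrow> 'r) set" where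
  "dual_cocycles R P d i =
     {f \<in> carrier (dual_module R (P i)). \<forall>x\<in>carrier (P (Suc i)). f (d i x) = \<zero>\<^bsub>R\<^esub>}"

definition dual_coboundaries ::
    "('r, 'x) ring_scheme \<Rightarrow> (nat \<Rightarrow> ('r, 'p) module) \<Rightarrow> (nat \<Rightarrow> 'p \<Rightarrow> 'p) \<Rightarrow> nat \<Rightarrow> ('p \<Rightarrow> 'r) set" where
  "dual_coboundaries R P d i = (case i of
       0 \<Rightarrow> {\<zero>\<^bsub>dual_module R (P 0)\<^esub>}
     | Suc j \<Rightarrow> (\<lambda>g. \<lambda>x\<in>carrier (P (Suc j)). g (d j x)) ` carrier (dual_module R (P j)))"

definition dual_cohomology ::
    "('r, 'x) ring_scheme \<Rightarrow> (nat \<Rightarrow> ('r, 'p) module) \<Rightarrow> (nat \<Rightarrow> 'p \<Rightarrow> 'p) \<Rightarrow> nat \<Rightarrow>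
     ('r, ('p \<Rightarrow> 'r) set) module" where
  "dual_cohomology R P d i =
     quotient_module ((dual_module R (P i))\<lparr>carrier := dual_cocycles R P d i\<rparr>)
       (dual_coboundaries R P d i)"

text \<open>\<open>Ext\<^sup>i\<close> of the left \<open>R\<close>-module \<open>M\<close> with values in \<open>R\<close>, as a right \<open>R\<close>-module.\<close>

definition Ext_regular ::
    "('r, 'x) ring_scheme \<Rightarrow> ('r, 'm) module \<Rightarrow> nat \<Rightarrow>
     ('r, ((('r, 'm) syzygy \<Rightarrow> 'r) \<Rightarrow> 'r) set) module" where
  "Ext_regular R M i = (case chosen_resolution R M of (P, d) \<Rightarrow> dual_cohomology R P d i)"


section \<open>Twisted Calabi--Yau algebras\<close>

definition enveloping :: "'k ring \<Rightarrow> ('k, 'a) module \<Rightarrow> ('k, ('a \<times> 'a) list set) module" where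
  "enveloping k A = tensor k A (opposite A)"

text \<open>\<open>A\<close> as a left module over its enveloping algebra: \<open>(a \<otimes> b) \<cdot> m = a m b\<close>.\<close>

definition regular_bimodule :: "('k, 'a) module \<Rightarrow> (('a \<times> 'a) list set, 'a) module" where
  "regular_bimodule A =
     with_action A (\<lambda>t m. tensor_lift A (\<lambda>a b. a \<otimes>\<^bsub>A\<^esub> m \<otimes>\<^bsub>A\<^esub> b) t)"

text \<open>
  The bimodule \<open>A\<^sup>\<mu>\<close>, with \<open>a \<cdot> m \<cdot> b = a m \<mu>(b)\<close>, as a right module over the enveloping algebra.
  A right module \<open>E\<close> is a bimodule via \<open>b \<cdot> e \<cdot> a = e \<cdot> (a \<otimes> b)\<close>, so here
  \<open>m \<cdot> (a \<otimes> b) = b m \<mu>(a)\<close>.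
\<close>

definition twisted_bimodule ::
    "('k, 'a) module \<Rightarrow> ('a \<Rightarrow> 'a) \<Rightarrow> (('a \<times> 'a) list set, 'a) module" where
  "twisted_bimodule A \<mu> =
     with_action A (\<lambda>t m. tensor_lift A (\<lambda>a b. b \<otimes>\<^bsub>A\<^esub> m \<otimes>\<^bsub>A\<^esub> \<mu> a) t)"

definition homologically_smooth :: "'k ring \<Rightarrow> ('k, 'a) module \<Rightarrow> bool" where
  "homologically_smooth k A \<longleftrightarrow>
     (\<exists>(P :: (('a \<times> 'a) list set, 'a) res_modules) d e.
        projective_resolution (enveloping k A) (regular_bimodule A) P d e \<and>
        (\<forall>n. fin_gen_module (enveloping k A) (P n)) \<and>
        (\<exists>N. \<forall>n>N. carrier (P n) = {\<zero>\<^bsub>P n\<^esub>}))"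

definition twisted_CY_with_Nakayama ::
    "'k ring \<Rightarrow> ('k, 'a) module \<Rightarrow> nat \<Rightarrow> ('a \<Rightarrow> 'a) \<Rightarrow> bool" where
  "twisted_CY_with_Nakayama k A d \<mu> \<longleftrightarrow>
     unital_algebra k A \<and> homologically_smooth k A \<and>
     \<mu> \<in> algebra_homs k A A \<and> bij_betw \<mu> (carrier A) (carrier A) \<and>
     (\<forall>i. i \<noteq> d \<longrightarrow>
        carrier (Ext_regular (enveloping k A) (regular_bimodule A) i) =
          {\<zero>\<^bsub>Ext_regular (enveloping k A) (regular_bimodule A) i\<^esub>}) \<and>
     module_iso (enveloping k A)
       (Ext_regular (enveloping k A) (regular_bimodule A) d) (twisted_bimodule A \<mu>)"

definition twisted_CY :: "'k ring \<Rightarrow> ('k, 'a) module \<Rightarrow> nat \<Rightarrow> bool" where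
  "twisted_CY k A d \<longleftrightarrow> (\<exists>\<mu>. twisted_CY_with_Nakayama k A d \<mu>)"

text \<open>
  The one-dimensional module on which \<open>A\<close> acts through \<open>\<xi> : A \<rightarrow> k\<close>.  As \<open>k\<close> is commutative, this is
  both the left and the right module.
\<close>

definition character_module :: "'k ring \<Rightarrow> ('a \<Rightarrow> 'k) \<Rightarrow> ('a, 'k) module" where
  "character_module k \<xi> = with_action k (\<lambda>a c. \<xi> a \<otimes>\<^bsub>k\<^esub> c)"

definition left_homological_integral ::
    "'k ring \<Rightarrow> ('k, 'a) module \<Rightarrow> ('a \<Rightarrow> 'k) \<Rightarrow> nat \<Rightarrow> ('a, ((('a, 'k) syzygy \<Rightarrow> 'a) \<Rightarrow> 'a) set) module"
  where "left_homological_integral k A \<epsilon> d = Ext_regular A (character_module k \<epsilon>) d"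

end

theory Submission
  imports Defs
begin

text \<open>
 Write \<open>H = C X X\<close> and \<open>B = C X Y\<close>.  The map \<open>\<delta> h = h\<^sub>1 \<otimes> S h\<^sub>2\<close>, with \<open>h\<^sub>1\<close> in \<open>C X Y\<close> and \<open>h\<^sub>2\<close> in \<open>C Y X\<close>, is an
 algebra homomorphism from \<open>H\<close> to \<open>B\<^sup>e\<close>.  Since the antipodes are bijective, \<open>B\<^sup>e\<close> is isomorphic to
 \<open>B \<otimes> H\<close> as a right and as a left \<open>H\<close>-module, and \<open>B\<^sup>e \<otimes>\<^sub>H k = B\<close>.  A finite projective resolution of \<open>H\<close>
 over \<open>H\<^sup>e\<close> yields one of \<open>k\<close> over \<open>H\<close> by applying the counit on the right, and this becomes one of
 \<open>B\<close> over \<open>B\<^sup>e\<close> after base change along \<open>\<delta>\<close>.  Dually \<open>Ext(B, B\<^sup>e) = Ext(k, H) \<otimes>\<^sub>H B\<^sup>e\<close>.  For \<open>Y = X\<close> the map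
 \<open>\<delta>\<close> has a retraction, so \<open>Ext(k, H)\<close> vanishes outside degree \<open>d\<close>; in degree \<open>d\<close> it is \<open>k\<^sub>\<xi>\<close>, and
 \<open>k\<^sub>\<xi> \<otimes>\<^sub>H B\<^sup>e\<close> is \<open>B\<^sup>\<mu>\<close> through \<open>a \<otimes> b \<mapsto> b \<mu>(a)\<close>.
\<close>

\<comment> \<open>\<open>Ext_regular\<close> is computed from one resolution fixed by choice in a
  prescribed type, so every statement about it passes through the comparison theorem to a resolution
  that is actually known. Known resolutions are kept as matrices: a finitely generated projective is
  the row space of an idempotent, and a change of rings applies a ring homomorphism to all entries.
  This sidesteps tensor products over noncommutative rings. Idempotency and zero products survive
  automatically; exactness and cohomology do not, and are recovered by expanding finitely many
  elements at a time in a dual basis. The formula for \<mu> comes from the last step. For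
  \<open>a \<otimes> b \<mapsto> b \<mu>(a)\<close> to turn left multiplication by
  \<open>\<delta> h\<close> into the scalar \<open>\<xi> h\<close>, the element
  \<open>S(h_2) \<mu>(h_1)\<close> must be \<open>\<xi>(h) 1\<close>. Since
  \<open>S(h_2) S(S(h_1)) = S(S(h_1) h_2)\<close> contracts to the counit, the square of the
  antipode preceded by a twist with \<xi> on the left does this.\<close>
syntax "_index_sub" :: "'a => index" (\<open>\<^sub>_\<close> [1000] 1000)
translations "_index_sub x" => "_index x"

section \<open>Modules over a general ring: free modules and lifting from projectives\<close>

section \<open>Additive and linear maps\<close>

text \<open>Many maps below are semilinear between modules over different rings, so additivity is
  kept apart from compatibility with scalars. With \<open>ring_scheme\<close> types the same notion
  covers rings and modules.\<close>

definition additive_maps ::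
  "('a, 'x) ring_scheme => ('b, 'y) ring_scheme => ('a => 'b) set" where
 "additive_maps G H = {f : carrier G \<rightarrow> carrier H.
   \<forall>x\<in>carrier G. \<forall>y\<in>carrier G. f (x \<oplus>\<^sub>G y) = f x \<oplus>\<^sub>H f y}"

lemma additive_mapsI:
 assumes "\<And>x. x : carrier G ==> f x : carrier H"
  and "\<And>x y. [|x : carrier G; y : carrier G|] ==> f (x \<oplus>\<^sub>G y) = f x \<oplus>\<^sub>H f y"
 shows "f : additive_maps G H"
 using assms unfolding additive_maps_def by auto

lemma additive_closed: "f : additive_maps G H ==> x : carrier G ==> f x : carrier H"
 unfolding additive_maps_def by auto

lemma additive_add:
 "f : additive_maps G H ==> x : carrier G ==> y : carrier G ==> f (x \<oplus>\<^sub>G y) = f x \<oplus>\<^sub>H f y"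
 unfolding additive_maps_def by auto

locale additive_hom = G?: abelian_group G + H?: abelian_group H
 for G (structure) and H (structure) +
 fixes f
 assumes additive: "f : additive_maps G H"
begin

lemma map_closed [simp]: "x : carrier G ==> f x : carrier H"
 by (rule additive_closed[OF additive])

lemma map_add: "x : carrier G ==> y : carrier G ==> f (x \<oplus>\<^sub>G y) = f x \<oplus>\<^sub>H f y"
 by (rule additive_add[OF additive])

lemma map_zero: "f \<zero>\<^sub>G = \<zero>\<^sub>H"
 using map_add[of "\<zero>\<^sub>G" "\<zero>\<^sub>G"] by (metis G.l_zero G.zero_closed H.add.l_cancel_one map_closed)

lemma map_uminus: "x : carrier G ==> f (\<ominus>\<^sub>G x) = \<ominus>\<^sub>H f x"
 by (metis G.a_inv_closed G.l_neg H.minus_equality map_add map_closed map_zero)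

lemma map_minus: "x : carrier G ==> y : carrier G ==> f (x \<ominus>\<^sub>G y) = f x \<ominus>\<^sub>H f y"
 by (simp add: G.minus_eq H.minus_eq map_add map_uminus)

lemma map_finsum:
 assumes "g : A \<rightarrow> carrier G"
 shows "f (finsum G g A) = finsum H (\<lambda>i. f (g i)) A"
proof (cases "finite A")
 case True
 then show ?thesis using assms
 proof (induction A rule: finite_induct)
  case empty
  then show ?case by (simp add: map_zero)
 next
  case (insert a A)
  then have 1: "g a : carrier G" "g : A \<rightarrow> carrier G" by auto
  then have "(\<lambda>i. f (g i)) : A \<rightarrow> carrier H" by (auto intro!: map_closed)
  with insert 1 show ?case
   by (simp add: G.finsum_insert H.finsum_insert map_add)
 qed
next
 case False
 then show ?thesis by (simp add: map_zero)
qed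

end

lemma additive_homI:
 "abelian_group G ==> abelian_group H ==> f : additive_maps G H ==> additive_hom G H f"
 by (simp add: additive_hom_axioms_def additive_hom_def)

lemma linear_additive: "f : linear_maps R M N ==> f : additive_maps M N"
 unfolding linear_maps_def additive_maps_def by auto

lemma linear_mapsI:
 assumes "\<And>x. x : carrier M ==> f x : carrier N"
  and "\<And>x y. [|x : carrier M; y : carrier M|] ==> f (x \<oplus>\<^sub>M y) = f x \<oplus>\<^sub>N f y"
  and "\<And>r x. [|r : carrier R; x : carrier M|] ==> f (r \<odot>\<^sub>M x) = r \<odot>\<^sub>N f x"
 shows "f : linear_maps R M N"
 using assms unfolding linear_maps_def by auto

lemma linear_closed: "f : linear_maps R M N ==> x : carrier M ==> f x : carrier N"
 unfolding linear_maps_def by auto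

lemma linear_add:
 "f : linear_maps R M N ==> x : carrier M ==> y : carrier M ==> f (x \<oplus>\<^sub>M y) = f x \<oplus>\<^sub>N f y"
 unfolding linear_maps_def by auto

lemma linear_smult:
 "f : linear_maps R M N ==> r : carrier R ==> x : carrier M ==> f (r \<odot>\<^sub>M x) = r \<odot>\<^sub>N f x"
 unfolding linear_maps_def by auto

lemma linear_id: "(\<lambda>x. x) : linear_maps R M M"
 unfolding linear_maps_def by auto

lemma linear_comp:
 "g : linear_maps R N L ==> f : linear_maps R M N ==> (\<lambda>x. g (f x)) : linear_maps R M L"
 by (rule linear_mapsI) (auto simp: linear_closed linear_add linear_smult)

lemma left_module_abelian: "left_module R M ==> abelian_group M"
 unfolding left_module_def by auto

lemma left_module_ring: "left_module R M ==> ring R"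
 unfolding left_module_def by auto

context left_module
begin

lemma smult_left_additive: "x : carrier M ==> (\<lambda>a. a \<odot>\<^sub>M x) : additive_maps R M"
 by (rule additive_mapsI) (auto simp: smult_closed smult_l_distr)

lemma smult_right_additive: "a : carrier R ==> (\<lambda>x. a \<odot>\<^sub>M x) : additive_maps M M"
 by (rule additive_mapsI) (auto simp: smult_closed smult_r_distr)

lemma smult_zero_left [simp]: "x : carrier M ==> \<zero>\<^sub>R \<odot>\<^sub>M x = \<zero>\<^sub>M"
 using additive_hom.map_zero[OF additive_homI[OF _ _ smult_left_additive]]
  R.abelian_group_axioms M.abelian_group_axioms by blast

lemma smult_zero_right [simp]: "a : carrier R ==> a \<odot>\<^sub>M \<zero>\<^sub>M = \<zero>\<^sub>M"
 using additive_hom.map_zero[OF additive_homI[OF _ _ smult_right_additive]]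
   M.abelian_group_axioms by blast

lemma smult_finsum:
 assumes "a : carrier R" "g : A \<rightarrow> carrier M"
 shows "a \<odot>\<^sub>M finsum M g A = finsum M (\<lambda>i. a \<odot>\<^sub>M g i) A"
 using additive_hom.map_finsum[OF additive_homI[OF _ _ smult_right_additive], OF _ _ assms]
   M.abelian_group_axioms by blast

lemma finsum_smult:
 assumes "x : carrier M" "g : A \<rightarrow> carrier R"
 shows "finsum R g A \<odot>\<^sub>M x = finsum M (\<lambda>i. g i \<odot>\<^sub>M x) A"
 using additive_hom.map_finsum[OF additive_homI[OF _ _ smult_left_additive], OF _ _ assms]
   M.abelian_group_axioms R.abelian_group_axioms by blast

lemma linear_sub:
 assumes "left_module R L" "f : linear_maps R L M" "g : linear_maps R L M"
 shows "(\<lambda>x. f x \<ominus>\<^sub>M g x) : linear_maps R L M"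
proof (rule linear_mapsI)
 interpret L: left_module R L by fact
 fix x y assume xy: "x : carrier L" "y : carrier L"
 note c = linear_closed[OF assms(2) xy(1)] linear_closed[OF assms(3) xy(1)]
  linear_closed[OF assms(2) xy(2)] linear_closed[OF assms(3) xy(2)]
 show "f x \<ominus>\<^sub>M g x : carrier M" using xy c by simp
 show "f (x \<oplus>\<^sub>L y) \<ominus>\<^sub>M g (x \<oplus>\<^sub>L y) = f x \<ominus>\<^sub>M g x \<oplus>\<^sub>M (f y \<ominus>\<^sub>M g y)"
  using c by (simp add: linear_add[OF assms(2) xy] linear_add[OF assms(3) xy] M.minus_eq M.minus_add M.a_ac)
next
 interpret L: left_module R L by fact
 fix r x assume rx: "r : carrier R" "x : carrier L"
 note c = linear_closed[OF assms(2) rx(2)] linear_closed[OF assms(3) rx(2)]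
 interpret h: additive_hom M M "\<lambda>x. r \<odot>\<^sub>M x"
  by (rule additive_homI) (use rx in "auto intro: smult_right_additive M.abelian_group_axioms")
 show "f (r \<odot>\<^sub>L x) \<ominus>\<^sub>M g (r \<odot>\<^sub>L x) = r \<odot>\<^sub>M (f x \<ominus>\<^sub>M g x)"
  using c by (simp add: linear_smult[OF assms(2) rx] linear_smult[OF assms(3) rx] h.map_minus)
qed

end

lemma linear_hom:
 "left_module R M ==> left_module R N ==> f : linear_maps R M N ==> additive_hom M N f"
 by (simp add: additive_homI left_module_abelian linear_additive)

lemma with_action_simps [simp]:
 "carrier (with_action G act) = carrier G" "add (with_action G act) = add G"
 "zero (with_action G act) = zero G" "mult (with_action G act) = mult G"
 "one (with_action G act) = one G" "smult (with_action G act) = act"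
 by (simp_all add: with_action_def)

lemma with_action_abelian: "abelian_group G ==> abelian_group (with_action G act)"
proof -
 assume "abelian_group G"
 then interpret abelian_group G .
 show ?thesis
  by (rule abelian_groupI) (auto simp: a_assoc intro: a_comm l_neg)
qed

lemma additive_maps_with_action [simp]:
 "additive_maps (with_action G act) H = additive_maps G H"
 "additive_maps G (with_action H act') = additive_maps G H"
 by (simp_all add: additive_maps_def)

lemma finsum_with_action [simp]: "finsum (with_action G act) = finsum G"
 by (simp add: with_action_def finsum_def finprod_def fun_eq_iff)

lemma regular_left_module: "ring R ==> left_module R (with_action R (mult R))"
 by (intro left_module.intro left_module_axioms.intro with_action_abelian)
  (auto simp: ring.is_abelian_group ring.ring_simprules(5,11,12,13,23))

section \<open>Free and projective modules\<close>

definition unit_vector :: "('r, 'x) ring_scheme => 'i => 'i => 'r" where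
 "unit_vector R i = (\<lambda>j. if j = i then \<one>\<^sub>R else \<zero>\<^sub>R)"

lemma free_module_simps [simp]:
 "zero (free_module R I) = (\<lambda>i. \<zero>\<^sub>R)"
 "add (free_module R I) = (\<lambda>f g i. f i \<oplus>\<^sub>R g i)"
 "smult (free_module R I) = (\<lambda>r f i. r \<otimes>\<^sub>R f i)"
 by (simp_all add: free_module_def)

lemma free_carrier_iff:
 "f : carrier (free_module R I) \<longleftrightarrow> (\<forall>i\<in>I. f i : carrier R) \<and> (\<forall>i. i \<notin> I \<longrightarrow> f i = \<zero>\<^sub>R) \<and>
   finite {i. f i \<noteq> \<zero>\<^sub>R}"
 by (simp add: free_module_def)

context ring
begin

lemma free_closed: "f : carrier (free_module R I) ==> f i : carrier R"
 by (metis free_carrier_iff zero_closed)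

lemma free_left_module: "left_module R (free_module R I)"
proof -
 have add: "(\<lambda>i. f i \<oplus> g i) : carrier (free_module R I)"
  if "f : carrier (free_module R I)" "g : carrier (free_module R I)" for f g
 proof -
  have "{i. f i \<oplus> g i \<noteq> \<zero>} \<subseteq> {i. f i \<noteq> \<zero>} \<union> {i. g i \<noteq> \<zero>}" by auto
  then show ?thesis using that unfolding free_carrier_iff
   by (auto intro: finite_subset)
 qed
 have smult: "(\<lambda>i. r \<otimes> f i) : carrier (free_module R I)"
  if "f : carrier (free_module R I)" "r : carrier R" for f r
 proof -
  have "{i. r \<otimes> f i \<noteq> \<zero>} \<subseteq> {i. f i \<noteq> \<zero>}" using that by auto
  then show ?thesis using that unfolding free_carrier_iff
   by (auto intro: finite_subset)
 qed
 have neg: "(\<lambda>i. \<ominus> f i) : carrier (free_module R I)"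
  if "f : carrier (free_module R I)" for f
 proof -
  have "{i. \<ominus> f i \<noteq> \<zero>} \<subseteq> {i. f i \<noteq> \<zero>}" using that by auto
  then show ?thesis using that unfolding free_carrier_iff
   by (auto intro: finite_subset)
 qed
 have ab: "abelian_group (free_module R I)"
 proof (rule abelian_groupI)
  fix f assume f: "f : carrier (free_module R I)"
  show "\<exists>y\<in>carrier (free_module R I). y \<oplus>\<^sub>(free_module R I) f = \<zero>\<^sub>(free_module R I)"
   by (rule bexI[OF _ neg[OF f]]) (use f in "auto simp: free_closed l_neg")
 qed (simp_all add: add free_closed[of _ I] a_ac, simp_all add: free_carrier_iff)
 show ?thesis
  by (intro left_module.intro ring_axioms ab left_module_axioms.intro)
   (auto simp: smult free_closed[of _ I] l_distr r_distr m_assoc)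
qed

lemma unit_vector_closed: "i : I ==> unit_vector R i : carrier (free_module R I)"
 by (auto simp: free_carrier_iff unit_vector_def)

lemma free_eval_additive: "(\<lambda>f. f i) : additive_maps (free_module R I) R"
 by (rule additive_mapsI) (auto simp: free_closed)

lemma free_finsum_eval:
 assumes "g : A \<rightarrow> carrier (free_module R I)"
 shows "finsum (free_module R I) g A i = (\<Oplus>a\<in>A. g a i)"
 using additive_hom.map_finsum[OF additive_homI[OF _ _ free_eval_additive] assms, of i]
  left_module_abelian[OF free_left_module] is_abelian_group by auto

lemma free_expansion:
 assumes f: "f : carrier (free_module R I)" and S: "finite S" "{i. f i \<noteq> \<zero>} \<subseteq> S" "S \<subseteq> I"
 shows "f = (\<Oplus>\<^sub>(free_module R I)i\<in>S. f i \<odot>\<^sub>(free_module R I) unit_vector R i)"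
proof
 interpret F: left_module R "free_module R I" by (rule free_left_module)
 fix j
 have cl: "(\<lambda>i. f i \<odot>\<^sub>(free_module R I) unit_vector R i) : S \<rightarrow> carrier (free_module R I)"
  using S(3) by (intro Pi_I F.smult_closed free_closed[OF f] unit_vector_closed) auto
 have "(\<Oplus>i\<in>S. f i \<otimes> unit_vector R i j) = (\<Oplus>i\<in>S. if j = i then f i else \<zero>)"
  by (rule finsum_cong') (auto simp: unit_vector_def free_closed[OF f])
 also have "... = f j"
 proof (cases "j : S")
  case True
  then show ?thesis using finsum_singleton[OF True S(1), of f] free_closed[OF f] by simp
 next
  case False
  then have "f j = \<zero>" using S by auto
  moreover have "(\<Oplus>i\<in>S. if j = i then f i else \<zero>) = (\<Oplus>i\<in>S. \<zero>)"
   by (rule finsum_cong') (use False in auto)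
  ultimately show ?thesis by simp
 qed
 finally show "f j = (\<Oplus>\<^sub>(free_module R I)i\<in>S. f i \<odot>\<^sub>(free_module R I) unit_vector R i) j"
  using free_finsum_eval[OF cl] by simp
qed

end

lemma free_extension:
 assumes M: "left_module R M" and m: "\<And>i. i : I ==> m i : carrier M"
 obtains h where "h : linear_maps R (free_module R I) M"
  and "\<And>i. i : I ==> h (unit_vector R i) = m i"
proof -
 interpret M: left_module R M by fact
 let ?F = "free_module R I"
 interpret F: left_module R "free_module R I" by (rule M.free_left_module)
 define h where "h f = (\<Oplus>\<^sub>M i\<in>{i. f i \<noteq> \<zero>\<^sub>R}. f i \<odot>\<^sub>M m i)" for f
 have sc: "f i \<odot>\<^sub>M m i : carrier M" if "f : carrier ?F" "i : I" for f i
  using that M.free_closed m M.smult_closed by metis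
 have supp: "finite {i. f i \<noteq> \<zero>\<^sub>R}" "{i. f i \<noteq> \<zero>\<^sub>R} \<subseteq> I" if "f : carrier ?F" for f
  using that by (auto simp: free_carrier_iff)
 \<comment> \<open>The sum in \<open>h\<close> runs over the support, which changes with
   \<open>f\<close>. Being able to enlarge it to any finite \<open>S\<close> lets values at
   different arguments be compared over one index set.\<close>
 have h: "h f = (\<Oplus>\<^sub>M i\<in>S. f i \<odot>\<^sub>M m i)"
  if "f : carrier ?F" "finite S" "{i. f i \<noteq> \<zero>\<^sub>R} \<subseteq> S" "S \<subseteq> I" for f S
  unfolding h_def
  by (rule M.add.finprod_mono_neutral_cong_left) (use that sc m in auto)
 have "h : linear_maps R ?F M"
 proof (rule linear_mapsI)
  fix f g assume fg: "f : carrier ?F" "g : carrier ?F"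
  let ?S = "{i. f i \<noteq> \<zero>\<^sub>R} \<union> {i. g i \<noteq> \<zero>\<^sub>R}"
  have S: "finite ?S" "?S \<subseteq> I" using supp[OF fg(1)] supp[OF fg(2)] by auto
  show "h f : carrier M" unfolding h_def using sc[OF fg(1)] supp[OF fg(1)]
   by (intro M.finsum_closed) auto
  have mI: "m i : carrier M" if "i : ?S" for i using that S(2) m by blast
  have "h (f \<oplus>\<^sub>?F g) = (\<Oplus>\<^sub>M i\<in>?S. (f \<oplus>\<^sub>?F g) i \<odot>\<^sub>M m i)"
   by (rule h) (use fg S F.a_closed[of f g] in auto)
  also have "... = (\<Oplus>\<^sub>M i\<in>?S. f i \<odot>\<^sub>M m i \<oplus>\<^sub>M g i \<odot>\<^sub>M m i)"
   by (rule M.finsum_cong')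
    (use mI M.free_closed[OF fg(1)] M.free_closed[OF fg(2)] in "simp_all add: Pi_def M.smult_l_distr M.smult_closed")
  also have "... = (\<Oplus>\<^sub>M i\<in>?S. f i \<odot>\<^sub>M m i) \<oplus>\<^sub>M (\<Oplus>\<^sub>M i\<in>?S. g i \<odot>\<^sub>M m i)"
   by (rule M.finsum_addf) (use S sc fg in auto)
  also have "... = h f \<oplus>\<^sub>M h g"
   using h[OF fg(1) S(1) _ S(2)] h[OF fg(2) S(1) _ S(2)] by simp
  finally show "h (f \<oplus>\<^sub>?F g) = h f \<oplus>\<^sub>M h g" .
 next
  fix r f assume rf: "r : carrier R" "f : carrier ?F"
  note S = supp[OF rf(2)]
  have mI: "m i : carrier M" if "f i \<noteq> \<zero>\<^sub>R" for i using that S(2) m by blast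
  have "h (r \<odot>\<^sub>?F f) = (\<Oplus>\<^sub>M i\<in>{i. f i \<noteq> \<zero>\<^sub>R}. (r \<odot>\<^sub>?F f) i \<odot>\<^sub>M m i)"
   by (rule h) (use rf S F.smult_closed[of r f] in auto)
  also have "... = (\<Oplus>\<^sub>M i\<in>{i. f i \<noteq> \<zero>\<^sub>R}. r \<odot>\<^sub>M (f i \<odot>\<^sub>M m i))"
   by (rule M.finsum_cong')
    (use mI rf(1) M.free_closed[OF rf(2)] in "simp_all add: Pi_def M.smult_assoc M.smult_closed")
  also have "... = r \<odot>\<^sub>M h f"
   unfolding h_def by (rule M.smult_finsum[symmetric]) (use rf S sc in auto)
  finally show "h (r \<odot>\<^sub>?F f) = r \<odot>\<^sub>M h f" .
 qed
 moreover have "h (unit_vector R i) = m i" if i: "i : I" for i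
 proof -
  have "h (unit_vector R i) = (\<Oplus>\<^sub>M j\<in>{i}. unit_vector R i j \<odot>\<^sub>M m j)"
   by (rule h) (use i M.unit_vector_closed[OF i] in "auto simp: unit_vector_def")
  also have "... = m i" using i m by (simp add: unit_vector_def M.smult_one)
  finally show ?thesis .
 qed
 ultimately show ?thesis using that by blast
qed

lemma free_linear_eq:
 assumes M: "left_module R M"
  and f: "f : linear_maps R (free_module R I) M" and g: "g : linear_maps R (free_module R I) M"
  and eq: "\<And>i. i : I ==> f (unit_vector R i) = g (unit_vector R i)"
  and x: "x : carrier (free_module R I)"
 shows "f x = g x"
proof -
 interpret M: left_module R M by fact
 let ?F = "free_module R I"
 interpret F: left_module R "free_module R I" by (rule M.free_left_module)
 let ?S = "{i. x i \<noteq> \<zero>\<^sub>R}"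
 have S: "finite ?S" "?S \<subseteq> I" using x by (auto simp: free_carrier_iff)
 have cl: "(\<lambda>i. x i \<odot>\<^sub>?F unit_vector R i) : ?S \<rightarrow> carrier ?F"
  using S(2) by (intro Pi_I F.smult_closed M.free_closed[OF x] M.unit_vector_closed) auto
 have ev: "h x = (\<Oplus>\<^sub>M i\<in>?S. x i \<odot>\<^sub>M h (unit_vector R i))" if h: "h : linear_maps R ?F M" for h
 proof -
  interpret h: additive_hom ?F M h
   by (rule linear_hom[OF F.left_module_axioms M h])
  have "h x = h (\<Oplus>\<^sub>?F i\<in>?S. x i \<odot>\<^sub>?F unit_vector R i)"
   using M.free_expansion[OF x S(1) _ S(2)] by simp
  also have "... = (\<Oplus>\<^sub>M i\<in>?S. h (x i \<odot>\<^sub>?F unit_vector R i))"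
   by (rule h.map_finsum[OF cl])
  also have "... = (\<Oplus>\<^sub>M i\<in>?S. x i \<odot>\<^sub>M h (unit_vector R i))"
  proof (rule M.finsum_cong')
   fix i assume "i : ?S"
   then have "i : I" using S(2) by blast
   then have i: "unit_vector R i : carrier ?F" by (rule M.unit_vector_closed)
   show "h (x i \<odot>\<^sub>?F unit_vector R i) = x i \<odot>\<^sub>M h (unit_vector R i)"
    by (rule linear_smult[OF h M.free_closed[OF x] i])
  next
   show "(\<lambda>i. x i \<odot>\<^sub>M h (unit_vector R i)) : ?S \<rightarrow> carrier M"
    using S(2) by (intro Pi_I M.smult_closed M.free_closed[OF x] linear_closed[OF h] M.unit_vector_closed) auto
  qed simp
  finally show ?thesis .
 qed
 show ?thesis unfolding ev[OF f] ev[OF g]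
 proof (rule M.finsum_cong')
  show "(\<lambda>i. x i \<odot>\<^sub>M g (unit_vector R i)) : ?S \<rightarrow> carrier M"
   using S(2) by (intro Pi_I M.smult_closed M.free_closed[OF x] linear_closed[OF g] M.unit_vector_closed) auto
  fix i assume "i : ?S"
  then have "i : I" using S(2) by blast
  then show "x i \<odot>\<^sub>M f (unit_vector R i) = x i \<odot>\<^sub>M g (unit_vector R i)" by (simp add: eq)
 qed simp
qed

text \<open>The lift is chosen on the unit vectors of a free module having \<open>P\<close> as a
  summand, extended linearly and precomposed with the inclusion \<open>s\<close>. The map
  \<open>g\<close> is asked to cover the image of \<open>f\<close> because the targets below are
  exact complexes, where a differential is onto the next kernel.\<close>

lemma projective_lift:
 fixes P :: "('r, 'p) module"
 assumes P: "projective_module R P" and M: "left_module R M" and N: "left_module R N"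
  and g: "g : linear_maps R M N" and f: "f : linear_maps R P N"
  and sub: "f ` carrier P \<subseteq> g ` carrier M"
 obtains h where "h : linear_maps R P M" "\<And>x. x : carrier P ==> g (h x) = f x"
proof -
 from P obtain I :: "'p set" and s p where s: "s : linear_maps R P (free_module R I)"
  and p: "p : linear_maps R (free_module R I) P" and ps: "\<forall>x\<in>carrier P. p (s x) = x"
  unfolding projective_module_def by blast
 interpret M: left_module R M by fact
 have "\<exists>m. \<forall>i\<in>I. m i : carrier M \<and> g (m i) = f (p (unit_vector R i))"
 proof (rule bchoice, rule ballI)
  fix i assume i: "i : I"
  have "f (p (unit_vector R i)) : g ` carrier M"
   using sub linear_closed[OF p M.unit_vector_closed[OF i]] by blast
  then show "\<exists>y. y : carrier M \<and> g y = f (p (unit_vector R i))" by force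
 qed
 then obtain m where m: "\<And>i. i : I ==> m i : carrier M"
  and gm: "\<And>i. i : I ==> g (m i) = f (p (unit_vector R i))" by auto
 obtain h where h: "h : linear_maps R (free_module R I) M"
  and hm: "\<And>i. i : I ==> h (unit_vector R i) = m i"
  using free_extension[OF M, of I m] m by blast
 have "g (h y) = f (p y)" if "y : carrier (free_module R I)" for y
  by (rule free_linear_eq[OF N linear_comp[OF g h] linear_comp[OF f p] _ that])
   (simp add: hm gm)
 then have "g (h (s x)) = f x" if "x : carrier P" for x
  using that ps linear_closed[OF s] by metis
 with linear_comp[OF h s] show ?thesis using that by blast
qed

lemma (in abelian_group) minus_eq_zero_iff:
 assumes "x : carrier G" "y : carrier G"
 shows "x \<ominus> y = \<zero> \<longleftrightarrow> x = y"
proof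
 assume "x \<ominus> y = \<zero>"
 then have "x \<ominus> y \<oplus> y = \<zero> \<oplus> y" by simp
 then show "x = y" using assms by (simp add: minus_eq a_assoc l_neg)
qed (use assms in "simp add: minus_eq r_neg")

lemma (in abelian_group) minus_zero_right: "x : carrier G ==> x \<ominus> \<zero> = x"
 using add.inv_one by (simp add: minus_eq)

section \<open>Cohomology of the dual complex, described without cosets\<close>

section \<open>Quotients and the first isomorphism theorem\<close>

text \<open>The dual of a left module carries a right action stored in \<open>smult\<close>, so
  \<open>Z\<close> is in general no \<open>left_module\<close>. The assumptions are those under
  which the action descends to cosets.\<close>

locale submodule_pair = Z?: abelian_group Z + B?: additive_subgroup B Z
 for R :: "('r, 'x) ring_scheme" and Z :: "('r, 'm) module" (structure) and B +
 assumes act_closed: "[|r : carrier R; x : carrier Z|] ==> r \<odot>\<^sub>Z x : carrier Z"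
  and act_add: "[|r : carrier R; x : carrier Z; y : carrier Z|] ==>
   r \<odot>\<^sub>Z (x \<oplus>\<^sub>Z y) = r \<odot>\<^sub>Z x \<oplus>\<^sub>Z r \<odot>\<^sub>Z y"
  and act_sub: "[|r : carrier R; x : B|] ==> r \<odot>\<^sub>Z x : B"
begin

sublocale abelian_subgroup B Z
 by (rule abelian_subgroupI3[OF B.additive_subgroup_axioms Z.abelian_group_axioms])

lemma coset_eq_iff:
 assumes "x : carrier Z" "y : carrier Z"
 shows "B +> x = B +> y \<longleftrightarrow> x \<ominus> y : B"
proof
 assume "B +> x = B +> y"
 then have "x : B +> y" using a_rcos_self[OF assms(1)] by simp
 then obtain b where "b : B" "x = b \<oplus> y" by (auto simp: a_r_coset_def')
 then show "x \<ominus> y : B" using assms by (simp add: Z.minus_eq Z.a_assoc Z.r_neg)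
next
 assume b: "x \<ominus> y : B"
 have "x = (x \<ominus> y) \<oplus> y" using assms by (simp add: Z.minus_eq Z.a_assoc Z.l_neg)
 then have "x : B +> y" using b by (auto simp: a_r_coset_def')
 then show "B +> x = B +> y"
  using a_repr_independence[OF _ assms(2)] B.a_subgroup by auto
qed

text \<open>The action on cosets is defined as a union over representatives; it collapses to one
  coset because the action is additive and preserves \<open>B\<close>.\<close>

lemma coset_act:
 assumes "r : carrier R" "x : carrier Z"
 shows "(\<Union>y\<in>B +> x. B +> (r \<odot>\<^sub>Z y)) = B +> (r \<odot>\<^sub>Z x)"
proof -
 have "B +> (r \<odot>\<^sub>Z y) = B +> (r \<odot>\<^sub>Z x)" if "y : B +> x" for y
 proof -
  from that obtain b where b: "b : B" "y = b \<oplus> x" by (auto simp: a_r_coset_def')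
  have bc: "b : carrier Z" "r \<odot>\<^sub>Z b : carrier Z" "r \<odot>\<^sub>Z x : carrier Z" "y : carrier Z"
   using b assms a_subset act_closed by auto
  have "r \<odot>\<^sub>Z y \<ominus> r \<odot>\<^sub>Z x = r \<odot>\<^sub>Z b"
   using b bc assms by (simp add: act_add Z.minus_eq Z.a_assoc Z.r_neg)
  then show ?thesis using coset_eq_iff[of "r \<odot>\<^sub>Z y" "r \<odot>\<^sub>Z x"] bc act_sub b assms act_closed by simp
 qed
 moreover have "x : B +> x" by (rule a_rcos_self[OF assms(2)])
 ultimately show ?thesis by blast
qed

lemma quotient_carrier: "carrier (quotient_module Z B) = (\<lambda>x. B +> x) ` carrier Z"
 by (auto simp: quotient_module_def A_RCOSETS_def')

lemma quotient_trivial_iff: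
 "carrier (quotient_module Z B) = {\<zero>\<^sub>(quotient_module Z B)} \<longleftrightarrow> carrier Z \<subseteq> B"
proof -
 have z: "\<zero>\<^sub>(quotient_module Z B) = B" by (simp add: quotient_module_def)
 have "B +> x = B \<longleftrightarrow> x : B" if "x : carrier Z" for x
  using coset_eq_iff[OF that Z.zero_closed] that a_coset_add_zero[OF a_subset]
  by (simp add: Z.minus_zero_right)
 then show ?thesis unfolding z quotient_carrier using Z.zero_closed by auto
qed

text \<open>The first isomorphism theorem, in both directions. It trades maps on classes for maps on
  representatives, so that later arguments can handle cocycles directly.\<close>

lemma module_iso_quotient_iff:
 assumes "abelian_group N"
 shows "module_iso R (quotient_module Z B) N \<longleftrightarrow>
  (\<exists>l\<in>linear_maps R Z N. l ` carrier Z = carrier N \<and> (\<forall>z\<in>carrier Z. l z = \<zero>\<^sub>N \<longleftrightarrow> z : B))"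
  (is "?L \<longleftrightarrow> ?R")
proof
 interpret N: abelian_group N by fact
 let ?Q = "quotient_module Z B"
 have Qadd: "(B +> x) \<oplus>\<^sub>?Q (B +> y) = B +> (x \<oplus> y)"
  if "x : carrier Z" "y : carrier Z" for x y
  using a_rcos_sum[OF that] by (simp add: quotient_module_def)
 have Qact: "r \<odot>\<^sub>?Q (B +> x) = B +> (r \<odot>\<^sub>Z x)"
  if "r : carrier R" "x : carrier Z" for r x
  using coset_act[OF that] by (simp add: quotient_module_def)
 have Qin: "B +> x : carrier ?Q" if "x : carrier Z" for x
  using that by (auto simp: quotient_carrier)
 {
  assume ?L
  then obtain f where f: "f : linear_maps R ?Q N" and b: "bij_betw f (carrier ?Q) (carrier N)"
   unfolding module_iso_def by blast
  let ?l = "\<lambda>x. f (B +> x)"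
  have l: "?l : linear_maps R Z N"
  proof (rule linear_mapsI)
   fix x y assume xy: "x : carrier Z" "y : carrier Z"
   show "f (B +> x) : carrier N" using linear_closed[OF f Qin[OF xy(1)]] .
   show "f (B +> (x \<oplus> y)) = f (B +> x) \<oplus>\<^sub>N f (B +> y)"
    using linear_add[OF f Qin[OF xy(1)] Qin[OF xy(2)]] Qadd[OF xy] by simp
  next
   fix r x assume rx: "r : carrier R" "x : carrier Z"
   show "f (B +> (r \<odot>\<^sub>Z x)) = r \<odot>\<^sub>N f (B +> x)"
    using linear_smult[OF f rx(1) Qin[OF rx(2)]] Qact[OF rx] by simp
  qed
  have im: "?l ` carrier Z = carrier N"
   using b unfolding bij_betw_def quotient_carrier by (simp add: image_image)
  interpret l: additive_hom Z N ?l
   by (rule additive_homI[OF Z.abelian_group_axioms assms linear_additive[OF l]])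
  have "?l z = \<zero>\<^sub>N \<longleftrightarrow> z : B" if z: "z : carrier Z" for z
  proof -
   have "?l z = \<zero>\<^sub>N \<longleftrightarrow> ?l z = ?l \<zero>" using l.map_zero by simp
   also have "... \<longleftrightarrow> B +> z = B +> \<zero>"
    using b Qin[OF z] Qin[OF Z.zero_closed] unfolding bij_betw_def by (metis inj_onD)
   also have "... \<longleftrightarrow> z : B" using coset_eq_iff[OF z Z.zero_closed] z by (simp add: Z.minus_zero_right)
   finally show ?thesis .
  qed
  with l im show ?R by blast
 }
 assume ?R
 then obtain l where l: "l : linear_maps R Z N" and im: "l ` carrier Z = carrier N"
  and ker: "\<And>z. z : carrier Z ==> l z = \<zero>\<^sub>N \<longleftrightarrow> z : B" by blast
 interpret l: additive_hom Z N l
  by (rule additive_homI[OF Z.abelian_group_axioms assms linear_additive[OF l]])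
 have eq: "l x = l y \<longleftrightarrow> B +> x = B +> y" if "x : carrier Z" "y : carrier Z" for x y
 proof -
  have "l x = l y \<longleftrightarrow> l (x \<ominus> y) = \<zero>\<^sub>N"
   using that by (simp add: l.map_minus N.minus_eq_zero_iff)
  then show ?thesis using ker[of "x \<ominus> y"] coset_eq_iff[OF that] that by simp
 qed
 define f where "f U = l (SOME x. x : carrier Z \<and> U = B +> x)" for U
 have f: "f (B +> x) = l x" if x: "x : carrier Z" for x
 proof -
  have "\<exists>y. y : carrier Z \<and> B +> x = B +> y" using x by blast
  from someI_ex[OF this] show ?thesis unfolding f_def using eq[OF x] by metis
 qed
 have "f : linear_maps R ?Q N"
  by (rule linear_mapsI)
   (auto simp: quotient_carrier f Qadd Qact l.map_add linear_smult[OF l] act_closed)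
 moreover have "bij_betw f (carrier ?Q) (carrier N)"
  unfolding bij_betw_def quotient_carrier
  by (auto simp: inj_on_def f eq image_image im[symmetric])
 ultimately show ?L unfolding module_iso_def by blast
qed

end


section \<open>Dual cohomology\<close>

lemma dual_simps:
 "zero (dual_module R P) = (\<lambda>p\<in>carrier P. \<zero>\<^sub>R)"
 "add (dual_module R P) = (\<lambda>f g. \<lambda>p\<in>carrier P. f p \<oplus>\<^sub>R g p)"
 "smult (dual_module R P) = (\<lambda>r f. \<lambda>p\<in>carrier P. f p \<otimes>\<^sub>R r)"
 by (simp_all add: dual_module_def)

lemma dual_carrier_iff:
 "f : carrier (dual_module R P) \<longleftrightarrow> f : linear_maps R P (with_action R (mult R)) \<and> f : extensional (carrier P)"
 by (simp add: dual_module_def)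

lemma dual_restrict:
 assumes "left_module R P" "f : linear_maps R P (with_action R (mult R))"
 shows "(\<lambda>p\<in>carrier P. f p) : carrier (dual_module R P)"
proof -
 interpret left_module R P by fact
 have "(\<lambda>p\<in>carrier P. f p) : linear_maps R P (with_action R (mult R))"
  by (rule linear_mapsI)
   (use linear_closed[OF assms(2)] linear_add[OF assms(2)] linear_smult[OF assms(2)] smult_closed in auto)
 then show ?thesis by (simp add: dual_carrier_iff)
qed

lemma dual_ext:
 assumes "f : carrier (dual_module R P)" "g : carrier (dual_module R P)"
  "\<And>x. x : carrier P ==> f x = g x"
 shows "f = g"
 using assms by (auto simp: dual_carrier_iff intro: extensionalityI)

context
 fixes R :: "('r, 'x) ring_scheme" and P :: "('r, 'p) module"
 assumes P: "left_module R P"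
begin

interpretation P: left_module R P by (rule P)

lemma dual_add_closed:
 assumes "f : carrier (dual_module R P)" "g : carrier (dual_module R P)"
 shows "f \<oplus>\<^sub>(dual_module R P) g : carrier (dual_module R P)"
proof -
 from assms have f: "f : linear_maps R P (with_action R (mult R))"
  and g: "g : linear_maps R P (with_action R (mult R))" by (auto simp: dual_carrier_iff)
 show ?thesis unfolding dual_simps
  by (rule dual_restrict[OF P], rule linear_mapsI)
   (use linear_closed[OF f] linear_add[OF f] linear_smult[OF f]
     linear_closed[OF g] linear_add[OF g] linear_smult[OF g] in \<open>auto simp: P.R.a_ac P.R.r_distr\<close>)
qed

lemma dual_neg_closed:
 assumes "f : carrier (dual_module R P)"
 shows "(\<lambda>x\<in>carrier P. \<ominus>\<^sub>R f x) : carrier (dual_module R P)"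
proof -
 from assms have f: "f : linear_maps R P (with_action R (mult R))" by (auto simp: dual_carrier_iff)
 show ?thesis
  by (rule dual_restrict[OF P], rule linear_mapsI)
   (use linear_closed[OF f] linear_add[OF f] linear_smult[OF f] in "auto simp: P.R.minus_add P.R.r_minus")
qed

lemma dual_zero_closed: "\<zero>\<^sub>(dual_module R P) : carrier (dual_module R P)"
 unfolding dual_simps by (rule dual_restrict[OF P], rule linear_mapsI) auto

lemma dual_act_closed:
 assumes "f : carrier (dual_module R P)" "r : carrier R"
 shows "r \<odot>\<^sub>(dual_module R P) f : carrier (dual_module R P)"
proof -
 from assms have f: "f : linear_maps R P (with_action R (mult R))" by (auto simp: dual_carrier_iff)
 show ?thesis unfolding dual_simps
  by (rule dual_restrict[OF P], rule linear_mapsI)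
   (use linear_closed[OF f] linear_add[OF f] linear_smult[OF f] assms(2) in "auto simp: P.R.l_distr P.R.m_assoc")
qed

lemma dual_value_closed: "f : carrier (dual_module R P) ==> x : carrier P ==> f x : carrier R"
 by (auto simp: dual_carrier_iff linear_maps_def)

lemma dual_abelian_group: "abelian_group (dual_module R P)"
proof (rule abelian_groupI)
 fix f assume f: "f : carrier (dual_module R P)"
 show "\<exists>y\<in>carrier (dual_module R P). y \<oplus>\<^sub>(dual_module R P) f = \<zero>\<^sub>(dual_module R P)"
  by (rule bexI[OF _ dual_neg_closed[OF f]])
   (auto simp: dual_simps P.R.l_neg dual_value_closed[OF f])
 show "\<zero>\<^sub>(dual_module R P) \<oplus>\<^sub>(dual_module R P) f = f"
  using f by (auto simp: dual_simps dual_carrier_iff extensional_def restrict_def dual_value_closed[OF f])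
next
 fix f g h assume *: "f : carrier (dual_module R P)" "g : carrier (dual_module R P)" "h : carrier (dual_module R P)"
 note v = *[THEN dual_value_closed]
 show "f \<oplus>\<^sub>(dual_module R P) g \<oplus>\<^sub>(dual_module R P) h = f \<oplus>\<^sub>(dual_module R P) (g \<oplus>\<^sub>(dual_module R P) h)"
  unfolding dual_simps using v by (auto intro!: restrict_ext simp: P.R.a_assoc)
next
 fix f g assume *: "f : carrier (dual_module R P)" "g : carrier (dual_module R P)"
 note v = *[THEN dual_value_closed]
 show "f \<oplus>\<^sub>(dual_module R P) g = g \<oplus>\<^sub>(dual_module R P) f"
  unfolding dual_simps using v by (auto intro!: restrict_ext simp: P.R.a_comm)
qed (auto intro: dual_add_closed dual_zero_closed)

end

abbreviation cocycle_module ::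
  "('r, 'x) ring_scheme => (nat => ('r, 'p) module) => (nat => 'p => 'p) => nat => ('r, 'p => 'r) module" where
 "cocycle_module R P d i \<equiv> (dual_module R (P i))\<lparr>carrier := dual_cocycles R P d i\<rparr>"

text \<open>Stands for an isomorphism of the degree \<open>i\<close> cohomology with
  \<open>N\<close>, in the coset-free form of \<open>module_iso_quotient_iff\<close>.\<close>

definition cohomology_onto ::
  "('r, 'x) ring_scheme => (nat => ('r, 'p) module) => (nat => 'p => 'p) => nat =>
   ('r, 'n) module => (('p => 'r) => 'n) => bool" where
 "cohomology_onto R P d i N l \<longleftrightarrow> l : linear_maps R (cocycle_module R P d i) N \<and>
   l ` dual_cocycles R P d i = carrier N \<and>
   (\<forall>c\<in>dual_cocycles R P d i. l c = \<zero>\<^sub>N \<longleftrightarrow> c : dual_coboundaries R P d i)"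

definition pullback :: "('r, 'p) module => ('p => 'q) => ('q => 'r) => 'p => 'r" where
 "pullback P u c = (\<lambda>x\<in>carrier P. c (u x))"

lemma pullback_closed:
 assumes "left_module R P" "u : linear_maps R P Q" "c : carrier (dual_module R Q)"
 shows "pullback P u c : carrier (dual_module R P)"
 unfolding pullback_def
 by (rule dual_restrict[OF assms(1) linear_comp[OF _ assms(2)]]) (use assms(3) in "simp add: dual_carrier_iff")

lemma dual_coboundaries_Suc:
 "dual_coboundaries R P d (Suc j) = pullback (P (Suc j)) (d j) ` carrier (dual_module R (P j))"
 by (simp add: dual_coboundaries_def pullback_def[abs_def])

lemma dual_coboundaries_0: "dual_coboundaries R P d 0 = {\<zero>\<^sub>(dual_module R (P 0))}"
 by (simp add: dual_coboundaries_def)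

locale module_complex =
 fixes R :: "('r, 'x) ring_scheme" and P :: "nat => ('r, 'p) module" and d :: "nat => 'p => 'p"
 assumes term_module: "left_module R (P n)"
  and diff_linear: "d n : linear_maps R (P (Suc n)) (P n)"
  and diff_diff: "x : carrier (P (Suc (Suc n))) ==> d n (d (Suc n) x) = \<zero>\<^sub>(P n)"
begin

lemma cocycle_dual: "c : dual_cocycles R P d i ==> c : carrier (dual_module R (P i))"
 by (simp add: dual_cocycles_def)

lemma dual_at_zero: "c : carrier (dual_module R (P i)) ==> c \<zero>\<^sub>(P i) = \<zero>\<^sub>R"
 using additive_hom.map_zero[OF linear_hom[OF term_module regular_left_module[OF left_module_ring[OF term_module]]]]
 by (metis dual_carrier_iff with_action_simps(3))

lemma coboundary_cocycle: "dual_coboundaries R P d i \<subseteq> dual_cocycles R P d i"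
proof
 fix c assume c: "c : dual_coboundaries R P d i"
 show "c : dual_cocycles R P d i"
 proof (cases i)
  case 0
  then show ?thesis using c dual_zero_closed[OF term_module[of 0]] linear_closed[OF diff_linear[of 0]]
   by (auto simp: dual_coboundaries_0 dual_cocycles_def dual_simps)
 next
  case (Suc j)
  then obtain g where g: "g : carrier (dual_module R (P j))" "c = pullback (P (Suc j)) (d j) g"
   using c by (auto simp: dual_coboundaries_Suc)
  then show ?thesis
   using pullback_closed[OF term_module diff_linear g(1)] Suc diff_diff dual_at_zero[OF g(1)]
    linear_closed[OF diff_linear]
   by (auto simp: dual_cocycles_def pullback_def)
 qed
qed

lemma cocycles_subgroup: "additive_subgroup (dual_cocycles R P d i) (dual_module R (P i))"
proof -
 interpret R: ring R by (rule left_module_ring[OF term_module])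
 interpret D: abelian_group "dual_module R (P i)" by (rule dual_abelian_group[OF term_module])
 note dd = linear_closed[OF diff_linear[of i]]
 have "subgroup (dual_cocycles R P d i) (add_monoid (dual_module R (P i)))"
 proof (rule D.add.subgroupI)
  show "dual_cocycles R P d i \<noteq> {}"
   using dual_zero_closed[OF term_module, of i] dd by (auto simp: dual_cocycles_def dual_simps)
  fix c assume c: "c : dual_cocycles R P d i"
  then have cd: "c : carrier (dual_module R (P i))" by (rule cocycle_dual)
  have "\<ominus>\<^sub>(dual_module R (P i)) c = (\<lambda>x\<in>carrier (P i). \<ominus>\<^sub>R c x)"
   by (rule D.minus_equality)
    (use cd dual_neg_closed[OF term_module] dual_value_closed[OF term_module cd]
     in \<open>auto simp: dual_simps R.l_neg\<close>)
  then show "\<ominus>\<^sub>((dual_module R (P i))) c : dual_cocycles R P d i"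
   using dual_neg_closed[OF term_module cd] c dd
   by (auto simp: dual_cocycles_def)
  fix c' assume c': "c' : dual_cocycles R P d i"
  then show "c \<oplus>\<^sub>((dual_module R (P i))) c' : dual_cocycles R P d i"
   using c dual_add_closed[OF term_module cd cocycle_dual[OF c']] dd
   by (auto simp: dual_cocycles_def dual_simps)
 qed (auto simp: dual_cocycles_def)
 then show ?thesis by (rule additive_subgroupI)
qed

lemma pullback_additive:
 assumes "left_module R Q" "u : linear_maps R Q (P i)"
 shows "pullback Q u : additive_maps (dual_module R (P i)) (dual_module R Q)"
proof (rule additive_mapsI)
 show "\<And>x. x : carrier (dual_module R (P i)) ==> pullback Q u x : carrier (dual_module R Q)"
  by (rule pullback_closed[OF assms])
qed (auto simp: pullback_def dual_simps linear_closed[OF assms(2)] intro!: restrict_ext)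

lemma coboundaries_subgroup: "additive_subgroup (dual_coboundaries R P d i) (dual_module R (P i))"
proof (cases i)
 case 0
 interpret D: abelian_group "dual_module R (P 0)" by (rule dual_abelian_group[OF term_module])
 show ?thesis unfolding 0 dual_coboundaries_0
  using D.add.triv_subgroup by (auto intro: additive_subgroupI)
next
 case (Suc j)
 interpret D: abelian_group "dual_module R (P j)" by (rule dual_abelian_group[OF term_module])
 interpret D': abelian_group "dual_module R (P (Suc j))" by (rule dual_abelian_group[OF term_module])
 interpret h: additive_hom "dual_module R (P j)" "dual_module R (P (Suc j))" "pullback (P (Suc j)) (d j)"
  by (rule additive_homI[OF D.abelian_group_axioms D'.abelian_group_axioms pullback_additive[OF term_module diff_linear]])
 have "subgroup (dual_coboundaries R P d (Suc j)) (add_monoid (dual_module R (P (Suc j))))"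
  unfolding dual_coboundaries_Suc
 proof (rule D'.add.subgroupI)
  fix a assume "a : pullback (P (Suc j)) (d j) ` carrier (dual_module R (P j))"
  then show "\<ominus>\<^sub>((dual_module R (P (Suc j)))) a : pullback (P (Suc j)) (d j) ` carrier (dual_module R (P j))"
   by (auto simp: h.map_uminus[symmetric])
 next
  fix a b assume "a : pullback (P (Suc j)) (d j) ` carrier (dual_module R (P j))"
   "b : pullback (P (Suc j)) (d j) ` carrier (dual_module R (P j))"
  then show "a \<oplus>\<^sub>((dual_module R (P (Suc j)))) b : pullback (P (Suc j)) (d j) ` carrier (dual_module R (P j))"
   by (auto simp: h.map_add[symmetric])
 qed (use D.zero_closed in auto)
 then show ?thesis unfolding Suc by (rule additive_subgroupI)
qed

lemma cocycle_act:
 assumes "c : dual_cocycles R P d i" "r : carrier R"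
 shows "r \<odot>\<^sub>(dual_module R (P i)) c : dual_cocycles R P d i"
proof -
 interpret R: ring R by (rule left_module_ring[OF term_module])
 show ?thesis
  using dual_act_closed[OF term_module cocycle_dual[OF assms(1)] assms(2)] assms linear_closed[OF diff_linear[of i]]
  by (auto simp: dual_cocycles_def dual_simps)
qed

lemma coboundary_act:
 assumes "c : dual_coboundaries R P d i" "r : carrier R"
 shows "r \<odot>\<^sub>(dual_module R (P i)) c : dual_coboundaries R P d i"
proof (cases i)
 case 0
 interpret R: ring R by (rule left_module_ring[OF term_module])
 show ?thesis using assms 0 by (auto simp: dual_coboundaries_0 dual_simps)
next
 case (Suc j)
 then obtain g where g: "g : carrier (dual_module R (P j))" "c = pullback (P (Suc j)) (d j) g"
  using assms by (auto simp: dual_coboundaries_Suc)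
 have "r \<odot>\<^sub>(dual_module R (P i)) c = pullback (P (Suc j)) (d j) (r \<odot>\<^sub>(dual_module R (P j)) g)"
  using linear_closed[OF diff_linear[of j]]
  by (auto simp: g Suc dual_simps pullback_def intro!: restrict_ext)
 then show ?thesis unfolding Suc dual_coboundaries_Suc
  using dual_act_closed[OF term_module g(1) assms(2)] by blast
qed

lemma cocycle_pair: "submodule_pair R (cocycle_module R P d i) (dual_coboundaries R P d i)"
proof -
 interpret R: ring R by (rule left_module_ring[OF term_module])
 interpret D: abelian_group "dual_module R (P i)" by (rule dual_abelian_group[OF term_module])
 interpret Z: additive_subgroup "dual_cocycles R P d i" "dual_module R (P i)" by (rule cocycles_subgroup)
 interpret B: additive_subgroup "dual_coboundaries R P d i" "dual_module R (P i)" by (rule coboundaries_subgroup)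
 interpret ZZ: abelian_group "cocycle_module R P d i"
 proof (rule abelian_groupI)
  fix x assume x: "x : carrier (cocycle_module R P d i)"
  then have xD: "x : carrier (dual_module R (P i))" by (simp add: cocycle_dual)
  show "\<exists>y\<in>carrier (cocycle_module R P d i). y \<oplus>\<^sub>(cocycle_module R P d i) x = \<zero>\<^sub>(cocycle_module R P d i)"
   by (rule bexI[of _ "\<ominus>\<^sub>(dual_module R (P i)) x"]) (use x xD D.l_neg in auto)
 qed (auto simp: cocycle_dual D.a_ac)
 have neg: "\<ominus>\<^sub>(cocycle_module R P d i) x = \<ominus>\<^sub>(dual_module R (P i)) x" if "x : dual_cocycles R P d i" for x
  by (rule ZZ.minus_equality) (use that in "auto simp: D.l_neg cocycle_dual")
 have "subgroup (dual_coboundaries R P d i) (add_monoid (cocycle_module R P d i))"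
 proof (rule ZZ.add.subgroupI)
  fix a assume a: "a : dual_coboundaries R P d i"
  then show "\<ominus>\<^sub>((cocycle_module R P d i)) a : dual_coboundaries R P d i"
   using neg[of a] coboundary_cocycle[of i] by (simp add: subset_iff)
 next
  show "dual_coboundaries R P d i \<noteq> {}" using B.zero_closed by blast
 qed (use coboundary_cocycle B.a_closed in auto)
 then have "additive_subgroup (dual_coboundaries R P d i) (cocycle_module R P d i)"
  by (rule additive_subgroupI)
 then interpret BB: additive_subgroup "dual_coboundaries R P d i" "cocycle_module R P d i" .
 show ?thesis
 proof (unfold_locales, goal_cases)
  case (1 r x) then show ?case by (simp add: cocycle_act)
 next
  case (2 r x y)
  then have "x : carrier (dual_module R (P i))" "y : carrier (dual_module R (P i))"
   by (auto simp: cocycle_dual)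
  then show ?case using 2 dual_value_closed[OF term_module, of _ i]
   by (auto simp: dual_simps R.l_distr intro!: restrict_ext)
 next
  case (3 r x) then show ?case by (simp add: coboundary_act)
 qed
qed

lemma module_iso_dual_cohomology_iff:
 "abelian_group N ==>
  module_iso R (dual_cohomology R P d i) N \<longleftrightarrow> (\<exists>l. cohomology_onto R P d i N l)"
 unfolding dual_cohomology_def submodule_pair.module_iso_quotient_iff[OF cocycle_pair]
 by (auto simp: cohomology_onto_def)

lemma dual_cohomology_trivial_iff:
 "carrier (dual_cohomology R P d i) = {\<zero>\<^sub>(dual_cohomology R P d i)} \<longleftrightarrow>
  dual_cocycles R P d i \<subseteq> dual_coboundaries R P d i"
 unfolding dual_cohomology_def submodule_pair.quotient_trivial_iff[OF cocycle_pair] by simp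

end

section \<open>Independence of the resolution: comparison maps and homotopies\<close>

section \<open>Comparison of projective resolutions\<close>

lemma resolution_complex:
 assumes "projective_resolution R M P d e"
 shows "module_complex R P d"
proof (rule module_complex.intro)
 fix n
 show "left_module R (P n)"
  using assms by (simp add: projective_resolution_def projective_module_def)
 show d: "d n : linear_maps R (P (Suc n)) (P n)"
  using assms by (simp add: projective_resolution_def)
 fix x assume x: "x : carrier (P (Suc (Suc n)))"
 have "d (Suc n) ` carrier (P (Suc (Suc n))) = {x : carrier (P (Suc n)). d n x = \<zero>\<^sub>(P n)}"
  using assms by (simp add: projective_resolution_def)
 then show "d n (d (Suc n) x) = \<zero>\<^sub>(P n)" using x by auto
qed

definition chain_map_over ::
  "('r, 'x) ring_scheme => (nat => ('r, 'p) module) => (nat => 'p => 'p) => ('p => 'm) =>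
   (nat => ('r, 'q) module) => (nat => 'q => 'q) => ('q => 'm) => (nat => 'p => 'q) => bool" where
 "chain_map_over R P d e P' d' e' f \<longleftrightarrow>
   (\<forall>n. f n : linear_maps R (P n) (P' n)) \<and>
   (\<forall>x\<in>carrier (P 0). e' (f 0 x) = e x) \<and>
   (\<forall>n. \<forall>x\<in>carrier (P (Suc n)). d' n (f (Suc n) x) = f n (d n x))"

context
 fixes R :: "('r, 'x) ring_scheme" and M :: "('r, 'm) module"
  and P :: "nat => ('r, 'p) module" and d e and P' :: "nat => ('r, 'q) module" and d' e'
 assumes res: "projective_resolution R M P d e" and res': "projective_resolution R M P' d' e'"
  and M: "left_module R M"
begin

interpretation C: module_complex R P d by (rule resolution_complex[OF res])
interpretation C': module_complex R P' d' by (rule resolution_complex[OF res'])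

lemma augmentation_facts:
 "e : linear_maps R (P 0) M" "e' : linear_maps R (P' 0) M"
 "e' ` carrier (P' 0) = carrier M" "e ` carrier (P 0) = carrier M"
 "x : carrier (P (Suc 0)) ==> e (d 0 x) = \<zero>\<^sub>M"
 "d' 0 ` carrier (P' (Suc 0)) = {x : carrier (P' 0). e' x = \<zero>\<^sub>M}"
 "d' (Suc n) ` carrier (P' (Suc (Suc n))) = {x : carrier (P' (Suc n)). d' n x = \<zero>\<^sub>(P' n)}"
proof -
 show "x : carrier (P (Suc 0)) ==> e (d 0 x) = \<zero>\<^sub>M"
 proof -
  assume "x : carrier (P (Suc 0))"
  then have "d 0 x : d 0 ` carrier (P (Suc 0))" by blast
  also have "... = {x : carrier (P 0). e x = \<zero>\<^sub>M}" using res by (simp add: projective_resolution_def)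
  finally show ?thesis by simp
 qed
qed (use res res' in "simp_all add: projective_resolution_def")

lemma term_projective: "projective_module R (P n)"
 using res by (simp add: projective_resolution_def)

lemma chain_map_exists: "\<exists>f. chain_map_over R P d e P' d' e' f"
proof -
 \<comment> \<open>\<open>A\<close> carries the invariant that makes the next lift possible:
   \<open>f\<close> sends boundaries into boundaries. \<open>B\<close> is the commuting square that
   ties consecutive choices together.\<close>
 define A where "A n f \<longleftrightarrow> f : linear_maps R (P n) (P' n) \<and>
  (\<forall>x\<in>carrier (P (Suc n)). f (d n x) : d' n ` carrier (P' (Suc n))) \<and>
  (n = 0 \<longrightarrow> (\<forall>x\<in>carrier (P 0). e' (f x) = e x))" for n f
 define B where "B n f g \<longleftrightarrow> (\<forall>x\<in>carrier (P (Suc n)). d' n (g x) = f (d n x))" for n f g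
 have "\<exists>f. \<forall>n. A n (f n) \<and> B n (f n) (f (Suc n))"
 proof (rule dependent_nat_choice)
  obtain h where h: "h : linear_maps R (P 0) (P' 0)" "\<And>x. x : carrier (P 0) ==> e' (h x) = e x"
   using projective_lift[OF term_projective C'.term_module M augmentation_facts(2,1)]
    linear_closed[OF augmentation_facts(1)] augmentation_facts(3) by blast
  have "h (d 0 x) : d' 0 ` carrier (P' (Suc 0))" if "x : carrier (P (Suc 0))" for x
   unfolding augmentation_facts(6)
   using linear_closed[OF C.diff_linear that] linear_closed[OF h(1)] h(2) augmentation_facts(5)[OF that] by simp
  then show "\<exists>f. A 0 f" unfolding A_def using h by blast
 next
  fix f n assume "A n f"
  then have f: "f : linear_maps R (P n) (P' n)"
   and im: "\<And>x. x : carrier (P (Suc n)) ==> f (d n x) : d' n ` carrier (P' (Suc n))"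
   by (auto simp: A_def)
  interpret f: additive_hom "P n" "P' n" f by (rule linear_hom[OF C.term_module C'.term_module f])
  obtain h where h: "h : linear_maps R (P (Suc n)) (P' (Suc n))"
   and dh: "\<And>x. x : carrier (P (Suc n)) ==> d' n (h x) = f (d n x)"
   using projective_lift[OF term_projective C'.term_module C'.term_module C'.diff_linear
     linear_comp[OF f C.diff_linear]] im by blast
  have "h (d (Suc n) x) : d' (Suc n) ` carrier (P' (Suc (Suc n)))"
   if x: "x : carrier (P (Suc (Suc n)))" for x
   unfolding augmentation_facts(7)
   using linear_closed[OF C.diff_linear x] linear_closed[OF h] dh C.diff_diff[OF x] f.map_zero by simp
  then show "\<exists>g. A (Suc n) g \<and> B n f g" using h dh by (auto simp: A_def B_def)
 qed
 then obtain f where "\<And>n. A n (f n)" "\<And>n. B n (f n) (f (Suc n))" by blast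
 then have "chain_map_over R P d e P' d' e' f"
  by (simp add: chain_map_over_def A_def B_def)
 then show ?thesis by blast
qed

text \<open>Both maps lift the identity of \<open>M\<close>, so their difference is killed by the
  augmentation and can be lifted degree by degree. The equations have the form
  \<open>d' h = (f - g) - h d\<close> because the right side is the element that is lifted.\<close>

lemma homotopy_exists:
 assumes f: "chain_map_over R P d e P' d' e' f" and g: "chain_map_over R P d e P' d' e' g"
 obtains h where "\<And>n. h n : linear_maps R (P n) (P' (Suc n))"
  "\<And>x. x : carrier (P 0) ==> d' 0 (h 0 x) = f 0 x \<ominus>\<^sub>(P' 0) g 0 x"
  "\<And>n x. x : carrier (P (Suc n)) ==>
    d' (Suc n) (h (Suc n) x) = (f (Suc n) x \<ominus>\<^sub>(P' (Suc n)) g (Suc n) x) \<ominus>\<^sub>(P' (Suc n)) h n (d n x)"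
proof -
 define D where "D n x = f n x \<ominus>\<^sub>(P' n) g n x" for n x
 have fl: "f n : linear_maps R (P n) (P' n)" and gl: "g n : linear_maps R (P n) (P' n)" for n
  using f g by (auto simp: chain_map_over_def)
 have Dl: "D n : linear_maps R (P n) (P' n)" for n
  unfolding D_def[abs_def]
  by (rule left_module.linear_sub[OF C'.term_module C.term_module fl gl])
 note dhom = linear_hom[OF C'.term_module C'.term_module C'.diff_linear]
 note dc = linear_closed[OF C.diff_linear]
 note D_closed = linear_closed[OF Dl]
 have dD: "d' n (D (Suc n) x) = D n (d n x)" if "x : carrier (P (Suc n))" for n x
  using f g that linear_closed[OF fl that] linear_closed[OF gl that]
  by (simp add: D_def additive_hom.map_minus[OF dhom] chain_map_over_def)
 have eD: "e' (D 0 x) = \<zero>\<^sub>M" if "x : carrier (P 0)" for x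
 proof -
  interpret M: abelian_group M by (rule left_module_abelian[OF M])
  have "e' (D 0 x) = e' (f 0 x) \<ominus>\<^sub>M e' (g 0 x)"
   using linear_closed[OF fl that] linear_closed[OF gl that]
   by (simp add: D_def additive_hom.map_minus[OF linear_hom[OF C'.term_module M augmentation_facts(2)]])
  then show ?thesis
   using f g that linear_closed[OF augmentation_facts(1) that]
   by (simp add: chain_map_over_def M.r_neg M.minus_eq)
 qed
 \<comment> \<open>The invariant says that \<open>D - h d\<close> is a cycle in the next degree,
   hence a boundary by exactness and projectivity lets it be lifted.\<close>
 define A where "A n h \<longleftrightarrow> h : linear_maps R (P n) (P' (Suc n)) \<and>
  (\<forall>x\<in>carrier (P (Suc n)). d' n (D (Suc n) x \<ominus>\<^sub>(P' (Suc n)) h (d n x)) = \<zero>\<^sub>(P' n)) \<and>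
  (n = 0 \<longrightarrow> (\<forall>x\<in>carrier (P 0). d' 0 (h x) = D 0 x))" for n h
 define B where "B n h h' \<longleftrightarrow>
  (\<forall>x\<in>carrier (P (Suc n)). d' (Suc n) (h' x) = D (Suc n) x \<ominus>\<^sub>(P' (Suc n)) h (d n x))" for n h h'
 have "\<exists>h. \<forall>n. A n (h n) \<and> B n (h n) (h (Suc n))"
 proof (rule dependent_nat_choice)
  have "D 0 ` carrier (P 0) \<subseteq> d' 0 ` carrier (P' (Suc 0))"
   unfolding augmentation_facts(6) using D_closed eD by auto
  then obtain h where h: "h : linear_maps R (P 0) (P' (Suc 0))"
   and dh: "\<And>x. x : carrier (P 0) ==> d' 0 (h x) = D 0 x"
   using projective_lift[OF term_projective C'.term_module C'.term_module C'.diff_linear Dl] by blast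
  interpret P0: left_module R "P' 0" by (rule C'.term_module)
  have "d' 0 (D (Suc 0) x \<ominus>\<^sub>(P' (Suc 0)) h (d 0 x)) = \<zero>\<^sub>(P' 0)" if x: "x : carrier (P (Suc 0))" for x
   using D_closed[OF x] linear_closed[OF h dc[OF x]] D_closed[OF dc[OF x]]
   by (simp add: additive_hom.map_minus[OF dhom] dD[OF x] dh dc[OF x] P0.M.r_neg P0.M.minus_eq)
  then show "\<exists>h. A 0 h" unfolding A_def using h dh by blast
 next
  fix h n assume "A n h"
  then have h: "h : linear_maps R (P n) (P' (Suc n))"
   and z: "\<And>x. x : carrier (P (Suc n)) ==> d' n (D (Suc n) x \<ominus>\<^sub>(P' (Suc n)) h (d n x)) = \<zero>\<^sub>(P' n)"
   by (auto simp: A_def)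
  interpret P1: left_module R "P' (Suc n)" by (rule C'.term_module)
  interpret h: additive_hom "P n" "P' (Suc n)" h by (rule linear_hom[OF C.term_module C'.term_module h])
  have l: "(\<lambda>x. D (Suc n) x \<ominus>\<^sub>(P' (Suc n)) h (d n x)) : linear_maps R (P (Suc n)) (P' (Suc n))"
   by (rule P1.linear_sub[OF C.term_module Dl linear_comp[OF h C.diff_linear]])
  have "(\<lambda>x. D (Suc n) x \<ominus>\<^sub>(P' (Suc n)) h (d n x)) ` carrier (P (Suc n)) \<subseteq> d' (Suc n) ` carrier (P' (Suc (Suc n)))"
   unfolding augmentation_facts(7) using z linear_closed[OF l] by auto
  then obtain h' where h': "h' : linear_maps R (P (Suc n)) (P' (Suc (Suc n)))"
   and dh': "\<And>x. x : carrier (P (Suc n)) ==> d' (Suc n) (h' x) = D (Suc n) x \<ominus>\<^sub>(P' (Suc n)) h (d n x)"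
   using projective_lift[OF term_projective C'.term_module C'.term_module C'.diff_linear l] by blast
  have "d' (Suc n) (D (Suc (Suc n)) x \<ominus>\<^sub>(P' (Suc (Suc n))) h' (d (Suc n) x)) = \<zero>\<^sub>(P' (Suc n))"
   if x: "x : carrier (P (Suc (Suc n)))" for x
  proof -
   have "d' (Suc n) (D (Suc (Suc n)) x \<ominus>\<^sub>(P' (Suc (Suc n))) h' (d (Suc n) x)) =
     D (Suc n) (d (Suc n) x) \<ominus>\<^sub>(P' (Suc n)) (D (Suc n) (d (Suc n) x) \<ominus>\<^sub>(P' (Suc n)) h (d n (d (Suc n) x)))"
    using D_closed[OF x] linear_closed[OF h' dc[OF x]]
    by (simp add: additive_hom.map_minus[OF dhom] dD[OF x] dh' dc[OF x])
   also have "h (d n (d (Suc n) x)) = \<zero>\<^sub>(P' (Suc n))" by (simp add: C.diff_diff[OF x] h.map_zero)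
   finally show ?thesis using D_closed[OF dc[OF x]]
    by (simp add: P1.M.minus_zero_right P1.M.minus_eq_zero_iff)
  qed
  then show "\<exists>h'. A (Suc n) h' \<and> B n h h'" using h' dh' by (auto simp: A_def B_def)
 qed
 then obtain h where "\<And>n. A n (h n)" "\<And>n. B n (h n) (h (Suc n))" by blast
 then show ?thesis using that[of h] by (simp add: A_def B_def D_def)
qed

lemma pullback_cocycle:
 assumes f: "chain_map_over R P d e P' d' e' f" and c: "c : dual_cocycles R P' d' i"
 shows "pullback (P i) (f i) c : dual_cocycles R P d i"
proof -
 have fl: "f i : linear_maps R (P i) (P' i)" for i using f by (auto simp: chain_map_over_def)
 have "c (f i (d i x)) = \<zero>\<^sub>R" if x: "x : carrier (P (Suc i))" for x
 proof -
  have "f i (d i x) = d' i (f (Suc i) x)" using f x by (simp add: chain_map_over_def)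
  then show ?thesis using c linear_closed[OF fl x] by (simp add: dual_cocycles_def)
 qed
 then show ?thesis
  using pullback_closed[OF C.term_module fl C'.cocycle_dual[OF c]] linear_closed[OF C.diff_linear]
  by (auto simp: dual_cocycles_def pullback_def)
qed

lemma pullback_coboundary:
 assumes f: "chain_map_over R P d e P' d' e' f" and c: "c : dual_coboundaries R P' d' i"
 shows "pullback (P i) (f i) c : dual_coboundaries R P d i"
proof -
 have fl: "f i : linear_maps R (P i) (P' i)" for i using f by (auto simp: chain_map_over_def)
 show ?thesis
 proof (cases i)
  case 0
  then show ?thesis using c linear_closed[OF fl]
   by (auto simp: dual_coboundaries_0 dual_simps pullback_def intro!: restrict_ext)
 next
  case (Suc j)
  then obtain g where g: "g : carrier (dual_module R (P' j))" "c = pullback (P' (Suc j)) (d' j) g"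
   using c by (auto simp: dual_coboundaries_Suc)
  have "pullback (P i) (f i) c = pullback (P (Suc j)) (d j) (pullback (P j) (f j) g)"
   using f linear_closed[OF fl] linear_closed[OF C.diff_linear]
   by (auto simp: g Suc pullback_def chain_map_over_def intro!: restrict_ext)
  then show ?thesis unfolding Suc dual_coboundaries_Suc
   using pullback_closed[OF C.term_module fl g(1)] by blast
 qed
qed

text \<open>A cocycle \<open>c\<close> vanishes on \<open>d' h\<close>, so what is left of the
  homotopy relation is the coboundary of \<open>c\<close> composed with \<open>h\<close>. In degree
  0 there is no \<open>h d\<close> term and the two pullbacks agree.\<close>

lemma pullback_homotopic:
 assumes f: "chain_map_over R P d e P' d' e' f" and g: "chain_map_over R P d e P' d' e' g"
  and c: "c : dual_cocycles R P' d' i"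
 shows "\<exists>b\<in>dual_coboundaries R P d i.
  pullback (P i) (f i) c = pullback (P i) (g i) c \<oplus>\<^sub>(dual_module R (P i)) b"
proof -
 obtain h where h: "\<And>n. h n : linear_maps R (P n) (P' (Suc n))"
  and h0: "\<And>x. x : carrier (P 0) ==> d' 0 (h 0 x) = f 0 x \<ominus>\<^sub>(P' 0) g 0 x"
  and hS: "\<And>n x. x : carrier (P (Suc n)) ==>
    d' (Suc n) (h (Suc n) x) = (f (Suc n) x \<ominus>\<^sub>(P' (Suc n)) g (Suc n) x) \<ominus>\<^sub>(P' (Suc n)) h n (d n x)"
  using homotopy_exists[OF f g] by metis
 have fl: "f n : linear_maps R (P n) (P' n)" and gl: "g n : linear_maps R (P n) (P' n)" for n
  using f g by (auto simp: chain_map_over_def)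
 interpret R: ring R by (rule left_module_ring[OF M])
 have cl: "c : linear_maps R (P' i) (with_action R (mult R))"
  using C'.cocycle_dual[OF c] by (simp add: dual_carrier_iff)
 interpret c: additive_hom "P' i" R c
  using linear_additive[OF cl] left_module_abelian[OF C'.term_module] R.is_abelian_group
  by (intro additive_homI) auto
 have cd: "c (d' i x) = \<zero>\<^sub>R" if "x : carrier (P' (Suc i))" for x
  using c that by (simp add: dual_cocycles_def)
 have fx: "f i x : carrier (P' i)" "g i x : carrier (P' i)" if "x : carrier (P i)" for x
  using linear_closed[OF fl that] linear_closed[OF gl that] by auto
 have key: "c (f i x) = c (g i x) \<oplus>\<^sub>R y"
  if "x : carrier (P i)" "c (f i x) \<ominus>\<^sub>R c (g i x) = y" for x y
 proof -
  have "c (f i x) = c (g i x) \<oplus>\<^sub>R (c (f i x) \<ominus>\<^sub>R c (g i x))"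
   using fx[OF that(1)] by (simp add: R.minus_eq R.a_lcomm R.r_neg)
  then show ?thesis using that(2) by simp
 qed
 show ?thesis
 proof (cases i)
  case 0
  have "c (f i x) = c (g i x) \<oplus>\<^sub>R \<zero>\<^sub>R" if x: "x : carrier (P i)" for x
  proof (rule key[OF x])
   have "c (f i x \<ominus>\<^sub>(P' i) g i x) = c (d' i (h i x))" using h0 x 0 by simp
   then show "c (f i x) \<ominus>\<^sub>R c (g i x) = \<zero>\<^sub>R"
    using cd[OF linear_closed[OF h x]] fx[OF x] by (simp add: c.map_minus)
  qed
  then have "pullback (P i) (f i) c = pullback (P i) (g i) c \<oplus>\<^sub>(dual_module R (P i)) \<zero>\<^sub>(dual_module R (P i))"
   by (auto simp: pullback_def dual_simps intro!: restrict_ext)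
  then show ?thesis using 0 by (auto simp: dual_coboundaries_0)
 next
  case (Suc j)
  let ?b = "pullback (P j) (h j) c"
  have hj: "h j : linear_maps R (P j) (P' i)" using h Suc by simp
  have "c (f i x) = c (g i x) \<oplus>\<^sub>R c (h j (d j x))" if x: "x : carrier (P i)" for x
  proof (rule key[OF x])
   have x': "x : carrier (P (Suc j))" using x Suc by simp
   note hx = linear_closed[OF hj linear_closed[OF C.diff_linear x']]
    have "c ((f i x \<ominus>\<^sub>(P' i) g i x) \<ominus>\<^sub>(P' i) h j (d j x)) = c (d' i (h i x))"
    using hS x' Suc by simp
   then have "(c (f i x) \<ominus>\<^sub>R c (g i x)) \<ominus>\<^sub>R c (h j (d j x)) = \<zero>\<^sub>R"
    using cd[OF linear_closed[OF h x]] fx[OF x] hx by (simp add: c.map_minus)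
   then show "c (f i x) \<ominus>\<^sub>R c (g i x) = c (h j (d j x))"
    using fx[OF x] hx by (simp add: R.minus_eq_zero_iff)
  qed
  then have "pullback (P i) (f i) c = pullback (P i) (g i) c \<oplus>\<^sub>(dual_module R (P i)) pullback (P i) (d j) ?b"
   using linear_closed[OF C.diff_linear[of j]] Suc
   by (auto simp: pullback_def dual_simps intro!: restrict_ext)
  moreover have "pullback (P i) (d j) ?b : dual_coboundaries R P d i"
   unfolding Suc dual_coboundaries_Suc
   using pullback_closed[OF C.term_module hj C'.cocycle_dual[OF c]] by blast
  ultimately show ?thesis by blast
 qed
qed

end

lemma chain_map_comp:
 assumes f: "chain_map_over R P d e P' d' e' f" and g: "chain_map_over R P' d' e' P'' d'' e'' g"
 shows "chain_map_over R P d e P'' d'' e'' (\<lambda>n x. g n (f n x))"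
proof -
 have fl: "f n : linear_maps R (P n) (P' n)" and gl: "g n : linear_maps R (P' n) (P'' n)" for n
  using assms by (auto simp: chain_map_over_def)
 show ?thesis
  using assms linear_comp[OF gl fl] linear_closed[OF fl] by (simp add: chain_map_over_def)
qed

lemma chain_map_id:
 "chain_map_over R P d e P d e (\<lambda>n x. x)"
 by (simp add: chain_map_over_def linear_id)

lemma pullback_pullback:
 assumes "u : linear_maps R P Q"
 shows "pullback P u (pullback Q v c) = pullback P (\<lambda>x. v (u x)) c"
 using linear_closed[OF assms] by (auto simp: pullback_def intro!: restrict_ext)

lemma pullback_id: "c : carrier (dual_module R P) ==> pullback P (\<lambda>x. x) c = c"
 by (auto simp: pullback_def dual_carrier_iff extensional_restrict)

context
 fixes R :: "('r, 'x) ring_scheme" and M :: "('r, 'm) module"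
  and P :: "nat => ('r, 'p) module" and d e and P' :: "nat => ('r, 'q) module" and d' e' f g
 assumes res: "projective_resolution R M P d e" and res': "projective_resolution R M P' d' e'"
  and M: "left_module R M"
  and f: "chain_map_over R P d e P' d' e' f" and g: "chain_map_over R P' d' e' P d e g"
begin

interpretation C: module_complex R P d by (rule resolution_complex[OF res])
interpretation C': module_complex R P' d' by (rule resolution_complex[OF res'])

text \<open>The composite of the two comparison maps and the identity map lift the same map of
  \<open>M\<close>, hence are homotopic.\<close>

lemma pullback_retract:
 assumes "c : dual_cocycles R P d i"
 shows "\<exists>b\<in>dual_coboundaries R P d i.
  pullback (P i) (f i) (pullback (P' i) (g i) c) = c \<oplus>\<^sub>(dual_module R (P i)) b"
proof -
 have "f i : linear_maps R (P i) (P' i)" using f by (auto simp: chain_map_over_def)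
 then have "pullback (P i) (f i) (pullback (P' i) (g i) c) = pullback (P i) (\<lambda>x. g i (f i x)) c"
  by (rule pullback_pullback)
 then show ?thesis
  using pullback_homotopic[OF res res M chain_map_comp[OF f g] chain_map_id assms]
   pullback_id[OF C.cocycle_dual[OF assms]] by simp
qed

end

text \<open>Pulling back once more along \<open>f\<close> returns \<open>c\<close> up to a
  coboundary, which can then be subtracted.\<close>

lemma coboundary_if_pullback:
 assumes res: "projective_resolution R M P d e" and res': "projective_resolution R M P' d' e'"
  and M: "left_module R M"
  and f: "chain_map_over R P d e P' d' e' f" and g: "chain_map_over R P' d' e' P d e g"
  and c: "c : dual_cocycles R P d i"
  and cob: "pullback (P' i) (g i) c : dual_coboundaries R P' d' i"
 shows "c : dual_coboundaries R P d i"
proof -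
 interpret C: module_complex R P d by (rule resolution_complex[OF res])
 interpret D: abelian_group "dual_module R (P i)" by (rule dual_abelian_group[OF C.term_module])
 interpret B: additive_subgroup "dual_coboundaries R P d i" "dual_module R (P i)"
  by (rule C.coboundaries_subgroup)
 obtain b where b: "b : dual_coboundaries R P d i"
  "pullback (P i) (f i) (pullback (P' i) (g i) c) = c \<oplus>\<^sub>(dual_module R (P i)) b"
  using pullback_retract[OF res res' M f g c] by blast
 then have "c \<oplus>\<^sub>(dual_module R (P i)) b : dual_coboundaries R P d i"
  using pullback_coboundary[OF res res' M f cob] by simp
 then have "(c \<oplus>\<^sub>(dual_module R (P i)) b) \<oplus>\<^sub>(dual_module R (P i)) \<ominus>\<^sub>(dual_module R (P i)) b : dual_coboundaries R P d i"
  using b by simp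
 moreover have "b : carrier (dual_module R (P i))" "c : carrier (dual_module R (P i))"
  using b(1) B.a_subset C.cocycle_dual[OF c] by auto
 ultimately show ?thesis by (simp add: D.a_assoc D.r_neg)
qed

theorem cohomology_vanish_transfer:
 assumes res: "projective_resolution R M P d e" and res': "projective_resolution R M P' d' e'"
  and M: "left_module R M"
  and van: "dual_cocycles R P d i \<subseteq> dual_coboundaries R P d i"
 shows "dual_cocycles R P' d' i \<subseteq> dual_coboundaries R P' d' i"
proof
 fix c assume c: "c : dual_cocycles R P' d' i"
 obtain f where f: "chain_map_over R P d e P' d' e' f" using chain_map_exists[OF res res' M] by blast
 obtain g where g: "chain_map_over R P' d' e' P d e g" using chain_map_exists[OF res' res M] by blast
 show "c : dual_coboundaries R P' d' i"
  by (rule coboundary_if_pullback[OF res' res M g f c])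
   (use pullback_cocycle[OF res res' M f c] van in blast)
qed

theorem cohomology_onto_transfer:
 assumes res: "projective_resolution R M P d e" and res': "projective_resolution R M P' d' e'"
  and M: "left_module R M" and N: "abelian_group N"
  and l: "cohomology_onto R P d i N l"
 shows "\<exists>l. cohomology_onto R P' d' i N l"
proof -
 interpret C: module_complex R P d by (rule resolution_complex[OF res])
 interpret C': module_complex R P' d' by (rule resolution_complex[OF res'])
 interpret N: abelian_group N by fact
 obtain f where f: "chain_map_over R P d e P' d' e' f" using chain_map_exists[OF res res' M] by blast
 obtain g where g: "chain_map_over R P' d' e' P d e g" using chain_map_exists[OF res' res M] by blast
 have fl: "f i : linear_maps R (P i) (P' i)" using f by (auto simp: chain_map_over_def)
 have ll: "l : linear_maps R (cocycle_module R P d i) N"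
  and onto: "l ` dual_cocycles R P d i = carrier N"
  and ker: "\<And>c. c : dual_cocycles R P d i ==> l c = \<zero>\<^sub>N \<longleftrightarrow> c : dual_coboundaries R P d i"
  using l by (auto simp: cohomology_onto_def)
 \<comment> \<open>Cocycles of the new resolution are evaluated through \<open>f\<close>; the map
   \<open>g\<close> in the other direction supplies preimages and detects coboundaries.\<close>
 let ?l = "\<lambda>c. l (pullback (P i) (f i) c)"
 have pb: "pullback (P i) (f i) c : dual_cocycles R P d i" if "c : dual_cocycles R P' d' i" for c
  by (rule pullback_cocycle[OF res res' M f that])
 have pb': "pullback (P' i) (g i) c : dual_cocycles R P' d' i" if "c : dual_cocycles R P d i" for c
  by (rule pullback_cocycle[OF res' res M g that])
 have "?l : linear_maps R (cocycle_module R P' d' i) N"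
 proof (rule linear_mapsI)
  fix x y assume "x : carrier (cocycle_module R P' d' i)" "y : carrier (cocycle_module R P' d' i)"
  then have xy: "x : dual_cocycles R P' d' i" "y : dual_cocycles R P' d' i" by auto
  show "?l x : carrier N" using pb[OF xy(1)] linear_closed[OF ll] by simp
  have "pullback (P i) (f i) (x \<oplus>\<^sub>(dual_module R (P' i)) y) =
   pullback (P i) (f i) x \<oplus>\<^sub>(dual_module R (P i)) pullback (P i) (f i) y"
   using additive_add[OF C'.pullback_additive[OF C.term_module fl]] C'.cocycle_dual xy by blast
  then show "?l (x \<oplus>\<^sub>(cocycle_module R P' d' i) y) = ?l x \<oplus>\<^sub>N ?l y"
   using linear_add[OF ll] pb[OF xy(1)] pb[OF xy(2)] by simp
 next
  fix r x assume r: "r : carrier R" and "x : carrier (cocycle_module R P' d' i)"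
  then have x: "x : dual_cocycles R P' d' i" by simp
  have "pullback (P i) (f i) (r \<odot>\<^sub>(dual_module R (P' i)) x) = r \<odot>\<^sub>(dual_module R (P i)) pullback (P i) (f i) x"
   using linear_closed[OF fl] by (auto simp: pullback_def dual_simps intro!: restrict_ext)
  then show "?l (r \<odot>\<^sub>(cocycle_module R P' d' i) x) = r \<odot>\<^sub>N ?l x"
   using linear_smult[OF ll r] pb[OF x] by simp
 qed
 moreover have "?l ` dual_cocycles R P' d' i = carrier N"
 proof
  show "?l ` dual_cocycles R P' d' i \<subseteq> carrier N" using pb onto by blast
  show "carrier N \<subseteq> ?l ` dual_cocycles R P' d' i"
  proof
   fix n assume "n : carrier N"
   then obtain c where c: "c : dual_cocycles R P d i" "n = l c" using onto by blast
   obtain b where b: "b : dual_coboundaries R P d i"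
    "pullback (P i) (f i) (pullback (P' i) (g i) c) = c \<oplus>\<^sub>(dual_module R (P i)) b"
    using pullback_retract[OF res res' M f g c(1)] by blast
   have bc: "b : dual_cocycles R P d i" using b(1) C.coboundary_cocycle by blast
   have "?l (pullback (P' i) (g i) c) = l c \<oplus>\<^sub>N l b"
    using linear_add[OF ll, of c b] c(1) bc b(2) by simp
   also have "... = n" using ker[OF bc] b(1) c linear_closed[OF ll, of c] by simp
   finally show "n : ?l ` dual_cocycles R P' d' i" using pb'[OF c(1)] by blast
  qed
 qed
 moreover have "?l c = \<zero>\<^sub>N \<longleftrightarrow> c : dual_coboundaries R P' d' i" if c: "c : dual_cocycles R P' d' i" for c
  unfolding ker[OF pb[OF c]]
  using coboundary_if_pullback[OF res' res M g f c] pullback_coboundary[OF res res' M f] by blast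
 ultimately show ?thesis unfolding cohomology_onto_def by blast
qed

text \<open>A choice is meaningful only if a candidate exists in the prescribed type. The hypothesis
  is such a candidate; the chosen resolution may be quite different from it.\<close>

lemma chosen_resolution_projective:
 fixes R :: "('r, 'x) ring_scheme" and M :: "('r, 'm) module"
 assumes "projective_resolution R M (P :: ('r, 'm) res_modules) d e"
 obtains P' d' e' where "chosen_resolution R M = (P', d')" "projective_resolution R M P' d' e'"
proof -
 let ?A = "\<lambda>x. case x of (P, d) => \<exists>e. projective_resolution R M (P :: ('r, 'm) res_modules) d e"
 obtain P' d' where Pd: "chosen_resolution R M = (P', d')" by (cases "chosen_resolution R M")
 have "?A (P, d)" using assms by auto
 then have "?A (chosen_resolution R M)" unfolding chosen_resolution_def by (rule someI)
 then show ?thesis using that[OF Pd] Pd by auto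
qed

section \<open>Finitely generated projective resolutions in coordinates\<close>

section \<open>Resolutions given by matrices\<close>

abbreviation rows :: "('r, 'x) ring_scheme => nat => ('r, nat => 'r) module" where
 "rows R m \<equiv> free_module R {..<m}"

abbreviation "vecs R m \<equiv> carrier (rows R m)"

abbreviation regular_module :: "('r, 'x) ring_scheme => ('r, 'r) module" where
 "regular_module R \<equiv> with_action R (mult R)"

text \<open>The product of the row \<open>x\<close> with the column \<open>t\<close>. If
  \<open>N\<close> is a module of rows, then \<open>t\<close> is a matrix listed by its rows and
  this is the product of a vector with a matrix.\<close>

definition comb :: "('r, 'n) module => nat => (nat => 'r) => (nat => 'n) => 'n" where
 "comb N m x t = (\<Oplus>\<^sub>N i\<in>{..<m}. x i \<odot>\<^sub>N t i)"

lemma rows_carrier_iff: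
 "x : vecs R m \<longleftrightarrow> (\<forall>i<m. x i : carrier R) \<and> (\<forall>i\<ge>m. x i = \<zero>\<^sub>R)"
proof -
 have "{i. x i \<noteq> \<zero>\<^sub>R} \<subseteq> {..<m}" if "\<forall>i\<ge>m. x i = \<zero>\<^sub>R" using that by (auto simp: not_le[symmetric])
 then show ?thesis unfolding free_carrier_iff by (auto intro: finite_subset simp: not_less)
qed

lemma rowsI:
 "(\<And>i. i < m ==> x i : carrier R) ==> (\<And>i. m \<le> i ==> x i = \<zero>\<^sub>R) ==> x : vecs R m"
 by (simp add: rows_carrier_iff)

lemma comb_cong:
 assumes "abelian_group N"
  and "\<And>i. i < m ==> x i \<odot>\<^sub>N t i = y i \<odot>\<^sub>N u i" "\<And>i. i < m ==> y i \<odot>\<^sub>N u i : carrier N"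
 shows "comb N m x t = comb N m y u"
proof -
 interpret abelian_group N by fact
 show ?thesis unfolding comb_def by (rule finsum_cong') (use assms(2,3) in auto)
qed

context left_module
begin

lemma comb_closed:
 "(\<And>i. i < m ==> x i : carrier R) ==> (\<And>i. i < m ==> t i : carrier M) ==> comb M m x t : carrier M"
 unfolding comb_def by (rule M.finsum_closed) (auto simp: smult_closed)

lemma comb_linear:
 assumes t: "\<And>i. i < m ==> t i : carrier M"
 shows "(\<lambda>x. comb M m x t) : linear_maps R (rows R m) M"
proof (rule linear_mapsI)
 fix x y assume "x : vecs R m" "y : vecs R m"
 then have x: "x i : carrier R" and y: "y i : carrier R" for i by (auto intro: R.free_closed)
 show "comb M m x t : carrier M" using x t by (rule comb_closed)
 have "comb M m (x \<oplus>\<^sub>(rows R m) y) t = (\<Oplus>\<^sub>M i\<in>{..<m}. x i \<odot>\<^sub>M t i \<oplus>\<^sub>M y i \<odot>\<^sub>M t i)"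
  unfolding comb_def by (rule M.finsum_cong') (use x y t in "auto simp: smult_l_distr smult_closed")
 also have "... = comb M m x t \<oplus>\<^sub>M comb M m y t"
  unfolding comb_def by (rule M.finsum_addf) (use x y t in "auto simp: smult_closed")
 finally show "comb M m (x \<oplus>\<^sub>(rows R m) y) t = comb M m x t \<oplus>\<^sub>M comb M m y t" .
next
 fix r x assume r: "r : carrier R" and "x : vecs R m"
 then have x: "x i : carrier R" for i by (auto intro: R.free_closed)
 have "comb M m (r \<odot>\<^sub>(rows R m) x) t = (\<Oplus>\<^sub>M i\<in>{..<m}. r \<odot>\<^sub>M (x i \<odot>\<^sub>M t i))"
  unfolding comb_def by (rule M.finsum_cong') (use x r t in "auto simp: smult_assoc smult_closed")
 also have "... = r \<odot>\<^sub>M comb M m x t"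
  unfolding comb_def by (rule smult_finsum[symmetric]) (use x r t in "auto simp: smult_closed")
 finally show "comb M m (r \<odot>\<^sub>(rows R m) x) t = r \<odot>\<^sub>M comb M m x t" .
qed

lemma comb_unit:
 assumes "i < m" "\<And>i. i < m ==> t i : carrier M"
 shows "comb M m (unit_vector R i) t = t i"
proof -
 have "comb M m (unit_vector R i) t = (\<Oplus>\<^sub>M j\<in>{..<m}. if i = j then t j else \<zero>\<^sub>M)"
  unfolding comb_def by (rule M.finsum_cong') (use assms in "auto simp: unit_vector_def smult_one")
 also have "... = t i" using assms by (intro M.finsum_singleton) auto
 finally show ?thesis .
qed

lemma comb_map:
 assumes N: "left_module R N" and f: "f : linear_maps R M N"
  and x: "\<And>i. i < m ==> x i : carrier R" and t: "\<And>i. i < m ==> t i : carrier M"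
 shows "f (comb M m x t) = comb N m x (\<lambda>i. f (t i))"
proof -
 interpret N: left_module R N by fact
 have "f (comb M m x t) = (\<Oplus>\<^sub>N i\<in>{..<m}. f (x i \<odot>\<^sub>M t i))"
  unfolding comb_def
  by (rule additive_hom.map_finsum[OF linear_hom[OF left_module_axioms N f]])
   (use x t in "auto simp: smult_closed")
 also have "... = comb N m x (\<lambda>i. f (t i))"
  unfolding comb_def
  by (rule N.M.finsum_cong')
   (use x t linear_closed[OF f] in "auto simp: linear_smult[OF f] N.smult_closed")
 finally show ?thesis .
qed

lemma comb_expand:
 assumes f: "f : linear_maps R (rows R m) M" and x: "x : vecs R m"
 shows "f x = comb M m x (\<lambda>i. f (unit_vector R i))"
proof -
 have u: "f (unit_vector R i) : carrier M" if "i < m" for i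
  using linear_closed[OF f R.unit_vector_closed[of i "{..<m}"]] that by simp
 show ?thesis
  by (rule free_linear_eq[OF left_module_axioms f comb_linear _ x]) (use u comb_unit in auto)
qed

text \<open>Linear maps commute with \<open>comb\<close>, and multiplication by \<open>t\<close> on
  the right is linear.\<close>

lemma comb_assoc:
 assumes x: "x : vecs R m" and A: "\<And>i. i < m ==> A i : vecs R m'"
  and t: "\<And>i. i < m' ==> t i : carrier M"
 shows "comb M m' (comb (rows R m') m x A) t = comb M m x (\<lambda>i. comb M m' (A i) t)"
proof -
 interpret F: left_module R "rows R m'" by (rule R.free_left_module)
 show ?thesis
  by (rule F.comb_map[OF left_module_axioms comb_linear]) (use x A t in "auto simp: R.free_closed")
qed

lemma comb_zero_right: "(\<And>i. i < m ==> x i : carrier R) ==> comb M m x (\<lambda>i. \<zero>\<^sub>M) = \<zero>\<^sub>M"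
 unfolding comb_def using M.finsum_zero
 by (subst M.finsum_cong'[where g = "\<lambda>i. \<zero>\<^sub>M" and B = "{..<m}"]) auto

lemma comb_zero_left: "(\<And>i. i < m ==> t i : carrier M) ==> comb M m (\<lambda>i. \<zero>\<^sub>R) t = \<zero>\<^sub>M"
 unfolding comb_def using M.finsum_zero
 by (subst M.finsum_cong'[where g = "\<lambda>i. \<zero>\<^sub>M" and B = "{..<m}"]) auto

end

lemma comb_rows_eval:
 assumes "ring R" "\<And>i. i < m ==> x i : carrier R" "\<And>i. i < m ==> A i : vecs R m'"
 shows "comb (rows R m') m x A j = comb (regular_module R) m x (\<lambda>i. A i j)"
proof -
 interpret ring R by fact
 interpret F: left_module R "rows R m'" by (rule free_left_module)
 have "(\<lambda>i. x i \<odot>\<^sub>(rows R m') A i) : {..<m} \<rightarrow> vecs R m'"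
  using assms(2,3) by (intro Pi_I F.smult_closed) auto
 from free_finsum_eval[OF this, of j] show ?thesis by (simp add: comb_def)
qed

text \<open>The computation behind every change of rings: ring homomorphisms applied entrywise to
  matrices and semilinear maps of the resolved modules are all instances.\<close>

lemma comb_semilinear:
 assumes N: "left_module H N" and N': "left_module R N'"
  and f: "f : additive_maps N N'"
  and smult: "\<And>h x. [|h : carrier H; x : carrier N|] ==> f (h \<odot>\<^sub>N x) = \<phi> h \<odot>\<^sub>N' f x"
  and \<phi>: "\<And>h. h : carrier H ==> \<phi> h : carrier R"
  and x: "\<And>i. i < m ==> x i : carrier H" and t: "\<And>i. i < m ==> t i : carrier N"
 shows "f (comb N m x t) = comb N' m (\<lambda>i. \<phi> (x i)) (\<lambda>i. f (t i))"
proof -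
 interpret N: left_module H N by fact
 interpret N': left_module R N' by fact
 have "f (comb N m x t) = (\<Oplus>\<^sub>N' i\<in>{..<m}. f (x i \<odot>\<^sub>N t i))"
  unfolding comb_def
  by (rule additive_hom.map_finsum[OF additive_homI[OF _ _ f]])
   (use x t N.M.abelian_group_axioms N'.M.abelian_group_axioms in "auto simp: N.smult_closed")
 also have "... = comb N' m (\<lambda>i. \<phi> (x i)) (\<lambda>i. f (t i))"
  unfolding comb_def
  by (rule N'.M.finsum_cong')
   (use x t additive_closed[OF f] \<phi> in "auto simp: smult N'.smult_closed")
 finally show ?thesis .
qed

type_synonym 'r matrices = "nat => nat => nat => 'r"

text \<open>
 The projective module in degree \<open>n\<close> consists of the row vectors fixed by the idempotent matrix
 \<open>E n\<close>; the differential is \<open>x \<mapsto> x D\<close> and the augmentation \<open>x \<mapsto> \<Sum> x\<^sub>l t\<^sub>l\<close>.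
\<close>

locale matrix_resolution = left_module R M
 for R (structure) and M :: "('r, 'm) module" (structure) +
 fixes m :: "nat => nat" and E D :: "'r matrices" and t :: "nat => 'm"
 assumes E_closed: "l < m n ==> E n l : vecs R (m n)"
  and D_closed: "l < m (Suc n) ==> D n l : vecs R (m n)"
  and t_closed: "l < m 0 ==> t l : carrier M"
  and EE: "l < m n ==> comb (rows R (m n)) (m n) (E n l) (E n) = E n l"
  and DE: "l < m (Suc n) ==> comb (rows R (m n)) (m n) (D n l) (E n) = D n l"
  and ED: "l < m (Suc n) ==> comb (rows R (m n)) (m (Suc n)) (E (Suc n) l) (D n) = D n l"
  and DD: "l < m (Suc (Suc n)) ==> comb (rows R (m n)) (m (Suc n)) (D (Suc n) l) (D n) = (\<lambda>i. \<zero>\<^sub>R)"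
  and Et: "l < m 0 ==> comb M (m 0) (E 0 l) t = t l"
  and Dt: "l < m (Suc 0) ==> comb M (m 0) (D 0 l) t = \<zero>\<^sub>M"
  and exact_0: "[|x : vecs R (m 0); comb (rows R (m 0)) (m 0) x (E 0) = x;
   comb M (m 0) x t = \<zero>\<^sub>M|] ==> \<exists>y\<in>vecs R (m (Suc 0)). x = comb (rows R (m 0)) (m (Suc 0)) y (D 0)"
  and exact_Suc: "[|x : vecs R (m (Suc n)); comb (rows R (m (Suc n))) (m (Suc n)) x (E (Suc n)) = x;
   comb (rows R (m n)) (m (Suc n)) x (D n) = (\<lambda>i. \<zero>\<^sub>R)|] ==>
   \<exists>y\<in>vecs R (m (Suc (Suc n))). x = comb (rows R (m (Suc n))) (m (Suc (Suc n))) y (D (Suc n))"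
  and onto: "z : carrier M ==> \<exists>x\<in>vecs R (m 0). comb M (m 0) x t = z"

definition row_module ::
  "('r, 'x) ring_scheme => (nat => nat) => 'r matrices => nat => ('r, nat => 'r) module" where
 "row_module R m E n = (rows R (m n))\<lparr>carrier :=
   {x : vecs R (m n). comb (rows R (m n)) (m n) x (E n) = x}\<rparr>"

definition row_map ::
  "('r, 'x) ring_scheme => (nat => nat) => 'r matrices => nat => (nat => 'r) => nat => 'r" where
 "row_map R m D n x = comb (rows R (m n)) (m (Suc n)) x (D n)"

lemma row_module_simps [simp]:
 "zero (row_module R m E n) = (\<lambda>i. \<zero>\<^sub>R)"
 "add (row_module R m E n) = (\<lambda>f g i. f i \<oplus>\<^sub>R g i)"
 "smult (row_module R m E n) = (\<lambda>r f i. r \<otimes>\<^sub>R f i)"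
 by (simp_all add: row_module_def)

lemma row_module_carrier_iff:
 "x : carrier (row_module R m E n) \<longleftrightarrow> x : vecs R (m n) \<and> comb (rows R (m n)) (m n) x (E n) = x"
 by (simp add: row_module_def)

lemma submodule_left_module:
 assumes F: "left_module R F" and S: "S \<subseteq> carrier F" "\<zero>\<^sub>F : S"
  and add: "\<And>x y. x : S ==> y : S ==> x \<oplus>\<^sub>F y : S"
  and smult: "\<And>r x. r : carrier R ==> x : S ==> r \<odot>\<^sub>F x : S"
 shows "left_module R (F\<lparr>carrier := S\<rparr>)"
proof -
 interpret F: left_module R F by fact
 have ab: "abelian_group (F\<lparr>carrier := S\<rparr>)"
 proof (rule abelian_groupI)
  fix x assume "x : carrier (F\<lparr>carrier := S\<rparr>)"
  then have x: "x : S" "x : carrier F" using S by auto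
  \<comment> \<open>Closure under negation comes from acting with minus one.\<close>
  have "\<ominus>\<^sub>R \<one>\<^sub>R \<odot>\<^sub>F x \<oplus>\<^sub>F x = (\<ominus>\<^sub>R \<one>\<^sub>R \<oplus>\<^sub>R \<one>\<^sub>R) \<odot>\<^sub>F x"
   using x by (subst F.smult_l_distr) (auto simp: F.smult_one)
  also have "... = \<zero>\<^sub>F" using x by (simp add: F.R.l_neg)
  finally show "\<exists>y\<in>carrier (F\<lparr>carrier := S\<rparr>). y \<oplus>\<^sub>(F\<lparr>carrier := S\<rparr>) x = \<zero>\<^sub>(F\<lparr>carrier := S\<rparr>)"
   using smult[of "\<ominus>\<^sub>R \<one>\<^sub>R" x] x by auto
 next
  fix x y z assume "x : carrier (F\<lparr>carrier := S\<rparr>)" "y : carrier (F\<lparr>carrier := S\<rparr>)" "z : carrier (F\<lparr>carrier := S\<rparr>)"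
  then have "x : carrier F" "y : carrier F" "z : carrier F" using S by auto
  then show "x \<oplus>\<^sub>(F\<lparr>carrier := S\<rparr>) y \<oplus>\<^sub>(F\<lparr>carrier := S\<rparr>) z = x \<oplus>\<^sub>(F\<lparr>carrier := S\<rparr>) (y \<oplus>\<^sub>(F\<lparr>carrier := S\<rparr>) z)"
   by (simp add: F.M.a_assoc)
 next
  fix x y assume "x : carrier (F\<lparr>carrier := S\<rparr>)" "y : carrier (F\<lparr>carrier := S\<rparr>)"
  then have "x : carrier F" "y : carrier F" using S by auto
  then show "x \<oplus>\<^sub>(F\<lparr>carrier := S\<rparr>) y = y \<oplus>\<^sub>(F\<lparr>carrier := S\<rparr>) x" by (simp add: F.M.a_comm)
 next
  fix x assume "x : carrier (F\<lparr>carrier := S\<rparr>)"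
  then have "x : carrier F" using S by auto
  then show "\<zero>\<^sub>(F\<lparr>carrier := S\<rparr>) \<oplus>\<^sub>(F\<lparr>carrier := S\<rparr>) x = x" by simp
 qed (use S add in auto)
 show ?thesis
  by (rule left_module.intro[OF F.R.ring_axioms ab], rule left_module_axioms.intro)
   (use S smult in "auto simp: F.smult_l_distr F.smult_r_distr F.smult_assoc F.smult_one subset_iff")
qed

context matrix_resolution
begin

lemma rows_left_module: "left_module R (rows R n)"
 by (rule R.free_left_module)

lemma E_map_linear: "(\<lambda>x. comb (rows R (m n)) (m n) x (E n)) : linear_maps R (rows R (m n)) (rows R (m n))"
 by (rule left_module.comb_linear[OF rows_left_module E_closed])

lemma D_map_linear: "(\<lambda>x. comb (rows R (m n)) (m (Suc n)) x (D n)) : linear_maps R (rows R (m (Suc n))) (rows R (m n))"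
 by (rule left_module.comb_linear[OF rows_left_module D_closed])

lemma E_comb_closed: "x : vecs R (m n) ==> comb (rows R (m n)) (m n) x (E n) : vecs R (m n)"
 by (rule linear_closed[OF E_map_linear])

lemma D_comb_closed: "x : vecs R (m (Suc n)) ==> comb (rows R (m n)) (m (Suc n)) x (D n) : vecs R (m n)"
 by (rule linear_closed[OF D_map_linear])

lemma comb_E_idem:
 assumes "x : vecs R (m n)"
 shows "comb (rows R (m n)) (m n) (comb (rows R (m n)) (m n) x (E n)) (E n) = comb (rows R (m n)) (m n) x (E n)"
 by (subst left_module.comb_assoc[OF rows_left_module assms E_closed E_closed])
  (auto intro!: comb_cong[OF left_module_abelian[OF rows_left_module]] simp: EE
   left_module.smult_closed[OF rows_left_module] E_closed assms R.free_closed[OF assms] simp del: free_module_simps)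

lemma comb_D_E:
 assumes "x : vecs R (m (Suc n))"
 shows "comb (rows R (m n)) (m n) (comb (rows R (m n)) (m (Suc n)) x (D n)) (E n) = comb (rows R (m n)) (m (Suc n)) x (D n)"
 by (subst left_module.comb_assoc[OF rows_left_module assms D_closed E_closed])
  (auto intro!: comb_cong[OF left_module_abelian[OF rows_left_module]] simp: DE
   left_module.smult_closed[OF rows_left_module] D_closed assms R.free_closed[OF assms] simp del: free_module_simps)

lemma comb_E_D:
 assumes "x : vecs R (m (Suc n))"
 shows "comb (rows R (m n)) (m (Suc n)) (comb (rows R (m (Suc n))) (m (Suc n)) x (E (Suc n))) (D n) = comb (rows R (m n)) (m (Suc n)) x (D n)"
 by (subst left_module.comb_assoc[OF rows_left_module assms E_closed D_closed])
  (auto intro!: comb_cong[OF left_module_abelian[OF rows_left_module]] simp: ED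
   left_module.smult_closed[OF rows_left_module] D_closed assms R.free_closed[OF assms] simp del: free_module_simps)

lemma comb_D_D:
 assumes "x : vecs R (m (Suc (Suc n)))"
 shows "comb (rows R (m n)) (m (Suc n)) (comb (rows R (m (Suc n))) (m (Suc (Suc n))) x (D (Suc n))) (D n) = (\<lambda>i. \<zero>\<^sub>R)"
proof -
 have "comb (rows R (m n)) (m (Suc n)) (comb (rows R (m (Suc n))) (m (Suc (Suc n))) x (D (Suc n))) (D n) =
   comb (rows R (m n)) (m (Suc (Suc n))) x (\<lambda>i. \<zero>\<^sub>(rows R (m n)))"
  by (subst left_module.comb_assoc[OF rows_left_module assms D_closed D_closed])
   (auto intro!: comb_cong[OF left_module_abelian[OF rows_left_module]] simp: DD R.free_closed[OF assms] rows_carrier_iff)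
 also have "... = (\<lambda>i. \<zero>\<^sub>R)"
  using left_module.comb_zero_right[OF rows_left_module[of "m n"], of "m (Suc (Suc n))" x] R.free_closed[OF assms] by simp
 finally show ?thesis .
qed

lemma comb_E_t:
 assumes "x : vecs R (m 0)"
 shows "comb M (m 0) (comb (rows R (m 0)) (m 0) x (E 0)) t = comb M (m 0) x t"
 by (subst comb_assoc[OF assms E_closed t_closed])
  (auto intro!: comb_cong[OF left_module_abelian[OF left_module_axioms]] simp: Et smult_closed t_closed R.free_closed[OF assms])

lemma comb_D_t:
 assumes "x : vecs R (m (Suc 0))"
 shows "comb M (m 0) (comb (rows R (m 0)) (m (Suc 0)) x (D 0)) t = \<zero>\<^sub>M"
proof -
 have "comb M (m 0) (comb (rows R (m 0)) (m (Suc 0)) x (D 0)) t = comb M (m (Suc 0)) x (\<lambda>i. \<zero>\<^sub>M)"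
  by (subst comb_assoc[OF assms D_closed t_closed])
   (auto intro!: comb_cong[OF left_module_abelian[OF left_module_axioms]] simp: Dt R.free_closed[OF assms])
 then show ?thesis using comb_zero_right R.free_closed[OF assms] by simp
qed

abbreviation "P \<equiv> row_module R m E"
abbreviation "dP \<equiv> row_map R m D"
abbreviation "eP \<equiv> (\<lambda>x. comb M (m 0) x t)"

lemma row_left_module: "left_module R (P n)"
 unfolding row_module_def
proof (rule submodule_left_module[OF rows_left_module])
 note E = E_map_linear[of n]
 let ?S = "{x : vecs R (m n). comb (rows R (m n)) (m n) x (E n) = x}"
 interpret F: left_module R "rows R (m n)" by (rule rows_left_module)
 show "\<zero>\<^sub>(rows R (m n)) : ?S"
  using F.M.zero_closed F.comb_zero_left[of "m n" "E n", OF E_closed] by simp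
 fix x assume x: "x : ?S"
 {
  fix y assume y: "y : ?S"
  show "x \<oplus>\<^sub>(rows R (m n)) y : ?S"
   using x y linear_add[OF E, of x y] F.M.a_closed[of x y] by (simp del: free_module_simps)
 }
 fix r assume r: "r : carrier R"
 show "r \<odot>\<^sub>(rows R (m n)) x : ?S"
  using x linear_smult[OF E r, of x] F.smult_closed[OF r, of x] by (simp del: free_module_simps)
qed auto

lemma row_sub: "carrier (P n) \<subseteq> vecs R (m n)"
 by (auto simp: row_module_carrier_iff)

lemma row_linear_restrict:
 "f : linear_maps R (rows R (m n)) N ==> f : linear_maps R (P n) N"
 using row_sub[of n] by (intro linear_mapsI) (auto simp: linear_closed subset_iff linear_add[of f R "rows R (m n)", simplified] linear_smult[of f R "rows R (m n)", simplified])

lemma E_row_closed: "x : vecs R (m n) ==> comb (rows R (m n)) (m n) x (E n) : carrier (P n)"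
 by (simp add: row_module_carrier_iff comb_E_idem E_comb_closed)

text \<open>The splitting is the equation \<open>x = x E\<close>: the free module sends its
  generators to the rows of \<open>E\<close>, and a vector fixed by \<open>E\<close> is the
  combination of these rows with its own entries as coefficients.\<close>

lemma row_projective:
 assumes "\<exists>a b :: 'r. a \<noteq> b"
 shows "projective_module R (P n)"
proof -
 obtain a b :: 'r where ab: "a \<noteq> b" using assms by blast
 \<comment> \<open>The index set of the free module must consist of elements of the type
   \<open>nat => 'r\<close>. With two distinct values \<open>a\<close> and \<open>b\<close> of the
   type, indicator functions serve as distinct names for the generators.\<close>
 define j :: "nat => nat => 'r" where "j l = (\<lambda>i. if i = l then a else b)" for l
 have inj: "inj j" using ab by (auto simp: inj_def j_def fun_eq_iff)
 let ?I = "j ` {..<m n}"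
 let ?F = "free_module R ?I"
 have jinv: "inv_into UNIV j (j l) = l" for l using inj by simp
 have Ecl: "E n (inv_into UNIV j i) : carrier (P n)" if "i : ?I" for i
  using that E_closed EE by (auto simp: jinv row_module_carrier_iff)
 obtain p where p: "p : linear_maps R ?F (P n)"
  and pu: "\<And>i. i : ?I ==> p (unit_vector R i) = E n (inv_into UNIV j i)"
  using free_extension[OF row_left_module, of ?I "\<lambda>i. E n (inv_into UNIV j i)" n] Ecl by blast
 interpret F: left_module R ?F by (rule R.free_left_module)
 have u: "unit_vector R (j l) : carrier ?F" if "l < m n" for l
  using that by (intro R.unit_vector_closed) auto
 define s where "s x = comb ?F (m n) x (\<lambda>l. unit_vector R (j l))" for x
 have s: "s : linear_maps R (rows R (m n)) ?F"
  unfolding s_def by (rule F.comb_linear) (use u in auto)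
 have "p (s x) = x" if x: "x : carrier (P n)" for x
 proof -
  have xr: "x : vecs R (m n)" using x row_sub by blast
  have p': "p : linear_maps R ?F (rows R (m n))"
   using p row_sub[of n] by (auto simp: linear_maps_def)
  have "p (s x) = comb (rows R (m n)) (m n) x (\<lambda>l. p (unit_vector R (j l)))"
   unfolding s_def by (rule F.comb_map[OF rows_left_module p']) (use u R.free_closed[OF xr] in auto)
  also have "... = comb (rows R (m n)) (m n) x (E n)"
  proof (rule comb_cong[OF left_module_abelian[OF rows_left_module]])
   fix l assume l: "l < m n"
   then have "p (unit_vector R (j l)) = E n l" using pu[of "j l"] jinv by simp
   then show "x l \<odot>\<^sub>(rows R (m n)) p (unit_vector R (j l)) = x l \<odot>\<^sub>(rows R (m n)) E n l" by simp
   show "x l \<odot>\<^sub>(rows R (m n)) E n l : vecs R (m n)"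
    by (rule left_module.smult_closed[OF rows_left_module R.free_closed[OF xr] E_closed[OF l]])
  qed
  also have "... = x" using x by (simp add: row_module_carrier_iff)
  finally show ?thesis .
 qed
 then show ?thesis unfolding projective_module_def
  by (intro conjI row_left_module exI[of _ ?I] bexI[OF _ p] bexI[OF _ row_linear_restrict[OF s]]) simp
qed

lemma row_map_linear: "dP n : linear_maps R (P (Suc n)) (P n)"
proof -
 have "dP n : linear_maps R (P (Suc n)) (rows R (m n))"
  unfolding row_map_def[abs_def] by (rule row_linear_restrict[OF D_map_linear])
 moreover have "dP n x : carrier (P n)" if "x : carrier (P (Suc n))" for x
  using that row_sub[of "Suc n"] comb_D_E D_comb_closed by (auto simp: row_module_carrier_iff row_map_def)
 ultimately show ?thesis by (auto simp: linear_maps_def)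
qed

lemma row_resolution:
 assumes "\<exists>a b :: 'r. a \<noteq> b"
 shows "projective_resolution R M P dP eP"
 unfolding projective_resolution_def
proof (intro conjI allI row_projective[OF assms] row_map_linear)
 have e: "eP : linear_maps R (rows R (m 0)) M" by (rule comb_linear[OF t_closed])
 then show "eP : linear_maps R (P 0) M" by (rule row_linear_restrict)
 show "eP ` carrier (P 0) = carrier M"
 proof
  show "eP ` carrier (P 0) \<subseteq> carrier M" using linear_closed[OF e] row_sub[of 0] by auto
  show "carrier M \<subseteq> eP ` carrier (P 0)"
  proof
   fix z assume "z : carrier M"
   then obtain x where x: "x : vecs R (m 0)" "eP x = z" using onto by blast
   then have "z = eP (comb (rows R (m 0)) (m 0) x (E 0))" using comb_E_t[OF x(1)] by simp
   then show "z : eP ` carrier (P 0)" using E_row_closed[OF x(1)] by (rule image_eqI)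
  qed
 qed
 \<comment> \<open>A preimage \<open>y\<close> may fail to be fixed by \<open>E\<close>. Replacing
   it by \<open>y E\<close> leaves its product with \<open>D\<close> unchanged, because
   \<open>E D = D\<close>.\<close>
 have pre: "comb (rows R (m n)) (m (Suc n)) y (D n) : dP n ` carrier (P (Suc n))"
  if "y : vecs R (m (Suc n))" for y n
  using imageI[OF E_row_closed[OF that], of "dP n"] comb_E_D[OF that] by (simp add: row_map_def)
 show "dP 0 ` carrier (P (Suc 0)) = {x : carrier (P 0). eP x = \<zero>\<^sub>M}"
 proof
  show "dP 0 ` carrier (P (Suc 0)) \<subseteq> {x : carrier (P 0). eP x = \<zero>\<^sub>M}"
   using linear_closed[OF row_map_linear[of 0]] row_sub[of "Suc 0"] comb_D_t by (auto simp: row_map_def)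
  show "{x : carrier (P 0). eP x = \<zero>\<^sub>M} \<subseteq> dP 0 ` carrier (P (Suc 0))"
   using exact_0 pre by (fastforce simp: row_module_carrier_iff)
 qed
 fix n
 show "dP (Suc n) ` carrier (P (Suc (Suc n))) = {x : carrier (P (Suc n)). dP n x = \<zero>\<^sub>(P n)}"
 proof
  show "dP (Suc n) ` carrier (P (Suc (Suc n))) \<subseteq> {x : carrier (P (Suc n)). dP n x = \<zero>\<^sub>(P n)}"
   using linear_closed[OF row_map_linear[of "Suc n"]] row_sub[of "Suc (Suc n)"] comb_D_D by (auto simp: row_map_def)
  show "{x : carrier (P (Suc n)). dP n x = \<zero>\<^sub>(P n)} \<subseteq> dP (Suc n) ` carrier (P (Suc (Suc n)))"
  proof
   fix x assume "x : {x : carrier (P (Suc n)). dP n x = \<zero>\<^sub>(P n)}"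
   then obtain y where "y : vecs R (m (Suc (Suc n)))" "x = comb (rows R (m (Suc n))) (m (Suc (Suc n))) y (D (Suc n))"
    using exact_Suc[of x n] by (auto simp: row_module_carrier_iff row_map_def)
   then show "x : dP (Suc n) ` carrier (P (Suc (Suc n)))" using pre by blast
  qed
 qed
qed

lemma row_fin_gen: "fin_gen_module R (P n)"
 unfolding fin_gen_module_def
proof (intro exI conjI ballI)
 interpret Pn: left_module R "P n" by (rule row_left_module)
 let ?G = "E n ` {..<m n}"
 show "finite ?G" by simp
 show G: "?G \<subseteq> carrier (P n)" using E_closed EE by (auto simp: row_module_carrier_iff)
 fix x assume x: "x : carrier (P n)"
 then have xr: "x : vecs R (m n)" using row_sub by blast
 \<comment> \<open>Coefficients are indexed by the set of generators, in which equal rows of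
   \<open>E\<close> coincide; so the entries belonging to equal rows are added up.\<close>
 define c where "c g = (\<Oplus>\<^sub>R l\<in>{l. l < m n \<and> E n l = g}. x l)" for g
 have inc: "(\<lambda>x. x) : linear_maps R (P n) (rows R (m n))"
  using row_sub by (auto simp: linear_maps_def)
 have "(\<Oplus>\<^sub>(P n)g\<in>?G. c g \<odot>\<^sub>(P n) g) =
   (\<Oplus>\<^sub>(P n)g\<in>?G. \<Oplus>\<^sub>(P n)l\<in>{l. l < m n \<and> E n l = g}. x l \<odot>\<^sub>(P n) E n l)"
 proof (rule Pn.M.finsum_cong')
  show "(\<lambda>g. \<Oplus>\<^sub>(P n)l\<in>{l. l < m n \<and> E n l = g}. x l \<odot>\<^sub>(P n) E n l) : ?G \<rightarrow> carrier (P n)"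
   using G by (intro Pi_I Pn.M.finsum_closed Pn.smult_closed) (auto simp: R.free_closed[OF xr] simp del: row_module_simps)
  fix g assume g: "g : ?G"
  have "c g \<odot>\<^sub>(P n) g = (\<Oplus>\<^sub>(P n)l\<in>{l. l < m n \<and> E n l = g}. x l \<odot>\<^sub>(P n) g)"
   unfolding c_def by (rule Pn.finsum_smult) (use g G R.free_closed[OF xr] in auto)
  also have "... = (\<Oplus>\<^sub>(P n)l\<in>{l. l < m n \<and> E n l = g}. x l \<odot>\<^sub>(P n) E n l)"
   by (rule Pn.M.finsum_cong') (use g G in "auto intro!: Pn.smult_closed R.free_closed[OF xr] simp del: row_module_simps")
  finally show "c g \<odot>\<^sub>(P n) g = (\<Oplus>\<^sub>(P n)l\<in>{l. l < m n \<and> E n l = g}. x l \<odot>\<^sub>(P n) E n l)" .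
 qed simp
 also have "... = (\<Oplus>\<^sub>(P n)l\<in>(\<Union>g\<in>?G. {l. l < m n \<and> E n l = g}). x l \<odot>\<^sub>(P n) E n l)"
  by (rule Pn.M.add.finprod_UN_disjoint[symmetric])
   (use G in "auto intro!: Pn.smult_closed R.free_closed[OF xr] simp: pairwise_def disjnt_def simp del: row_module_simps")
 also have "(\<Union>g\<in>?G. {l. l < m n \<and> E n l = g}) = {..<m n}" by auto
 also have "(\<Oplus>\<^sub>(P n)l\<in>{..<m n}. x l \<odot>\<^sub>(P n) E n l) = comb (P n) (m n) x (E n)" by (simp add: comb_def)
 also have "... = comb (rows R (m n)) (m n) x (E n)"
  using Pn.comb_map[OF rows_left_module inc, of "m n" x "E n"] G R.free_closed[OF xr] by auto
 also have "... = x" using x by (simp add: row_module_carrier_iff)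
 finally have "x = (\<Oplus>\<^sub>(P n)g\<in>?G. c g \<odot>\<^sub>(P n) g)" by (simp only:)
 moreover have "c : ?G \<rightarrow> carrier R"
  unfolding c_def by (intro Pi_I R.finsum_closed R.free_closed[OF xr])
 ultimately show "\<exists>c\<in>?G \<rightarrow> carrier R. x = (\<Oplus>\<^sub>(P n)g\<in>?G. c g \<odot>\<^sub>(P n) g)" by (rule bexI)
qed

end

section \<open>Moving a resolution into the type prescribed by the definitions\<close>

section \<open>Transport along an injection\<close>

text \<open>Smoothness and \<open>chosen_resolution\<close> prescribe modules whose elements are
  functions on syzygies, whereas row vectors are functions on \<open>nat\<close>. A copy of the
  module is placed on the image of an injection between the element types.\<close>

definition transport :: "('p => 'q) => ('r, 'p) module => ('r, 'q) module" where
 "transport \<tau> N = \<lparr>carrier = \<tau> ` carrier N, mult = undefined, one = undefined, zero = \<tau> \<zero>\<^sub>N,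
   add = (\<lambda>x y. \<tau> (inv_into UNIV \<tau> x \<oplus>\<^sub>N inv_into UNIV \<tau> y)),
   smult = (\<lambda>r x. \<tau> (r \<odot>\<^sub>N inv_into UNIV \<tau> x))\<rparr>"

lemma transport_simps:
 "carrier (transport \<tau> N) = \<tau> ` carrier N" "zero (transport \<tau> N) = \<tau> \<zero>\<^sub>N"
 "add (transport \<tau> N) x y = \<tau> (inv_into UNIV \<tau> x \<oplus>\<^sub>N inv_into UNIV \<tau> y)"
 "smult (transport \<tau> N) r x = \<tau> (r \<odot>\<^sub>N inv_into UNIV \<tau> x)"
 by (simp_all add: transport_def)

context
 fixes \<tau> :: "'p => 'q"
 assumes inj: "inj \<tau>"
begin

abbreviation (input) "\<sigma> \<equiv> inv_into UNIV \<tau>"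

lemma inv_transport [simp]: "\<sigma> (\<tau> x) = x"
 using inj by simp

lemma transport_left_module:
 assumes "left_module R N"
 shows "left_module R (transport \<tau> N)"
proof -
 interpret N: left_module R N by fact
 have ab: "abelian_group (transport \<tau> N)"
 proof (rule abelian_groupI)
  fix x assume "x : carrier (transport \<tau> N)"
  then obtain y where "y : carrier N" "x = \<tau> y" by (auto simp: transport_simps)
  then show "\<exists>y\<in>carrier (transport \<tau> N). y \<oplus>\<^sub>(transport \<tau> N) x = \<zero>\<^sub>(transport \<tau> N)"
   by (intro bexI[of _ "\<tau> (\<ominus>\<^sub>N y)"]) (auto simp: transport_simps N.M.l_neg)
 qed (auto simp: transport_simps N.M.a_ac)
 show ?thesis
  by (rule left_module.intro[OF N.R.ring_axioms ab], rule left_module_axioms.intro)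
   (auto simp: transport_simps N.smult_closed N.smult_l_distr N.smult_r_distr N.smult_assoc N.smult_one)
qed

lemma transport_linear: "\<tau> : linear_maps R N (transport \<tau> N)"
 by (rule linear_mapsI) (auto simp: transport_simps)

lemma transport_inv_linear: "left_module R N ==> \<sigma> : linear_maps R (transport \<tau> N) N"
 by (rule linear_mapsI) (auto simp: transport_simps)

lemma transport_projective:
 fixes N :: "('r, 'p) module"
 assumes "projective_module R N"
 shows "projective_module R (transport \<tau> N)"
proof -
 from assms have N: "left_module R N" by (simp add: projective_module_def)
 from assms obtain I :: "'p set" and s p where s: "s : linear_maps R N (free_module R I)"
  and p: "p : linear_maps R (free_module R I) N" and ps: "\<forall>x\<in>carrier N. p (s x) = x"
  unfolding projective_module_def by blast
 interpret R: ring R by (rule left_module_ring[OF N])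
 \<comment> \<open>The index set lives in the element type of the module and has to move along; the
   maps \<open>u\<close> and \<open>v\<close> below relabel the generators in both
   directions.\<close>
 let ?F = "free_module R I" and ?F' = "free_module R (\<tau> ` I)"
 have F: "left_module R ?F" and F': "left_module R ?F'" by (rule R.free_left_module)+
 have cl: "unit_vector R (\<tau> i) : carrier ?F'" if "i : I" for i
  using that by (intro R.unit_vector_closed) auto
 have cl': "unit_vector R (\<sigma> j) : carrier ?F" if "j : \<tau> ` I" for j
  using that by (intro R.unit_vector_closed) auto
 obtain u where u: "u : linear_maps R ?F ?F'"
  and uu: "\<And>i. i : I ==> u (unit_vector R i) = unit_vector R (\<tau> i)"
  using free_extension[OF F', of I "\<lambda>i. unit_vector R (\<tau> i)", OF cl] by blast
 obtain v where v: "v : linear_maps R ?F' ?F"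
  and vu: "\<And>j. j : \<tau> ` I ==> v (unit_vector R j) = unit_vector R (\<sigma> j)"
  using free_extension[OF F, of "\<tau> ` I" "\<lambda>j. unit_vector R (\<sigma> j)", OF cl'] by blast
 have vu: "v (u y) = y" if "y : carrier ?F" for y
  by (rule free_linear_eq[OF F linear_comp[OF v u] linear_id _ that]) (simp add: uu vu)
 have 1: "(\<lambda>x. u (s (\<sigma> x))) : linear_maps R (transport \<tau> N) ?F'"
  by (rule linear_comp[OF u linear_comp[OF s transport_inv_linear[OF N]]])
 have 2: "(\<lambda>x. \<tau> (p (v x))) : linear_maps R ?F' (transport \<tau> N)"
  by (rule linear_comp[OF transport_linear linear_comp[OF p v]])
 have 3: "\<forall>x\<in>carrier (transport \<tau> N). \<tau> (p (v (u (s (\<sigma> x))))) = x"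
  using ps linear_closed[OF s] by (auto simp: transport_simps vu)
 have "\<exists>I :: 'q set. \<exists>s\<in>linear_maps R (transport \<tau> N) (free_module R I).
   \<exists>p\<in>linear_maps R (free_module R I) (transport \<tau> N). \<forall>x\<in>carrier (transport \<tau> N). p (s x) = x"
  by (intro exI[of _ "\<tau> ` I"] bexI[OF _ 1] bexI[OF _ 2]) (rule 3)
 then show ?thesis unfolding projective_module_def using transport_left_module[OF N] by (rule conjI[rotated])
qed

lemma transport_fin_gen:
 assumes N: "left_module R N" and "fin_gen_module R N"
 shows "fin_gen_module R (transport \<tau> N)"
proof -
 interpret N: left_module R N by fact
 interpret T: left_module R "transport \<tau> N" by (rule transport_left_module[OF N])
 obtain G where G: "finite G" "G \<subseteq> carrier N"
  and gen: "\<And>x. x : carrier N ==> \<exists>c\<in>G \<rightarrow> carrier R. x = (\<Oplus>\<^sub>N g\<in>G. c g \<odot>\<^sub>N g)"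
  using assms(2) unfolding fin_gen_module_def by auto
 show ?thesis unfolding fin_gen_module_def
 proof (intro exI[of _ "\<tau> ` G"] conjI ballI)
  fix x assume "x : carrier (transport \<tau> N)"
  then obtain y where y: "y : carrier N" "x = \<tau> y" by (auto simp: transport_simps)
  obtain c where c: "c : G \<rightarrow> carrier R" "y = (\<Oplus>\<^sub>N g\<in>G. c g \<odot>\<^sub>N g)" using gen[OF y(1)] by blast
  have cgt: "c g \<odot>\<^sub>N g : carrier N" if "g : G" for g using c G that by (auto intro: N.smult_closed)
  have "x = (\<Oplus>\<^sub>(transport \<tau> N)g\<in>G. \<tau> (c g \<odot>\<^sub>N g))"
   unfolding y(2) c(2)
   by (rule additive_hom.map_finsum[OF linear_hom[OF N T.left_module_axioms transport_linear]]) (use cgt in auto)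
  also have "... = (\<Oplus>\<^sub>(transport \<tau> N)g\<in>G. c (\<sigma> (\<tau> g)) \<odot>\<^sub>(transport \<tau> N) \<tau> g)"
   by (rule T.M.finsum_cong') (use cgt in "auto simp: transport_simps")
  also have "... = (\<Oplus>\<^sub>(transport \<tau> N)g\<in>\<tau> ` G. c (\<sigma> g) \<odot>\<^sub>(transport \<tau> N) g)"
   by (rule T.M.finsum_reindex[symmetric])
    (use cgt inj_on_subset[OF inj] in "auto simp: transport_simps")
  finally show "\<exists>c\<in>\<tau> ` G \<rightarrow> carrier R. x = (\<Oplus>\<^sub>(transport \<tau> N)g\<in>\<tau> ` G. c g \<odot>\<^sub>(transport \<tau> N) g)"
   using c(1) by (intro bexI[of _ "\<lambda>g. c (\<sigma> g)"]) auto
 qed (use G in "auto simp: transport_simps")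
qed

lemma transport_resolution:
 assumes "projective_resolution R M P d e"
 shows "projective_resolution R M (\<lambda>n. transport \<tau> (P n)) (\<lambda>n x. \<tau> (d n (\<sigma> x))) (\<lambda>x. e (\<sigma> x))"
proof -
 have proj: "projective_module R (P n)" and d: "d n : linear_maps R (P (Suc n)) (P n)"
  and e: "e : linear_maps R (P 0) M" "e ` carrier (P 0) = carrier M"
  and ex0: "d 0 ` carrier (P (Suc 0)) = {x : carrier (P 0). e x = \<zero>\<^sub>M}"
  and ex: "d (Suc n) ` carrier (P (Suc (Suc n))) = {x : carrier (P (Suc n)). d n x = \<zero>\<^sub>(P n)}" for n
  using assms by (auto simp: projective_resolution_def)
 have N: "left_module R (P n)" for n using proj by (simp add: projective_module_def)
 have eq: "\<tau> x = \<tau> y \<longleftrightarrow> x = y" for x y using inj by (auto dest: injD)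
 have im: "(\<lambda>x. \<tau> (d n (\<sigma> x))) ` carrier (transport \<tau> (P (Suc n))) = \<tau> ` d n ` carrier (P (Suc n))" for n
  by (simp add: transport_simps image_image)
 show ?thesis unfolding projective_resolution_def
 proof (intro conjI allI transport_projective[OF proj]
   linear_comp[OF transport_linear linear_comp[OF d transport_inv_linear[OF N]]]
   linear_comp[OF e(1) transport_inv_linear[OF N]])
  show "(\<lambda>x. e (\<sigma> x)) ` carrier (transport \<tau> (P 0)) = carrier M"
   using e(2) by (simp add: transport_simps image_image)
  show "(\<lambda>x. \<tau> (d 0 (\<sigma> x))) ` carrier (transport \<tau> (P (Suc 0))) = {x : carrier (transport \<tau> (P 0)). e (\<sigma> x) = \<zero>\<^sub>M}"
   unfolding im ex0 by (auto simp: transport_simps)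
  show "(\<lambda>x. \<tau> (d (Suc n) (\<sigma> x))) ` carrier (transport \<tau> (P (Suc (Suc n)))) =
    {x : carrier (transport \<tau> (P (Suc n))). \<tau> (d n (\<sigma> x)) = \<zero>\<^sub>(transport \<tau> (P n))}" for n
   unfolding im ex by (auto simp: transport_simps eq)
 qed
qed

end

lemma syzygy_injection: "\<exists>\<iota> :: nat => ('r, 'm) syzygy. inj \<iota>"
proof
 show "inj (\<lambda>n. Rel (replicate n (undefined, Gen undefined)) :: ('r, 'm) syzygy)"
  by (auto simp: inj_def replicate_eq_replicate)
qed

text \<open>A left inverse of an injection is onto, so composing sequences with it is
  injective.\<close>

lemma sequence_injection: "\<exists>\<tau> :: (nat => 'r) => ('r, 'm) syzygy => 'r. inj \<tau>"
proof -
 obtain \<iota> :: "nat => ('r, 'm) syzygy" where \<iota>: "inj \<iota>" using syzygy_injection by blast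
 have "inj (\<lambda>(x :: nat => 'r) s. x (inv_into UNIV \<iota> s))"
 proof (rule injI)
  fix x y :: "nat => 'r" assume "(\<lambda>s. x (inv_into UNIV \<iota> s)) = (\<lambda>s. y (inv_into UNIV \<iota> s))"
  then have "x (inv_into UNIV \<iota> (\<iota> n)) = y (inv_into UNIV \<iota> (\<iota> n))" for n by meson
  then show "x = y" using \<iota> by (simp add: fun_eq_iff)
 qed
 then show ?thesis by blast
qed

text \<open>The last conclusion tracks vanishing: a zero idempotent gives a zero module. This is how
  the boundedness of a resolution survives a change of rings.\<close>

lemma (in matrix_resolution) resolution_in_syzygies:
 assumes "\<exists>a b :: 'r. a \<noteq> b"
 obtains Q :: "('r, 'm) res_modules" and d e where "projective_resolution R M Q d e"
  "\<And>n. fin_gen_module R (Q n)"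
  "\<And>n. (\<And>l i. l < m n ==> E n l i = \<zero>) ==> carrier (Q n) = {\<zero>\<^sub>(Q n)}"
proof -
 obtain \<tau> :: "(nat => 'r) => ('r, 'm) syzygy => 'r" where \<tau>: "inj \<tau>" using sequence_injection by blast
 have triv: "carrier (transport \<tau> (P n)) = {\<zero>\<^sub>(transport \<tau> (P n))}" if "\<And>l i. l < m n ==> E n l i = \<zero>" for n
 proof -
  interpret Pn: left_module R "P n" by (rule row_left_module)
  have eq: "x = (\<lambda>i. \<zero>)" if x: "x : carrier (P n)" for x
  proof -
   have xr: "x : vecs R (m n)" using x row_sub by blast
   interpret F: left_module R "rows R (m n)" by (rule rows_left_module)
   have "x = comb (rows R (m n)) (m n) x (E n)" using x by (simp add: row_module_carrier_iff)
   also have "... = comb (rows R (m n)) (m n) x (\<lambda>l. \<zero>\<^sub>(rows R (m n)))"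
   proof (rule comb_cong[OF F.M.abelian_group_axioms])
    fix l assume "l < m n"
    then have "E n l = \<zero>\<^sub>(rows R (m n))" using \<open>\<And>l i. l < m n ==> E n l i = \<zero>\<close> by (simp add: fun_eq_iff)
    then show "x l \<odot>\<^sub>(rows R (m n)) E n l = x l \<odot>\<^sub>(rows R (m n)) \<zero>\<^sub>(rows R (m n))" by simp
    show "x l \<odot>\<^sub>(rows R (m n)) \<zero>\<^sub>(rows R (m n)) : vecs R (m n)"
     by (rule F.smult_closed[OF R.free_closed[OF xr] F.M.zero_closed])
   qed
   also have "... = (\<lambda>i. \<zero>)"
    using F.comb_zero_right[of "m n" x] R.free_closed[OF xr] by simp
   finally show ?thesis .
  qed
  have "carrier (P n) = {\<zero>\<^sub>(P n)}"
  proof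
   show "{\<zero>\<^sub>(P n)} \<subseteq> carrier (P n)" using Pn.M.zero_closed by simp
   show "carrier (P n) \<subseteq> {\<zero>\<^sub>(P n)}"
   proof
    fix x assume "x : carrier (P n)"
    from eq[OF this] show "x : {\<zero>\<^sub>(P n)}" by simp
   qed
  qed
  then show ?thesis by (simp add: transport_simps)
 qed
 show ?thesis
 proof (rule that)
  show "projective_resolution R M (\<lambda>n. transport \<tau> (P n)) (\<lambda>n x. \<tau> (dP n (inv_into UNIV \<tau> x)))
    (\<lambda>x. eP (inv_into UNIV \<tau> x))"
   by (rule transport_resolution[OF \<tau> row_resolution[OF assms]])
  show "fin_gen_module R (transport \<tau> (P n))" for n
   by (rule transport_fin_gen[OF \<tau> row_left_module row_fin_gen])
 qed (rule triv)
qed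


section \<open>The dual complex in coordinates\<close>

section \<open>Dual cohomology through column vectors\<close>

text \<open>A functional on the row space of an idempotent \<open>E\<close> is determined by its
  values on the rows of \<open>E\<close>, and the columns arising in this way are those with
  \<open>E c = c\<close>. The second condition is the cocycle condition for the corresponding
  functional.\<close>

definition col_cocycles ::
  "('r, 'x) ring_scheme => (nat => nat) => 'r matrices => 'r matrices => nat =>
   (nat => 'r) set" where
 "col_cocycles R m E D i = {c : vecs R (m i).
   (\<forall>l<m i. comb (regular_module R) (m i) (E i l) c = c l) \<and>
   (\<forall>l<m (Suc i). comb (regular_module R) (m i) (D i l) c = \<zero>\<^sub>R)}"

definition col_image ::
  "('r, 'x) ring_scheme => (nat => nat) => 'r matrices => nat => (nat => 'r) => nat => 'r" where
 "col_image R m D j g = (\<lambda>l. if l < m (Suc j) then comb (regular_module R) (m j) (D j l) g else \<zero>\<^sub>R)"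

text \<open>The column may be arbitrary, not just one fixed by \<open>E\<close>: since
  \<open>D E = D\<close>, both choices give the same image.\<close>

definition col_coboundaries ::
  "('r, 'x) ring_scheme => (nat => nat) => 'r matrices => nat => (nat => 'r) set" where
 "col_coboundaries R m D i = (case i of
   0 => {\<lambda>l. \<zero>\<^sub>R} | Suc j => col_image R m D j ` vecs R (m j))"

definition col_onto ::
  "('r, 'x) ring_scheme => (nat => nat) => 'r matrices => 'r matrices => nat =>
   ('r, 'n) module => ((nat => 'r) => 'n) => bool" where
 "col_onto R m E D i N l \<longleftrightarrow>
   (\<forall>c\<in>col_cocycles R m E D i. l c : carrier N) \<and>
   (\<forall>c\<in>col_cocycles R m E D i. \<forall>c'\<in>col_cocycles R m E D i. l (\<lambda>i. c i \<oplus>\<^sub>R c' i) = l c \<oplus>\<^sub>N l c') \<and>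
   (\<forall>r\<in>carrier R. \<forall>c\<in>col_cocycles R m E D i. l (\<lambda>i. c i \<otimes>\<^sub>R r) = r \<odot>\<^sub>N l c) \<and>
   (\<forall>n\<in>carrier N. \<exists>c\<in>col_cocycles R m E D i. l c = n) \<and>
   (\<forall>c\<in>col_cocycles R m E D i. l c = \<zero>\<^sub>N \<longleftrightarrow> c : col_coboundaries R m D i)"

context matrix_resolution
begin

abbreviation "Rr \<equiv> regular_module R"

lemma Rr_left_module: "left_module R Rr"
 by (rule regular_left_module[OF R.ring_axioms])

definition col_functional where "col_functional i c = (\<lambda>x\<in>carrier (P i). comb Rr (m i) x c)"

definition functional_col where "functional_col i f = (\<lambda>l. if l < m i then f (E i l) else \<zero>)"

lemma E_in_row: "l < m i ==> E i l : carrier (P i)"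
 by (simp add: row_module_carrier_iff EE E_closed)

lemma D_in_row: "l < m (Suc i) ==> D i l : carrier (P i)"
 by (simp add: row_module_carrier_iff DE D_closed)

lemma row_entry_closed: "x : carrier (P i) ==> x l : carrier R"
 by (rule R.free_closed[OF subsetD[OF row_sub]])

lemma col_functional_dual:
 assumes "c : vecs R (m i)"
 shows "col_functional i c : carrier (dual_module R (P i))"
 unfolding col_functional_def
 by (rule dual_restrict[OF row_left_module row_linear_restrict[OF left_module.comb_linear[OF Rr_left_module]]])
  (use R.free_closed[OF assms] in simp)

lemma functional_col_closed:
 assumes "f : carrier (dual_module R (P i))"
 shows "functional_col i f : vecs R (m i)"
 by (rule rowsI) (use dual_value_closed[OF row_left_module assms E_in_row] in "auto simp: functional_col_def")

text \<open>Since \<open>x = x E\<close>, the vector is the combination of the rows of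
  \<open>E\<close> with coefficients its own entries, and linearity of \<open>f\<close>
  finishes.\<close>

lemma functional_eval:
 assumes f: "f : carrier (dual_module R (P i))" and x: "x : carrier (P i)"
 shows "f x = comb Rr (m i) x (functional_col i f)"
proof -
 interpret Pi: left_module R "P i" by (rule row_left_module)
 have fl: "f : linear_maps R (P i) Rr" using f by (simp add: dual_carrier_iff)
 have inc: "(\<lambda>x. x) : linear_maps R (P i) (rows R (m i))"
  by (rule row_linear_restrict[OF linear_id])
 have "comb (P i) (m i) x (E i) = comb (rows R (m i)) (m i) x (E i)"
  using Pi.comb_map[OF rows_left_module inc, of "m i" x "E i"] E_in_row row_entry_closed[OF x] by auto
 also have "... = x" using x by (simp add: row_module_carrier_iff)
 finally have "f x = f (comb (P i) (m i) x (E i))" by simp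
 also have "... = comb Rr (m i) x (\<lambda>l. f (E i l))"
  by (rule Pi.comb_map[OF Rr_left_module fl]) (use E_in_row row_entry_closed[OF x] in auto)
 also have "... = comb Rr (m i) x (functional_col i f)"
  by (rule comb_cong[OF left_module_abelian[OF Rr_left_module]])
   (use dual_value_closed[OF row_left_module f E_in_row] row_entry_closed[OF x] in "auto simp: functional_col_def")
 finally show ?thesis .
qed

lemma col_functional_cocycle:
 assumes c: "c : col_cocycles R m E D i"
 shows "col_functional i c : dual_cocycles R P dP i"
proof -
 from c have cr: "c : vecs R (m i)"
  and cz: "\<And>l. l < m (Suc i) ==> comb Rr (m i) (D i l) c = \<zero>" by (auto simp: col_cocycles_def)
 have "col_functional i c (dP i x) = \<zero>" if x: "x : carrier (P (Suc i))" for x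
 proof -
  have xr: "x : vecs R (m (Suc i))" using x row_sub by blast
  have "col_functional i c (dP i x) = comb Rr (m i) (comb (rows R (m i)) (m (Suc i)) x (D i)) c"
   using linear_closed[OF row_map_linear x] by (simp add: col_functional_def row_map_def)
  also have "... = comb Rr (m (Suc i)) x (\<lambda>l. comb Rr (m i) (D i l) c)"
   by (rule left_module.comb_assoc[OF Rr_left_module xr D_closed]) (use R.free_closed[OF cr] in auto)
  also have "... = comb Rr (m (Suc i)) x (\<lambda>l. \<zero>\<^sub>Rr)"
   by (rule comb_cong[OF left_module_abelian[OF Rr_left_module]]) (use cz R.free_closed[OF xr] in auto)
  also have "... = \<zero>"
   using left_module.comb_zero_right[OF Rr_left_module, of "m (Suc i)" x] R.free_closed[OF xr] by simp
  finally show ?thesis .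
 qed
 then show ?thesis using col_functional_dual[OF cr] by (simp add: dual_cocycles_def)
qed

lemma functional_col_cocycle:
 assumes f: "f : dual_cocycles R P dP i"
 shows "functional_col i f : col_cocycles R m E D i"
proof -
 from f have fd: "f : carrier (dual_module R (P i))"
  and fz: "\<And>x. x : carrier (P (Suc i)) ==> f (dP i x) = \<zero>" by (auto simp: dual_cocycles_def)
 have "comb Rr (m i) (E i l) (functional_col i f) = functional_col i f l" if "l < m i" for l
  using functional_eval[OF fd E_in_row[OF that]] that by (simp add: functional_col_def)
 moreover have "comb Rr (m i) (D i l) (functional_col i f) = \<zero>" if "l < m (Suc i)" for l
  using functional_eval[OF fd D_in_row[OF that]] fz[OF E_in_row[OF that]] ED[OF that] by (simp add: row_map_def)
 ultimately show ?thesis using functional_col_closed[OF fd] by (simp add: col_cocycles_def)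
qed

lemma functional_col_functional:
 assumes c: "c : col_cocycles R m E D i"
 shows "functional_col i (col_functional i c) = c"
proof
 fix l
 show "functional_col i (col_functional i c) l = c l"
  using c E_in_row by (auto simp: functional_col_def col_functional_def col_cocycles_def rows_carrier_iff)
qed

lemma col_functional_functional:
 assumes f: "f : carrier (dual_module R (P i))"
 shows "col_functional i (functional_col i f) = f"
 by (rule dual_ext[OF col_functional_dual[OF functional_col_closed[OF f]] f])
  (simp add: col_functional_def functional_eval[OF f])

text \<open>Evaluated at the rows of \<open>E\<close>, the composite of a functional with the
  differential becomes \<open>D\<close> times the column of that functional, because
  \<open>E D = D\<close>. Degree 0 is separate, as there only the zero functional bounds.\<close>

lemma col_coboundary_iff:
 assumes c: "c : col_cocycles R m E D i"
 shows "col_functional i c : dual_coboundaries R P dP i \<longleftrightarrow> c : col_coboundaries R m D i"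
proof (cases i)
 case 0
 have z: "functional_col 0 (\<zero>\<^sub>(dual_module R (P 0))) = (\<lambda>l. \<zero>)"
  using E_in_row[of _ 0] by (auto simp: functional_col_def dual_simps)
 have "c = (\<lambda>l. \<zero>) \<longleftrightarrow> col_functional 0 c = \<zero>\<^sub>(dual_module R (P 0))"
  using z functional_col_functional[OF c] col_functional_functional[OF dual_zero_closed[OF row_left_module], of 0] 0
  by metis
 then show ?thesis using 0 by (auto simp: dual_coboundaries_0 col_coboundaries_def)
next
 case (Suc j)
 show ?thesis
 proof
  assume "col_functional i c : dual_coboundaries R P dP i"
  then obtain g where g: "g : carrier (dual_module R (P j))"
   "col_functional i c = pullback (P (Suc j)) (dP j) g"
   unfolding Suc dual_coboundaries_Suc by blast
  have "c = col_image R m D j (functional_col j g)"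
  proof
   fix l
   show "c l = col_image R m D j (functional_col j g) l"
   proof (cases "l < m i")
    case True
    have "c l = col_functional i c (E i l)"
     using c True E_in_row[OF True] by (simp add: col_functional_def col_cocycles_def)
    also have "... = pullback (P (Suc j)) (dP j) g (E i l)" by (simp only: g(2))
    also have "... = g (D j l)"
     using True E_in_row[OF True] ED[of l j] Suc by (simp add: pullback_def row_map_def)
    also have "... = comb Rr (m j) (D j l) (functional_col j g)"
     using functional_eval[OF g(1) D_in_row] True Suc by simp
    finally show ?thesis using True Suc by (simp add: col_image_def)
   next
    case False
    then show ?thesis using c Suc by (simp add: col_image_def col_cocycles_def rows_carrier_iff)
   qed
  qed
  then show "c : col_coboundaries R m D i"
   using functional_col_closed[OF g(1)] by (auto simp: Suc col_coboundaries_def)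
 next
  assume "c : col_coboundaries R m D i"
  then obtain g where g: "g : vecs R (m j)" "c = col_image R m D j g"
   by (auto simp: Suc col_coboundaries_def)
  have "col_functional i c = pullback (P (Suc j)) (dP j) (col_functional j g)"
   unfolding Suc col_functional_def pullback_def
  proof (rule restrict_ext)
   fix x assume x: "x : carrier (P (Suc j))"
   have xr: "x : vecs R (m (Suc j))" using x row_sub by blast
   have "comb Rr (m (Suc j)) x c = comb Rr (m (Suc j)) x (\<lambda>l. comb Rr (m j) (D j l) g)"
    by (rule comb_cong[OF left_module_abelian[OF Rr_left_module]])
     (use R.free_closed[OF xr] left_module.comb_closed[OF Rr_left_module, of "m j"] R.free_closed[OF D_closed]
       R.free_closed[OF g(1)] in \<open>auto simp: g(2) col_image_def\<close>)
   also have "... = comb Rr (m j) (comb (rows R (m j)) (m (Suc j)) x (D j)) g"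
    by (rule left_module.comb_assoc[OF Rr_left_module xr D_closed, symmetric]) (use R.free_closed[OF g(1)] in auto)
   finally show "comb Rr (m (Suc j)) x c = (\<lambda>x\<in>carrier (P j). comb Rr (m j) x g) (dP j x)"
    using linear_closed[OF row_map_linear x] by (simp add: row_map_def)
  qed
  then show "col_functional i c : dual_coboundaries R P dP i"
   unfolding Suc dual_coboundaries_Suc using col_functional_dual[OF g(1)] by auto
 qed
qed

lemma cocycle_functional_col:
 "f : dual_cocycles R P dP i ==> col_functional i (functional_col i f) = f"
 by (rule col_functional_functional) (simp add: dual_cocycles_def)

lemma col_vanish_iff:
 "dual_cocycles R P dP i \<subseteq> dual_coboundaries R P dP i \<longleftrightarrow> col_cocycles R m E D i \<subseteq> col_coboundaries R m D i"
proof
 assume sub: "dual_cocycles R P dP i \<subseteq> dual_coboundaries R P dP i"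
 show "col_cocycles R m E D i \<subseteq> col_coboundaries R m D i"
 proof
  fix c assume c: "c : col_cocycles R m E D i"
  then show "c : col_coboundaries R m D i"
   using subsetD[OF sub col_functional_cocycle[OF c]] col_coboundary_iff[OF c] by simp
 qed
next
 assume sub: "col_cocycles R m E D i \<subseteq> col_coboundaries R m D i"
 show "dual_cocycles R P dP i \<subseteq> dual_coboundaries R P dP i"
 proof
  fix f assume f: "f : dual_cocycles R P dP i"
  note c = functional_col_cocycle[OF f]
  show "f : dual_coboundaries R P dP i"
   using subsetD[OF sub c] col_coboundary_iff[OF c] cocycle_functional_col[OF f] by simp
 qed
qed

lemma col_functional_add:
 assumes "c : col_cocycles R m E D i" "c' : col_cocycles R m E D i"
 shows "col_functional i (\<lambda>l. c l \<oplus> c' l) = col_functional i c \<oplus>\<^sub>(dual_module R (P i)) col_functional i c'"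
proof -
 from assms have c: "c l : carrier R" "c' l : carrier R" for l
  by (auto simp: col_cocycles_def intro: R.free_closed)
 have "comb Rr (m i) x (\<lambda>l. c l \<oplus> c' l) = comb Rr (m i) x c \<oplus> comb Rr (m i) x c'" if x: "x : carrier (P i)" for x
 proof -
  have "comb Rr (m i) x (\<lambda>l. c l \<oplus> c' l) = (\<Oplus>l\<in>{..<m i}. x l \<otimes> c l \<oplus> x l \<otimes> c' l)"
   unfolding comb_def finsum_with_action
   by (rule R.finsum_cong') (use c row_entry_closed[OF x] in "auto simp: R.r_distr")
  also have "... = comb Rr (m i) x c \<oplus> comb Rr (m i) x c'"
   unfolding comb_def finsum_with_action with_action_simps
   by (rule R.finsum_addf) (use c row_entry_closed[OF x] in auto)
  finally show ?thesis .
 qed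
 then show ?thesis by (auto simp: col_functional_def dual_simps intro!: restrict_ext)
qed

lemma col_functional_act:
 assumes "c : col_cocycles R m E D i" "r : carrier R"
 shows "col_functional i (\<lambda>l. c l \<otimes> r) = r \<odot>\<^sub>(dual_module R (P i)) col_functional i c"
proof -
 from assms have c: "c l : carrier R" for l
  by (auto simp: col_cocycles_def intro: R.free_closed)
 have "comb Rr (m i) x (\<lambda>l. c l \<otimes> r) = comb Rr (m i) x c \<otimes> r" if x: "x : carrier (P i)" for x
 proof -
  have "comb Rr (m i) x (\<lambda>l. c l \<otimes> r) = (\<Oplus>l\<in>{..<m i}. x l \<otimes> c l \<otimes> r)"
   unfolding comb_def finsum_with_action
   by (rule R.finsum_cong') (use c assms(2) row_entry_closed[OF x] in "auto simp: R.m_assoc")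
  also have "... = comb Rr (m i) x c \<otimes> r"
   unfolding comb_def finsum_with_action with_action_simps
   by (rule R.finsum_ldistr[symmetric]) (use c assms(2) row_entry_closed[OF x] in auto)
  finally show ?thesis .
 qed
 then show ?thesis by (auto simp: col_functional_def dual_simps intro!: restrict_ext)
qed

lemma col_onto_if_cohomology_onto:
 assumes l: "cohomology_onto R P dP i N l"
 shows "col_onto R m E D i N (\<lambda>c. l (col_functional i c))"
proof -
 have ll: "l : linear_maps R (cocycle_module R P dP i) N"
  and im: "l ` dual_cocycles R P dP i = carrier N"
  and ker: "\<And>c. c : dual_cocycles R P dP i ==> l c = \<zero>\<^sub>N \<longleftrightarrow> c : dual_coboundaries R P dP i"
  using l by (auto simp: cohomology_onto_def)
 note Fc = col_functional_cocycle
 show ?thesis unfolding col_onto_def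
 proof (intro conjI ballI)
  fix n assume "n : carrier N"
  then obtain f where f: "f : dual_cocycles R P dP i" "n = l f" using im by blast
  then show "\<exists>c\<in>col_cocycles R m E D i. l (col_functional i c) = n"
   using functional_col_cocycle cocycle_functional_col by (intro bexI[of _ "functional_col i f"]) auto
 qed (use Fc linear_closed[OF ll] linear_add[OF ll] linear_smult[OF ll] ker
   in \<open>simp_all add: col_functional_add col_functional_act col_coboundary_iff\<close>)
qed

lemma cohomology_onto_if_col_onto:
 assumes two: "\<exists>a b :: 'r. a \<noteq> b" and l: "col_onto R m E D i N l"
 shows "cohomology_onto R P dP i N (\<lambda>f. l (functional_col i f))"
proof -
 note Gc = functional_col_cocycle
 have add: "functional_col i (x \<oplus>\<^sub>(dual_module R (P i)) y) = (\<lambda>l. functional_col i x l \<oplus> functional_col i y l)" for x y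
  using E_in_row[of _ i] by (auto simp: functional_col_def dual_simps)
 have act: "functional_col i (r \<odot>\<^sub>(dual_module R (P i)) x) = (\<lambda>l. functional_col i x l \<otimes> r)" if "r : carrier R" for r x
  using E_in_row[of _ i] that by (auto simp: functional_col_def dual_simps)
 show ?thesis unfolding cohomology_onto_def
 proof (intro conjI ballI linear_mapsI)
  show "(\<lambda>f. l (functional_col i f)) ` dual_cocycles R P dP i = carrier N"
  proof
   show "(\<lambda>f. l (functional_col i f)) ` dual_cocycles R P dP i \<subseteq> carrier N"
    using l Gc by (auto simp: col_onto_def)
   show "carrier N \<subseteq> (\<lambda>f. l (functional_col i f)) ` dual_cocycles R P dP i"
   proof
    fix n assume "n : carrier N"
    then obtain c where c: "c : col_cocycles R m E D i" "l c = n" using l by (auto simp: col_onto_def)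
    then have "n = l (functional_col i (col_functional i c))" by (simp add: functional_col_functional)
    then show "n : (\<lambda>f. l (functional_col i f)) ` dual_cocycles R P dP i"
     using col_functional_cocycle[OF c(1)] by (rule image_eqI)
   qed
  qed
 next
  fix c assume c: "c : dual_cocycles R P dP i"
  show "l (functional_col i c) = \<zero>\<^sub>N \<longleftrightarrow> c : dual_coboundaries R P dP i"
   using l Gc[OF c] col_coboundary_iff[OF Gc[OF c]] cocycle_functional_col[OF c] by (simp add: col_onto_def)
 qed (use l Gc in "simp_all add: col_onto_def add act")
qed

end

section \<open>Change of rings for resolutions and for their duals\<close>

section \<open>Base change\<close>

text \<open>\<open>R\<close> is viewed as a right \<open>H\<close>-module through \<phi>; coordinate
  functions of a basis are maps of this kind.\<close>

definition right_linear_maps ::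
  "('h, 'y) ring_scheme => ('r, 'x) ring_scheme => ('h => 'r) => ('r => 'h) set" where
 "right_linear_maps H R \<phi> = {f : additive_maps R H.
   \<forall>r\<in>carrier R. \<forall>h\<in>carrier H. f (r \<otimes>\<^sub>R \<phi> h) = f r \<otimes>\<^sub>H h}"

definition left_linear_maps ::
  "('h, 'y) ring_scheme => ('r, 'x) ring_scheme => ('h => 'r) => ('r => 'h) set" where
 "left_linear_maps H R \<phi> = {f : additive_maps R H.
   \<forall>r\<in>carrier R. \<forall>h\<in>carrier H. f (\<phi> h \<otimes>\<^sub>R r) = h \<otimes>\<^sub>H f r}"

text \<open>The semilinear map \<tau> stands for the \<open>R\<close>-linear map from the tensor
  product of \<open>R\<close> and \<open>M\<close> over \<open>H\<close> to \<open>N\<close>, so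
  that this tensor product never has to be constructed.\<close>

locale matrix_base_change = matrix_resolution H M m E D t
 for H :: "('h, 'y) ring_scheme" and M :: "('h, 'm) module" and m E D t +
 fixes R :: "('r, 'x) ring_scheme" (structure) and \<phi> :: "'h => 'r" and N :: "('r, 'n) module" and \<tau> :: "'m => 'n"
 assumes target: "left_module R N"
  and hom: "\<phi> : ring_hom H R"
  and \<tau>_additive: "\<tau> : additive_maps M N"
  and \<tau>_smult: "[|h : carrier H; z : carrier M|] ==> \<tau> (h \<odot>\<^sub>M z) = \<phi> h \<odot>\<^sub>N \<tau> z"
begin

sublocale N: left_module R N by (rule target)

lemma phi_closed [simp]: "h : carrier H ==> \<phi> h : carrier R"
 using hom by (auto simp: ring_hom_def)

lemma phi_additive: "\<phi> : additive_maps H R"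
 using hom by (auto simp: ring_hom_def additive_maps_def)

lemma phi_mult: "x : carrier H ==> y : carrier H ==> \<phi> (x \<otimes>\<^sub>H y) = \<phi> x \<otimes> \<phi> y"
 using hom by (auto simp: ring_hom_def)

lemma phi_zero: "\<phi> \<zero>\<^sub>H = \<zero>"
 using additive_hom.map_zero[OF additive_homI[OF R.is_abelian_group N.R.is_abelian_group phi_additive]] .

abbreviation "\<phi>E \<equiv> (\<lambda>n l i. \<phi> (E n l i))"
abbreviation "\<phi>D \<equiv> (\<lambda>n l i. \<phi> (D n l i))"

lemma phi_row: "x : vecs H k ==> (\<lambda>i. \<phi> (x i)) : vecs R k"
 by (rule rowsI) (auto simp: rows_carrier_iff phi_zero)

lemma phi_row_additive: "(\<lambda>x i. \<phi> (x i)) : additive_maps (rows H k) (rows R k)"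
 by (rule additive_mapsI) (auto simp: phi_row R.free_closed[of _ "{..<k}"] additive_add[OF phi_additive])

lemma phi_comb_rows:
 assumes "\<And>l. l < k ==> x l : carrier H" "\<And>l. l < k ==> A l : vecs H k'"
 shows "(\<lambda>i. \<phi> (comb (rows H k') k x A i)) = comb (rows R k') k (\<lambda>l. \<phi> (x l)) (\<lambda>l i. \<phi> (A l i))"
 by (rule comb_semilinear[where \<phi> = \<phi>, OF R.free_left_module N.R.free_left_module phi_row_additive])
  (auto simp: phi_mult R.free_closed[of _ "{..<k'}"] assms)

lemma phi_comb:
 assumes "\<And>l. l < k ==> x l : carrier H" "\<And>l. l < k ==> c l : carrier H"
 shows "\<phi> (comb (regular_module H) k x c) = comb (regular_module R) k (\<lambda>l. \<phi> (x l)) (\<lambda>l. \<phi> (c l))"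
 by (rule comb_semilinear[where \<phi> = \<phi>, OF regular_left_module[OF R.ring_axioms] regular_left_module[OF N.R.ring_axioms]])
  (auto simp: phi_mult phi_additive assms)

lemma tau_comb:
 assumes "\<And>l. l < k ==> x l : carrier H" "\<And>l. l < k ==> s l : carrier M"
 shows "\<tau> (comb M k x s) = comb N k (\<lambda>l. \<phi> (x l)) (\<lambda>l. \<tau> (s l))"
 by (rule comb_semilinear[where \<phi> = \<phi>, OF left_module_axioms target \<tau>_additive \<tau>_smult])
  (auto simp: assms)

lemma tau_zero: "\<tau> \<zero>\<^sub>M = \<zero>\<^sub>N"
 using additive_hom.map_zero[OF additive_homI[OF M.abelian_group_axioms N.M.abelian_group_axioms \<tau>_additive]] .

text \<open>
 Exactness is the only part of a matrix resolution that base change does not preserve for free.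
\<close>

lemma base_change_resolutionI:
 assumes "\<And>x. [|x : vecs R (m 0); comb (rows R (m 0)) (m 0) x (\<phi>E 0) = x;
   comb N (m 0) x (\<lambda>l. \<tau> (t l)) = \<zero>\<^sub>N|] ==>
   \<exists>y\<in>vecs R (m (Suc 0)). x = comb (rows R (m 0)) (m (Suc 0)) y (\<phi>D 0)"
  and "\<And>n x. [|x : vecs R (m (Suc n)); comb (rows R (m (Suc n))) (m (Suc n)) x (\<phi>E (Suc n)) = x;
   comb (rows R (m n)) (m (Suc n)) x (\<phi>D n) = (\<lambda>i. \<zero>)|] ==>
   \<exists>y\<in>vecs R (m (Suc (Suc n))). x = comb (rows R (m (Suc n))) (m (Suc (Suc n))) y (\<phi>D (Suc n))"
  and "\<And>z. z : carrier N ==> \<exists>x\<in>vecs R (m 0). comb N (m 0) x (\<lambda>l. \<tau> (t l)) = z"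
 shows "matrix_resolution R N m \<phi>E \<phi>D (\<lambda>l. \<tau> (t l))"
proof -
 have ent: "l < m n ==> E n l i : carrier H" "l < m (Suc n) ==> D n l i : carrier H" for n l i
  using R.free_closed[OF E_closed] R.free_closed[OF D_closed] by auto
 show ?thesis
 proof (rule matrix_resolution.intro[OF target], rule matrix_resolution_axioms.intro)
  show "comb (rows R (m n)) (m n) (\<phi>E n l) (\<phi>E n) = \<phi>E n l" if l: "l < m n" for n l
   using phi_comb_rows[of "m n" "E n l" "E n" "m n", OF ent(1)[OF l] E_closed] by (simp only: EE[OF l])
  show "comb (rows R (m n)) (m n) (\<phi>D n l) (\<phi>E n) = \<phi>D n l" if l: "l < m (Suc n)" for n l
   using phi_comb_rows[of "m n" "D n l" "E n" "m n", OF ent(2)[OF l] E_closed] by (simp only: DE[OF l])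
  show "comb (rows R (m n)) (m (Suc n)) (\<phi>E (Suc n) l) (\<phi>D n) = \<phi>D n l" if l: "l < m (Suc n)" for n l
   using phi_comb_rows[of "m (Suc n)" "E (Suc n) l" "D n" "m n", OF ent(1)[OF l] D_closed] by (simp only: ED[OF l])
  show "comb (rows R (m n)) (m (Suc n)) (\<phi>D (Suc n) l) (\<phi>D n) = (\<lambda>i. \<zero>)" if l: "l < m (Suc (Suc n))" for n l
   using phi_comb_rows[of "m (Suc n)" "D (Suc n) l" "D n" "m n", OF ent(2)[OF l] D_closed] by (simp only: DD[OF l] phi_zero)
  show "comb N (m 0) (\<phi>E 0 l) (\<lambda>l. \<tau> (t l)) = \<tau> (t l)" if "l < m 0" for l
   using tau_comb[of "m 0" "E 0 l" t] Et[OF that] ent that t_closed by simp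
  show "comb N (m 0) (\<phi>D 0 l) (\<lambda>l. \<tau> (t l)) = \<zero>\<^sub>N" if "l < m (Suc 0)" for l
   using tau_comb[of "m 0" "D 0 l" t] Dt[OF that] ent that t_closed tau_zero by simp
  show "\<phi>E n l : vecs R (m n)" if "l < m n" for n l by (rule phi_row[OF E_closed[OF that]])
  show "\<phi>D n l : vecs R (m n)" if "l < m (Suc n)" for n l by (rule phi_row[OF D_closed[OF that]])
  show "\<tau> (t l) : carrier N" if "l < m 0" for l by (rule additive_closed[OF \<tau>_additive t_closed[OF that]])
 qed (fact assms)+
qed

end

subsection \<open>Flat base change of the resolution\<close>

text \<open>
 Over a field every algebra that is free over \<open>H\<close> has, for every finite subset, finitely many
 elements of a dual basis which expand the subset.  Such local dual bases are all that is used of freeness.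
 The maps \<open>\<rho>\<close> and \<open>\<eta>\<close> together with the generator \<open>w\<close> of \<open>M\<close> express that \<open>R \<otimes>\<^sub>H M \<rightarrow> N\<close> is bijective.
\<close>

locale flat_base_change = matrix_base_change H M m E D t R \<phi> N \<tau>
 for H :: "('h, 'y) ring_scheme" and M :: "('h, 'm) module" and m E D t
  and R :: "('r, 'x) ring_scheme" (structure) and \<phi> :: "'h => 'r" and N :: "('r, 'n) module" and \<tau> :: "'m => 'n" +
 fixes \<rho> :: "'n => 'r" and \<eta> :: "'m => 'h" and w :: 'm
 assumes \<rho>_additive: "\<rho> : additive_maps N R"
  and generator: "w : carrier M"
  and \<eta>_closed: "z : carrier M ==> \<eta> z : carrier H"
  and \<eta>_generator: "z : carrier M ==> \<eta> z \<odot>\<^sub>M w = z"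
  and cyclic: "n : carrier N ==> \<exists>r\<in>carrier R. n = r \<odot>\<^sub>N \<tau> w"
  and right_basis: "[|finite W; W \<subseteq> carrier R|] ==> \<exists>k u \<kappa>.
   (\<forall>i<k::nat. u i : carrier R \<and> \<kappa> i : right_linear_maps H R \<phi> \<and>
     (\<forall>z\<in>carrier M. \<rho> (u i \<odot>\<^sub>N \<tau> z) = u i \<otimes> \<phi> (\<eta> z))) \<and>
   (\<forall>r\<in>W. r = (\<Oplus>i\<in>{..<k}. u i \<otimes> \<phi> (\<kappa> i r)))"
begin

text \<open>Matrices act on rows from the right, so right linear coordinates pass through a matrix
  with entries in the image of \<open>H\<close>. Hence equations satisfied by a row over
  \<open>R\<close> are inherited by its coordinate rows.\<close>

lemma right_linear_comb:
 assumes f: "f : right_linear_maps H R \<phi>" and x: "\<And>l. l < k ==> x l : carrier R"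
  and A: "\<And>l. l < k ==> A l : vecs H k'"
 shows "f (comb (rows R k') k x (\<lambda>l i. \<phi> (A l i)) j) = comb (rows H k') k (\<lambda>l. f (x l)) A j"
proof -
 have fa: "f : additive_maps R H" using f by (simp add: right_linear_maps_def)
 have Aj: "A l j : carrier H" if "l < k" for l using R.free_closed[OF A[OF that]] .
 have "f (comb (rows R k') k x (\<lambda>l i. \<phi> (A l i)) j) = f (\<Oplus>l\<in>{..<k}. x l \<otimes> \<phi> (A l j))"
  by (subst comb_rows_eval[OF N.R.ring_axioms]) (use x phi_row[OF A] in "auto simp: comb_def")
 also have "... = (\<Oplus>\<^sub>H l\<in>{..<k}. f (x l \<otimes> \<phi> (A l j)))"
  by (rule additive_hom.map_finsum[OF additive_homI[OF N.R.is_abelian_group R.is_abelian_group fa]])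
   (use x Aj in auto)
 also have "... = (\<Oplus>\<^sub>H l\<in>{..<k}. f (x l) \<otimes>\<^sub>H A l j)"
  by (rule R.finsum_cong') (use x Aj f additive_closed[OF fa] in "auto simp: right_linear_maps_def")
 also have "... = comb (rows H k') k (\<lambda>l. f (x l)) A j"
  by (subst comb_rows_eval[OF R.ring_axioms]) (use x A additive_closed[OF fa] in "auto simp: comb_def")
 finally show ?thesis .
qed

lemma right_linear_row:
 assumes f: "f : right_linear_maps H R \<phi>" and x: "x : vecs R k"
 shows "(\<lambda>l. f (x l)) : vecs H k"
proof -
 have fa: "f : additive_maps R H" using f by (simp add: right_linear_maps_def)
 then show ?thesis
  using x additive_hom.map_zero[OF additive_homI[OF N.R.is_abelian_group R.is_abelian_group fa]]
  by (auto simp: rows_carrier_iff additive_closed[OF fa])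
qed

text \<open>One local dual basis expands all entries simultaneously, so the whole row is a
  combination of rows that come from \<open>H\<close>.\<close>

lemma row_basis:
 assumes x: "x : vecs R q"
 obtains k :: nat and u \<kappa> where "\<And>i. i < k ==> u i : carrier R"
  "\<And>i. i < k ==> \<kappa> i : right_linear_maps H R \<phi>"
  "\<And>i z. i < k ==> z : carrier M ==> \<rho> (u i \<odot>\<^sub>N \<tau> z) = u i \<otimes> \<phi> (\<eta> z)"
  "x = comb (rows R q) k u (\<lambda>i l. \<phi> (\<kappa> i (x l)))"
proof -
 have xc: "x l : carrier R" for l by (rule N.R.free_closed[OF x])
 have "finite (x ` {..<q})" "x ` {..<q} \<subseteq> carrier R" using xc by auto
 from right_basis[OF this] obtain k :: nat and u \<kappa> where *: "\<forall>i<k. u i : carrier R \<and> \<kappa> i : right_linear_maps H R \<phi> \<and>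
     (\<forall>z\<in>carrier M. \<rho> (u i \<odot>\<^sub>N \<tau> z) = u i \<otimes> \<phi> (\<eta> z))"
  and ex: "\<forall>r\<in>x ` {..<q}. r = (\<Oplus>i\<in>{..<k}. u i \<otimes> \<phi> (\<kappa> i r))" by blast
 have row: "(\<lambda>l. \<phi> (\<kappa> i (x l))) : vecs R q" if "i < k" for i
  using * that by (intro phi_row right_linear_row[OF _ x]) auto
 have F: "left_module R (rows R q)" by (rule N.R.free_left_module)
 have "x = comb (rows R q) k u (\<lambda>i l. \<phi> (\<kappa> i (x l)))"
 proof
  fix l
  show "x l = comb (rows R q) k u (\<lambda>i l. \<phi> (\<kappa> i (x l))) l"
  proof (cases "l < q")
   case True
   then have "x l = (\<Oplus>i\<in>{..<k}. u i \<otimes> \<phi> (\<kappa> i (x l)))" using ex by blast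
   then show ?thesis using * row by (subst comb_rows_eval[OF N.R.ring_axioms]) (auto simp: comb_def)
  next
   case False
   have "comb (rows R q) k u (\<lambda>i l. \<phi> (\<kappa> i (x l))) : vecs R q"
    by (rule left_module.comb_closed[OF F]) (use * row in auto)
   then show ?thesis using False x by (simp add: rows_carrier_iff)
  qed
 qed
 then show ?thesis using that[of k u \<kappa>] * by blast
qed

text \<open>Preimages are found over \<open>H\<close> for each coordinate row and reassembled with
  the coefficients \<open>u i\<close>.\<close>

lemma lift_through_D:
 assumes u: "\<And>i. i < k ==> u i : carrier R"
  and v: "\<And>i. i < k ==> \<exists>y\<in>vecs H (m (Suc n)). v i = comb (rows H (m n)) (m (Suc n)) y (D n)"
 shows "\<exists>y\<in>vecs R (m (Suc n)).
  comb (rows R (m n)) k u (\<lambda>i l. \<phi> (v i l)) = comb (rows R (m n)) (m (Suc n)) y (\<phi>D n)"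
proof -
 have "\<forall>i\<in>{..<k}. \<exists>y. y : vecs H (m (Suc n)) \<and> v i = comb (rows H (m n)) (m (Suc n)) y (D n)"
  using v by blast
 from bchoice[OF this] obtain y where y: "\<And>i. i < k ==> y i : vecs H (m (Suc n))"
  "\<And>i. i < k ==> v i = comb (rows H (m n)) (m (Suc n)) (y i) (D n)" by auto
 let ?F = "rows R (m n)" and ?F1 = "rows R (m (Suc n))"
 have F: "left_module R ?F" and F1: "left_module R ?F1" by (rule N.R.free_left_module)+
 let ?y = "comb ?F1 k u (\<lambda>i l. \<phi> (y i l))"
 have D: "\<phi>D n l : carrier ?F" if "l < m (Suc n)" for l by (rule phi_row[OF D_closed[OF that]])
 have "comb ?F (m (Suc n)) ?y (\<phi>D n) = comb ?F k u (\<lambda>i. comb ?F (m (Suc n)) (\<lambda>l. \<phi> (y i l)) (\<phi>D n))"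
  by (rule left_module.comb_map[OF F1 F left_module.comb_linear[OF F D]]) (use u y phi_row in auto)
 also have "... = comb ?F k u (\<lambda>i l. \<phi> (v i l))"
 proof (rule comb_cong[OF left_module_abelian[OF F]])
  fix i assume i: "i < k"
  have "comb ?F (m (Suc n)) (\<lambda>l. \<phi> (y i l)) (\<phi>D n) = (\<lambda>l. \<phi> (v i l))"
   unfolding y(2)[OF i] by (rule phi_comb_rows[symmetric]) (use R.free_closed[OF y(1)[OF i]] D_closed in auto)
  then show "u i \<odot>\<^sub>?F comb ?F (m (Suc n)) (\<lambda>l. \<phi> (y i l)) (\<phi>D n) = u i \<odot>\<^sub>?F (\<lambda>l. \<phi> (v i l))" by simp
  have "v i : vecs H (m n)" unfolding y(2)[OF i] by (rule D_comb_closed[OF y(1)[OF i]])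
  then show "u i \<odot>\<^sub>?F (\<lambda>l. \<phi> (v i l)) : carrier ?F"
   by (intro left_module.smult_closed[OF F u[OF i]] phi_row)
 qed
 finally have "comb ?F k u (\<lambda>i l. \<phi> (v i l)) = comb ?F (m (Suc n)) ?y (\<phi>D n)" by simp
 moreover have "?y : carrier ?F1" by (rule left_module.comb_closed[OF F1]) (use u y phi_row in auto)
 ultimately show ?thesis by blast
qed

lemma coordinate_row:
 assumes f: "f : right_linear_maps H R \<phi>" and x: "x : vecs R (m n)"
  and xE: "comb (rows R (m n)) (m n) x (\<phi>E n) = x"
 shows "comb (rows H (m n)) (m n) (\<lambda>l. f (x l)) (E n) = (\<lambda>l. f (x l))"
proof
 fix j
 show "comb (rows H (m n)) (m n) (\<lambda>l. f (x l)) (E n) j = f (x j)"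
  using right_linear_comb[OF f, of "m n" x "E n" "m n" j] N.R.free_closed[OF x] E_closed xE by simp
qed

text \<open>In positive degrees the coordinate rows of a cycle are cycles over \<open>H\<close> and
  lift one at a time. In degree 0 only a combination of their augmentations vanishes, so each row is
  first corrected by a multiple of a lift of \<open>w\<close>; the map \<rho> shows that these
  corrections add up to zero.\<close>

theorem base_change_resolution: "matrix_resolution R N m \<phi>E \<phi>D (\<lambda>l. \<tau> (t l))"
proof (rule base_change_resolutionI)
 fix n x
 assume x: "x : vecs R (m (Suc n))" and xE: "comb (rows R (m (Suc n))) (m (Suc n)) x (\<phi>E (Suc n)) = x"
  and xD: "comb (rows R (m n)) (m (Suc n)) x (\<phi>D n) = (\<lambda>i. \<zero>)"
 obtain k :: nat and u \<kappa> where u: "\<And>i. i < k ==> u i : carrier R"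
  and \<kappa>: "\<And>i. i < k ==> \<kappa> i : right_linear_maps H R \<phi>"
  and ex: "x = comb (rows R (m (Suc n))) k u (\<lambda>i l. \<phi> (\<kappa> i (x l)))"
  by (rule row_basis[OF x]) blast
 have "\<exists>y\<in>vecs H (m (Suc (Suc n))).
   (\<lambda>l. \<kappa> i (x l)) = comb (rows H (m (Suc n))) (m (Suc (Suc n))) y (D (Suc n))" if i: "i < k" for i
 proof (rule exact_Suc)
  show "(\<lambda>l. \<kappa> i (x l)) : vecs H (m (Suc n))" by (rule right_linear_row[OF \<kappa>[OF i] x])
  show "comb (rows H (m (Suc n))) (m (Suc n)) (\<lambda>l. \<kappa> i (x l)) (E (Suc n)) = (\<lambda>l. \<kappa> i (x l))"
   by (rule coordinate_row[OF \<kappa>[OF i] x xE])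
  have z: "\<kappa> i \<zero> = \<zero>\<^sub>H"
   using additive_hom.map_zero[OF additive_homI[OF N.R.is_abelian_group R.is_abelian_group]] \<kappa>[OF i]
   by (auto simp: right_linear_maps_def)
  show "comb (rows H (m n)) (m (Suc n)) (\<lambda>l. \<kappa> i (x l)) (D n) = (\<lambda>i. \<zero>\<^sub>H)"
  proof
   fix j
   show "comb (rows H (m n)) (m (Suc n)) (\<lambda>l. \<kappa> i (x l)) (D n) j = \<zero>\<^sub>H"
    using right_linear_comb[OF \<kappa>[OF i], of "m (Suc n)" x "D n" "m n" j] N.R.free_closed[OF x] D_closed xD z by simp
  qed
 qed
 from lift_through_D[OF u this, of k "\<lambda>i. i" "\<lambda>i. i"]
 have "\<exists>y\<in>vecs R (m (Suc (Suc n))). comb (rows R (m (Suc n))) k u (\<lambda>i l. \<phi> (\<kappa> i (x l))) =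
   comb (rows R (m (Suc n))) (m (Suc (Suc n))) y (\<phi>D (Suc n))" by simp
 then show "\<exists>y\<in>vecs R (m (Suc (Suc n))). x = comb (rows R (m (Suc n))) (m (Suc (Suc n))) y (\<phi>D (Suc n))"
  using ex by simp
next
 fix x
 assume x: "x : vecs R (m 0)" and xE: "comb (rows R (m 0)) (m 0) x (\<phi>E 0) = x"
  and xt: "comb N (m 0) x (\<lambda>l. \<tau> (t l)) = \<zero>\<^sub>N"
 obtain k :: nat and u \<kappa> where u: "\<And>i. i < k ==> u i : carrier R"
  and \<kappa>: "\<And>i. i < k ==> \<kappa> i : right_linear_maps H R \<phi>"
  and \<rho>: "\<And>i z. i < k ==> z : carrier M ==> \<rho> (u i \<odot>\<^sub>N \<tau> z) = u i \<otimes> \<phi> (\<eta> z)"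
  and ex: "x = comb (rows R (m 0)) k u (\<lambda>i l. \<phi> (\<kappa> i (x l)))"
  by (rule row_basis[OF x]) blast
 let ?F = "rows R (m 0)" and ?G = "rows H (m 0)"
 interpret F: left_module R ?F by (rule N.R.free_left_module)
 interpret G: left_module H ?G by (rule R.free_left_module)
 have e: "(\<lambda>x. comb M (m 0) x t) : linear_maps H ?G M" by (rule comb_linear[OF t_closed])
 interpret e: additive_hom ?G M "\<lambda>x. comb M (m 0) x t"
  by (rule linear_hom[OF G.left_module_axioms left_module_axioms e])
 interpret Em: additive_hom ?G ?G "\<lambda>x. comb ?G (m 0) x (E 0)"
  by (rule linear_hom[OF G.left_module_axioms G.left_module_axioms E_map_linear])
 obtain p0 where p0: "p0 : carrier ?G" "comb M (m 0) p0 t = w" using onto[OF generator] by blast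
 define p where "p = comb ?G (m 0) p0 (E 0)"
 have p: "p : carrier ?G" "comb ?G (m 0) p (E 0) = p" "comb M (m 0) p t = w"
  unfolding p_def using p0 E_comb_closed comb_E_idem comb_E_t by auto
 define q where "q i = (\<lambda>l. \<kappa> i (x l))" for i
 have q: "q i : carrier ?G" if "i < k" for i unfolding q_def by (rule right_linear_row[OF \<kappa>[OF that] x])
 define z where "z i = comb M (m 0) (q i) t" for i
 have z: "z i : carrier M" if "i < k" for i unfolding z_def using q[OF that] by simp
 have etap: "\<eta> (z i) \<odot>\<^sub>?G p : carrier ?G" if "i < k" for i
  by (rule G.smult_closed[OF \<eta>_closed[OF z[OF that]] p(1)])
 \<comment> \<open>The correction term has the same augmentation \<open>z i\<close> as
   \<open>q i\<close>, because \<open>p\<close> lifts \<open>w\<close> and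
   \<open>\<eta> (z i)\<close> takes \<open>w\<close> to \<open>z i\<close>.\<close>
 define v where "v i = q i \<ominus>\<^sub>?G \<eta> (z i) \<odot>\<^sub>?G p" for i
 have v: "v i : carrier ?G" if "i < k" for i unfolding v_def using q[OF that] etap[OF that] by (rule G.M.minus_closed)
 have "\<exists>y\<in>vecs H (m (Suc 0)). v i = comb ?G (m (Suc 0)) y (D 0)" if i: "i < k" for i
 proof (rule exact_0[OF v[OF i]])
  show "comb ?G (m 0) (v i) (E 0) = v i"
  proof -
   have "comb ?G (m 0) (v i) (E 0) = comb ?G (m 0) (q i) (E 0) \<ominus>\<^sub>?G comb ?G (m 0) (\<eta> (z i) \<odot>\<^sub>?G p) (E 0)"
    unfolding v_def by (rule Em.map_minus[OF q[OF i] etap[OF i]])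
   also have "comb ?G (m 0) (q i) (E 0) = q i" unfolding q_def by (rule coordinate_row[OF \<kappa>[OF i] x xE])
   also have "comb ?G (m 0) (\<eta> (z i) \<odot>\<^sub>?G p) (E 0) = \<eta> (z i) \<odot>\<^sub>?G p"
    using linear_smult[OF E_map_linear \<eta>_closed[OF z[OF i]] p(1)] p(2) by simp
   finally show ?thesis unfolding v_def .
  qed
  have "comb M (m 0) (v i) t = z i \<ominus>\<^sub>M comb M (m 0) (\<eta> (z i) \<odot>\<^sub>?G p) t"
   unfolding v_def z_def by (rule e.map_minus[OF q[OF i] etap[OF i, unfolded z_def]])
  also have "comb M (m 0) (\<eta> (z i) \<odot>\<^sub>?G p) t = z i"
   using linear_smult[OF e \<eta>_closed[OF z[OF i]] p(1)] p(3) \<eta>_generator[OF z[OF i]] by simp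
  finally show "comb M (m 0) (v i) t = \<zero>\<^sub>M" using z[OF i] by (simp add: M.minus_eq_zero_iff)
 qed
 from lift_through_D[OF u this, of k "\<lambda>i. i" "\<lambda>i. i"]
 obtain y where y: "y : vecs R (m (Suc 0))"
  "comb ?F k u (\<lambda>i l. \<phi> (v i l)) = comb ?F (m (Suc 0)) y (\<phi>D 0)" by auto
 have te: "\<tau> (z i) : carrier N" if "i < k" for i by (rule additive_closed[OF \<tau>_additive z[OF that]])
 have tt: "\<tau> (t l) : carrier N" if "l < m 0" for l by (rule additive_closed[OF \<tau>_additive t_closed[OF that]])
 \<comment> \<open>The coefficients of \<open>p\<close> add up to \<open>\<rho>\<close> of the augmentation of \<open>x\<close>.\<close>
 have sum0: "comb (regular_module R) k u (\<lambda>i. \<phi> (\<eta> (z i))) = \<zero>"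
 proof -
  have tz: "\<tau> (z i) = comb N (m 0) (\<lambda>l. \<phi> (q i l)) (\<lambda>l. \<tau> (t l))" if "i < k" for i
   unfolding z_def by (rule tau_comb) (use R.free_closed[OF q[OF that]] t_closed in auto)
  have "comb N (m 0) x (\<lambda>l. \<tau> (t l)) = comb N (m 0) (comb ?F k u (\<lambda>i l. \<phi> (q i l))) (\<lambda>l. \<tau> (t l))"
   using ex by (simp add: q_def)
  also have "... = comb N k u (\<lambda>i. comb N (m 0) (\<lambda>l. \<phi> (q i l)) (\<lambda>l. \<tau> (t l)))"
   by (rule F.comb_map[OF target N.comb_linear[OF tt]]) (use u q phi_row in auto)
  also have "... = comb N k u (\<lambda>i. \<tau> (z i))"
   by (rule comb_cong[OF N.M.abelian_group_axioms]) (use u te tz in "auto simp: N.smult_closed")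
  finally have s: "comb N k u (\<lambda>i. \<tau> (z i)) = \<zero>\<^sub>N" using xt by simp
  interpret \<rho>: additive_hom N R \<rho>
   by (rule additive_homI[OF N.M.abelian_group_axioms N.R.is_abelian_group \<rho>_additive])
  have "\<zero> = \<rho> (comb N k u (\<lambda>i. \<tau> (z i)))" using s \<rho>.map_zero by simp
  also have "... = (\<Oplus>i\<in>{..<k}. \<rho> (u i \<odot>\<^sub>N \<tau> (z i)))"
   unfolding comb_def by (rule \<rho>.map_finsum) (use u te in "auto simp: N.smult_closed")
  also have "... = (\<Oplus>i\<in>{..<k}. u i \<otimes> \<phi> (\<eta> (z i)))"
   by (rule N.R.finsum_cong') (use u z \<rho> \<eta>_closed in auto)
  finally show ?thesis by (simp add: comb_def)
 qed
 have pr: "(\<lambda>l. \<phi> (p l)) : carrier ?F" by (rule phi_row[OF p(1)])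
 have vr: "(\<lambda>l. \<phi> (v i l)) : carrier ?F" if "i < k" for i by (rule phi_row[OF v[OF that]])
 have "comb ?F k u (\<lambda>i l. \<phi> (q i l)) = comb ?F k u (\<lambda>i. (\<lambda>l. \<phi> (v i l)) \<oplus>\<^sub>?F \<phi> (\<eta> (z i)) \<odot>\<^sub>?F (\<lambda>l. \<phi> (p l)))"
 proof (rule comb_cong[OF F.M.abelian_group_axioms])
  fix i assume i: "i < k"
  have "q i = v i \<oplus>\<^sub>?G \<eta> (z i) \<odot>\<^sub>?G p"
   unfolding v_def using q[OF i] etap[OF i] by (simp add: G.M.minus_eq G.M.a_assoc G.M.l_neg del: free_module_simps)
  then have "(\<lambda>l. \<phi> (q i l)) = (\<lambda>l. \<phi> (v i l)) \<oplus>\<^sub>?F \<phi> (\<eta> (z i)) \<odot>\<^sub>?F (\<lambda>l. \<phi> (p l))"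
   using R.free_closed[OF v[OF i]] R.free_closed[OF p(1)] \<eta>_closed[OF z[OF i]]
   by (simp add: additive_add[OF phi_additive] phi_mult)
  then show "u i \<odot>\<^sub>?F (\<lambda>l. \<phi> (q i l)) = u i \<odot>\<^sub>?F ((\<lambda>l. \<phi> (v i l)) \<oplus>\<^sub>?F \<phi> (\<eta> (z i)) \<odot>\<^sub>?F (\<lambda>l. \<phi> (p l)))"
   by simp
  show "u i \<odot>\<^sub>?F ((\<lambda>l. \<phi> (v i l)) \<oplus>\<^sub>?F \<phi> (\<eta> (z i)) \<odot>\<^sub>?F (\<lambda>l. \<phi> (p l))) : carrier ?F"
   by (intro F.smult_closed F.M.a_closed u i vr pr phi_closed \<eta>_closed z)
 qed
 also have "... = comb ?F k u (\<lambda>i l. \<phi> (v i l)) \<oplus>\<^sub>?F comb ?F k u (\<lambda>i. \<phi> (\<eta> (z i)) \<odot>\<^sub>?F (\<lambda>l. \<phi> (p l)))"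
 proof -
  have c1: "u i \<odot>\<^sub>?F (\<lambda>l. \<phi> (v i l)) : carrier ?F" if "i < k" for i
   by (intro F.smult_closed u vr that)
  have c2: "u i \<odot>\<^sub>?F (\<phi> (\<eta> (z i)) \<odot>\<^sub>?F (\<lambda>l. \<phi> (p l))) : carrier ?F" if "i < k" for i
   by (intro F.smult_closed u pr that phi_closed \<eta>_closed z)
  have "comb ?F k u (\<lambda>i. (\<lambda>l. \<phi> (v i l)) \<oplus>\<^sub>?F \<phi> (\<eta> (z i)) \<odot>\<^sub>?F (\<lambda>l. \<phi> (p l))) =
    (\<Oplus>\<^sub>?F i\<in>{..<k}. u i \<odot>\<^sub>?F (\<lambda>l. \<phi> (v i l)) \<oplus>\<^sub>?F u i \<odot>\<^sub>?F (\<phi> (\<eta> (z i)) \<odot>\<^sub>?F (\<lambda>l. \<phi> (p l))))"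
   unfolding comb_def
  proof (rule F.M.finsum_cong')
   fix i assume "i : {..<k}"
   then have i: "i < k" by simp
   show "u i \<odot>\<^sub>?F ((\<lambda>l. \<phi> (v i l)) \<oplus>\<^sub>?F \<phi> (\<eta> (z i)) \<odot>\<^sub>?F (\<lambda>l. \<phi> (p l))) =
     u i \<odot>\<^sub>?F (\<lambda>l. \<phi> (v i l)) \<oplus>\<^sub>?F u i \<odot>\<^sub>?F (\<phi> (\<eta> (z i)) \<odot>\<^sub>?F (\<lambda>l. \<phi> (p l)))"
    by (intro F.smult_r_distr u vr i F.smult_closed pr phi_closed \<eta>_closed z)
  qed (use c1 c2 F.M.a_closed in "auto simp del: free_module_simps")
  also have "... = (\<Oplus>\<^sub>?F i\<in>{..<k}. u i \<odot>\<^sub>?F (\<lambda>l. \<phi> (v i l))) \<oplus>\<^sub>?F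
    (\<Oplus>\<^sub>?F i\<in>{..<k}. u i \<odot>\<^sub>?F (\<phi> (\<eta> (z i)) \<odot>\<^sub>?F (\<lambda>l. \<phi> (p l))))"
   by (rule F.M.finsum_addf) (use c1 c2 in "auto simp del: free_module_simps")
  finally show ?thesis by (simp only: comb_def)
 qed
 \<comment> \<open>Every correction is a multiple of the same row, so they add up to that row times
   the coefficient computed in \<open>sum0\<close>.\<close>
 also have "comb ?F k u (\<lambda>i. \<phi> (\<eta> (z i)) \<odot>\<^sub>?F (\<lambda>l. \<phi> (p l))) = \<zero>\<^sub>?F"
 proof -
  have lin: "(\<lambda>r. r \<odot>\<^sub>?F (\<lambda>l. \<phi> (p l))) : linear_maps R (regular_module R) ?F"
   by (rule linear_mapsI)
    (use F.smult_closed[OF _ pr] F.smult_l_distr[OF _ _ pr] F.smult_assoc[OF _ _ pr] in "simp_all del: free_module_simps")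
  have "comb ?F k u (\<lambda>i. \<phi> (\<eta> (z i)) \<odot>\<^sub>?F (\<lambda>l. \<phi> (p l))) =
    comb (regular_module R) k u (\<lambda>i. \<phi> (\<eta> (z i))) \<odot>\<^sub>?F (\<lambda>l. \<phi> (p l))"
   by (rule left_module.comb_map[OF regular_left_module[OF N.R.ring_axioms] F.left_module_axioms lin, symmetric])
    (use u z \<eta>_closed in auto)
  also have "... = \<zero>\<^sub>?F" unfolding sum0 by (rule F.smult_zero_left[OF pr])
  finally show ?thesis .
 qed
 finally have "comb ?F k u (\<lambda>i l. \<phi> (q i l)) = comb ?F k u (\<lambda>i l. \<phi> (v i l))"
  using F.comb_closed[of k u "\<lambda>i l. \<phi> (v i l)"] u vr F.M.r_zero by (simp del: free_module_simps)
 then have "x = comb ?F (m (Suc 0)) y (\<phi>D 0)" using ex y(2) by (simp add: q_def)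
 then show "\<exists>y\<in>vecs R (m (Suc 0)). x = comb ?F (m (Suc 0)) y (\<phi>D 0)" using y(1) by blast
next
 fix n assume "n : carrier N"
 then obtain r where r: "r : carrier R" "n = r \<odot>\<^sub>N \<tau> w" using cyclic by blast
 obtain p where p: "p : vecs H (m 0)" "comb M (m 0) p t = w" using onto[OF generator] by blast
 have tt: "\<tau> (t l) : carrier N" if "l < m 0" for l by (rule additive_closed[OF \<tau>_additive t_closed[OF that]])
 have pr: "(\<lambda>l. \<phi> (p l)) : vecs R (m 0)" by (rule phi_row[OF p(1)])
 have "comb N (m 0) (\<lambda>l. \<phi> (p l)) (\<lambda>l. \<tau> (t l)) = \<tau> w"
  using tau_comb[of "m 0" p t] R.free_closed[OF p(1)] t_closed p(2) by simp
 then have "comb N (m 0) (r \<odot>\<^sub>(rows R (m 0)) (\<lambda>l. \<phi> (p l))) (\<lambda>l. \<tau> (t l)) = n"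
  using linear_smult[OF N.comb_linear[OF tt] r(1) pr] r(2) by simp
 then show "\<exists>x\<in>vecs R (m 0). comb N (m 0) x (\<lambda>l. \<tau> (t l)) = n"
  using left_module.smult_closed[OF N.R.free_left_module r(1) pr] by blast
qed

end

subsection \<open>Base change of the dual complex\<close>

lemma comb_regular_additive:
 fixes R (structure)
 assumes "ring R" "\<And>l. l < k ==> x l : carrier R" "\<And>l. l < k ==> c l : carrier R" "\<And>l. l < k ==> c' l : carrier R"
 shows "comb (regular_module R) k x (\<lambda>l. c l \<oplus> c' l) =
  comb (regular_module R) k x c \<oplus> comb (regular_module R) k x c'"
proof -
 interpret ring R by fact
 have "comb (regular_module R) k x (\<lambda>l. c l \<oplus> c' l) = (\<Oplus>l\<in>{..<k}. x l \<otimes> c l \<oplus> x l \<otimes> c' l)"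
  unfolding comb_def finsum_with_action
  by (rule finsum_cong') (use assms(2-4) in "auto simp: r_distr")
 also have "... = comb (regular_module R) k x c \<oplus> comb (regular_module R) k x c'"
  unfolding comb_def finsum_with_action with_action_simps
  by (rule finsum_addf) (use assms(2-4) in auto)
 finally show ?thesis .
qed

lemma comb_regular_mult:
 fixes R (structure)
 assumes "ring R" "\<And>l. l < k ==> x l : carrier R" "\<And>l. l < k ==> c l : carrier R" "r : carrier R"
 shows "comb (regular_module R) k x (\<lambda>l. c l \<otimes> r) = comb (regular_module R) k x c \<otimes> r"
proof -
 interpret ring R by fact
 have "comb (regular_module R) k x (\<lambda>l. c l \<otimes> r) = (\<Oplus>l\<in>{..<k}. x l \<otimes> c l \<otimes> r)"
  unfolding comb_def finsum_with_action
  by (rule finsum_cong') (use assms(2-4) in "auto simp: m_assoc")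
 also have "... = comb (regular_module R) k x c \<otimes> r"
  unfolding comb_def finsum_with_action with_action_simps
  by (rule finsum_ldistr[symmetric]) (use assms(2-4) in auto)
 finally show ?thesis .
qed

context matrix_resolution
begin

lemma E_entry_closed: "l < m n ==> E n l i : carrier R"
 using R.free_closed[OF E_closed] .

lemma D_entry_closed: "l < m (Suc n) ==> D n l i : carrier R"
 using R.free_closed[OF D_closed] .

lemma col_entry_closed: "c : col_cocycles R m E D i ==> c l : carrier R"
 by (auto simp: col_cocycles_def intro: R.free_closed)

lemma col_cocycles_add:
 assumes "c : col_cocycles R m E D i" "c' : col_cocycles R m E D i"
 shows "(\<lambda>l. c l \<oplus> c' l) : col_cocycles R m E D i"
 using assms col_entry_closed[OF assms(1)] col_entry_closed[OF assms(2)] E_entry_closed D_entry_closed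
 by (simp add: col_cocycles_def comb_regular_additive[OF R.ring_axioms] rows_carrier_iff)

lemma col_cocycles_mult:
 assumes "c : col_cocycles R m E D i" "r : carrier R"
 shows "(\<lambda>l. c l \<otimes> r) : col_cocycles R m E D i"
 using assms col_entry_closed[OF assms(1)] E_entry_closed D_entry_closed
 by (simp add: col_cocycles_def comb_regular_mult[OF R.ring_axioms] rows_carrier_iff)

lemma col_coboundary_entry: "c : col_coboundaries R m D i ==> c l : carrier R"
proof (cases i)
 case (Suc j)
 assume "c : col_coboundaries R m D i"
 then obtain g where g: "g : vecs R (m j)" "c = col_image R m D j g"
  using Suc by (auto simp: col_coboundaries_def)
 show ?thesis unfolding g(2) col_image_def
  using left_module.comb_closed[OF Rr_left_module, of "m j" "D j l" g] D_entry_closed R.free_closed[OF g(1)] by auto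
qed (auto simp: col_coboundaries_def)

lemma col_coboundaries_add:
 assumes "c : col_coboundaries R m D i" "c' : col_coboundaries R m D i"
 shows "(\<lambda>l. c l \<oplus> c' l) : col_coboundaries R m D i"
proof (cases i)
 case 0
 then show ?thesis using assms by (auto simp: col_coboundaries_def)
next
 case (Suc j)
 then obtain g g' where g: "g : vecs R (m j)" "c = col_image R m D j g"
  "g' : vecs R (m j)" "c' = col_image R m D j g'"
  using assms by (auto simp: col_coboundaries_def)
 have "(\<lambda>l. c l \<oplus> c' l) = col_image R m D j (\<lambda>l. g l \<oplus> g' l)"
  using R.free_closed[OF g(1)] R.free_closed[OF g(3)] D_entry_closed
  by (auto simp: g(2,4) col_image_def comb_regular_additive[OF R.ring_axioms])
 moreover have "(\<lambda>l. g l \<oplus> g' l) : vecs R (m j)" using g(1,3) by (simp add: rows_carrier_iff)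
 ultimately show ?thesis using Suc by (auto simp: col_coboundaries_def)
qed

lemma col_coboundaries_mult:
 assumes "c : col_coboundaries R m D i" "r : carrier R"
 shows "(\<lambda>l. c l \<otimes> r) : col_coboundaries R m D i"
proof (cases i)
 case 0
 then show ?thesis using assms by (auto simp: col_coboundaries_def)
next
 case (Suc j)
 then obtain g where g: "g : vecs R (m j)" "c = col_image R m D j g"
  using assms by (auto simp: col_coboundaries_def)
 have "(\<lambda>l. c l \<otimes> r) = col_image R m D j (\<lambda>l. g l \<otimes> r)"
  using R.free_closed[OF g(1)] D_entry_closed assms(2)
  by (auto simp: g(2) col_image_def comb_regular_mult[OF R.ring_axioms])
 moreover have "(\<lambda>l. g l \<otimes> r) : vecs R (m j)" using g(1) assms(2) by (simp add: rows_carrier_iff)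
 ultimately show ?thesis using Suc by (auto simp: col_coboundaries_def)
qed

lemma col_coboundaries_zero: "(\<lambda>l. \<zero>) : col_coboundaries R m D i"
proof (cases i)
 case (Suc j)
 have "col_image R m D j (\<lambda>l. \<zero>\<^sub>Rr) = (\<lambda>l. \<zero>)"
  using left_module.comb_zero_right[OF Rr_left_module, of "m j"] D_entry_closed by (auto simp: col_image_def)
 moreover have "(\<lambda>l. \<zero>\<^sub>Rr) : vecs R (m j)" by (simp add: rows_carrier_iff)
 ultimately show ?thesis using Suc by (auto simp: col_coboundaries_def intro!: image_eqI[of _ _ "\<lambda>l. \<zero>"])
qed (simp add: col_coboundaries_def)

lemma col_coboundaries_finsum:
 assumes "\<And>i. i < (k::nat) ==> c i : col_coboundaries R m D q"
 shows "(\<lambda>l. \<Oplus>i\<in>{..<k}. c i l) : col_coboundaries R m D q"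
 using assms
proof (induction k)
 case 0
 then show ?case by (simp add: col_coboundaries_zero)
next
 case (Suc k)
 have "(\<Oplus>i\<in>{..<Suc k}. c i l) = c k l \<oplus> (\<Oplus>i\<in>{..<k}. c i l)" for l
  unfolding lessThan_Suc by (rule R.finsum_insert) (use col_coboundary_entry[OF Suc.prems] in auto)
 then show ?case using col_coboundaries_add[OF Suc.prems[of k] Suc.IH] Suc.prems by simp
qed

end

context matrix_base_change
begin

lemma phi_cocycle:
 assumes c: "c : col_cocycles H m E D i"
 shows "(\<lambda>l. \<phi> (c l)) : col_cocycles R m \<phi>E \<phi>D i"
proof -
 have "comb (regular_module R) (m i) (\<phi>E i l) (\<lambda>l. \<phi> (c l)) = \<phi> (comb (regular_module H) (m i) (E i l) c)" if "l < m i" for l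
  by (rule phi_comb[symmetric]) (use col_entry_closed[OF c] E_entry_closed[OF that] in auto)
 moreover have "comb (regular_module R) (m i) (\<phi>D i l) (\<lambda>l. \<phi> (c l)) = \<phi> (comb (regular_module H) (m i) (D i l) c)" if "l < m (Suc i)" for l
  by (rule phi_comb[symmetric]) (use col_entry_closed[OF c] D_entry_closed[OF that] in auto)
 ultimately show ?thesis using c phi_row by (simp add: col_cocycles_def phi_zero)
qed

lemma phi_coboundary:
 assumes c: "c : col_coboundaries H m D i"
 shows "(\<lambda>l. \<phi> (c l)) : col_coboundaries R m \<phi>D i"
proof (cases i)
 case 0
 then show ?thesis using c by (simp add: col_coboundaries_def phi_zero)
next
 case (Suc j)
 then obtain g where g: "g : vecs H (m j)" "c = col_image H m D j g"
  using c by (auto simp: col_coboundaries_def)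
 have "(\<lambda>l. \<phi> (c l)) = col_image R m \<phi>D j (\<lambda>l. \<phi> (g l))"
 proof
  fix l
  have "\<phi> (comb (regular_module H) (m j) (D j l) g) = comb (regular_module R) (m j) (\<phi>D j l) (\<lambda>l. \<phi> (g l))"
   if "l < m (Suc j)"
   by (rule phi_comb) (use D_entry_closed[OF that] R.free_closed[OF g(1)] in auto)
  then show "\<phi> (c l) = col_image R m \<phi>D j (\<lambda>l. \<phi> (g l)) l" by (simp add: g(2) col_image_def phi_zero)
 qed
 then show ?thesis using phi_row[OF g(1)] Suc by (auto simp: col_coboundaries_def)
qed

text \<open>A coboundary over \<open>R\<close> is witnessed by some column; applying the retraction
  \<psi> entrywise turns the witness into one over \<open>H\<close> and gives back the original
  cocycle.\<close>

lemma vanish_descent: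
 assumes \<psi>: "\<psi> : ring_hom R H" and ret: "\<And>h. h : carrier H ==> \<psi> (\<phi> h) = h"
  and van: "col_cocycles R m \<phi>E \<phi>D i \<subseteq> col_coboundaries R m \<phi>D i"
 shows "col_cocycles H m E D i \<subseteq> col_coboundaries H m D i"
proof
 fix c assume c: "c : col_cocycles H m E D i"
 have cc: "(\<lambda>l. \<phi> (c l)) : col_coboundaries R m \<phi>D i" using van phi_cocycle[OF c] by blast
 have ceq: "c = (\<lambda>l. \<psi> (\<phi> (c l)))" using ret col_entry_closed[OF c] by simp
 have \<psi>z: "\<psi> \<zero> = \<zero>\<^sub>H" using ret[of "\<zero>\<^sub>H"] phi_zero by simp
 show "c : col_coboundaries H m D i"
 proof (cases i)
  case 0
  then have "\<phi> (c l) = \<zero>" for l using cc by (simp add: col_coboundaries_def fun_eq_iff)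
  then show ?thesis using ceq 0 by (simp add: col_coboundaries_def \<psi>z)
 next
  case (Suc j)
  then obtain g where g: "g : vecs R (m j)" "(\<lambda>l. \<phi> (c l)) = col_image R m \<phi>D j g"
   using cc by (auto simp: col_coboundaries_def)
  have \<psi>c: "\<psi> r : carrier H" if "r : carrier R" for r using \<psi> that by (auto simp: ring_hom_def)
  have "c = col_image H m D j (\<lambda>l. \<psi> (g l))"
  proof
   fix l
   have "\<psi> (comb (regular_module R) (m j) (\<phi>D j l) g) =
     comb (regular_module H) (m j) (\<lambda>i. \<psi> (\<phi> (D j l i))) (\<lambda>l. \<psi> (g l))" if "l < m (Suc j)"
    by (rule comb_semilinear[where \<phi> = \<psi>, OF regular_left_module[OF N.R.ring_axioms] regular_left_module[OF R.ring_axioms]])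
     (use \<psi> \<psi>c D_entry_closed[OF that] N.R.free_closed[OF g(1)] in "auto simp: ring_hom_def additive_maps_def")
   then have "l < m (Suc j) ==> \<psi> (comb (regular_module R) (m j) (\<phi>D j l) g) =
     comb (regular_module H) (m j) (D j l) (\<lambda>l. \<psi> (g l))"
    using ret D_entry_closed by (simp add: comb_def)
   then have "\<psi> (col_image R m \<phi>D j g l) = col_image H m D j (\<lambda>l. \<psi> (g l)) l"
    by (simp add: col_image_def \<psi>z)
   then show "c l = col_image H m D j (\<lambda>l. \<psi> (g l)) l" using fun_cong[OF g(2), of l] fun_cong[OF ceq, of l] by simp
  qed
  moreover have "(\<lambda>l. \<psi> (g l)) : vecs H (m j)"
   using g(1) \<psi>c \<psi>z by (simp add: rows_carrier_iff)
  ultimately show ?thesis using Suc by (auto simp: col_coboundaries_def)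
 qed
qed

lemma left_linear_closed: "f : left_linear_maps H R \<phi> ==> r : carrier R ==> f r : carrier H"
 by (auto simp: left_linear_maps_def additive_maps_def)

lemma left_linear_mult:
 "f : left_linear_maps H R \<phi> ==> h : carrier H ==> r : carrier R ==> f (\<phi> h \<otimes> r) = h \<otimes>\<^sub>H f r"
 by (auto simp: left_linear_maps_def)

lemma left_linear_zero: "f : left_linear_maps H R \<phi> ==> f \<zero> = \<zero>\<^sub>H"
 using additive_hom.map_zero[OF additive_homI[OF N.R.is_abelian_group R.is_abelian_group]]
 by (auto simp: left_linear_maps_def)

text \<open>Matrices act on columns from the left, so for the dual complex it is the left linear
  coordinates that commute with the differential.\<close>

lemma left_linear_comb:
 assumes f: "f : left_linear_maps H R \<phi>" and x: "\<And>l. l < k ==> x l : carrier H"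
  and c: "\<And>l. l < k ==> c l : carrier R"
 shows "f (comb (regular_module R) k (\<lambda>l. \<phi> (x l)) c) = comb (regular_module H) k x (\<lambda>l. f (c l))"
proof -
 have "f (comb (regular_module R) k (\<lambda>l. \<phi> (x l)) c) = (\<Oplus>\<^sub>H l\<in>{..<k}. f (\<phi> (x l) \<otimes> c l))"
  unfolding comb_def finsum_with_action with_action_simps
  by (rule additive_hom.map_finsum[OF additive_homI[OF N.R.is_abelian_group R.is_abelian_group]])
   (use f x c in "auto simp: left_linear_maps_def")
 also have "... = comb (regular_module H) k x (\<lambda>l. f (c l))"
  unfolding comb_def finsum_with_action with_action_simps
  by (rule R.finsum_cong') (use x c left_linear_mult[OF f] left_linear_closed[OF f] in auto)
 finally show ?thesis .
qed

lemma left_linear_cocycle: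
 assumes f: "f : left_linear_maps H R \<phi>" and c: "c : col_cocycles R m \<phi>E \<phi>D i"
 shows "(\<lambda>l. f (c l)) : col_cocycles H m E D i"
proof -
 have cr: "c : vecs R (m i)" using c by (simp add: col_cocycles_def)
 note ce = N.R.free_closed[OF cr]
 have "comb (regular_module H) (m i) (E i l) (\<lambda>l. f (c l)) = f (comb (regular_module R) (m i) (\<phi>E i l) c)" if "l < m i" for l
  by (rule left_linear_comb[OF f, symmetric]) (use ce E_entry_closed[OF that] in auto)
 moreover have "comb (regular_module H) (m i) (D i l) (\<lambda>l. f (c l)) = f (comb (regular_module R) (m i) (\<phi>D i l) c)" if "l < m (Suc i)" for l
  by (rule left_linear_comb[OF f, symmetric]) (use ce D_entry_closed[OF that] in auto)
 moreover have "(\<lambda>l. f (c l)) : vecs H (m i)"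
  using cr left_linear_closed[OF f] left_linear_zero[OF f] by (simp add: rows_carrier_iff)
 ultimately show ?thesis using c by (simp add: col_cocycles_def left_linear_zero[OF f])
qed

lemma left_linear_coboundary:
 assumes f: "f : left_linear_maps H R \<phi>" and c: "c : col_coboundaries R m \<phi>D i"
 shows "(\<lambda>l. f (c l)) : col_coboundaries H m D i"
proof (cases i)
 case 0
 then show ?thesis using c by (simp add: col_coboundaries_def left_linear_zero[OF f])
next
 case (Suc j)
 then obtain g where g: "g : vecs R (m j)" "c = col_image R m \<phi>D j g"
  using c by (auto simp: col_coboundaries_def)
 have "(\<lambda>l. f (c l)) = col_image H m D j (\<lambda>l. f (g l))"
 proof
  fix l
  have "f (comb (regular_module R) (m j) (\<phi>D j l) g) = comb (regular_module H) (m j) (D j l) (\<lambda>l. f (g l))"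
   if "l < m (Suc j)"
   by (rule left_linear_comb[OF f]) (use D_entry_closed[OF that] N.R.free_closed[OF g(1)] in auto)
  then show "f (c l) = col_image H m D j (\<lambda>l. f (g l)) l"
   by (simp add: g(2) col_image_def left_linear_zero[OF f])
 qed
 moreover have "(\<lambda>l. f (g l)) : vecs H (m j)"
  using g(1) left_linear_closed[OF f] left_linear_zero[OF f] by (simp add: rows_carrier_iff)
 ultimately show ?thesis using Suc by (auto simp: col_coboundaries_def)
qed

end

text \<open>
 Now \<open>R\<close> is free over \<open>H\<close> on the left.  The module \<open>L\<close> is the dual cohomology over \<open>H\<close>, generated by \<open>w\<close>;
 the maps \<open>\<pi>\<close> and \<open>\<zeta>\<close> identify \<open>L \<otimes>\<^sub>H R\<close> with \<open>Q\<close>, where \<open>\<pi> r\<close> corresponds to \<open>w \<otimes> r\<close>.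
\<close>

locale dual_base_change = matrix_base_change H M m E D t R \<phi> N \<tau> + L: left_module H L
 for H :: "('h, 'y) ring_scheme" and M :: "('h, 'm) module" and m E D t
  and R :: "('r, 'x) ring_scheme" (structure) and \<phi> :: "'h => 'r" and N :: "('r, 'n) module" and \<tau> :: "'m => 'n"
  and L :: "('h, 'l) module" +
 fixes Q :: "('r, 'q) module" and w :: 'l and \<eta> :: "'l => 'h" and \<pi> :: "'r => 'q" and \<zeta> :: "'q => 'r"
 assumes changed: "matrix_resolution R N m \<phi>E \<phi>D (\<lambda>l. \<tau> (t l))"
  and Q: "abelian_group Q"
  and generator: "w : carrier L"
  and \<eta>_additive: "\<eta> : additive_maps L H"
  and \<eta>_generator: "z : carrier L ==> \<eta> z \<odot>\<^sub>L w = z"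
  and \<pi>_additive: "\<pi> : additive_maps R Q"
  and \<pi>_mult: "[|r : carrier R; r' : carrier R|] ==> \<pi> (r \<otimes> r') = r' \<odot>\<^sub>Q \<pi> r"
  and \<pi>_phi: "[|h : carrier H; r : carrier R|] ==> \<pi> (\<phi> h \<otimes> r) = \<pi> (\<phi> (\<eta> (h \<odot>\<^sub>L w)) \<otimes> r)"
  and \<zeta>_additive: "\<zeta> : additive_maps Q R"
  and \<pi>_\<zeta>: "q : carrier Q ==> \<pi> (\<zeta> q) = q"
  and left_basis: "[|finite W; W \<subseteq> carrier R|] ==> \<exists>k v \<kappa>.
   (\<forall>i<k::nat. v i : carrier R \<and> \<kappa> i : left_linear_maps H R \<phi> \<and>
     (\<forall>z\<in>carrier L. \<zeta> (\<pi> (\<phi> (\<eta> z) \<otimes> v i)) = \<phi> (\<eta> z) \<otimes> v i)) \<and>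
   (\<forall>r\<in>W. r = (\<Oplus>i\<in>{..<k}. \<phi> (\<kappa> i r) \<otimes> v i))"
begin

interpretation C: matrix_resolution R N m \<phi>E \<phi>D "\<lambda>l. \<tau> (t l)" by (rule changed)
interpretation Q: abelian_group Q by (rule Q)

definition basis_for where "basis_for k v \<kappa> W \<longleftrightarrow> (\<forall>i<k::nat. v i : carrier R \<and> \<kappa> i : left_linear_maps H R \<phi> \<and>
     (\<forall>z\<in>carrier L. \<zeta> (\<pi> (\<phi> (\<eta> z) \<otimes> v i)) = \<phi> (\<eta> z) \<otimes> v i)) \<and>
   (\<forall>r\<in>W. r = (\<Oplus>i\<in>{..<k}. \<phi> (\<kappa> i r) \<otimes> v i))"

lemma basis_exists: "finite W ==> W \<subseteq> carrier R ==> \<exists>k v \<kappa>. basis_for k v \<kappa> W"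
 unfolding basis_for_def by (rule left_basis)

lemma basis_forD:
 assumes "basis_for k v \<kappa> W" "i < k"
 shows "v i : carrier R" "\<kappa> i : left_linear_maps H R \<phi>"
  "z : carrier L ==> \<zeta> (\<pi> (\<phi> (\<eta> z) \<otimes> v i)) = \<phi> (\<eta> z) \<otimes> v i"
 using assms by (auto simp: basis_for_def)

lemma basis_expand: "basis_for k v \<kappa> W ==> r : W ==> r = (\<Oplus>i\<in>{..<k}. \<phi> (\<kappa> i r) \<otimes> v i)"
 by (simp add: basis_for_def)

lemma coboundary_combination:
 assumes B: "basis_for k v \<kappa> W" and b: "\<And>i. i < k ==> b i : col_coboundaries H m D q"
 shows "(\<lambda>l. \<Oplus>i\<in>{..<k}. \<phi> (b i l) \<otimes> v i) : col_coboundaries R m \<phi>D q"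
 by (rule C.col_coboundaries_finsum) (use phi_coboundary[OF b] basis_forD(1)[OF B] C.col_coboundaries_mult in blast)

text \<open>The coordinates of a cocycle are cocycles over \<open>H\<close>, hence coboundaries
  there, and combine with the elements \<open>v i\<close> to a coboundary over
  \<open>R\<close>.\<close>

theorem vanish_base_change:
 assumes "col_cocycles H m E D q \<subseteq> col_coboundaries H m D q"
 shows "col_cocycles R m \<phi>E \<phi>D q \<subseteq> col_coboundaries R m \<phi>D q"
proof
 fix c assume c: "c : col_cocycles R m \<phi>E \<phi>D q"
 have cr: "c : vecs R (m q)" using c by (simp add: col_cocycles_def)
 \<comment> \<open>Columns are zero from position \<open>m q\<close> on. Adding zero to the finite
   set makes the expansion valid at every position.\<close>
 have "insert \<zero> (c ` {..<m q}) \<subseteq> carrier R" using C.col_entry_closed[OF c] by auto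
 then obtain k v \<kappa> where B: "basis_for k v \<kappa> (insert \<zero> (c ` {..<m q}))"
  using basis_exists[of "insert \<zero> (c ` {..<m q})"] by auto
 have "c l : insert \<zero> (c ` {..<m q})" for l using cr by (cases "l < m q") (auto simp: rows_carrier_iff)
 then have "c = (\<lambda>l. \<Oplus>i\<in>{..<k}. \<phi> (\<kappa> i (c l)) \<otimes> v i)" using basis_expand[OF B] by blast
 moreover have "(\<lambda>l. \<Oplus>i\<in>{..<k}. \<phi> (\<kappa> i (c l)) \<otimes> v i) : col_coboundaries R m \<phi>D q"
  by (rule coboundary_combination[OF B]) (use assms left_linear_cocycle[OF basis_forD(2)[OF B] c] in blast)
 ultimately show "c : col_coboundaries R m \<phi>D q" by simp
qed

context
 fixes q l0 z0
 assumes l0: "col_onto H m E D q L l0" and z0: "z0 : col_cocycles H m E D q" "l0 z0 = w"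
begin

lemma eta_closed: "z : carrier L ==> \<eta> z : carrier H"
 by (rule additive_closed[OF \<eta>_additive])

lemma zeta_closed: "z : carrier Q ==> \<zeta> z : carrier R"
 by (rule additive_closed[OF \<zeta>_additive])

lemma pi_closed: "r : carrier R ==> \<pi> r : carrier Q"
 by (rule additive_closed[OF \<pi>_additive])

interpretation \<pi>: additive_hom R Q \<pi> by (rule additive_homI[OF N.R.is_abelian_group Q \<pi>_additive])
interpretation \<zeta>: additive_hom Q R \<zeta> by (rule additive_homI[OF Q N.R.is_abelian_group \<zeta>_additive])
interpretation \<eta>: additive_hom L H \<eta> by (rule additive_homI[OF L.M.abelian_group_axioms R.is_abelian_group \<eta>_additive])

lemma l0_facts:
 "c : col_cocycles H m E D q ==> l0 c : carrier L"
 "c : col_cocycles H m E D q ==> c' : col_cocycles H m E D q ==> l0 (\<lambda>i. c i \<oplus>\<^sub>H c' i) = l0 c \<oplus>\<^sub>L l0 c'"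
 "c : col_cocycles H m E D q ==> l0 c = \<zero>\<^sub>L \<longleftrightarrow> c : col_coboundaries H m D q"
 "h : carrier H ==> l0 (\<lambda>i. z0 i \<otimes>\<^sub>H h) = h \<odot>\<^sub>L w"
 using l0 z0 by (simp_all add: col_onto_def)

lemma z0_entry: "z0 l : carrier H"
 by (rule col_entry_closed[OF z0(1)])

text \<open>In the tensor product of \<open>L\<close> and \<open>R\<close> over \<open>H\<close>,
  the class of \<open>c\<close> is \<open>w \<otimes> \<zeta> n\<close>, with
  \<open>\<zeta> n\<close> as the normal form for \<open>n\<close>. Working with a relation
  postpones the choice of a value until uniqueness is proved.\<close>

definition represents where "represents c n \<longleftrightarrow> n : carrier Q \<and>
   (\<exists>b\<in>col_coboundaries R m \<phi>D q. c = (\<lambda>l. \<phi> (z0 l) \<otimes> \<zeta> n \<oplus> b l))"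

lemma representsI:
 "n : carrier Q ==> b : col_coboundaries R m \<phi>D q ==>
  c = (\<lambda>l. \<phi> (z0 l) \<otimes> \<zeta> n \<oplus> b l) ==> represents c n"
 by (auto simp: represents_def)

text \<open>Each coordinate cocycle is cohomologous over \<open>H\<close> to a multiple of
  \<open>z0\<close>, the factor being read off from its class in \<open>L\<close>. Recombining gives
  \<open>z0\<close> times an element \<open>r0\<close> of \<open>R\<close>, and \<zeta> after \<pi>
  fixes \<open>r0\<close> because it fixes each of its terms.\<close>

lemma represents_basis:
 assumes B: "basis_for k v \<kappa> W" and c: "c : col_cocycles R m \<phi>E \<phi>D q" and W: "\<And>l. c l : W"
 shows "represents c (\<pi> (\<Oplus>i\<in>{..<k}. \<phi> (\<eta> (l0 (\<lambda>l. \<kappa> i (c l)))) \<otimes> v i))"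
proof -
 define cc where "cc i = (\<lambda>l. \<kappa> i (c l))" for i
 have cc: "cc i : col_cocycles H m E D q" if "i < k" for i
  unfolding cc_def by (rule left_linear_cocycle[OF basis_forD(2)[OF B that] c])
 define lm where "lm i = l0 (cc i)" for i
 have lam: "lm i : carrier L" if "i < k" for i unfolding lm_def by (rule l0_facts(1)[OF cc[OF that]])
 note v = basis_forD(1)[OF B]
 \<comment> \<open>The coordinate cocycle minus the multiple of \<open>z0\<close> in its class. The
   map \<open>l0\<close> sends it to \<open>lm i - \<eta> (lm i) w\<close>, which is zero.\<close>
 define b where "b i = (\<lambda>l. cc i l \<oplus>\<^sub>H z0 l \<otimes>\<^sub>H (\<ominus>\<^sub>H \<eta> (lm i)))" for i
 have b: "b i : col_coboundaries H m D q" if i: "i < k" for i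
 proof -
  have h: "\<ominus>\<^sub>H \<eta> (lm i) : carrier H" using eta_closed[OF lam[OF i]] by simp
  note zc = col_cocycles_mult[OF z0(1) h]
  have "l0 (b i) = lm i \<oplus>\<^sub>L (\<ominus>\<^sub>H \<eta> (lm i)) \<odot>\<^sub>L w"
   unfolding b_def lm_def using l0_facts(2)[OF cc[OF i] zc] l0_facts(4)[OF h] by (simp add: lm_def)
  also have "(\<ominus>\<^sub>H \<eta> (lm i)) \<odot>\<^sub>L w = \<ominus>\<^sub>L lm i"
  proof -
   interpret s: additive_hom H L "\<lambda>h. h \<odot>\<^sub>L w"
    by (rule additive_homI[OF R.is_abelian_group L.M.abelian_group_axioms L.smult_left_additive[OF generator]])
   show ?thesis using s.map_uminus[OF eta_closed[OF lam[OF i]]] \<eta>_generator[OF lam[OF i]] by simp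
  qed
  finally have "l0 (b i) = \<zero>\<^sub>L" using lam[OF i] by (simp add: L.M.r_neg)
  moreover have "b i : col_cocycles H m E D q" unfolding b_def by (rule col_cocycles_add[OF cc[OF i] zc])
  ultimately show ?thesis using l0_facts(3) by blast
 qed
 define r0 where "r0 = (\<Oplus>i\<in>{..<k}. \<phi> (\<eta> (lm i)) \<otimes> v i)"
 have trm: "\<phi> (\<eta> (lm i)) \<otimes> v i : carrier R" if "i < k" for i
  using v[OF that] eta_closed[OF lam[OF that]] by simp
 have r0: "r0 : carrier R" unfolding r0_def by (rule N.R.finsum_closed) (use trm in auto)
 have "\<zeta> (\<pi> r0) = (\<Oplus>i\<in>{..<k}. \<zeta> (\<pi> (\<phi> (\<eta> (lm i)) \<otimes> v i)))"
  unfolding r0_def using trm pi_closed by (subst \<pi>.map_finsum, simp, subst \<zeta>.map_finsum) auto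
 also have "... = r0" unfolding r0_def
  by (rule N.R.finsum_cong') (use trm basis_forD(3)[OF B] lam in auto)
 finally have fixed: "\<zeta> (\<pi> r0) = r0" .
 let ?b = "\<lambda>l. \<Oplus>i\<in>{..<k}. \<phi> (b i l) \<otimes> v i"
 have bc: "b i l : carrier H" if "i < k" for i l by (rule col_coboundary_entry[OF b[OF that]])
 have ceq: "c = (\<lambda>l. \<phi> (z0 l) \<otimes> \<zeta> (\<pi> r0) \<oplus> ?b l)"
 proof
  fix l
  have "\<phi> (z0 l) \<otimes> r0 = (\<Oplus>i\<in>{..<k}. \<phi> (z0 l) \<otimes> (\<phi> (\<eta> (lm i)) \<otimes> v i))"
   unfolding r0_def by (rule N.R.finsum_rdistr) (use trm z0_entry in auto)
  then have "\<phi> (z0 l) \<otimes> r0 \<oplus> ?b l =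
    (\<Oplus>i\<in>{..<k}. \<phi> (z0 l) \<otimes> (\<phi> (\<eta> (lm i)) \<otimes> v i) \<oplus> \<phi> (b i l) \<otimes> v i)"
   using trm z0_entry v bc by (subst N.R.finsum_addf) auto
  also have "... = (\<Oplus>i\<in>{..<k}. \<phi> (cc i l) \<otimes> v i)"
  proof (rule N.R.finsum_cong')
   fix i assume "i : {..<k}"
   then have i: "i < k" by simp
   note h = eta_closed[OF lam[OF i]] z0_entry[of l] col_entry_closed[OF cc[OF i], of l]
   have "cc i l = z0 l \<otimes>\<^sub>H \<eta> (lm i) \<oplus>\<^sub>H b i l"
    unfolding b_def using h by (simp add: R.r_minus R.a_lcomm R.r_neg)
   then have "\<phi> (cc i l) = \<phi> (z0 l) \<otimes> \<phi> (\<eta> (lm i)) \<oplus> \<phi> (b i l)"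
    using h bc[OF i] by (simp add: additive_add[OF phi_additive] phi_mult)
   then show "\<phi> (z0 l) \<otimes> (\<phi> (\<eta> (lm i)) \<otimes> v i) \<oplus> \<phi> (b i l) \<otimes> v i = \<phi> (cc i l) \<otimes> v i"
    using h bc[OF i] v[OF i] by (simp add: N.R.l_distr N.R.m_assoc)
  qed (use col_entry_closed[OF cc] v in auto)
  also have "... = c l" using basis_expand[OF B W[of l]] by (simp add: cc_def)
  finally show "c l = \<phi> (z0 l) \<otimes> \<zeta> (\<pi> r0) \<oplus> ?b l" by (simp add: fixed)
 qed
 have "?b : col_coboundaries R m \<phi>D q" by (rule coboundary_combination[OF B b])
 then have "represents c (\<pi> r0)" by (rule representsI[OF pi_closed[OF r0] _ ceq])
 then show ?thesis by (simp add: r0_def lm_def cc_def)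
qed

lemma represents_exists:
 assumes c: "c : col_cocycles R m \<phi>E \<phi>D q"
 shows "\<exists>n. represents c n"
proof -
 have cr: "c : vecs R (m q)" using c by (simp add: col_cocycles_def)
 have "insert \<zero> (c ` {..<m q}) \<subseteq> carrier R" using C.col_entry_closed[OF c] by auto
 then obtain k v \<kappa> where B: "basis_for k v \<kappa> (insert \<zero> (c ` {..<m q}))"
  using basis_exists[of "insert \<zero> (c ` {..<m q})"] by auto
 have "c l : insert \<zero> (c ` {..<m q})" for l using cr by (cases "l < m q") (auto simp: rows_carrier_iff)
 from represents_basis[OF B c this] show ?thesis by blast
qed

lemma generator_multiple_cocycle:
 "r : carrier R ==> (\<lambda>l. \<phi> (z0 l) \<otimes> r) : col_cocycles R m \<phi>E \<phi>D q"
 by (rule C.col_cocycles_mult[OF phi_cocycle[OF z0(1)]])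

text \<open>The previous lemma yields a representative written in terms of a basis. Here the
  coordinate classes are multiples of \<open>w\<close>, and \<open>\<pi>_phi\<close> identifies the
  result with \<open>\<pi> r\<close>, whatever the basis.\<close>

lemma represents_generator_multiple:
 assumes r: "r : carrier R"
 shows "represents (\<lambda>l. \<phi> (z0 l) \<otimes> r) (\<pi> r)"
proof -
 let ?c = "\<lambda>l. \<phi> (z0 l) \<otimes> r"
 note c = generator_multiple_cocycle[OF r]
 have cr: "?c : vecs R (m q)" using c by (simp add: col_cocycles_def)
 \<comment> \<open>The factor \<open>r\<close> is included so that it is expanded in the same basis
   as the entries of the column.\<close>
 have "insert r (insert \<zero> (?c ` {..<m q})) \<subseteq> carrier R" using C.col_entry_closed[OF c] r by auto
 then obtain k v \<kappa> where B: "basis_for k v \<kappa> (insert r (insert \<zero> (?c ` {..<m q})))"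
  using basis_exists[of "insert r (insert \<zero> (?c ` {..<m q}))"] by auto
 have "?c l : insert r (insert \<zero> (?c ` {..<m q}))" for l
  using cr by (cases "l < m q") (auto simp: rows_carrier_iff)
 from represents_basis[OF B c this]
 have "represents ?c (\<pi> (\<Oplus>i\<in>{..<k}. \<phi> (\<eta> (l0 (\<lambda>l. \<kappa> i (?c l)))) \<otimes> v i))" .
 also have "\<pi> (\<Oplus>i\<in>{..<k}. \<phi> (\<eta> (l0 (\<lambda>l. \<kappa> i (?c l)))) \<otimes> v i) = \<pi> r"
 proof -
  note v = basis_forD(1)[OF B] and \<kappa> = basis_forD(2)[OF B]
  have l: "l0 (\<lambda>l. \<kappa> i (?c l)) = \<kappa> i r \<odot>\<^sub>L w" if "i < k" for i
   using l0_facts(4)[OF left_linear_closed[OF \<kappa>[OF that] r]] left_linear_mult[OF \<kappa>[OF that] z0_entry r] by simp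
  have e: "\<eta> (\<kappa> i r \<odot>\<^sub>L w) : carrier H" if "i < k" for i
   by (rule eta_closed[OF L.smult_closed[OF left_linear_closed[OF \<kappa>[OF that] r] generator]])
  have "\<pi> (\<Oplus>i\<in>{..<k}. \<phi> (\<eta> (l0 (\<lambda>l. \<kappa> i (?c l)))) \<otimes> v i) =
    (\<Oplus>\<^sub>Q i\<in>{..<k}. \<pi> (\<phi> (\<eta> (l0 (\<lambda>l. \<kappa> i (?c l)))) \<otimes> v i))"
   by (rule \<pi>.map_finsum) (use l e v in auto)
  also have "... = (\<Oplus>\<^sub>Q i\<in>{..<k}. \<pi> (\<phi> (\<kappa> i r) \<otimes> v i))"
   by (rule Q.finsum_cong') (use l \<pi>_phi[OF left_linear_closed[OF \<kappa> r] v] v e left_linear_closed[OF \<kappa> r] in "auto intro!: pi_closed")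
  also have "... = \<pi> (\<Oplus>i\<in>{..<k}. \<phi> (\<kappa> i r) \<otimes> v i)"
   by (rule \<pi>.map_finsum[symmetric]) (use v left_linear_closed[OF \<kappa> r] in auto)
  also have "(\<Oplus>i\<in>{..<k}. \<phi> (\<kappa> i r) \<otimes> v i) = r" using basis_expand[OF B, of r] by simp
  finally show ?thesis .
 qed
 finally show ?thesis .
qed

text \<open>The coordinates of the column are multiples of \<open>z0\<close> that bound over
  \<open>H\<close>, so the coordinates of \<open>\<zeta> n\<close> annihilate \<open>w\<close>. By
  \<open>\<pi>_phi\<close> every term in the expansion of \<open>n = \<pi> (\<zeta> n)\<close> then
  vanishes.\<close>

lemma represented_coboundary:
 assumes n: "n : carrier Q" and cob: "(\<lambda>l. \<phi> (z0 l) \<otimes> \<zeta> n) : col_coboundaries R m \<phi>D q"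
 shows "n = \<zero>\<^sub>Q"
proof -
 note r = zeta_closed[OF n]
 obtain k v \<kappa> where B: "basis_for k v \<kappa> {\<zeta> n}" using basis_exists[of "{\<zeta> n}"] r by blast
 note v = basis_forD(1)[OF B] and \<kappa> = basis_forD(2)[OF B]
 have z: "\<kappa> i (\<zeta> n) \<odot>\<^sub>L w = \<zero>\<^sub>L" if i: "i < k" for i
 proof -
  note h = left_linear_closed[OF \<kappa>[OF i] r]
  have "(\<lambda>l. z0 l \<otimes>\<^sub>H \<kappa> i (\<zeta> n)) : col_coboundaries H m D q"
   using left_linear_coboundary[OF \<kappa>[OF i] cob] left_linear_mult[OF \<kappa>[OF i] z0_entry r] by simp
  then show ?thesis using l0_facts(3)[OF col_cocycles_mult[OF z0(1) h]] l0_facts(4)[OF h] by simp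
 qed
 have "n = \<pi> (\<Oplus>i\<in>{..<k}. \<phi> (\<kappa> i (\<zeta> n)) \<otimes> v i)"
  using basis_expand[OF B, of "\<zeta> n"] \<pi>_\<zeta>[OF n] by simp
 also have "... = (\<Oplus>\<^sub>Q i\<in>{..<k}. \<pi> (\<phi> (\<kappa> i (\<zeta> n)) \<otimes> v i))"
  by (rule \<pi>.map_finsum) (use v left_linear_closed[OF \<kappa> r] in auto)
 also have "... = (\<Oplus>\<^sub>Q i\<in>{..<k}. \<zero>\<^sub>Q)"
  by (rule Q.finsum_cong')
   (use \<pi>_phi[OF left_linear_closed[OF \<kappa> r] v] z v \<eta>.map_zero phi_zero \<pi>.map_zero in auto)
 finally show ?thesis by simp
qed

lemma represents_unique:
 assumes "represents c n" "represents c n'"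
 shows "n = n'"
proof -
 obtain b b' where n: "n : carrier Q" "n' : carrier Q"
  and b: "b : col_coboundaries R m \<phi>D q" "b' : col_coboundaries R m \<phi>D q"
  and eq: "(\<lambda>l. \<phi> (z0 l) \<otimes> \<zeta> n \<oplus> b l) = (\<lambda>l. \<phi> (z0 l) \<otimes> \<zeta> n' \<oplus> b' l)"
  using assms by (auto simp: represents_def)
 have mo: "\<ominus> \<one> : carrier R" by simp
 have "(\<lambda>l. \<phi> (z0 l) \<otimes> \<zeta> (n \<ominus>\<^sub>Q n')) = (\<lambda>l. b' l \<oplus> b l \<otimes> \<ominus> \<one>)"
 proof
  fix l
  define x y b1 b2 where "x = \<phi> (z0 l) \<otimes> \<zeta> n" "y = \<phi> (z0 l) \<otimes> \<zeta> n'" "b1 = b l" "b2 = b' l"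
  have cl: "x : carrier R" "y : carrier R" "b1 : carrier R" "b2 : carrier R"
   using n z0_entry C.col_coboundary_entry b by (auto simp: x_y_b1_b2_def zeta_closed)
  have e: "x \<oplus> b1 = y \<oplus> b2" using fun_cong[OF eq, of l] by (simp add: x_y_b1_b2_def)
  have "\<phi> (z0 l) \<otimes> \<zeta> (n \<ominus>\<^sub>Q n') = x \<ominus> y"
   using n z0_entry by (simp add: \<zeta>.map_minus x_y_b1_b2_def zeta_closed N.R.minus_eq N.R.r_distr N.R.r_minus)
  also have "x = y \<oplus> b2 \<ominus> b1" unfolding e[symmetric] using cl by (simp add: N.R.minus_eq N.R.a_assoc N.R.r_neg)
  also have "y \<oplus> b2 \<ominus> b1 \<ominus> y = (b2 \<ominus> b1) \<oplus> (y \<ominus> y)"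
   using cl by (simp add: N.R.minus_eq N.R.a_ac)
  also have "... = b2 \<ominus> b1" using cl by (simp add: N.R.minus_eq N.R.r_neg)
  also have "... = b2 \<oplus> b1 \<otimes> \<ominus> \<one>" using cl by (simp add: N.R.minus_eq N.R.r_minus)
  finally show "\<phi> (z0 l) \<otimes> \<zeta> (n \<ominus>\<^sub>Q n') = b' l \<oplus> b l \<otimes> \<ominus> \<one>" by (simp add: x_y_b1_b2_def)
 qed
 also have "... : col_coboundaries R m \<phi>D q"
  by (rule C.col_coboundaries_add[OF b(2) C.col_coboundaries_mult[OF b(1) mo]])
 finally have "n \<ominus>\<^sub>Q n' = \<zero>\<^sub>Q" using n by (intro represented_coboundary) auto
 then show ?thesis using n by (simp add: Q.minus_eq_zero_iff)
qed

lemma represents_add: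
 assumes "represents c n" "represents c' n'"
 shows "represents (\<lambda>l. c l \<oplus> c' l) (n \<oplus>\<^sub>Q n')"
proof -
 obtain b b' where n: "n : carrier Q" "n' : carrier Q"
  and b: "b : col_coboundaries R m \<phi>D q" "b' : col_coboundaries R m \<phi>D q"
  and c: "c = (\<lambda>l. \<phi> (z0 l) \<otimes> \<zeta> n \<oplus> b l)" "c' = (\<lambda>l. \<phi> (z0 l) \<otimes> \<zeta> n' \<oplus> b' l)"
  using assms by (auto simp: represents_def)
 have "(\<lambda>l. c l \<oplus> c' l) = (\<lambda>l. \<phi> (z0 l) \<otimes> \<zeta> (n \<oplus>\<^sub>Q n') \<oplus> (b l \<oplus> b' l))"
  using n z0_entry C.col_coboundary_entry[OF b(1)] C.col_coboundary_entry[OF b(2)]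
  by (simp add: c \<zeta>.map_add zeta_closed N.R.r_distr N.R.a_ac)
 then show ?thesis by (rule representsI[OF Q.a_closed[OF n] C.col_coboundaries_add[OF b]])
qed

text \<open>The section \<zeta> is only additive, so \<open>\<zeta> n\<close> times \<open>r\<close>
  and \<zeta> of \<open>n\<close> acted on by \<open>r\<close> can differ. Both have the same image
  under \<pi>, and therefore give cohomologous multiples of \<open>z0\<close>.\<close>

lemma represents_mult:
 assumes "represents c n" and r: "r : carrier R"
 shows "represents (\<lambda>l. c l \<otimes> r) (r \<odot>\<^sub>Q n)"
proof -
 obtain b where n: "n : carrier Q" and b: "b : col_coboundaries R m \<phi>D q"
  and c: "c = (\<lambda>l. \<phi> (z0 l) \<otimes> \<zeta> n \<oplus> b l)"
  using assms by (auto simp: represents_def)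
 have zr: "\<zeta> n \<otimes> r : carrier R" using zeta_closed[OF n] r by simp
 have "\<pi> (\<zeta> n \<otimes> r) = r \<odot>\<^sub>Q n" using \<pi>_mult[OF zeta_closed[OF n] r] \<pi>_\<zeta>[OF n] by simp
 with represents_generator_multiple[OF zr] have "represents (\<lambda>l. \<phi> (z0 l) \<otimes> (\<zeta> n \<otimes> r)) (r \<odot>\<^sub>Q n)" by simp
 then obtain b' where n': "r \<odot>\<^sub>Q n : carrier Q" and b': "b' : col_coboundaries R m \<phi>D q"
  and e: "(\<lambda>l. \<phi> (z0 l) \<otimes> (\<zeta> n \<otimes> r)) = (\<lambda>l. \<phi> (z0 l) \<otimes> \<zeta> (r \<odot>\<^sub>Q n) \<oplus> b' l)"
  unfolding represents_def by blast
 have "(\<lambda>l. c l \<otimes> r) = (\<lambda>l. \<phi> (z0 l) \<otimes> \<zeta> (r \<odot>\<^sub>Q n) \<oplus> (b' l \<oplus> b l \<otimes> r))"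
 proof
  fix l
  have "c l \<otimes> r = \<phi> (z0 l) \<otimes> (\<zeta> n \<otimes> r) \<oplus> b l \<otimes> r"
   using n z0_entry C.col_coboundary_entry[OF b] r by (simp add: c zeta_closed N.R.l_distr N.R.m_assoc)
  also have "... = \<phi> (z0 l) \<otimes> \<zeta> (r \<odot>\<^sub>Q n) \<oplus> (b' l \<oplus> b l \<otimes> r)"
   unfolding fun_cong[OF e, of l]
   using zeta_closed[OF n'] z0_entry C.col_coboundary_entry[OF b] C.col_coboundary_entry[OF b'] r by (simp add: N.R.a_assoc)
  finally show "c l \<otimes> r = \<phi> (z0 l) \<otimes> \<zeta> (r \<odot>\<^sub>Q n) \<oplus> (b' l \<oplus> b l \<otimes> r)" .
 qed
 then show ?thesis
  by (rule representsI[OF n' C.col_coboundaries_add[OF b' C.col_coboundaries_mult[OF b r]]])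
qed

lemma col_onto_base_change_aux: "\<exists>l. col_onto R m \<phi>E \<phi>D q Q l"
proof
 define l where "l c = (THE n. represents c n)" for c
 have l: "represents c n ==> l c = n" for c n
  unfolding l_def using represents_unique by blast
 have lr: "represents c (l c)" if "c : col_cocycles R m \<phi>E \<phi>D q" for c
  using represents_exists[OF that] l by blast
 show "col_onto R m \<phi>E \<phi>D q Q l" unfolding col_onto_def
 proof (intro conjI ballI)
  fix c assume c: "c : col_cocycles R m \<phi>E \<phi>D q"
  note rc = lr[OF c]
  show "l c : carrier Q" using rc by (simp add: represents_def)
  show "l c = \<zero>\<^sub>Q \<longleftrightarrow> c : col_coboundaries R m \<phi>D q"
  proof
   assume "l c = \<zero>\<^sub>Q"
   then obtain b where "b : col_coboundaries R m \<phi>D q" "c = (\<lambda>l. \<phi> (z0 l) \<otimes> \<zeta> \<zero>\<^sub>Q \<oplus> b l)"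
    using rc by (auto simp: represents_def)
   then show "c : col_coboundaries R m \<phi>D q"
    using C.col_coboundary_entry z0_entry by (simp add: \<zeta>.map_zero)
  next
   assume "c : col_coboundaries R m \<phi>D q"
   then have "represents c \<zero>\<^sub>Q" unfolding represents_def
    using z0_entry C.col_coboundary_entry by (auto simp: \<zeta>.map_zero intro!: bexI[of _ c])
   then show "l c = \<zero>\<^sub>Q" by (rule l)
  qed
  {
   fix c' assume "c' : col_cocycles R m \<phi>E \<phi>D q"
   from represents_add[OF rc lr[OF this]]
   show "l (\<lambda>i. c i \<oplus> c' i) = l c \<oplus>\<^sub>Q l c'" by (rule l)
  }
  fix r assume "r : carrier R"
  from represents_mult[OF rc this]
  show "l (\<lambda>i. c i \<otimes> r) = r \<odot>\<^sub>Q l c" by (rule l)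
 next
  fix n assume n: "n : carrier Q"
  from represents_generator_multiple[OF zeta_closed[OF n]]
  have "l (\<lambda>l. \<phi> (z0 l) \<otimes> \<zeta> n) = n" by (simp add: l \<pi>_\<zeta>[OF n])
  then show "\<exists>c\<in>col_cocycles R m \<phi>E \<phi>D q. l c = n"
   using generator_multiple_cocycle[OF zeta_closed[OF n]] by blast
 qed
qed

end

theorem col_onto_base_change:
 assumes "col_onto H m E D q L l0"
 shows "\<exists>l. col_onto R m \<phi>E \<phi>D q Q l"
proof -
 obtain z0 where "z0 : col_cocycles H m E D q" "l0 z0 = w"
  using assms generator by (auto simp: col_onto_def)
 then show ?thesis by (rule col_onto_base_change_aux[OF assms])
qed

end

section \<open>Universal property and algebra structure of the tensor product\<close>

section \<open>Tensor products\<close>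

lemma module_left_module: "module k V ==> left_module k V"
 unfolding module_def module_axioms_def left_module_def left_module_axioms_def
 by (auto simp: cring.axioms)

definition bilinear_maps ::
  "'k ring => ('k, 'v) module => ('k, 'w) module => ('k, 'n) module => ('v => 'w => 'n) set" where
 "bilinear_maps k V W N = {f. (\<forall>w\<in>carrier W. (\<lambda>v. f v w) : linear_maps k V N) \<and>
   (\<forall>v\<in>carrier V. (\<lambda>w. f v w) : linear_maps k W N)}"

lemma bilinearI:
 "(\<And>w. w : carrier W ==> (\<lambda>v. f v w) : linear_maps k V N) ==>
  (\<And>v. v : carrier V ==> (\<lambda>w. f v w) : linear_maps k W N) ==> f : bilinear_maps k V W N"
 by (simp add: bilinear_maps_def)

lemma bilinearD:
 "f : bilinear_maps k V W N ==> w : carrier W ==> (\<lambda>v. f v w) : linear_maps k V N"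
 "f : bilinear_maps k V W N ==> v : carrier V ==> f v : linear_maps k W N"
 by (auto simp: bilinear_maps_def)

lemma bilinear_closed:
 "f : bilinear_maps k V W N ==> v : carrier V ==> w : carrier W ==> f v w : carrier N"
 using linear_closed[OF bilinearD(2)] .

text \<open>The sum inside \<open>tensor_lift\<close>, for an explicit representative instead of a
  chosen one.\<close>

definition list_sum :: "('r, 'n) module => ('v => 'w => 'n) => ('v \<times> 'w) list => 'n" where
 "list_sum N f ps = foldr (\<lambda>(v, w) s. f v w \<oplus>\<^sub>N s) ps \<zero>\<^sub>N"

lemma list_sum_simps [simp]:
 "list_sum N f [] = \<zero>\<^sub>N" "list_sum N f (p # ps) = f (fst p) (snd p) \<oplus>\<^sub>N list_sum N f ps"
 by (simp_all add: list_sum_def case_prod_unfold)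

locale tensor_product = V?: module k V + W?: module k W
 for k :: "'k ring" and V :: "('k, 'v) module" and W :: "('k, 'w) module"
begin

abbreviation "T \<equiv> tensor k V W"
abbreviation "pairs \<equiv> lists (carrier V \<times> carrier W)"
abbreviation "cls \<equiv> tensor_class k V W"
abbreviation "pure \<equiv> pure_tensor k V W"

lemma tensor_eq_pairs: "tensor_eq k V W ps qs ==> ps : pairs \<and> qs : pairs"
 by (induction rule: tensor_eq.induct) auto

lemma class_eq_iff: "ps : pairs ==> cls ps = cls qs \<longleftrightarrow> tensor_eq k V W ps qs"
 unfolding tensor_class_def by (blast intro: tensor_eq.intros)

lemma class_self: "ps : pairs ==> ps : cls ps"
 by (simp add: tensor_class_def tensor_eq.refl)

lemma class_member: "qs : cls ps ==> qs : pairs \<and> cls qs = cls ps"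
 unfolding tensor_class_def by (blast intro: tensor_eq.intros dest: tensor_eq_pairs)

lemma class_closed: "ps : pairs ==> cls ps : carrier T"
 by (auto simp: tensor_def)

lemma tensor_cases:
 assumes "t : carrier T"
 obtains ps where "ps : pairs" "t = cls ps"
 using assms by (auto simp: tensor_def)

lemma tensor_zero: "\<zero>\<^sub>T = cls []" and tensor_one: "\<one>\<^sub>T = pure \<one>\<^sub>V \<one>\<^sub>W"
 by (simp_all add: tensor_def pure_tensor_def)

lemma tensor_add:
 assumes "ps : pairs" "qs : pairs"
 shows "cls ps \<oplus>\<^sub>T cls qs = cls (ps @ qs)"
proof -
 have "cls (ps' @ qs') = cls (ps @ qs)" if "ps' : cls ps" "qs' : cls qs" for ps' qs'
 proof -
  have "tensor_eq k V W ps ps'" "tensor_eq k V W qs qs'" using that by (simp_all only: tensor_class_def mem_Collect_eq)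
  then have "tensor_eq k V W (ps @ qs) (ps' @ qs')" by (rule tensor_eq.append)
  moreover have "ps @ qs : pairs" using assms by simp
  ultimately show ?thesis using class_eq_iff by blast
 qed
 moreover have "ps : cls ps" "qs : cls qs" using assms class_self by auto
 ultimately have "(\<Union>ps'\<in>cls ps. \<Union>qs'\<in>cls qs. cls (ps' @ qs')) = cls (ps @ qs)" by blast
 then show ?thesis by (simp add: tensor_def)
qed

lemma scale_respects:
 assumes c: "c : carrier k" and "tensor_eq k V W ps qs"
 shows "tensor_eq k V W [(c \<odot>\<^sub>V v, w). (v, w) \<leftarrow> ps] [(c \<odot>\<^sub>V v, w). (v, w) \<leftarrow> qs]"
 using assms(2)
proof (induction rule: tensor_eq.induct)
 case (refl ps)
 then have "[(c \<odot>\<^sub>V v, w). (v, w) \<leftarrow> ps] : pairs" using c by (induction ps) auto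
 then show ?case by (rule tensor_eq.refl)
next
 case (commute ps qs)
 then have "[(c \<odot>\<^sub>V v, w). (v, w) \<leftarrow> ps] : pairs" "[(c \<odot>\<^sub>V v, w). (v, w) \<leftarrow> qs] : pairs"
  using c by (induction ps, auto) (induction qs, auto)
 from tensor_eq.commute[OF this, of k] show ?case by simp
next
 case (add_left v v' w)
 then show ?case using c tensor_eq.add_left[of "c \<odot>\<^sub>V v" V "c \<odot>\<^sub>V v'" w W k] by (simp add: V.smult_r_distr)
next
 case (scale a v w)
 have "c \<odot>\<^sub>V (a \<odot>\<^sub>V v) = a \<odot>\<^sub>V (c \<odot>\<^sub>V v)"
  using scale c by (simp add: V.smult_assoc1[symmetric] V.R.m_comm)
 then show ?case using c scale tensor_eq.scale[of a k "c \<odot>\<^sub>V v" V w W] by simp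
qed (use c in "auto intro: tensor_eq.intros simp: V.smult_r_null")

lemma tensor_smult:
 assumes "ps : pairs" "c : carrier k"
 shows "c \<odot>\<^sub>T cls ps = cls [(c \<odot>\<^sub>V v, w). (v, w) \<leftarrow> ps]"
proof -
 let ?f = "\<lambda>ps. [(c \<odot>\<^sub>V v, w). (v, w) \<leftarrow> ps]"
 have p: "?f ps : pairs" using assms by (induction ps) auto
 have "cls (?f qs) = cls (?f ps)" if "qs : cls ps" for qs
  using that scale_respects[OF assms(2), of ps qs] class_eq_iff[OF p] by (auto simp: tensor_class_def)
 moreover have "ps : cls ps" using assms class_self by auto
 ultimately have "(\<Union>qs\<in>cls ps. cls (?f qs)) = cls (?f ps)" by blast
 then show ?thesis by (simp add: tensor_def)
qed

lemma pure_closed [simp]: "v : carrier V ==> w : carrier W ==> pure v w : carrier T"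
 unfolding pure_tensor_def by (rule class_closed) auto

lemma class_Cons: "v : carrier V ==> w : carrier W ==> ps : pairs ==> cls ((v, w) # ps) = pure v w \<oplus>\<^sub>T cls ps"
 unfolding pure_tensor_def by (subst tensor_add) auto

lemma tensor_induct [consumes 1, case_names zero add]:
 assumes t: "t : carrier T" and z: "Q \<zero>\<^sub>T"
  and step: "\<And>v w t. [|v : carrier V; w : carrier W; t : carrier T; Q t|] ==> Q (pure v w \<oplus>\<^sub>T t)"
 shows "Q t"
proof -
 obtain ps where "ps : pairs" "t = cls ps" using t by (rule tensor_cases)
 moreover have "ps : pairs ==> Q (cls ps)" for ps
 proof (induction ps)
  case Nil
  then show ?case using z by (simp add: tensor_zero)
 next
  case (Cons p ps)
  then show ?case using step[of "fst p" "snd p" "cls ps"] class_Cons[of "fst p" "snd p" ps] class_closed by auto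
 qed
 ultimately show ?thesis by blast
qed

lemma pure_add_left: "v : carrier V ==> v' : carrier V ==> w : carrier W ==>
  pure (v \<oplus>\<^sub>V v') w = pure v w \<oplus>\<^sub>T pure v' w"
 unfolding pure_tensor_def by (subst tensor_add) (auto simp: class_eq_iff intro: tensor_eq.add_left)

lemma pure_add_right: "v : carrier V ==> w : carrier W ==> w' : carrier W ==>
  pure v (w \<oplus>\<^sub>W w') = pure v w \<oplus>\<^sub>T pure v w'"
 unfolding pure_tensor_def by (subst tensor_add) (auto simp: class_eq_iff intro: tensor_eq.add_right)

lemma pure_smult_left: "c : carrier k ==> v : carrier V ==> w : carrier W ==>
  pure (c \<odot>\<^sub>V v) w = c \<odot>\<^sub>T pure v w"
 unfolding pure_tensor_def by (subst tensor_smult) auto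

lemma pure_smult_right: "c : carrier k ==> v : carrier V ==> w : carrier W ==>
  pure v (c \<odot>\<^sub>W w) = c \<odot>\<^sub>T pure v w"
 unfolding pure_smult_left[symmetric] unfolding pure_tensor_def
 by (auto simp: class_eq_iff intro: tensor_eq.scale tensor_eq.sym)

lemma pure_zero_left: "w : carrier W ==> pure \<zero>\<^sub>V w = \<zero>\<^sub>T"
 unfolding pure_tensor_def tensor_zero by (auto simp: class_eq_iff intro: tensor_eq.zero)

lemma tensor_abelian_group: "abelian_group T"
proof (rule abelian_groupI)
 fix x y assume "x : carrier T" "y : carrier T"
 then obtain ps qs where p: "ps : pairs" "x = cls ps" "qs : pairs" "y = cls qs" by (metis tensor_cases)
 then show "x \<oplus>\<^sub>T y : carrier T" by (simp add: tensor_add class_closed)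
 show "x \<oplus>\<^sub>T y = y \<oplus>\<^sub>T x"
  using p tensor_eq.commute[OF p(1) p(3), of k] by (simp add: tensor_add class_eq_iff)
next
 fix x y z assume "x : carrier T" "y : carrier T" "z : carrier T"
 then obtain ps qs rs where "ps : pairs" "x = cls ps" "qs : pairs" "y = cls qs" "rs : pairs" "z = cls rs"
  by (metis tensor_cases)
 then show "x \<oplus>\<^sub>T y \<oplus>\<^sub>T z = x \<oplus>\<^sub>T (y \<oplus>\<^sub>T z)" by (simp add: tensor_add)
next
 show "\<zero>\<^sub>T : carrier T" by (simp add: tensor_zero class_closed)
 fix x assume x: "x : carrier T"
 then obtain ps where p: "ps : pairs" "x = cls ps" by (rule tensor_cases)
 then show "\<zero>\<^sub>T \<oplus>\<^sub>T x = x" unfolding tensor_zero p(2) by (subst tensor_add) auto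
 let ?f = "\<lambda>ps. [(\<ominus>\<^sub>V v, w). (v, w) \<leftarrow> ps]"
 have "?f ps : pairs" using p(1) by (induction ps) auto
 moreover have "ps : pairs ==> tensor_eq k V W (?f ps @ ps) []" for ps
 proof (induction ps)
  case Nil
  show ?case by (simp add: tensor_eq.refl)
 next
  case (Cons p ps)
  obtain v w where [simp]: "p = (v, w)" by (cases p)
  from Cons have vw: "v : carrier V" "w : carrier W" "ps : pairs" by auto
  have fp: "?f ps : pairs" using vw(3) by (induction ps) auto
  have one: "tensor_eq k V W [(\<ominus>\<^sub>V v, w), (v, w)] []"
   using tensor_eq.add_left[of "\<ominus>\<^sub>V v" V v w W k] tensor_eq.zero[of w W k V] vw
   by (metis V.M.a_inv_closed V.M.l_neg tensor_eq.sym tensor_eq.trans)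
  \<comment> \<open>The first entry is moved next to its negative; the pair cancels, and the
    induction hypothesis disposes of the rest.\<close>
  have "tensor_eq k V W ((\<ominus>\<^sub>V v, w) # ?f ps @ [(v, w)] @ ps) ([(\<ominus>\<^sub>V v, w)] @ ([(v, w)] @ ?f ps) @ ps)"
  proof -
   have "tensor_eq k V W ([(\<ominus>\<^sub>V v, w)] @ (?f ps @ [(v, w)]) @ ps) ([(\<ominus>\<^sub>V v, w)] @ ([(v, w)] @ ?f ps) @ ps)"
    by (intro tensor_eq.append tensor_eq.commute tensor_eq.refl) (use vw fp in auto)
   then show ?thesis by simp
  qed
  also have "tensor_eq k V W ([(\<ominus>\<^sub>V v, w), (v, w)] @ (?f ps @ ps)) ([] @ [])"
   by (rule tensor_eq.append[OF one Cons.IH[OF vw(3)]])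
  then have "tensor_eq k V W ([(\<ominus>\<^sub>V v, w)] @ ([(v, w)] @ ?f ps) @ ps) []" by simp
  finally (tensor_eq.trans) show ?case by simp
 qed
 ultimately show "\<exists>y\<in>carrier T. y \<oplus>\<^sub>T x = \<zero>\<^sub>T"
  using p by (intro bexI[of _ "cls (?f ps)"]) (auto simp: tensor_add tensor_zero class_eq_iff class_closed)
qed

sublocale T: abelian_group T by (rule tensor_abelian_group)

lemma tensor_module: "module k T"
proof (rule moduleI)
 have sc: "[(c \<odot>\<^sub>V v, w). (v, w) \<leftarrow> ps] : pairs" if "c : carrier k" "ps : pairs" for c ps
  using that by (induction ps) auto
 show "cring k" by (rule V.R.cring_axioms)
 show "abelian_group T" by (rule tensor_abelian_group)
 show cl: "c \<odot>\<^sub>T x : carrier T" if c: "c : carrier k" and x: "x : carrier T" for c x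
 proof -
  obtain ps where p: "ps : pairs" "x = cls ps" using x by (rule tensor_cases)
  show ?thesis unfolding p(2) tensor_smult[OF p(1) c] by (rule class_closed[OF sc[OF c p(1)]])
 qed
 show distr: "c \<odot>\<^sub>T (x \<oplus>\<^sub>T y) = c \<odot>\<^sub>T x \<oplus>\<^sub>T c \<odot>\<^sub>T y"
  if c: "c : carrier k" and x: "x : carrier T" and y: "y : carrier T" for c x y
 proof -
  obtain ps where p: "ps : pairs" "x = cls ps" using x by (rule tensor_cases)
  obtain qs where q: "qs : pairs" "y = cls qs" using y by (rule tensor_cases)
  have pq: "ps @ qs : pairs" using p(1) q(1) by simp
  show ?thesis unfolding p(2) q(2) tensor_add[OF p(1) q(1)] tensor_smult[OF p(1) c]
    tensor_smult[OF q(1) c] tensor_smult[OF pq c] tensor_add[OF sc[OF c p(1)] sc[OF c q(1)]]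
   by simp
 qed
 have z: "c \<odot>\<^sub>T \<zero>\<^sub>T = \<zero>\<^sub>T" if "c : carrier k" for c
  using that by (simp add: tensor_zero tensor_smult)
 have p: "c \<odot>\<^sub>T pure v w = pure (c \<odot>\<^sub>V v) w" if "c : carrier k" "v : carrier V" "w : carrier W" for c v w
  using that by (simp add: pure_smult_left)
 show "(a \<oplus>\<^sub>k b) \<odot>\<^sub>T x = a \<odot>\<^sub>T x \<oplus>\<^sub>T b \<odot>\<^sub>T x"
  if ab: "a : carrier k" "b : carrier k" and "x : carrier T" for a b x
  using that(3)
 proof (induction rule: tensor_induct)
  case (add v w t)
  then show ?case using ab
   by (simp add: distr p V.smult_l_distr pure_add_left T.a_ac cl)
 qed (use ab z in auto)
 show "(a \<otimes>\<^sub>k b) \<odot>\<^sub>T x = a \<odot>\<^sub>T (b \<odot>\<^sub>T x)"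
  if ab: "a : carrier k" "b : carrier k" and "x : carrier T" for a b x
  using that(3)
 proof (induction rule: tensor_induct)
  case (add v w t)
  then show ?case using ab
   by (simp add: distr p V.smult_assoc1 cl)
 qed (use ab z in auto)
 show "\<one>\<^sub>k \<odot>\<^sub>T x = x" if "x : carrier T" for x
  using that
 proof (induction rule: tensor_induct)
  case (add v w t)
  then show ?case
   by (simp add: distr p cl)
 qed (use z in auto)
qed

sublocale T: module k T by (rule tensor_module)

lemma pure_bilinear: "pure : bilinear_maps k V W T"
 by (intro bilinearI linear_mapsI)
  (auto simp: pure_add_left pure_add_right pure_smult_left pure_smult_right)

lemma list_sum_closed:
 assumes "module k N" "f : bilinear_maps k V W N" "ps : pairs"
 shows "list_sum N f ps : carrier N"
proof -
 interpret N: module k N by fact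
 show ?thesis using assms(3) by (induction ps) (auto simp: bilinear_closed[OF assms(2)])
qed

lemma list_sum_append:
 assumes "module k N" "f : bilinear_maps k V W N" "ps : pairs" "qs : pairs"
 shows "list_sum N f (ps @ qs) = list_sum N f ps \<oplus>\<^sub>N list_sum N f qs"
proof -
 interpret N: module k N by fact
 show ?thesis using assms(3)
 proof (induction ps)
  case Nil
  then show ?case using list_sum_closed[OF assms(1,2,4)] by simp
 next
  case (Cons p ps)
  then show ?case
   using list_sum_closed[OF assms(1,2,4)] list_sum_closed[OF assms(1,2), of ps]
    bilinear_closed[OF assms(2), of "fst p" "snd p"] by (auto simp: N.M.a_assoc)
 qed
qed

lemma list_sum_respects:
 assumes N: "module k N" and f: "f : bilinear_maps k V W N" and e: "tensor_eq k V W ps qs"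
 shows "list_sum N f ps = list_sum N f qs"
proof -
 interpret N: module k N by fact
 note l = linear_add[OF bilinearD(1)[OF f]] linear_add[OF bilinearD(2)[OF f]]
  linear_smult[OF bilinearD(1)[OF f]] linear_smult[OF bilinearD(2)[OF f]] bilinear_closed[OF f]
 show ?thesis using e
 proof (induction rule: tensor_eq.induct)
  case (append ps ps' qs qs')
  then show ?case using tensor_eq_pairs list_sum_append[OF N f] by metis
 next
  case (commute ps qs)
  then show ?case using list_sum_append[OF N f] list_sum_closed[OF N f] N.M.a_comm by simp
 next
  case (zero w)
  have "f \<zero>\<^sub>V w = \<zero>\<^sub>N"
   using additive_hom.map_zero[OF linear_hom[OF module_left_module[OF V.module_axioms] module_left_module[OF N] bilinearD(1)[OF f zero]]] .
  then show ?case by simp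
 next
  case (add_left v v' w)
  then show ?case using l by (simp add: N.M.a_assoc)
 next
  case (add_right v w w')
  then show ?case using l by (simp add: N.M.a_assoc)
 next
  case (scale c v w)
  then show ?case using l by simp
 qed auto
qed

text \<open>Sums of a bilinear map respect the generating relations, so the choice in
  \<open>tensor_lift\<close> can be replaced by any representative.\<close>

lemma lift_class:
 assumes N: "module k N" and f: "f : bilinear_maps k V W N" and "ps : pairs"
 shows "tensor_lift N f (cls ps) = list_sum N f ps"
proof -
 have "(SOME qs. qs : cls ps) : cls ps" using class_self[OF assms(3)] by (rule someI)
 then have "tensor_eq k V W ps (SOME qs. qs : cls ps)" by (simp add: tensor_class_def)
 from list_sum_respects[OF N f this] show ?thesis by (simp add: tensor_lift_def list_sum_def)
qed

lemma lift_zero: "module k N ==> f : bilinear_maps k V W N ==> tensor_lift N f \<zero>\<^sub>T = \<zero>\<^sub>N"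
 by (simp add: tensor_zero lift_class)

lemma lift_pure:
 assumes "module k N" "f : bilinear_maps k V W N" "v : carrier V" "w : carrier W"
 shows "tensor_lift N f (pure v w) = f v w"
proof -
 interpret N: module k N by fact
 show ?thesis using assms bilinear_closed[OF assms(2-4)] unfolding pure_tensor_def by (subst lift_class) auto
qed

lemma lift_closed: "module k N ==> f : bilinear_maps k V W N ==> t : carrier T ==> tensor_lift N f t : carrier N"
 by (elim tensor_cases) (simp add: lift_class list_sum_closed)

lemma lift_add:
 assumes "module k N" "f : bilinear_maps k V W N" "s : carrier T" "t : carrier T"
 shows "tensor_lift N f (s \<oplus>\<^sub>T t) = tensor_lift N f s \<oplus>\<^sub>N tensor_lift N f t"
proof -
 obtain ps qs where "ps : pairs" "s = cls ps" "qs : pairs" "t = cls qs" using assms by (metis tensor_cases)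
 then show ?thesis using assms by (simp add: tensor_add lift_class list_sum_append)
qed

lemma lift_linear:
 assumes N: "module k N" and f: "f : bilinear_maps k V W N"
 shows "tensor_lift N f : linear_maps k T N"
proof (rule linear_mapsI)
 interpret N: module k N by fact
 show "\<And>x. x : carrier T ==> tensor_lift N f x : carrier N" by (rule lift_closed[OF N f])
 show "\<And>x y. x : carrier T ==> y : carrier T ==> tensor_lift N f (x \<oplus>\<^sub>T y) = tensor_lift N f x \<oplus>\<^sub>N tensor_lift N f y"
  by (rule lift_add[OF N f])
 fix c t assume c: "c : carrier k" and "t : carrier T"
 from this(2) show "tensor_lift N f (c \<odot>\<^sub>T t) = c \<odot>\<^sub>N tensor_lift N f t"
 proof (induction rule: tensor_induct)
  case zero
  then show ?case using c by (simp add: lift_zero[OF N f])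
 next
  case (add v w t)
  then show ?case using c
   by (simp add: T.smult_r_distr lift_add[OF N f] lift_closed[OF N f] N.smult_r_distr pure_smult_left[symmetric]
     lift_pure[OF N f] bilinear_closed[OF f] linear_smult[OF bilinearD(1)[OF f]])
 qed
qed

lemma tensor_linear_eq:
 assumes N: "module k N" and g: "g : linear_maps k T N" and h: "h : linear_maps k T N"
  and eq: "\<And>v w. v : carrier V ==> w : carrier W ==> g (pure v w) = h (pure v w)"
  and t: "t : carrier T"
 shows "g t = h t"
proof -
 interpret N: module k N by fact
 have z: "f \<zero>\<^sub>T = \<zero>\<^sub>N" if "f : linear_maps k T N" for f
  using additive_hom.map_zero[OF linear_hom[OF module_left_module[OF tensor_module] module_left_module[OF N] that]] .
 show ?thesis using t
  by (induction rule: tensor_induct) (auto simp: z[OF g] z[OF h] linear_add[OF g] linear_add[OF h] eq)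
qed

lemma linear_lift:
 assumes N: "module k N" and L: "module k L" and f: "f : bilinear_maps k V W N" and g: "g : linear_maps k N L"
  and t: "t : carrier T"
 shows "g (tensor_lift N f t) = tensor_lift L (\<lambda>v w. g (f v w)) t"
proof -
 have gf: "(\<lambda>v w. g (f v w)) : bilinear_maps k V W L"
  by (intro bilinearI linear_comp[OF g] bilinearD[OF f])
 show ?thesis
  by (rule tensor_linear_eq[OF L linear_comp[OF g lift_linear[OF N f]] lift_linear[OF L gf] _ t])
   (simp add: lift_pure[OF N f] lift_pure[OF L gf])
qed

text \<open>Nested Sweedler sums are treated one variable at a time; this supplies linearity in the
  variables bound outside the inner sum.\<close>

lemma lift_parametric_linear:
 assumes U: "module k U" and N: "module k N"
  and f: "\<And>u. u : carrier U ==> f u : bilinear_maps k V W N"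
  and lin: "\<And>v w. v : carrier V ==> w : carrier W ==> (\<lambda>u. f u v w) : linear_maps k U N"
  and t: "t : carrier T"
 shows "(\<lambda>u. tensor_lift N (f u) t) : linear_maps k U N"
 using t
proof (induction rule: tensor_induct)
 interpret N: module k N by fact
 interpret U: module k U by fact
 case zero
 show ?case
  by (rule linear_mapsI) (simp_all add: lift_zero[OF N f])
next
 interpret N: module k N by fact
 interpret U: module k U by fact
 case (add v w t)
 have e: "tensor_lift N (f u) (pure v w \<oplus>\<^sub>T t) = f u v w \<oplus>\<^sub>N tensor_lift N (f u) t" if "u : carrier U" for u
  using add that by (simp add: lift_add[OF N f] lift_pure[OF N f])
 note l = lin[OF add(1,2)] add.IH
 show ?case
  by (rule linear_mapsI)
   (use linear_closed[OF l(1)] linear_closed[OF l(2)] in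
    \<open>simp_all add: e linear_add[OF l(1)] linear_add[OF l(2)] linear_smult[OF l(1)] linear_smult[OF l(2)]
     N.smult_r_distr N.M.a_ac\<close>)
qed

end

subsection \<open>Tensor products of algebras\<close>

lemma unital_algebraD:
 assumes "unital_algebra k A"
 shows "module k A" "ring A"
  "\<And>c x y. c : carrier k ==> x : carrier A ==> y : carrier A ==> (c \<odot>\<^sub>A x) \<otimes>\<^sub>A y = c \<odot>\<^sub>A (x \<otimes>\<^sub>A y)"
  "\<And>c x y. c : carrier k ==> x : carrier A ==> y : carrier A ==> x \<otimes>\<^sub>A (c \<odot>\<^sub>A y) = c \<odot>\<^sub>A (x \<otimes>\<^sub>A y)"
 using assms by (auto simp: unital_algebra_def)

lemma mult_left_linear:
 assumes "unital_algebra k A" "a : carrier A"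
 shows "(\<lambda>x. a \<otimes>\<^sub>A x) : linear_maps k A A"
proof -
 interpret ring A by (rule unital_algebraD(2)[OF assms(1)])
 show ?thesis by (rule linear_mapsI) (use assms in "auto simp: r_distr unital_algebraD(4)[OF assms(1)]")
qed

lemma mult_right_linear:
 assumes "unital_algebra k A" "a : carrier A"
 shows "(\<lambda>x. x \<otimes>\<^sub>A a) : linear_maps k A A"
proof -
 interpret ring A by (rule unital_algebraD(2)[OF assms(1)])
 show ?thesis by (rule linear_mapsI) (use assms in "auto simp: l_distr unital_algebraD(3)[OF assms(1)]")
qed

locale tensor_algebra =
 fixes k :: "'k ring" and V :: "('k, 'v) module" and W :: "('k, 'w) module"
 assumes left_algebra: "unital_algebra k V" and right_algebra: "unital_algebra k W"
begin

sublocale VR: ring V by (rule unital_algebraD(2)[OF left_algebra])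
sublocale WR: ring W by (rule unital_algebraD(2)[OF right_algebra])
sublocale tensor_product k V W
 by (intro tensor_product.intro unital_algebraD(1) left_algebra right_algebra)

definition prod_map where "prod_map v w v' w' = pure (v \<otimes>\<^sub>V v') (w \<otimes>\<^sub>W w')"

lemma prod_map_bilinear:
 assumes "v : carrier V" "w : carrier W"
 shows "prod_map v w : bilinear_maps k V W T"
 unfolding prod_map_def
 by (intro bilinearI)
  (use assms linear_comp[OF bilinearD(1)[OF pure_bilinear] mult_left_linear[OF left_algebra assms(1)]]
    linear_comp[OF bilinearD(2)[OF pure_bilinear] mult_left_linear[OF right_algebra assms(2)]] in auto)

lemma prod_map_bilinear':
 assumes t: "t : carrier T"
 shows "(\<lambda>v w. tensor_lift T (prod_map v w) t) : bilinear_maps k V W T"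
proof (rule bilinearI)
 fix w assume w: "w : carrier W"
 show "(\<lambda>v. tensor_lift T (prod_map v w) t) : linear_maps k V T"
  by (rule lift_parametric_linear[OF V.module_axioms tensor_module prod_map_bilinear[OF _ w] _ t])
   (use w linear_comp[OF bilinearD(1)[OF pure_bilinear] mult_right_linear[OF left_algebra]] in "auto simp: prod_map_def")
next
 fix v assume v: "v : carrier V"
 show "(\<lambda>w. tensor_lift T (prod_map v w) t) : linear_maps k W T"
  by (rule lift_parametric_linear[OF W.module_axioms tensor_module prod_map_bilinear[OF v] _ t])
   (use v linear_comp[OF bilinearD(2)[OF pure_bilinear] mult_right_linear[OF right_algebra]] in "auto simp: prod_map_def")
qed

lemma list_sum_prod:
 assumes ps: "ps : pairs" and qs: "qs : pairs"
 shows "cls [(v \<otimes>\<^sub>V v', w \<otimes>\<^sub>W w'). (v, w) \<leftarrow> ps, (v', w') \<leftarrow> qs] =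
  list_sum T (\<lambda>v w. list_sum T (prod_map v w) qs) ps"
proof -
 have inner: "[(v \<otimes>\<^sub>V v', w \<otimes>\<^sub>W w'). (v', w') \<leftarrow> qs] : pairs \<and>
   cls [(v \<otimes>\<^sub>V v', w \<otimes>\<^sub>W w'). (v', w') \<leftarrow> qs] = list_sum T (prod_map v w) qs"
  if "v : carrier V" "w : carrier W" for v w
  using qs
 proof (induction qs)
  case Nil
  then show ?case by (simp add: tensor_zero)
 next
  case (Cons q qs)
  then show ?case using that by (cases q) (auto simp: class_Cons prod_map_def)
 qed
 have "[(v \<otimes>\<^sub>V v', w \<otimes>\<^sub>W w'). (v, w) \<leftarrow> ps, (v', w') \<leftarrow> qs] : pairs \<and>
   cls [(v \<otimes>\<^sub>V v', w \<otimes>\<^sub>W w'). (v, w) \<leftarrow> ps, (v', w') \<leftarrow> qs] =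
    list_sum T (\<lambda>v w. list_sum T (prod_map v w) qs) ps"
  using ps
 proof (induction ps)
  case Nil
  then show ?case by (simp add: tensor_zero)
 next
  case (Cons p ps)
  obtain v w where [simp]: "p = (v, w)" by (cases p)
  have vw: "v : carrier V" "w : carrier W" "ps : pairs" using Cons by auto
  note i = inner[OF vw(1,2)] and I = Cons.IH
  from tensor_add[OF conjunct1[OF i] conjunct1[OF I]] i I show ?case by simp
 qed
 then show ?thesis by blast
qed

text \<open>The product is defined by a union over representatives. Written as a nested lift of a
  multilinear map, its ring laws can be tested on pure tensors.\<close>

lemma tensor_mult:
 assumes "s : carrier T" "t : carrier T"
 shows "s \<otimes>\<^sub>T t = tensor_lift T (\<lambda>v w. tensor_lift T (prod_map v w) t) s"
proof -
 have e: "cls [(v \<otimes>\<^sub>V v', w \<otimes>\<^sub>W w'). (v, w) \<leftarrow> ps, (v', w') \<leftarrow> qs] =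
   tensor_lift T (\<lambda>v w. tensor_lift T (prod_map v w) t) s" if "ps : s" "qs : t" for ps qs
 proof -
  obtain ps0 qs0 where 0: "s = cls ps0" "t = cls qs0" using assms by (metis tensor_cases)
  then have p: "ps : pairs" "s = cls ps" "qs : pairs" "t = cls qs" using that class_member by auto
  have "tensor_lift T (\<lambda>v w. tensor_lift T (prod_map v w) t) s = list_sum T (\<lambda>v w. tensor_lift T (prod_map v w) t) ps"
   unfolding p(2) by (rule lift_class[OF tensor_module prod_map_bilinear'[OF assms(2)] p(1)])
  also have "... = list_sum T (\<lambda>v w. list_sum T (prod_map v w) qs) ps"
   using p(1) unfolding p(4)
  proof (induction ps)
   case (Cons p ps)
   then have "fst p : carrier V" "snd p : carrier W" "ps : pairs" by auto
   with Cons.IH show ?case using lift_class[OF tensor_module prod_map_bilinear p(3)] by simp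
  qed simp
  finally show ?thesis using list_sum_prod[OF p(1,3)] by simp
 qed
 obtain ps qs where "ps : pairs" "s = cls ps" "qs : pairs" "t = cls qs" using assms by (metis tensor_cases)
 then have "ps : s" "qs : t" using class_self by auto
 then have "(\<Union>ps\<in>s. \<Union>qs\<in>t. cls [(v \<otimes>\<^sub>V v', w \<otimes>\<^sub>W w'). (v, w) \<leftarrow> ps, (v', w') \<leftarrow> qs]) =
   tensor_lift T (\<lambda>v w. tensor_lift T (prod_map v w) t) s" using e by blast
 then show ?thesis by (simp add: tensor_def)
qed

lemma tensor_mult_closed: "s : carrier T ==> t : carrier T ==> s \<otimes>\<^sub>T t : carrier T"
 by (simp add: tensor_mult lift_closed[OF tensor_module prod_map_bilinear'])

lemma tensor_mult_right_linear: "t : carrier T ==> (\<lambda>s. s \<otimes>\<^sub>T t) : linear_maps k T T"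
 using lift_linear[OF tensor_module prod_map_bilinear', of t]
 by (auto simp: linear_maps_def tensor_mult)

lemma tensor_mult_left_linear: "s : carrier T ==> (\<lambda>t. s \<otimes>\<^sub>T t) : linear_maps k T T"
proof -
 assume s: "s : carrier T"
 have "(\<lambda>t. tensor_lift T (\<lambda>v w. tensor_lift T (prod_map v w) t) s) : linear_maps k T T"
  by (rule lift_parametric_linear[OF tensor_module tensor_module prod_map_bilinear' lift_linear[OF tensor_module prod_map_bilinear] s])
 then show ?thesis using s by (auto simp: linear_maps_def tensor_mult)
qed

lemma pure_mult:
 "[|v : carrier V; w : carrier W; v' : carrier V; w' : carrier W|] ==>
  pure v w \<otimes>\<^sub>T pure v' w' = pure (v \<otimes>\<^sub>V v') (w \<otimes>\<^sub>W w')"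
 by (simp add: tensor_mult lift_pure[OF tensor_module prod_map_bilinear'] lift_pure[OF tensor_module prod_map_bilinear])
  (simp add: prod_map_def)

lemma tensor_ring: "ring T"
proof (rule ringI)
 note L = tensor_mult_left_linear and R = tensor_mult_right_linear
 show "abelian_group T" by (rule tensor_abelian_group)
 show "Group.monoid T"
 proof (rule monoidI)
  show "\<one>\<^sub>T : carrier T" by (simp add: tensor_one)
  show "x \<otimes>\<^sub>T y : carrier T" if "x : carrier T" "y : carrier T" for x y using that by (rule tensor_mult_closed)
  show "\<one>\<^sub>T \<otimes>\<^sub>T x = x" if x: "x : carrier T" for x
   by (rule tensor_linear_eq[OF tensor_module L linear_id _ x]) (auto simp: tensor_one pure_mult)
  show "x \<otimes>\<^sub>T \<one>\<^sub>T = x" if x: "x : carrier T" for x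
   by (rule tensor_linear_eq[OF tensor_module R linear_id _ x]) (auto simp: tensor_one pure_mult)
  show "x \<otimes>\<^sub>T y \<otimes>\<^sub>T z = x \<otimes>\<^sub>T (y \<otimes>\<^sub>T z)" if xyz: "x : carrier T" "y : carrier T" "z : carrier T" for x y z
  proof (rule tensor_linear_eq[OF tensor_module linear_comp[OF R[OF xyz(3)] R[OF xyz(2)]] R[OF tensor_mult_closed[OF xyz(2,3)]] _ xyz(1)])
   fix v w assume vw: "v : carrier V" "w : carrier W"
   show "pure v w \<otimes>\<^sub>T y \<otimes>\<^sub>T z = pure v w \<otimes>\<^sub>T (y \<otimes>\<^sub>T z)"
   proof (rule tensor_linear_eq[OF tensor_module linear_comp[OF R[OF xyz(3)] L] linear_comp[OF L R[OF xyz(3)]] _ xyz(2)])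
    show "pure v w : carrier T" "pure v w : carrier T" using vw by simp_all
    fix v' w' assume vw': "v' : carrier V" "w' : carrier W"
    show "pure v w \<otimes>\<^sub>T pure v' w' \<otimes>\<^sub>T z = pure v w \<otimes>\<^sub>T (pure v' w' \<otimes>\<^sub>T z)"
    proof (rule tensor_linear_eq[OF tensor_module L linear_comp[OF L L] _ xyz(3)])
     fix v'' w'' assume "v'' : carrier V" "w'' : carrier W"
     then show "pure v w \<otimes>\<^sub>T pure v' w' \<otimes>\<^sub>T pure v'' w'' = pure v w \<otimes>\<^sub>T (pure v' w' \<otimes>\<^sub>T pure v'' w'')"
      using vw vw' by (simp add: pure_mult VR.m_assoc WR.m_assoc)
    qed (use vw vw' in "simp_all add: tensor_mult_closed")
   qed
  qed
 qed
 show "(x \<oplus>\<^sub>T y) \<otimes>\<^sub>T z = x \<otimes>\<^sub>T z \<oplus>\<^sub>T y \<otimes>\<^sub>T z" if "x : carrier T" "y : carrier T" "z : carrier T" for x y z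
  using linear_add[OF R[OF that(3)] that(1,2)] .
 show "z \<otimes>\<^sub>T (x \<oplus>\<^sub>T y) = z \<otimes>\<^sub>T x \<oplus>\<^sub>T z \<otimes>\<^sub>T y" if "x : carrier T" "y : carrier T" "z : carrier T" for x y z
  using linear_add[OF L[OF that(3)] that(1,2)] .
qed

lemma tensor_unital_algebra: "unital_algebra k T"
 unfolding unital_algebra_def
 using tensor_module tensor_ring linear_smult[OF tensor_mult_left_linear] linear_smult[OF tensor_mult_right_linear] by auto

lemma ring_hom_from_tensor:
 assumes A: "unital_algebra k A" and g: "g : linear_maps k T A" and one: "g \<one>\<^sub>T = \<one>\<^sub>A"
  and mult: "\<And>v w v' w'. [|v : carrier V; w : carrier W; v' : carrier V; w' : carrier W|] ==>
   g (pure (v \<otimes>\<^sub>V v') (w \<otimes>\<^sub>W w')) = g (pure v w) \<otimes>\<^sub>A g (pure v' w')"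
 shows "g : ring_hom T A"
proof (rule ring_hom_memI)
 interpret A: ring A by (rule unital_algebraD(2)[OF A])
 note mA = unital_algebraD(1)[OF A]
 note L = tensor_mult_left_linear and R = tensor_mult_right_linear
 note LA = mult_left_linear[OF A] and RA = mult_right_linear[OF A]
 fix x y assume x: "x : carrier T" and y: "y : carrier T"
 show "g (x \<otimes>\<^sub>T y) = g x \<otimes>\<^sub>A g y"
 proof (rule tensor_linear_eq[OF mA linear_comp[OF g R[OF y]] linear_comp[OF RA[OF linear_closed[OF g y]] g] _ x])
  fix v w assume vw: "v : carrier V" "w : carrier W"
  then have p: "pure v w : carrier T" by simp
  show "g (pure v w \<otimes>\<^sub>T y) = g (pure v w) \<otimes>\<^sub>A g y"
   by (rule tensor_linear_eq[OF mA linear_comp[OF g L[OF p]] linear_comp[OF LA[OF linear_closed[OF g p]] g] _ y])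
    (simp add: vw pure_mult mult)
 qed
qed (use g one linear_closed linear_add in auto)

end

lemma opposite_simps [simp]:
 "carrier (opposite A) = carrier A" "add (opposite A) = add A" "zero (opposite A) = zero A"
 "one (opposite A) = one A" "smult (opposite A) = smult A" "mult (opposite A) = (\<lambda>x y. y \<otimes>\<^sub>A x)"
 by (simp_all add: opposite_def)

lemma opposite_module:
 assumes "module k A"
 shows "module k (opposite A)"
proof -
 interpret module k A by fact
 have "abelian_group (opposite A)"
  by (rule abelian_groupI) (auto simp: M.a_ac intro: M.l_neg)
 then show ?thesis
  by (intro moduleI) (auto simp: smult_l_distr smult_r_distr smult_assoc1 R.cring_axioms)
qed

lemma opposite_algebra:
 assumes "unital_algebra k A"
 shows "unital_algebra k (opposite A)"
proof -
 interpret A: ring A by (rule unital_algebraD(2)[OF assms])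
 have m: "module k (opposite A)" by (rule opposite_module[OF unital_algebraD(1)[OF assms]])
 have "Group.monoid (opposite A)" by (rule monoidI) (auto simp: A.m_assoc)
 then have "ring (opposite A)"
  using m by (intro ringI) (auto simp: module_def A.l_distr A.r_distr)
 then show ?thesis using m unital_algebraD(3,4)[OF assms] by (simp add: unital_algebra_def)
qed

lemma linear_maps_opposite [simp]:
 "linear_maps k (opposite A) N = linear_maps k A N" "linear_maps k N (opposite A') = linear_maps k N A'"
 by (simp_all add: linear_maps_def)

lemma ground_simps [simp]:
 "carrier (ground k) = carrier k" "add (ground k) = add k" "zero (ground k) = zero k"
 "one (ground k) = one k" "mult (ground k) = mult k" "smult (ground k) = mult k"
 by (simp_all add: ground_def)

lemma ground_algebra:
 assumes "cring k"
 shows "unital_algebra k (ground k)"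
proof -
 interpret cring k by fact
 have ab: "abelian_group (ground k)" by (simp add: ground_def with_action_abelian is_abelian_group)
 have m: "module k (ground k)"
  by (rule moduleI) (auto simp: ab is_cring l_distr r_distr m_assoc assms)
 have "Group.monoid (ground k)" by (rule monoidI) (auto simp: m_assoc)
 then have "ring (ground k)" using ab by (intro ringI) (auto simp: l_distr r_distr)
 then show ?thesis using m by (auto simp: unital_algebra_def m_assoc m_lcomm)
qed

section \<open>Linear algebra over the ground field: bases and local dual bases\<close>

section \<open>Vector spaces are projective\<close>

lemma (in ring) free_module_mono:
 assumes "I \<subseteq> J"
 shows "carrier (free_module R I) \<subseteq> carrier (free_module R J)"
proof
 fix f assume f: "f : carrier (free_module R I)"
 then show "f : carrier (free_module R J)"
  using assms free_closed[OF f] by (auto simp: free_carrier_iff)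
qed

text \<open>The map \<open>h\<close> evaluates formal linear combinations of vectors, so
  independence of \<open>I\<close> is injectivity of \<open>h\<close> over \<open>I\<close>. Zorn's
  lemma gives a maximal independent set, and maximality makes \<open>h\<close> onto over it.\<close>

lemma vector_space_basis:
 fixes k :: "'k ring" and V :: "('k, 'v) module"
 assumes fld: "field k" and V: "module k V"
  and h: "h : linear_maps k (free_module k (carrier V)) V"
  and hu: "\<And>v. v : carrier V ==> h (unit_vector k v) = v"
 obtains I where "I \<subseteq> carrier V"
  "\<And>f. f : carrier (free_module k I) ==> h f = \<zero>\<^sub>V ==> f = (\<lambda>i. \<zero>\<^sub>k)"
  "\<And>v. v : carrier V ==> \<exists>f\<in>carrier (free_module k I). h f = v"
proof -
 interpret k: field k by fact
 interpret V: module k V by fact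
 interpret F: left_module k "free_module k (carrier V)" by (rule k.free_left_module)
 let ?F = "\<lambda>I. carrier (free_module k I)"
 define ind where "ind I \<longleftrightarrow> I \<subseteq> carrier V \<and> (\<forall>f\<in>?F I. h f = \<zero>\<^sub>V \<longrightarrow> f = (\<lambda>i. \<zero>\<^sub>k))" for I
 interpret h: additive_hom "free_module k (carrier V)" V h
  by (rule linear_hom[OF F.left_module_axioms module_left_module[OF V] h])
 have "\<exists>I\<in>{I. ind I}. \<forall>J\<in>{I. ind I}. I \<subseteq> J \<longrightarrow> J = I"
 proof (rule subset_Zorn')
  fix C assume C: "subset.chain {I. ind I} C"
  have sub: "ind I" if "I : C" for I using C that by (auto simp: subset.chain_def)
  have "f = (\<lambda>i. \<zero>\<^sub>k)" if f: "f : ?F (\<Union>C)" "h f = \<zero>\<^sub>V" for f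
  proof (cases "C = {}")
   case True
   then show ?thesis using f by (auto simp: free_carrier_iff)
  next
   case False
   \<comment> \<open>A finitely supported vector over the union of a chain already lives over one of
     its members.\<close>
   have fin: "finite {i. f i \<noteq> \<zero>\<^sub>k}" "{i. f i \<noteq> \<zero>\<^sub>k} \<subseteq> \<Union>C" using f(1) by (auto simp: free_carrier_iff)
   obtain I where I: "I : C" "{i. f i \<noteq> \<zero>\<^sub>k} \<subseteq> I"
    using finite_subset_Union_chain[OF fin False C] by blast
   have "f i : carrier k" for i using k.free_closed[OF f(1)] .
   then have "f : ?F I" using I(2) fin(1) by (auto simp: free_carrier_iff)
   then show ?thesis using sub[OF I(1)] f(2) by (auto simp: ind_def)
  qed
  then show "\<Union>C : {I. ind I}" using sub by (auto simp: ind_def)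
 qed
 then obtain I where I: "ind I" and mx: "\<And>J. ind J ==> I \<subseteq> J ==> J = I" by blast
 have IV: "I \<subseteq> carrier V" using I by (simp add: ind_def)
 note IF = subsetD[OF k.free_module_mono[OF IV]]
 interpret FI: left_module k "free_module k I" by (rule k.free_left_module)
 have "\<exists>f\<in>?F I. h f = v" if v: "v : carrier V" for v
 proof (rule ccontr)
  assume no: "\<not> (\<exists>f\<in>?F I. h f = v)"
  have "v \<notin> I" using no hu[OF v] k.unit_vector_closed[of v I] by auto
  moreover have "ind (insert v I)"
   unfolding ind_def
  proof (intro conjI ballI impI)
   show "insert v I \<subseteq> carrier V" using v IV by simp
   fix f assume f: "f : ?F (insert v I)" and hf: "h f = \<zero>\<^sub>V"
   have fc: "f i : carrier k" for i using k.free_closed[OF f] .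
   let ?g = "f(v := \<zero>\<^sub>k)"
   have "{i. ?g i \<noteq> \<zero>\<^sub>k} \<subseteq> {i. f i \<noteq> \<zero>\<^sub>k}" by auto
   then have g: "?g : ?F I" using f by (auto simp: free_carrier_iff intro: finite_subset)
   have u: "unit_vector k v : ?F (carrier V)" using v by (rule k.unit_vector_closed)
   have fu: "f v \<odot>\<^sub>(free_module k (carrier V)) unit_vector k v : ?F (carrier V)"
    by (rule F.smult_closed[OF fc u])
   have "f = f v \<odot>\<^sub>(free_module k (carrier V)) unit_vector k v \<oplus>\<^sub>(free_module k (carrier V)) ?g"
    using fc by (auto simp: unit_vector_def)
   then have "h f = h (f v \<odot>\<^sub>(free_module k (carrier V)) unit_vector k v \<oplus>\<^sub>(free_module k (carrier V)) ?g)"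
    by (rule arg_cong)
   also have "... = f v \<odot>\<^sub>V v \<oplus>\<^sub>V h ?g"
    by (simp only: h.map_add[OF fu IF[OF g]] linear_smult[OF h fc u, of v] hu[OF v])
   finally have e: "f v \<odot>\<^sub>V v \<oplus>\<^sub>V h ?g = \<zero>\<^sub>V" using hf by simp
   have fv: "f v = \<zero>\<^sub>k"
   proof (rule ccontr)
    assume nz: "f v \<noteq> \<zero>\<^sub>k"
    then have un: "f v : Units k" using fc k.field_Units by auto
    \<comment> \<open>A nonzero coefficient of \<open>v\<close> is invertible, and solving the
      relation for \<open>v\<close> would make it a value of \<open>h\<close> over
      \<open>I\<close>.\<close>
    let ?c = "\<ominus>\<^sub>k (inv\<^bsub>k\<^esub> f v)"
    have c: "?c : carrier k" using un by simp
    note hg = h.map_closed[OF IF[OF g]]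
    have "h ?g = \<ominus>\<^sub>V (f v \<odot>\<^sub>V v)"
     using e V.M.minus_equality[of "h ?g" "f v \<odot>\<^sub>V v"] hg fc v by (simp add: V.M.a_comm)
    then have "h (?c \<odot>\<^sub>(free_module k I) ?g) = ?c \<odot>\<^sub>V (\<ominus>\<^sub>V (f v \<odot>\<^sub>V v))"
     using linear_smult[OF h c IF[OF g]] by simp
    also have "... = (inv\<^bsub>k\<^esub> f v \<otimes>\<^sub>k f v) \<odot>\<^sub>V v"
     using un fc v by (simp add: V.smult_l_minus V.smult_r_minus V.smult_assoc1[symmetric] k.l_minus)
    also have "... = v" using un v by simp
    finally show False using no FI.smult_closed[OF c g] by blast
   qed
   then have "f = ?g" by auto
   then have "f : ?F I" using g by simp
   then show "f = (\<lambda>i. \<zero>\<^sub>k)" using I hf by (simp add: ind_def)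
  qed
  ultimately show False using mx[of "insert v I"] by blast
 qed
 then show ?thesis using that[OF IV] I by (auto simp: ind_def)
qed

text \<open>Over a basis the evaluation map is bijective, and its inverse is the required section.
  Splittings of linear surjections and the finite coordinate systems below both rest on
  this.\<close>

theorem vector_space_projective:
 fixes k :: "'k ring" and V :: "('k, 'v) module"
 assumes fld: "field k" and V: "module k V"
 shows "projective_module k V"
proof -
 interpret k: field k by fact
 interpret V: module k V by fact
 interpret F: left_module k "free_module k (carrier V)" by (rule k.free_left_module)
 note VL = module_left_module[OF V]
 obtain h where h: "h : linear_maps k (free_module k (carrier V)) V"
  and hu: "\<And>v. v : carrier V ==> h (unit_vector k v) = v"
  using free_extension[OF VL, of "carrier V" "\<lambda>v. v"] by blast
 obtain I where I: "I \<subseteq> carrier V"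
  and inj: "\<And>f. f : carrier (free_module k I) ==> h f = \<zero>\<^sub>V ==> f = (\<lambda>i. \<zero>\<^sub>k)"
  and onto: "\<And>v. v : carrier V ==> \<exists>f\<in>carrier (free_module k I). h f = v"
  by (rule vector_space_basis[OF fld V h hu]) auto
 let ?FI = "free_module k I"
 interpret FI: left_module k ?FI by (rule k.free_left_module)
 note IF = subsetD[OF k.free_module_mono[OF I]]
 have hI: "h : linear_maps k ?FI V"
  by (rule linear_mapsI)
   (use linear_closed[OF h IF] linear_add[OF h IF IF] linear_smult[OF h _ IF] in simp_all)
 interpret h: additive_hom ?FI V h by (rule linear_hom[OF FI.left_module_axioms VL hI])
 have eq: "f = g" if "f : carrier ?FI" "g : carrier ?FI" "h f = h g" for f g
 proof -
  have "h (f \<ominus>\<^sub>?FI g) = \<zero>\<^sub>V" using that by (simp add: h.map_minus V.M.minus_eq_zero_iff)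
  from inj[OF FI.M.minus_closed[OF that(1,2)] this] have "f \<ominus>\<^sub>?FI g = \<zero>\<^sub>?FI" by simp
  then show ?thesis using that FI.M.minus_eq_zero_iff by blast
 qed
 define s where "s v = (SOME f. f : carrier ?FI \<and> h f = v)" for v
 have s: "s v : carrier ?FI" "h (s v) = v" if "v : carrier V" for v
 proof -
  have "\<exists>f. f : carrier ?FI \<and> h f = v" using onto[OF that] by blast
  from someI_ex[OF this] show "s v : carrier ?FI" "h (s v) = v" unfolding s_def by simp_all
 qed
 have sl: "s : linear_maps k V ?FI"
 proof (rule linear_mapsI)
  fix x y assume xy: "x : carrier V" "y : carrier V"
  show "s x : carrier ?FI" by (rule s(1)[OF xy(1)])
  show "s (x \<oplus>\<^sub>V y) = s x \<oplus>\<^sub>?FI s y"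
  proof (rule eq)
   show "s (x \<oplus>\<^sub>V y) : carrier ?FI" using xy by (intro s) simp
   show "s x \<oplus>\<^sub>?FI s y : carrier ?FI" by (rule FI.M.a_closed[OF s(1)[OF xy(1)] s(1)[OF xy(2)]])
   show "h (s (x \<oplus>\<^sub>V y)) = h (s x \<oplus>\<^sub>?FI s y)"
    unfolding h.map_add[OF s(1)[OF xy(1)] s(1)[OF xy(2)]] using xy by (simp only: s(2) V.M.a_closed)
  qed
 next
  fix c x assume cx: "c : carrier k" "x : carrier V"
  show "s (c \<odot>\<^sub>V x) = c \<odot>\<^sub>?FI s x"
  proof (rule eq)
   show "s (c \<odot>\<^sub>V x) : carrier ?FI" using cx by (intro s) simp
   show "c \<odot>\<^sub>?FI s x : carrier ?FI" by (rule FI.smult_closed[OF cx(1) s(1)[OF cx(2)]])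
   show "h (s (c \<odot>\<^sub>V x)) = h (c \<odot>\<^sub>?FI s x)"
    unfolding linear_smult[OF hI cx(1) s(1)[OF cx(2)]] using cx by (simp only: s(2) V.smult_closed)
  qed
 qed
 show ?thesis unfolding projective_module_def
  by (intro conjI VL exI[of _ I] bexI[OF _ sl] bexI[OF _ hI]) (simp add: s(2))
qed

text \<open>Only finitely many coordinates are nonzero on a finite set \<open>W\<close>; these are
  enumerated by natural numbers.\<close>

lemma local_dual_basis:
 fixes k :: "'k ring" and V :: "('k, 'v) module"
 assumes fld: "field k" and V: "module k V" and W: "finite W" "W \<subseteq> carrier V"
 shows "\<exists>(n :: nat) (b :: nat => 'v) (\<beta> :: nat => 'v => 'k).
  (\<forall>i<n. b i : carrier V \<and> \<beta> i : linear_maps k V (ground k)) \<and>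
  (\<forall>v\<in>W. v = (\<Oplus>\<^sub>V i\<in>{..<n}. \<beta> i v \<odot>\<^sub>V b i))"
proof -
 interpret k: field k by fact
 interpret V: module k V by fact
 note VL = module_left_module[OF V]
 obtain I :: "'v set" and s p where s: "s : linear_maps k V (free_module k I)"
  and p: "p : linear_maps k (free_module k I) V" and ps: "\<forall>x\<in>carrier V. p (s x) = x"
  using vector_space_projective[OF fld V] unfolding projective_module_def by blast
 interpret FI: left_module k "free_module k I" by (rule k.free_left_module)
 interpret p: additive_hom "free_module k I" V p by (rule linear_hom[OF FI.left_module_axioms VL p])
 define J where "J = (\<Union>v\<in>W. {i. s v i \<noteq> \<zero>\<^sub>k})"
 have sc: "s v : carrier (free_module k I)" if "v : W" for v
  by (rule linear_closed[OF s subsetD[OF W(2) that]])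
 have J: "finite J" "J \<subseteq> I" using sc W(1) by (auto simp: J_def free_carrier_iff)
 obtain e where e: "bij_betw e {..<card J} J" using ex_bij_betw_nat_finite[OF J(1)] by (auto simp: atLeast0LessThan)
 have eJ: "e i : J" if "i < card J" for i using e that by (auto simp: bij_betw_def)
 have uJ: "unit_vector k j : carrier (free_module k I)" if "j : J" for j
  by (rule k.unit_vector_closed[OF subsetD[OF J(2) that]])
 show ?thesis
 proof (intro exI conjI allI impI ballI)
  show "p (unit_vector k (e i)) : carrier V" if "i < card J" for i by (rule p.map_closed[OF uJ[OF eJ[OF that]]])
  show "(\<lambda>v. s v (e i)) : linear_maps k V (ground k)" if "i < card J" for i
   by (rule linear_mapsI)
    (use k.free_closed[OF linear_closed[OF s]] linear_add[OF s] linear_smult[OF s] in simp_all)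
  fix v assume v: "v : W"
  have vc: "s v i : carrier k" for i using k.free_closed[OF sc[OF v]] .
  have "s v = (\<Oplus>\<^sub>(free_module k I)i\<in>J. s v i \<odot>\<^sub>(free_module k I) unit_vector k i)"
   by (rule k.free_expansion[OF sc[OF v] J(1) _ J(2)]) (use v in "auto simp: J_def")
  then have "p (s v) = p (\<Oplus>\<^sub>(free_module k I)i\<in>J. s v i \<odot>\<^sub>(free_module k I) unit_vector k i)"
   by (rule arg_cong)
  also have "... = (\<Oplus>\<^sub>V i\<in>J. p (s v i \<odot>\<^sub>(free_module k I) unit_vector k i))"
   by (rule p.map_finsum, intro Pi_I FI.smult_closed vc uJ)
  also have "... = (\<Oplus>\<^sub>V i\<in>J. s v i \<odot>\<^sub>V p (unit_vector k i))"
  proof (rule V.M.finsum_cong')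
   show "(\<lambda>i. s v i \<odot>\<^sub>V p (unit_vector k i)) : J \<rightarrow> carrier V"
    by (intro Pi_I V.smult_closed vc p.map_closed uJ)
   show "p (s v i \<odot>\<^sub>(free_module k I) unit_vector k i) = s v i \<odot>\<^sub>V p (unit_vector k i)" if "i : J" for i
    by (rule linear_smult[OF p vc uJ[OF that]])
  qed simp
  also have "... = (\<Oplus>\<^sub>V i\<in>e ` {..<card J}. s v i \<odot>\<^sub>V p (unit_vector k i))"
   using e by (simp add: bij_betw_def)
  also have "... = (\<Oplus>\<^sub>V i\<in>{..<card J}. s v (e i) \<odot>\<^sub>V p (unit_vector k (e i)))"
  proof (rule V.M.finsum_reindex)
   show "(\<lambda>i. s v i \<odot>\<^sub>V p (unit_vector k i)) : e ` {..<card J} \<rightarrow> carrier V"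
    using eJ by (intro Pi_I V.smult_closed vc p.map_closed uJ) auto
  qed (use e in "simp add: bij_betw_def")
  finally show "v = (\<Oplus>\<^sub>V i\<in>{..<card J}. s v (e i) \<odot>\<^sub>V p (unit_vector k (e i)))"
   using ps W(2) v by auto
 qed
qed

context tensor_product
begin

lemma coordinate_bilinear:
 assumes "\<beta> : linear_maps k V (ground k)"
 shows "(\<lambda>v w. \<beta> v \<odot>\<^sub>W w) : bilinear_maps k V W W"
 using linear_closed[OF assms] linear_add[OF assms] linear_smult[OF assms]
 by (intro bilinearI linear_mapsI)
  (simp_all add: W.smult_l_distr W.smult_r_distr W.smult_assoc1[symmetric] V.R.m_comm)

text \<open>The left components in chosen representatives of the tensors in \<open>S\<close> form a
  finite subset of \<open>V\<close>. A dual basis for that subset expands all these tensors, the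
  coordinates now being elements of \<open>W\<close>.\<close>

lemma local_tensor_basis:
 assumes fld: "field k" and S: "finite S" "S \<subseteq> carrier T"
 shows "\<exists>(n :: nat) (b :: nat => 'v) (\<beta> :: nat => 'v => 'k).
  (\<forall>i<n. b i : carrier V \<and> \<beta> i : linear_maps k V (ground k)) \<and>
  (\<forall>t\<in>S. t = (\<Oplus>\<^sub>T i\<in>{..<n}. pure (b i) (tensor_lift W (\<lambda>v w. \<beta> i v \<odot>\<^sub>W w) t)))"
proof -
 have "\<exists>ps. ps : pairs \<and> t = cls ps" if "t : S" for t
  using subsetD[OF S(2) that] by (rule tensor_cases) blast
 then have "\<forall>t\<in>S. \<exists>ps. ps : pairs \<and> t = cls ps" by blast
 from bchoice[OF this] obtain r where r: "\<And>t. t : S ==> r t : pairs" "\<And>t. t : S ==> t = cls (r t)" by blast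
 define X where "X = (\<Union>t\<in>S. fst ` set (r t))"
 have "finite X" "X \<subseteq> carrier V" using S(1) r(1) unfolding X_def by fastforce+
 from local_dual_basis[OF fld V.module_axioms this]
 obtain n :: nat and b \<beta> where b: "\<And>i. i < n ==> b i : carrier V"
  and \<beta>: "\<And>i. i < n ==> \<beta> i : linear_maps k V (ground k)"
  and ex: "\<And>v. v : X ==> v = (\<Oplus>\<^sub>V i\<in>{..<n}. \<beta> i v \<odot>\<^sub>V b i)" by blast
 note bil = coordinate_bilinear[OF \<beta>]
 let ?l = "\<lambda>i. tensor_lift W (\<lambda>v w. \<beta> i v \<odot>\<^sub>W w)"
 let ?e = "\<lambda>t. \<Oplus>\<^sub>T i\<in>{..<n}. pure (b i) (?l i t)"
 have lc: "?l i t : carrier W" if "i < n" "t : carrier T" for i t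
  by (rule lift_closed[OF W.module_axioms bil[OF that(1)] that(2)])
 have pl: "pure (b i) (?l i t) : carrier T" if "i < n" "t : carrier T" for i t
  by (rule pure_closed[OF b[OF that(1)] lc[OF that]])
 have "cls ps = ?e (cls ps)" if ps: "ps : pairs" "fst ` set ps \<subseteq> X" for ps
  using ps(2) ps(1)[unfolded in_lists_conv_set]
 proof (induction ps)
  case Nil
  have "?e \<zero>\<^sub>T = (\<Oplus>\<^sub>T i\<in>{..<n}. \<zero>\<^sub>T)"
  proof (rule T.finsum_cong')
   fix i assume "i : {..<n}"
   then show "pure (b i) (?l i \<zero>\<^sub>T) = \<zero>\<^sub>T"
    using lift_zero[OF W.module_axioms bil] b
     additive_hom.map_zero[OF linear_hom[OF module_left_module[OF W.module_axioms] module_left_module[OF tensor_module] bilinearD(2)[OF pure_bilinear]]]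
    by simp
  qed auto
  then have "?e \<zero>\<^sub>T = \<zero>\<^sub>T" by simp
  then show ?case by (simp add: tensor_zero)
 next
  case (Cons p ps)
  obtain v w where p: "p = (v, w)" by (cases p)
  have vw: "v : carrier V" "w : carrier W" and ps: "ps : pairs" using Cons.prems p by auto
  have pc: "pure v w : carrier T" "cls ps : carrier T" using vw class_closed[OF ps] by auto
  have v: "v = (\<Oplus>\<^sub>V i\<in>{..<n}. \<beta> i v \<odot>\<^sub>V b i)" by (rule ex) (use Cons.prems p in auto)
  have bv: "\<beta> i v : carrier k" if "i < n" for i using linear_closed[OF \<beta>[OF that] vw(1)] by simp
  have "pure v w = pure (\<Oplus>\<^sub>V i\<in>{..<n}. \<beta> i v \<odot>\<^sub>V b i) w" using v by (rule arg_cong)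
  also have "... = (\<Oplus>\<^sub>T i\<in>{..<n}. pure (\<beta> i v \<odot>\<^sub>V b i) w)"
   by (rule additive_hom.map_finsum[OF linear_hom[OF module_left_module[OF V.module_axioms] module_left_module[OF tensor_module] bilinearD(1)[OF pure_bilinear vw(2)]]])
    (use b bv in auto)
  also have "... = ?e (pure v w)"
   by (rule T.finsum_cong')
    (use b bv vw in "auto simp: lift_pure[OF W.module_axioms bil] pure_smult_left pure_smult_right")
  finally have 1: "pure v w = ?e (pure v w)" .
  have 2: "cls ps = ?e (cls ps)" by (rule Cons.IH) (use Cons.prems in auto)
  have "?e (pure v w \<oplus>\<^sub>T cls ps) = (\<Oplus>\<^sub>T i\<in>{..<n}. pure (b i) (?l i (pure v w)) \<oplus>\<^sub>T pure (b i) (?l i (cls ps)))"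
  proof (rule T.finsum_cong')
   fix i assume "i : {..<n}"
   then have i: "i < n" by simp
   show "pure (b i) (?l i (pure v w \<oplus>\<^sub>T cls ps)) = pure (b i) (?l i (pure v w)) \<oplus>\<^sub>T pure (b i) (?l i (cls ps))"
    unfolding lift_add[OF W.module_axioms bil[OF i] pc]
    by (rule pure_add_right[OF b[OF i] lc[OF i pc(1)] lc[OF i pc(2)]])
  qed (use pl pc in auto)
  also have "... = ?e (pure v w) \<oplus>\<^sub>T ?e (cls ps)"
   by (rule T.finsum_addf) (use pl pc in auto)
  also have "... = pure v w \<oplus>\<^sub>T cls ps" by (simp only: 1[symmetric] 2[symmetric])
  finally show ?case using p vw ps by (simp only: class_Cons)
 qed
 then have "t = ?e t" if "t : S" for t
 proof -
  have "fst ` set (r t) \<subseteq> X" using that by (auto simp: X_def)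
  with \<open>\<And>ps. ps : pairs ==> fst ` set ps \<subseteq> X ==> cls ps = ?e (cls ps)\<close>[OF r(1)[OF that]]
  show ?thesis using r(2)[OF that] by simp
 qed
 then show ?thesis using b \<beta> by (intro exI[of _ n] exI[of _ b] exI[of _ \<beta>]) auto
qed

end

section \<open>From projective resolutions to idempotent matrices\<close>

section \<open>Matrices of a resolution by finitely generated projectives\<close>

lemma fin_gen_projective_retract:
 assumes P: "projective_module R P" and fg: "fin_gen_module R P"
 shows "\<exists>m :: nat. \<exists>\<sigma>\<in>linear_maps R P (rows R m). \<exists>\<pi>\<in>linear_maps R (rows R m) P. \<forall>x\<in>carrier P. \<pi> (\<sigma> x) = x"
proof -
 have PL: "left_module R P" using P by (simp add: projective_module_def)
 interpret P: left_module R P by (rule PL)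
 obtain G where G: "finite G" "G \<subseteq> carrier P"
  and gen: "\<And>x. x : carrier P ==> \<exists>c\<in>G \<rightarrow> carrier R. x = (\<Oplus>\<^sub>P g\<in>G. c g \<odot>\<^sub>P g)"
  using fg unfolding fin_gen_module_def by auto
 obtain e where e: "bij_betw e {..<card G} G" using ex_bij_betw_nat_finite[OF G(1)] by (auto simp: atLeast0LessThan)
 have eG: "e i : G" if "i < card G" for i using e that by (auto simp: bij_betw_def)
 have eP: "e i : carrier P" if "i < card G" for i using eG[OF that] G(2) by blast
 let ?F = "rows R (card G)"
 have F: "left_module R ?F" by (rule P.R.free_left_module)
 define \<pi> where "\<pi> x = comb P (card G) x e" for x
 have \<pi>: "\<pi> : linear_maps R ?F P" unfolding \<pi>_def by (rule P.comb_linear[OF eP])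
 have "carrier P \<subseteq> \<pi> ` carrier ?F"
 proof
  fix x assume "x : carrier P"
  then obtain c where c: "c : G \<rightarrow> carrier R" "x = (\<Oplus>\<^sub>P g\<in>G. c g \<odot>\<^sub>P g)" using gen by blast
  define y where "y i = (if i < card G then c (e i) else \<zero>\<^sub>R)" for i
  have y: "y : carrier ?F" using c(1) eG by (auto simp: rows_carrier_iff y_def)
  have cg: "c g \<odot>\<^sub>P g : carrier P" if "g : G" for g
   using c(1) G(2) that by (auto intro: P.smult_closed)
  have "x = (\<Oplus>\<^sub>P g\<in>e ` {..<card G}. c g \<odot>\<^sub>P g)" using e c(2) by (simp add: bij_betw_def)
  also have "... = (\<Oplus>\<^sub>P i\<in>{..<card G}. c (e i) \<odot>\<^sub>P e i)"
   by (rule P.M.finsum_reindex) (use e cg in "auto simp: bij_betw_def")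
  also have "... = \<pi> y" unfolding \<pi>_def comb_def
   by (rule P.M.finsum_cong') (use cg eG in "auto simp: y_def")
  finally show "x : \<pi> ` carrier ?F" using y by blast
 qed
 then have sub: "(\<lambda>x. x) ` carrier P \<subseteq> \<pi> ` carrier ?F" by simp
 obtain \<sigma> where "\<sigma> : linear_maps R P ?F" "\<And>x. x : carrier P ==> \<pi> (\<sigma> x) = x"
  by (rule projective_lift[OF P F PL \<pi> linear_id sub]) blast
 then show ?thesis using \<pi> by blast
qed

text \<open>Maps \<open>\<sigma>\<close> and \<open>\<pi>\<close> exhibit each term as a retract of
  a space of rows. \<open>E\<close> is the matrix of \<open>\<sigma> \<pi>\<close> and
  \<open>D\<close> that of the differential between these maps; all identities reduce to
  \<open>\<pi> \<sigma> = id\<close>. A zero term gives a zero idempotent, so boundedness stays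
  visible.\<close>

theorem matrix_resolution_exists:
 fixes R :: "('r, 'x) ring_scheme" and M :: "('r, 'm) module" and P :: "nat => ('r, 'p) module"
 assumes M: "left_module R M" and res: "projective_resolution R M P d e"
  and fg: "\<And>n. fin_gen_module R (P n)"
 shows "\<exists>m E D t. matrix_resolution R M m E D t \<and>
  (\<forall>n. carrier (P n) = {\<zero>\<^sub>(P n)} \<longrightarrow> (\<forall>l<m n. \<forall>i. E n l i = \<zero>\<^sub>R))"
proof -
 interpret M: left_module R M by fact
 have proj: "projective_module R (P n)" and d: "d n : linear_maps R (P (Suc n)) (P n)"
  and e: "e : linear_maps R (P 0) M" "e ` carrier (P 0) = carrier M"
  and ex0: "d 0 ` carrier (P (Suc 0)) = {x : carrier (P 0). e x = \<zero>\<^sub>M}"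
  and ex: "d (Suc n) ` carrier (P (Suc (Suc n))) = {x : carrier (P (Suc n)). d n x = \<zero>\<^sub>(P n)}" for n
  using res by (auto simp: projective_resolution_def)
 interpret C: module_complex R P d by (rule resolution_complex[OF res])
 note PL = C.term_module
 have "\<forall>n. \<exists>m. \<exists>\<sigma>\<in>linear_maps R (P n) (rows R m). \<exists>\<pi>\<in>linear_maps R (rows R m) (P n). \<forall>x\<in>carrier (P n). \<pi> (\<sigma> x) = x"
  using fin_gen_projective_retract[OF proj fg] by blast
 then have "\<exists>m. \<forall>n. \<exists>\<sigma>\<in>linear_maps R (P n) (rows R (m n)). \<exists>\<pi>\<in>linear_maps R (rows R (m n)) (P n). \<forall>x\<in>carrier (P n). \<pi> (\<sigma> x) = x"
  by (rule choice)
 then obtain m where "\<forall>n. \<exists>\<sigma>. \<sigma>\<in>linear_maps R (P n) (rows R (m n)) \<and> (\<exists>\<pi>\<in>linear_maps R (rows R (m n)) (P n). \<forall>x\<in>carrier (P n). \<pi> (\<sigma> x) = x)"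
  unfolding Bex_def by blast
 from choice[OF this] obtain \<sigma> where \<sigma>: "\<And>n. \<sigma> n : linear_maps R (P n) (rows R (m n))"
  and "\<forall>n. \<exists>\<pi>. \<pi>\<in>linear_maps R (rows R (m n)) (P n) \<and> (\<forall>x\<in>carrier (P n). \<pi> (\<sigma> n x) = x)"
  unfolding Bex_def by blast
 from choice[OF this(2)] obtain \<pi> where \<pi>: "\<And>n. \<pi> n : linear_maps R (rows R (m n)) (P n)"
  and ps: "\<And>n x. x : carrier (P n) ==> \<pi> n (\<sigma> n x) = x" by blast
 note F = M.R.free_left_module
 define E where "E n l = \<sigma> n (\<pi> n (unit_vector R l))" for n and l :: nat
 define D where "D n l = \<sigma> n (d n (\<pi> (Suc n) (unit_vector R l)))" for n and l :: nat
 define t where "t l = e (\<pi> 0 (unit_vector R l))" for l :: nat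
 have u: "unit_vector R l : vecs R q" if "l < q" for l q
  using that by (intro M.R.unit_vector_closed) auto
 have Elin: "(\<lambda>x. \<sigma> n (\<pi> n x)) : linear_maps R (rows R (m n)) (rows R (m n))" for n
  by (rule linear_comp[OF \<sigma> \<pi>])
 have Dlin: "(\<lambda>x. \<sigma> n (d n (\<pi> (Suc n) x))) : linear_maps R (rows R (m (Suc n))) (rows R (m n))" for n
  by (rule linear_comp[OF \<sigma> linear_comp[OF d \<pi>]])
 have tlin: "(\<lambda>x. e (\<pi> 0 x)) : linear_maps R (rows R (m 0)) M"
  by (rule linear_comp[OF e(1) \<pi>])
 have Ec: "comb (rows R (m n)) (m n) x (E n) = \<sigma> n (\<pi> n x)" if "x : vecs R (m n)" for n x
  unfolding E_def[abs_def] by (rule left_module.comb_expand[OF F Elin that, symmetric])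
 have Dc: "comb (rows R (m n)) (m (Suc n)) x (D n) = \<sigma> n (d n (\<pi> (Suc n) x))" if "x : vecs R (m (Suc n))" for n x
  unfolding D_def[abs_def] by (rule left_module.comb_expand[OF F Dlin that, symmetric])
 have tc: "comb M (m 0) x t = e (\<pi> 0 x)" if "x : vecs R (m 0)" for x
  unfolding t_def[abs_def] by (rule M.comb_expand[OF tlin that, symmetric])
 note \<pi>c = linear_closed[OF \<pi>] and \<sigma>c = linear_closed[OF \<sigma>] and dc = linear_closed[OF d]
 have z\<sigma>: "\<sigma> n \<zero>\<^sub>(P n) = (\<lambda>i. \<zero>\<^sub>R)" and z\<pi>: "\<pi> n (\<lambda>i. \<zero>\<^sub>R) = \<zero>\<^sub>(P n)" for n
  using additive_hom.map_zero[OF linear_hom[OF PL F \<sigma>]] additive_hom.map_zero[OF linear_hom[OF F PL \<pi>]] by simp_all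
 have ed: "e (d 0 x) = \<zero>\<^sub>M" if "x : carrier (P (Suc 0))" for x
  using ex0 that by auto
 have "matrix_resolution R M m E D t"
 proof (rule matrix_resolution.intro[OF M], rule matrix_resolution_axioms.intro)
  show "E n l : vecs R (m n)" if "l < m n" for n l
   unfolding E_def by (intro \<sigma>c \<pi>c u that)
  show "D n l : vecs R (m n)" if "l < m (Suc n)" for n l
   unfolding D_def by (intro \<sigma>c dc \<pi>c u that)
  show "t l : carrier M" if "l < m 0" for l
   unfolding t_def by (intro linear_closed[OF e(1)] \<pi>c u that)
  show "comb (rows R (m n)) (m n) (E n l) (E n) = E n l" if "l < m n" for n l
   using Ec[OF \<sigma>c[OF \<pi>c[OF u[OF that]]]] ps[OF \<pi>c[OF u[OF that]]] by (simp add: E_def)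
  show "comb (rows R (m n)) (m n) (D n l) (E n) = D n l" if "l < m (Suc n)" for n l
   using Ec[OF \<sigma>c[OF dc[OF \<pi>c[OF u[OF that]]]]] ps[OF dc[OF \<pi>c[OF u[OF that]]]] by (simp add: D_def)
  show "comb (rows R (m n)) (m (Suc n)) (E (Suc n) l) (D n) = D n l" if "l < m (Suc n)" for n l
   using Dc[OF \<sigma>c[OF \<pi>c[OF u[OF that]]]] ps[OF \<pi>c[OF u[OF that]]] by (simp add: D_def E_def)
  show "comb (rows R (m n)) (m (Suc n)) (D (Suc n) l) (D n) = (\<lambda>i. \<zero>\<^sub>R)" if "l < m (Suc (Suc n))" for n l
   using Dc[OF \<sigma>c[OF dc[OF \<pi>c[OF u[OF that]]]]] ps[OF dc[OF \<pi>c[OF u[OF that]]]] C.diff_diff[OF \<pi>c[OF u[OF that]]] z\<sigma>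
   by (simp add: D_def)
  show "comb M (m 0) (E 0 l) t = t l" if "l < m 0" for l
   using tc[OF \<sigma>c[OF \<pi>c[OF u[OF that]]]] ps[OF \<pi>c[OF u[OF that]]] by (simp add: t_def E_def)
  show "comb M (m 0) (D 0 l) t = \<zero>\<^sub>M" if "l < m (Suc 0)" for l
   using tc[OF \<sigma>c[OF dc[OF \<pi>c[OF u[OF that]]]]] ps[OF dc[OF \<pi>c[OF u[OF that]]]] ed[OF \<pi>c[OF u[OF that]]] by (simp add: D_def)
  have lift: "\<exists>y\<in>vecs R (m (Suc n)). x = comb (rows R (m n)) (m (Suc n)) y (D n)"
   if x: "x : vecs R (m n)" and xE: "comb (rows R (m n)) (m n) x (E n) = x"
    and im: "\<pi> n x : d n ` carrier (P (Suc n))" for n x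
  proof -
   obtain z where z: "z : carrier (P (Suc n))" "\<pi> n x = d n z" using im by blast
   have "x = \<sigma> n (\<pi> n x)" using Ec[OF x] xE by simp
   also have "... = comb (rows R (m n)) (m (Suc n)) (\<sigma> (Suc n) z) (D n)"
    using Dc[OF \<sigma>c[OF z(1)]] ps[OF z(1)] z(2) by simp
   finally show ?thesis using \<sigma>c[OF z(1)] by blast
  qed
  show "\<exists>y\<in>vecs R (m (Suc 0)). x = comb (rows R (m 0)) (m (Suc 0)) y (D 0)"
   if "x : vecs R (m 0)" "comb (rows R (m 0)) (m 0) x (E 0) = x" "comb M (m 0) x t = \<zero>\<^sub>M" for x
   by (rule lift[OF that(1,2)]) (use tc[OF that(1)] that(3) \<pi>c[OF that(1)] ex0 in auto)
  show "\<exists>y\<in>vecs R (m (Suc (Suc n))). x = comb (rows R (m (Suc n))) (m (Suc (Suc n))) y (D (Suc n))"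
   if x: "x : vecs R (m (Suc n))" and xE: "comb (rows R (m (Suc n))) (m (Suc n)) x (E (Suc n)) = x"
    and xD: "comb (rows R (m n)) (m (Suc n)) x (D n) = (\<lambda>i. \<zero>\<^sub>R)" for x n
  proof (rule lift[OF x xE])
   have "d n (\<pi> (Suc n) x) = \<pi> n (\<sigma> n (d n (\<pi> (Suc n) x)))" by (rule ps[OF dc[OF \<pi>c[OF x]], symmetric])
   also have "... = \<zero>\<^sub>(P n)" using Dc[OF x] xD z\<pi> by simp
   finally show "\<pi> (Suc n) x : d (Suc n) ` carrier (P (Suc (Suc n)))" using ex \<pi>c[OF x] by simp
  qed
  fix z assume "z : carrier M"
  then obtain x where x: "x : carrier (P 0)" "z = e x" using e(2) by blast
  then show "\<exists>x\<in>vecs R (m 0). comb M (m 0) x t = z"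
   using tc[OF \<sigma>c[OF x(1)]] ps[OF x(1)] \<sigma>c[OF x(1)] by (intro bexI[of _ "\<sigma> 0 x"]) simp_all
 qed
 moreover have "E n l i = \<zero>\<^sub>R" if "carrier (P n) = {\<zero>\<^sub>(P n)}" "l < m n" for n l i
  using \<pi>c[OF u[OF that(2)]] that(1) z\<sigma> by (simp add: E_def)
 ultimately show ?thesis by blast
qed


section \<open>Reducing a bimodule resolution to a resolution of the trivial module\<close>

section \<open>Augmenting the second tensor factor\<close>

text \<open>
 A resolution over \<open>A \<otimes> B\<close> of a module which is free of rank one over the second factor is contractible
 as a complex of \<open>B\<close>-modules, hence stays exact when an augmentation of \<open>B\<close> is applied.
\<close>

locale augmented_tensor = tensor_algebra k A B
 for k :: "'k ring" and A :: "('k, 'a) module" and B :: "('k, 'b) module" +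
 fixes \<epsilon> :: "'b => 'k"
 assumes fld: "field k" and aug: "\<epsilon> : algebra_homs k B (ground k)"
begin

sublocale TR: ring T by (rule tensor_ring)

lemma eps_linear: "\<epsilon> : linear_maps k B (ground k)"
 using aug by (simp add: algebra_homs_def)

lemma eps_closed: "b : carrier B ==> \<epsilon> b : carrier k"
 using linear_closed[OF eps_linear] by simp

lemma eps_mult: "b : carrier B ==> b' : carrier B ==> \<epsilon> (b \<otimes>\<^sub>B b') = \<epsilon> b \<otimes>\<^sub>k \<epsilon> b'"
 and eps_one: "\<epsilon> \<one>\<^sub>B = \<one>\<^sub>k"
 using aug by (auto simp: algebra_homs_def ring_hom_def)

text \<open>This is \<open>id \<otimes> \<epsilon>\<close>, the homomorphism along which the second
  tensor factor is reduced.\<close>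

definition \<psi> where "\<psi> = tensor_lift A (\<lambda>a b. \<epsilon> b \<odot>\<^sub>A a)"

lemma psi_bilinear: "(\<lambda>a b. \<epsilon> b \<odot>\<^sub>A a) : bilinear_maps k A B A"
 using linear_closed[OF eps_linear] linear_add[OF eps_linear] linear_smult[OF eps_linear]
 by (intro bilinearI linear_mapsI)
  (simp_all add: V.smult_l_distr V.smult_r_distr V.smult_assoc1[symmetric] V.R.m_comm)

lemma psi_linear: "\<psi> : linear_maps k T A"
 unfolding \<psi>_def by (rule lift_linear[OF V.module_axioms psi_bilinear])

lemma psi_pure: "a : carrier A ==> b : carrier B ==> \<psi> (pure a b) = \<epsilon> b \<odot>\<^sub>A a"
 unfolding \<psi>_def by (rule lift_pure[OF V.module_axioms psi_bilinear])

lemma psi_ring_hom: "\<psi> : ring_hom T A"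
proof (rule ring_hom_from_tensor[OF left_algebra psi_linear])
 show "\<psi> \<one>\<^sub>T = \<one>\<^sub>A" by (simp add: tensor_one psi_pure eps_one)
 fix a b a' b' assume *: "a : carrier A" "b : carrier B" "a' : carrier A" "b' : carrier B"
 then show "\<psi> (pure (a \<otimes>\<^sub>A a') (b \<otimes>\<^sub>B b')) = \<psi> (pure a b) \<otimes>\<^sub>A \<psi> (pure a' b')"
  using eps_closed
  by (simp add: psi_pure eps_mult unital_algebraD(3,4)[OF left_algebra] V.smult_assoc1[symmetric] V.R.m_comm)
qed

lemma psi_closed: "r : carrier T ==> \<psi> r : carrier A"
 by (rule linear_closed[OF psi_linear])

lemma psi_mult: "r : carrier T ==> s : carrier T ==> \<psi> (r \<otimes>\<^sub>T s) = \<psi> r \<otimes>\<^sub>A \<psi> s"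
 by (rule ring_hom_mult[OF psi_ring_hom])

lemma psi_add: "r : carrier T ==> s : carrier T ==> \<psi> (r \<oplus>\<^sub>T s) = \<psi> r \<oplus>\<^sub>A \<psi> s"
 by (rule linear_add[OF psi_linear])

definition j where "j b = pure \<one>\<^sub>A b"

lemma j_closed [simp]: "b : carrier B ==> j b : carrier T"
 by (simp add: j_def)

lemma j_mult: "b : carrier B ==> b' : carrier B ==> j (b \<otimes>\<^sub>B b') = j b \<otimes>\<^sub>T j b'"
 by (simp add: j_def pure_mult)

lemma j_add: "b : carrier B ==> b' : carrier B ==> j (b \<oplus>\<^sub>B b') = j b \<oplus>\<^sub>T j b'"
 by (simp add: j_def pure_add_right)

lemma j_one: "j \<one>\<^sub>B = \<one>\<^sub>T"
 by (simp add: j_def tensor_one)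

lemma j_zero: "j \<zero>\<^sub>B = \<zero>\<^sub>T"
 using additive_hom.map_zero[OF additive_homI[OF WR.is_abelian_group tensor_abelian_group]]
  additive_mapsI[of B j T] j_add by auto

lemma j_pure: "a : carrier A ==> b : carrier B ==> b' : carrier B ==> j b \<otimes>\<^sub>T pure a b' = pure a (b \<otimes>\<^sub>B b')"
 by (simp add: j_def pure_mult)

lemma psi_j: "b : carrier B ==> \<psi> (j b) = \<epsilon> b \<odot>\<^sub>A \<one>\<^sub>A"
 by (simp add: j_def psi_pure)

text \<open>The copy of the field in the centre of the tensor product. A module over the tensor
  product records no action of \<open>k\<close>, and it is recovered through these elements.\<close>

definition scal where "scal c = j (c \<odot>\<^sub>B \<one>\<^sub>B)"

lemma scal_closed [simp]: "c : carrier k ==> scal c : carrier T"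
 by (simp add: scal_def)

lemma scal_mult: "c : carrier k ==> r : carrier T ==> scal c \<otimes>\<^sub>T r = c \<odot>\<^sub>T r"
 using linear_smult[OF bilinearD(2)[OF pure_bilinear], of "\<one>\<^sub>A" c "\<one>\<^sub>B"]
  unital_algebraD(3)[OF tensor_unital_algebra, of c "\<one>\<^sub>T" r]
 by (simp add: scal_def j_def tensor_one[symmetric])

lemma scal_central: "c : carrier k ==> r : carrier T ==> r \<otimes>\<^sub>T scal c = scal c \<otimes>\<^sub>T r"
 using unital_algebraD(4)[OF tensor_unital_algebra, of c r "\<one>\<^sub>T"] scal_mult[of c "\<one>\<^sub>T"] scal_mult[of c r]
 by simp

definition kmod :: "(('a \<times> 'b) list set, 'x) module => ('k, 'x) module" where
 "kmod X = with_action X (\<lambda>c x. scal c \<odot>\<^sub>X x)"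

lemma kmod_simps [simp]:
 "carrier (kmod X) = carrier X" "add (kmod X) = add X" "zero (kmod X) = zero X"
 "smult (kmod X) = (\<lambda>c x. scal c \<odot>\<^sub>X x)"
 by (simp_all add: kmod_def)

lemma kmod_module:
 assumes "left_module T X"
 shows "module k (kmod X)"
proof -
 interpret X: left_module T X by fact
 have add: "scal (a \<oplus>\<^sub>k b) = scal a \<oplus>\<^sub>T scal b" if "a : carrier k" "b : carrier k" for a b
  using that by (simp add: scal_def W.smult_l_distr j_add)
 have mult: "scal (a \<otimes>\<^sub>k b) = scal a \<otimes>\<^sub>T scal b" if "a : carrier k" "b : carrier k" for a b
  using that unital_algebraD(3)[OF right_algebra, of a "\<one>\<^sub>B" "b \<odot>\<^sub>B \<one>\<^sub>B"]
  by (simp add: scal_def j_mult[symmetric] W.smult_assoc1)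
 have one: "scal \<one>\<^sub>k = \<one>\<^sub>T" by (simp add: scal_def j_one)
 have ab: "abelian_group (kmod X)" unfolding kmod_def by (rule with_action_abelian[OF X.M.abelian_group_axioms])
 show ?thesis
  by (rule moduleI)
   (simp_all add: ab V.R.cring_axioms X.smult_closed X.smult_l_distr X.smult_r_distr X.smult_assoc X.smult_one add mult one)
qed

text \<open>Linearity over the second factor alone. The contraction of the resolution that is
  constructed below is linear in this weaker sense.\<close>

definition second_linear ::
  "(('a \<times> 'b) list set, 'x) module => (('a \<times> 'b) list set, 'y) module => ('x => 'y) set" where
 "second_linear X Y = {f : additive_maps X Y. \<forall>b\<in>carrier B. \<forall>x\<in>carrier X. f (j b \<odot>\<^sub>X x) = j b \<odot>\<^sub>Y f x}"

lemma second_linearD: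
 assumes "f : second_linear X Y"
 shows "f : additive_maps X Y" "x : carrier X ==> f x : carrier Y"
  "b : carrier B ==> x : carrier X ==> f (j b \<odot>\<^sub>X x) = j b \<odot>\<^sub>Y f x"
 using assms by (auto simp: second_linear_def additive_closed)

lemma linear_second_linear: "f : linear_maps T X Y ==> f : second_linear X Y"
 by (simp add: second_linear_def linear_additive linear_smult)

lemma second_linear_comp: "g : second_linear Y Z ==> f : second_linear X Y ==> (\<lambda>x. g (f x)) : second_linear X Z"
 by (auto simp: second_linear_def additive_maps_def Pi_iff)

lemma second_linear_minus:
 assumes "left_module T X" "left_module T Y" "f : second_linear X Y" "g : second_linear X Y"
 shows "(\<lambda>x. f x \<ominus>\<^sub>Y g x) : second_linear X Y"
proof -
 interpret X: left_module T X by fact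
 interpret Y: left_module T Y by fact
 note f = second_linearD[OF assms(3)] and g = second_linearD[OF assms(4)]
 have "j b \<odot>\<^sub>Y (y \<ominus>\<^sub>Y y') = j b \<odot>\<^sub>Y y \<ominus>\<^sub>Y j b \<odot>\<^sub>Y y'"
  if "b : carrier B" "y : carrier Y" "y' : carrier Y" for b y y'
  by (rule additive_hom.map_minus[OF additive_homI[OF Y.M.abelian_group_axioms Y.M.abelian_group_axioms Y.smult_right_additive]])
   (use that in auto)
 then show ?thesis
  using f(2,3) g(2,3)
  by (auto simp: second_linear_def additive_maps_def additive_add[OF f(1)] additive_add[OF g(1)]
    Y.M.minus_eq Y.M.minus_add Y.M.a_ac)
qed

lemma second_linear_kmod:
 "left_module T X ==> f : second_linear X Y ==> f : linear_maps k (kmod X) (kmod Y)"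
 by (rule linear_mapsI) (auto simp: second_linearD additive_add[OF second_linearD(1)] scal_def)

text \<open>The module generated by one element \<open>y\<close> over the tensor product behaves like a free \<open>B\<close>-module.\<close>

lemma second_linear_cyclic_lift:
 assumes P: "left_module T P" and X: "left_module T X" and Y: "left_module T Y"
  and f: "f : second_linear P Y" and g: "g : second_linear X Y"
  and sub: "f ` carrier P \<subseteq> g ` carrier X" and y: "y : carrier P"
 shows "\<exists>s\<in>second_linear (with_action T (mult T)) X. \<forall>r\<in>carrier T. g (s r) = f (r \<odot>\<^sub>P y)"
proof -
 interpret P: left_module T P by (rule P)
 interpret X: left_module T X by (rule X)
 interpret Y: left_module T Y by (rule Y)
 note kX = kmod_module[OF X] and kY = kmod_module[OF Y]
 have act: "(\<lambda>r. r \<odot>\<^sub>P y) : linear_maps k T (kmod P)"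
  by (rule linear_mapsI) (use y in "simp_all add: P.smult_closed P.smult_l_distr scal_mult[symmetric] P.smult_assoc")
 have fk: "(\<lambda>r. f (r \<odot>\<^sub>P y)) : linear_maps k T (kmod Y)"
  by (rule linear_comp[OF second_linear_kmod[OF P f] act])
 have fa: "(\<lambda>a. f (pure a \<one>\<^sub>B \<odot>\<^sub>P y)) : linear_maps k A (kmod Y)"
  by (rule linear_comp[OF fk bilinearD(1)[OF pure_bilinear]]) simp
 have im: "(\<lambda>a. f (pure a \<one>\<^sub>B \<odot>\<^sub>P y)) ` carrier A \<subseteq> g ` carrier (kmod X)"
 proof
  fix z assume "z : (\<lambda>a. f (pure a \<one>\<^sub>B \<odot>\<^sub>P y)) ` carrier A"
  then obtain a where a: "a : carrier A" "z = f (pure a \<one>\<^sub>B \<odot>\<^sub>P y)" by blast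
  have "pure a \<one>\<^sub>B \<odot>\<^sub>P y : carrier P" using a y by (intro P.smult_closed) auto
  then show "z : g ` carrier (kmod X)" using sub a by auto
 qed
 \<comment> \<open>Over the field there is a \<open>k\<close>-linear lift of the map
   \<open>a \<mapsto> f ((a \<otimes> 1) y)\<close>. Extending it by the action of the second factor
   produces \<open>s\<close>.\<close>
 obtain F where F: "F : linear_maps k A (kmod X)"
  and gF: "\<And>a. a : carrier A ==> g (F a) = f (pure a \<one>\<^sub>B \<odot>\<^sub>P y)"
  using projective_lift[OF vector_space_projective[OF fld V.module_axioms] module_left_module[OF kX] module_left_module[OF kY]
    second_linear_kmod[OF X g] fa im] by blast
 have Fc: "F a : carrier X" if "a : carrier A" for a using linear_closed[OF F that] by simp
 have jk: "j (c \<odot>\<^sub>B b) = scal c \<otimes>\<^sub>T j b" if "c : carrier k" "b : carrier B" for c b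
  using that by (simp add: scal_mult j_def pure_smult_right)
 have bil: "(\<lambda>a b. j b \<odot>\<^sub>X F a) : bilinear_maps k A B (kmod X)"
 proof (rule bilinearI)
  fix b assume b: "b : carrier B"
  show "(\<lambda>a. j b \<odot>\<^sub>X F a) : linear_maps k A (kmod X)"
   by (rule linear_mapsI)
    (use b Fc linear_add[OF F] linear_smult[OF F] in
     \<open>simp_all add: X.smult_closed X.smult_r_distr X.smult_assoc[symmetric] scal_central\<close>)
 next
  fix a assume a: "a : carrier A"
  show "(\<lambda>b. j b \<odot>\<^sub>X F a) : linear_maps k B (kmod X)"
   by (rule linear_mapsI)
    (use Fc[OF a] in "simp_all add: X.smult_closed X.smult_l_distr j_add jk X.smult_assoc")
 qed
 define s where "s = tensor_lift (kmod X) (\<lambda>a b. j b \<odot>\<^sub>X F a)"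
 have sl: "s : linear_maps k T (kmod X)" unfolding s_def by (rule lift_linear[OF kX bil])
 have sp: "s (pure a b) = j b \<odot>\<^sub>X F a" if "a : carrier A" "b : carrier B" for a b
  unfolding s_def by (rule lift_pure[OF kX bil that])
 have jl: "(\<lambda>x. j b \<odot>\<^sub>X x) : linear_maps k (kmod X) (kmod X)" if "b : carrier B" for b
  by (rule linear_mapsI)
   (use that in "simp_all add: X.smult_closed X.smult_r_distr X.smult_assoc[symmetric] scal_central")
 have "s (j b \<otimes>\<^sub>T r) = j b \<odot>\<^sub>X s r" if b: "b : carrier B" and r: "r : carrier T" for b r
 proof (rule tensor_linear_eq[OF kX linear_comp[OF sl tensor_mult_left_linear] linear_comp[OF jl[OF b] sl] _ r])
  show "j b : carrier T" using b by simp
  fix a b' assume "a : carrier A" "b' : carrier B"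
  then show "s (j b \<otimes>\<^sub>T pure a b') = j b \<odot>\<^sub>X s (pure a b')"
   using b by (simp add: j_pure sp j_mult X.smult_assoc Fc)
 qed
 moreover have "s : additive_maps T X" using linear_additive[OF sl] by (simp add: additive_maps_def)
 ultimately have "s : second_linear (with_action T (mult T)) X" by (simp add: second_linear_def)
 moreover have "g (s r) = f (r \<odot>\<^sub>P y)" if r: "r : carrier T" for r
 proof (rule tensor_linear_eq[OF kY linear_comp[OF second_linear_kmod[OF X g] sl] fk _ r])
  fix a b assume ab: "a : carrier A" "b : carrier B"
  have "g (s (pure a b)) = j b \<odot>\<^sub>Y f (pure a \<one>\<^sub>B \<odot>\<^sub>P y)"
   using ab by (simp add: sp second_linearD(3)[OF g] Fc gF)
  also have "... = f (j b \<odot>\<^sub>P (pure a \<one>\<^sub>B \<odot>\<^sub>P y))"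
   using ab y by (simp add: second_linearD(3)[OF f] P.smult_closed)
  also have "j b \<odot>\<^sub>P (pure a \<one>\<^sub>B \<odot>\<^sub>P y) = pure a b \<odot>\<^sub>P y"
   using ab y by (simp add: P.smult_assoc[symmetric] j_pure)
  finally show "g (s (pure a b)) = f (pure a b \<odot>\<^sub>P y)" .
 qed
 ultimately show ?thesis by blast
qed

end

lemma (in matrix_resolution) row_expand:
 assumes x: "x : carrier (P n)"
 shows "comb (P n) (m n) x (E n) = x"
proof -
 interpret Pn: left_module R "P n" by (rule row_left_module)
 have "comb (P n) (m n) x (E n) = comb (rows R (m n)) (m n) x (E n)"
  by (rule Pn.comb_map[OF rows_left_module row_linear_restrict[OF linear_id]])
   (use E_in_row row_entry_closed[OF x] in auto)
 then show ?thesis using x by (simp add: row_module_carrier_iff)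
qed

text \<open>Over the second factor \<open>M\<close> is free of rank one on \<open>w\<close>, with
  coordinate \<sigma>. The map \<theta> reduces \<open>M\<close> along \<epsilon>: elements of its
  kernel have a coordinate in the augmentation ideal.\<close>

locale augmented_resolution = augmented_tensor k A B \<epsilon> + C: matrix_resolution "tensor k A B" M m E D t
 for k :: "'k ring" and A :: "('k, 'a) module" and B :: "('k, 'b) module" and \<epsilon> :: "'b => 'k"
  and M :: "(('a \<times> 'b) list set, 'm) module" and m E D t +
 fixes M' :: "('a, 'n) module" and \<theta> :: "'m => 'n" and \<sigma> :: "'m => 'b" and w :: 'm
 assumes M': "left_module A M'"
  and \<theta>_additive: "\<theta> : additive_maps M M'"
  and \<theta>_smult: "[|r : carrier T; x : carrier M|] ==> \<theta> (r \<odot>\<^sub>M x) = \<psi> r \<odot>\<^sub>M' \<theta> x"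
  and \<theta>_onto: "\<theta> ` carrier M = carrier M'"
  and generator: "w : carrier M"
  and \<sigma>_additive: "\<sigma> : additive_maps M B"
  and \<sigma>_smult: "[|b : carrier B; x : carrier M|] ==> \<sigma> (j b \<odot>\<^sub>M x) = b \<otimes>\<^sub>B \<sigma> x"
  and \<sigma>_generator: "x : carrier M ==> j (\<sigma> x) \<odot>\<^sub>M w = x"
  and \<theta>_zero: "[|x : carrier M; \<theta> x = \<zero>\<^sub>M'|] ==> \<epsilon> (\<sigma> x) = \<zero>\<^sub>k"
begin

sublocale matrix_base_change T M m E D t A \<psi> M' \<theta>
 by (intro matrix_base_change.intro C.matrix_resolution_axioms matrix_base_change_axioms.intro
   M' psi_ring_hom \<theta>_additive \<theta>_smult)

abbreviation "P \<equiv> row_module T m E"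
abbreviation "dP \<equiv> row_map T m D"
abbreviation "eP \<equiv> (\<lambda>x. comb M (m 0) x t)"

lemma two_elements: "\<exists>a b :: ('a \<times> 'b) list set. a \<noteq> b"
 by (rule exI[of _ "{}"], rule exI[of _ UNIV]) simp

lemma resolution: "projective_resolution T M P dP eP"
 by (rule C.row_resolution[OF two_elements])

interpretation RC: module_complex T P dP
 by (rule resolution_complex[OF resolution])

lemma res_facts:
 "dP n : linear_maps T (P (Suc n)) (P n)" "eP : linear_maps T (P 0) M"
 "eP ` carrier (P 0) = carrier M"
 "dP 0 ` carrier (P (Suc 0)) = {x : carrier (P 0). eP x = \<zero>\<^sub>M}"
 "dP (Suc n) ` carrier (P (Suc (Suc n))) = {x : carrier (P (Suc n)). dP n x = \<zero>\<^sub>(P n)}"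
 using resolution by (auto simp: projective_resolution_def)

lemma generator_lift: "\<exists>p\<in>carrier (P 0). eP p = w"
proof -
 have "w : eP ` carrier (P 0)" using generator by (simp only: res_facts(3))
 then obtain p where "p : carrier (P 0)" "w = eP p" by (rule imageE)
 then have "p : carrier (P 0) \<and> eP p = w" by (simp only: conj_absorb simp_thms)
 then show ?thesis by (simp only: Bex_def) (rule exI)
qed

text \<open>An element of the row module is the combination of the rows of \<open>E\<close> with its
  own entries. Lifting along each of these cyclic pieces and adding the results gives a lift on the
  whole module.\<close>

lemma row_second_lift:
 assumes X: "left_module T X" and Y: "left_module T Y"
  and f: "f : second_linear (P n) Y" and g: "g : second_linear X Y"
  and sub: "f ` carrier (P n) \<subseteq> g ` carrier X"
 shows "\<exists>s\<in>second_linear (P n) X. \<forall>x\<in>carrier (P n). g (s x) = f x"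
proof -
 interpret X: left_module T X by (rule X)
 interpret Y: left_module T Y by (rule Y)
 interpret Pn: left_module T "P n" by (rule C.row_left_module)
 have "\<forall>l\<in>{..<m n}. \<exists>s. s : second_linear (with_action T (mult T)) X \<and> (\<forall>r\<in>carrier T. g (s r) = f (r \<odot>\<^sub>(P n) E n l))"
  using second_linear_cyclic_lift[OF C.row_left_module X Y f g sub C.E_in_row] by blast
 from bchoice[OF this] obtain S where S: "\<And>l. l < m n ==> S l : second_linear (with_action T (mult T)) X"
  and gS: "\<And>l r. l < m n ==> r : carrier T ==> g (S l r) = f (r \<odot>\<^sub>(P n) E n l)" by auto
 have Sa: "S l : additive_maps T X" if "l < m n" for l
  using S[OF that] by (simp add: second_linear_def)
 have Sc: "S l r : carrier X" if "l < m n" "r : carrier T" for l r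
  by (rule additive_closed[OF Sa[OF that(1)] that(2)])
 define s where "s x = (\<Oplus>\<^sub>X l\<in>{..<m n}. S l (x l))" for x
 note xc = C.row_entry_closed
 have sc: "s x : carrier X" if "x : carrier (P n)" for x
  unfolding s_def by (rule X.M.finsum_closed) (use Sc xc[OF that] in auto)
 have "s : second_linear (P n) X"
  unfolding second_linear_def
 proof (intro CollectI conjI ballI additive_mapsI sc)
  fix x y assume x: "x : carrier (P n)" and y: "y : carrier (P n)"
  have "s (x \<oplus>\<^sub>(P n) y) = (\<Oplus>\<^sub>X l\<in>{..<m n}. S l (x l) \<oplus>\<^sub>X S l (y l))"
   unfolding s_def by (rule X.M.finsum_cong') (use Sc xc[OF x] xc[OF y] additive_add[OF Sa] in auto)
  also have "... = s x \<oplus>\<^sub>X s y"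
   unfolding s_def by (rule X.M.finsum_addf) (use Sc xc[OF x] xc[OF y] in auto)
  finally show "s (x \<oplus>\<^sub>(P n) y) = s x \<oplus>\<^sub>X s y" .
 next
  fix b x assume b: "b : carrier B" and x: "x : carrier (P n)"
  have "s (j b \<odot>\<^sub>(P n) x) = (\<Oplus>\<^sub>X l\<in>{..<m n}. j b \<odot>\<^sub>X S l (x l))"
   unfolding s_def
   by (rule X.M.finsum_cong') (use Sc xc[OF x] b S X.smult_closed in "auto simp: second_linear_def")
  also have "... = j b \<odot>\<^sub>X s x"
   unfolding s_def by (rule X.smult_finsum[symmetric]) (use Sc xc[OF x] b in auto)
  finally show "s (j b \<odot>\<^sub>(P n) x) = j b \<odot>\<^sub>X s x" .
 qed
 moreover have "g (s x) = f x" if x: "x : carrier (P n)" for x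
 proof -
  interpret g: additive_hom X Y g
   by (rule additive_homI[OF X.M.abelian_group_axioms Y.M.abelian_group_axioms second_linearD(1)[OF g]])
  interpret f: additive_hom "P n" Y f
   by (rule additive_homI[OF Pn.M.abelian_group_axioms Y.M.abelian_group_axioms second_linearD(1)[OF f]])
  have xE: "x l \<odot>\<^sub>(P n) E n l : carrier (P n)" if "l < m n" for l
   by (rule Pn.smult_closed[OF xc[OF x] C.E_in_row[OF that]])
  have "g (s x) = (\<Oplus>\<^sub>Y l\<in>{..<m n}. g (S l (x l)))"
   unfolding s_def by (rule g.map_finsum) (use Sc xc[OF x] in auto)
  also have "... = (\<Oplus>\<^sub>Y l\<in>{..<m n}. f (x l \<odot>\<^sub>(P n) E n l))"
  proof (rule Y.M.finsum_cong')
   show "(\<lambda>l. f (x l \<odot>\<^sub>(P n) E n l)) : {..<m n} \<rightarrow> carrier Y"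
    by (intro Pi_I f.map_closed xE) simp
  qed (use gS xc[OF x] in auto)
  also have "... = f (comb (P n) (m n) x (E n))"
   unfolding comb_def by (rule f.map_finsum[symmetric], intro Pi_I xE) simp
  finally show ?thesis by (simp only: C.row_expand[OF x])
 qed
 ultimately show ?thesis by blast
qed

text \<open>A projection onto the boundaries that is linear over \<open>B\<close>, which amounts to
  a contraction. In degree 0 it subtracts the multiple of a lift of \<open>w\<close> with the same
  augmentation. In the next degrees it is \<open>x - s (d x)\<close>, where \<open>s\<close> lifts
  the previous projection through \<open>d\<close>, so that \<open>d s d = d\<close>.\<close>

lemma retraction_exists:
 "\<exists>\<rho>\<in>second_linear (P n) (P n). (\<forall>x\<in>carrier (P n). \<rho> x : dP n ` carrier (P (Suc n))) \<and>
  (\<forall>z\<in>dP n ` carrier (P (Suc n)). \<rho> z = z)"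
proof (induction n)
 case 0
 interpret P0: left_module T "P 0" by (rule C.row_left_module)
 interpret e: additive_hom "P 0" M eP by (rule linear_hom[OF C.row_left_module C.left_module_axioms res_facts(2)])
 interpret s: additive_hom M B \<sigma>
  by (rule additive_homI[OF C.M.abelian_group_axioms WR.is_abelian_group \<sigma>_additive])
 obtain p where p: "p : carrier (P 0)" "eP p = w" using generator_lift by (elim bexE)
 have s0: "(\<lambda>x. j (\<sigma> (eP x)) \<odot>\<^sub>(P 0) p) : second_linear (P 0) (P 0)"
 proof -
  have "(\<lambda>x. j (\<sigma> x) \<odot>\<^sub>(P 0) p) : second_linear M (P 0)"
   unfolding second_linear_def
  proof (intro CollectI conjI ballI additive_mapsI)
   show "j (\<sigma> x) \<odot>\<^sub>(P 0) p : carrier (P 0)" if "x : carrier M" for x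
    by (rule P0.smult_closed[OF j_closed[OF s.map_closed[OF that]] p(1)])
   show "j (\<sigma> (x \<oplus>\<^sub>M y)) \<odot>\<^sub>(P 0) p = j (\<sigma> x) \<odot>\<^sub>(P 0) p \<oplus>\<^sub>(P 0) j (\<sigma> y) \<odot>\<^sub>(P 0) p"
    if "x : carrier M" "y : carrier M" for x y
    unfolding s.map_add[OF that] j_add[OF s.map_closed[OF that(1)] s.map_closed[OF that(2)]]
    by (rule P0.smult_l_distr[OF j_closed[OF s.map_closed[OF that(1)]] j_closed[OF s.map_closed[OF that(2)]] p(1)])
   show "j (\<sigma> (j b \<odot>\<^sub>M x)) \<odot>\<^sub>(P 0) p = j b \<odot>\<^sub>(P 0) (j (\<sigma> x) \<odot>\<^sub>(P 0) p)"
    if "b : carrier B" "x : carrier M" for b x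
    unfolding \<sigma>_smult[OF that] j_mult[OF that(1) s.map_closed[OF that(2)]]
    by (rule P0.smult_assoc[OF j_closed[OF that(1)] j_closed[OF s.map_closed[OF that(2)]] p(1)])
  qed
  from second_linear_comp[OF this linear_second_linear[OF res_facts(2)]] show ?thesis .
 qed
 define \<rho> where "\<rho> x = x \<ominus>\<^sub>(P 0) j (\<sigma> (eP x)) \<odot>\<^sub>(P 0) p" for x
 have \<rho>: "\<rho> : second_linear (P 0) (P 0)"
  unfolding \<rho>_def
  by (rule second_linear_minus[OF C.row_left_module C.row_left_module linear_second_linear[OF linear_id] s0])
 have r1: "\<rho> x : dP 0 ` carrier (P (Suc 0))" if x: "x : carrier (P 0)" for x
 proof -
  have ex: "eP x : carrier M" by (rule e.map_closed[OF x])
  have jx: "j (\<sigma> (eP x)) : carrier T" by (rule j_closed[OF s.map_closed[OF ex]])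
  have "eP (j (\<sigma> (eP x)) \<odot>\<^sub>(P 0) p) = eP x"
   using linear_smult[OF res_facts(2) jx p(1)] p(2) \<sigma>_generator[OF ex] by simp
  then have "eP (\<rho> x) = \<zero>\<^sub>M"
   unfolding \<rho>_def e.map_minus[OF x P0.smult_closed[OF jx p(1)]] using ex by (simp add: C.M.minus_eq_zero_iff)
  then show ?thesis unfolding res_facts(4) using second_linearD(2)[OF \<rho> x] by simp
 qed
 have r2: "\<rho> z = z" if "z : dP 0 ` carrier (P (Suc 0))" for z
 proof -
  have z: "z : carrier (P 0)" "eP z = \<zero>\<^sub>M" using that unfolding res_facts(4) by auto
  show ?thesis unfolding \<rho>_def z(2) s.map_zero j_zero P0.smult_zero_left[OF p(1)]
   by (rule P0.M.minus_zero_right[OF z(1)])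
 qed
 show ?case by (intro bexI[OF _ \<rho>] conjI ballI r1 r2)
next
 case (Suc n)
 then obtain \<rho> where \<rho>: "\<rho> : second_linear (P n) (P n)"
  and im: "\<And>x. x : carrier (P n) ==> \<rho> x : dP n ` carrier (P (Suc n))"
  and idem: "\<And>z. z : dP n ` carrier (P (Suc n)) ==> \<rho> z = z" by auto
 interpret Pn: left_module T "P n" by (rule C.row_left_module)
 interpret Pm: left_module T "P (Suc n)" by (rule C.row_left_module)
 interpret d: additive_hom "P (Suc n)" "P n" "dP n"
  by (rule linear_hom[OF C.row_left_module C.row_left_module res_facts(1)])
 obtain s where s: "s : second_linear (P n) (P (Suc n))" and ds: "\<And>x. x : carrier (P n) ==> dP n (s x) = \<rho> x"
  using row_second_lift[OF C.row_left_module C.row_left_module \<rho> linear_second_linear[OF res_facts(1)]] im by blast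
 interpret s: additive_hom "P n" "P (Suc n)" s
  by (rule additive_homI[OF Pn.M.abelian_group_axioms Pm.M.abelian_group_axioms second_linearD(1)[OF s]])
 define \<rho>' where "\<rho>' x = x \<ominus>\<^sub>(P (Suc n)) s (dP n x)" for x
 have \<rho>': "\<rho>' : second_linear (P (Suc n)) (P (Suc n))"
  unfolding \<rho>'_def
  by (rule second_linear_minus[OF C.row_left_module C.row_left_module linear_second_linear[OF linear_id]
     second_linear_comp[OF s linear_second_linear[OF res_facts(1)]]])
 have r1: "\<rho>' x : dP (Suc n) ` carrier (P (Suc (Suc n)))" if x: "x : carrier (P (Suc n))" for x
 proof -
  note dx = d.map_closed[OF x]
  have "dP n (\<rho>' x) = dP n x \<ominus>\<^sub>(P n) dP n x"
   unfolding \<rho>'_def d.map_minus[OF x s.map_closed[OF dx]] ds[OF dx]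
   by (subst idem) (use x in blast)+
  then have "dP n (\<rho>' x) = \<zero>\<^sub>(P n)" using dx by (simp only: Pn.M.minus_eq_zero_iff)
  then show ?thesis unfolding res_facts(5) using second_linearD(2)[OF \<rho>' x] by blast
 qed
 have r2: "\<rho>' z = z" if "z : dP (Suc n) ` carrier (P (Suc (Suc n)))" for z
 proof -
  have z: "z : carrier (P (Suc n))" "dP n z = \<zero>\<^sub>(P n)" using that unfolding res_facts(5) by auto
  show ?thesis unfolding \<rho>'_def z(2) s.map_zero by (rule Pm.M.minus_zero_right[OF z(1)])
 qed
 show ?case by (intro bexI[OF _ \<rho>'] conjI ballI r1 r2)
qed

text \<open>A \<open>B\<close>-linear map preserves the vectors that \<open>\<psi>\<close> annihilates, because they are generated by
 the multiples of \<open>1 \<otimes> b\<close> with \<open>\<epsilon> b = 0\<close>.\<close>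

lemma second_linear_psi:
 assumes s: "s : second_linear (P n) (P n')" and y: "y : carrier (P n)" and r: "r : carrier T"
 shows "\<psi> (s (r \<odot>\<^sub>(P n) y) l) = \<psi> (s (pure (\<psi> r) \<one>\<^sub>B \<odot>\<^sub>(P n) y) l)"
 using r
proof (induction rule: tensor_induct)
 interpret Pn: left_module T "P n" by (rule C.row_left_module)
 case zero
 have "\<psi> \<zero>\<^sub>T = \<zero>\<^sub>A" by (rule phi_zero)
 then show ?case by (simp only: pure_zero_left[OF WR.one_closed])
next
 interpret Pn: left_module T "P n" by (rule C.row_left_module)
 interpret Pm: left_module T "P n'" by (rule C.row_left_module)
 note sc = second_linearD(2)[OF s] and sadd = additive_add[OF second_linearD(1)[OF s]]
 have split: "\<psi> (s ((r1 \<oplus>\<^sub>T r2) \<odot>\<^sub>(P n) y) l) = \<psi> (s (r1 \<odot>\<^sub>(P n) y) l) \<oplus>\<^sub>A \<psi> (s (r2 \<odot>\<^sub>(P n) y) l)"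
  if "r1 : carrier T" "r2 : carrier T" for r1 r2
 proof -
  note c = Pn.smult_closed[OF that(1) y] Pn.smult_closed[OF that(2) y]
  have "s ((r1 \<oplus>\<^sub>T r2) \<odot>\<^sub>(P n) y) l = s (r1 \<odot>\<^sub>(P n) y) l \<oplus>\<^sub>T s (r2 \<odot>\<^sub>(P n) y) l"
   unfolding Pn.smult_l_distr[OF that y] sadd[OF c] by simp
  then show ?thesis using psi_add[OF C.row_entry_closed[OF sc[OF c(1)]] C.row_entry_closed[OF sc[OF c(2)]]] by simp
 qed
 have jl: "\<psi> (s (j b \<odot>\<^sub>(P n) x) l) = \<epsilon> b \<odot>\<^sub>A \<psi> (s x l)" if "b : carrier B" "x : carrier (P n)" for b x
 proof -
  have "s (j b \<odot>\<^sub>(P n) x) l = j b \<otimes>\<^sub>T s x l"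
   unfolding second_linearD(3)[OF s that] by simp
  then show ?thesis
   using psi_mult[OF j_closed[OF that(1)] C.row_entry_closed[OF sc[OF that(2)]]] that(1)
    eps_closed[OF that(1)] psi_closed[OF C.row_entry_closed[OF sc[OF that(2)]]]
    unital_algebraD(3)[OF left_algebra]
   by (simp add: psi_j)
 qed
 case (add a b t)
 have pa: "pure a \<one>\<^sub>B \<odot>\<^sub>(P n) y : carrier (P n)" by (rule Pn.smult_closed) (use add y in auto)
 have e: "\<epsilon> b : carrier k" by (rule eps_closed[OF add(2)])
 have "pure a b \<odot>\<^sub>(P n) y = j b \<odot>\<^sub>(P n) (pure a \<one>\<^sub>B \<odot>\<^sub>(P n) y)"
  using add y by (subst Pn.smult_assoc[symmetric]) (auto simp: j_pure simp del: row_module_simps)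
 then have 1: "\<psi> (s (pure a b \<odot>\<^sub>(P n) y) l) = \<epsilon> b \<odot>\<^sub>A \<psi> (s (pure a \<one>\<^sub>B \<odot>\<^sub>(P n) y) l)"
  by (simp only: jl[OF add(2) pa])
 have ec: "\<epsilon> b \<odot>\<^sub>B \<one>\<^sub>B : carrier B" using e by simp
 have "pure (\<epsilon> b \<odot>\<^sub>A a) \<one>\<^sub>B \<odot>\<^sub>(P n) y = j (\<epsilon> b \<odot>\<^sub>B \<one>\<^sub>B) \<odot>\<^sub>(P n) (pure a \<one>\<^sub>B \<odot>\<^sub>(P n) y)"
  using add y e by (subst Pn.smult_assoc[symmetric]) (auto simp: j_pure pure_smult_left pure_smult_right simp del: row_module_simps)
 moreover have "\<epsilon> (\<epsilon> b \<odot>\<^sub>B \<one>\<^sub>B) = \<epsilon> b"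
  using linear_smult[OF eps_linear e WR.one_closed] e by (simp add: eps_one)
 ultimately have 2: "\<psi> (s (pure (\<psi> (pure a b)) \<one>\<^sub>B \<odot>\<^sub>(P n) y) l) = \<epsilon> b \<odot>\<^sub>A \<psi> (s (pure a \<one>\<^sub>B \<odot>\<^sub>(P n) y) l)"
  by (simp only: psi_pure[OF add(1,2)] jl[OF ec pa])
 have ab: "pure a b : carrier T" using add by simp
 have "pure (\<psi> (pure a b \<oplus>\<^sub>T t)) \<one>\<^sub>B = pure (\<psi> (pure a b)) \<one>\<^sub>B \<oplus>\<^sub>T pure (\<psi> t) \<one>\<^sub>B"
  unfolding psi_add[OF ab add(3)] by (rule pure_add_left[OF psi_closed[OF ab] psi_closed[OF add(3)] WR.one_closed])
 moreover have "pure (\<psi> (pure a b)) \<one>\<^sub>B : carrier T" "pure (\<psi> t) \<one>\<^sub>B : carrier T"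
  using psi_closed[OF ab] psi_closed[OF add(3)] by auto
 ultimately show ?case
  by (simp only: split[OF ab add(3)] split 1 2 add.IH)
qed

text \<open>The coefficients of \<open>x\<close> along the rows of \<open>E\<close> are its entries;
  modulo the kernel of \<psi> each can be replaced by its image under \<psi>, which is zero.\<close>

lemma second_linear_kernel:
 assumes s: "s : second_linear (P n) (P n')" and x: "x : carrier (P n)" and 0: "\<And>l. \<psi> (x l) = \<zero>\<^sub>A"
 shows "\<psi> (s x l) = \<zero>\<^sub>A"
proof -
 interpret Pn: left_module T "P n" by (rule C.row_left_module)
 interpret Pm: left_module T "P n'" by (rule C.row_left_module)
 interpret s: additive_hom "P n" "P n'" s
  by (rule additive_homI[OF Pn.M.abelian_group_axioms Pm.M.abelian_group_axioms second_linearD(1)[OF s]])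
 note xc = C.row_entry_closed[OF x]
 have xE: "x i \<odot>\<^sub>(P n) E n i : carrier (P n)" if "i < m n" for i
  by (rule Pn.smult_closed[OF xc C.E_in_row[OF that]])
 have ev: "(\<lambda>v. \<psi> (v l)) : additive_maps (P n') A"
  by (rule additive_mapsI) (simp_all add: psi_closed[OF C.row_entry_closed] psi_add[OF C.row_entry_closed C.row_entry_closed])
 interpret ev: additive_hom "P n'" A "\<lambda>v. \<psi> (v l)"
  by (rule additive_homI[OF Pm.M.abelian_group_axioms VR.is_abelian_group ev])
 have "s x = s (comb (P n) (m n) x (E n))" by (simp only: C.row_expand[OF x])
 also have "... = (\<Oplus>\<^sub>(P n')i\<in>{..<m n}. s (x i \<odot>\<^sub>(P n) E n i))"
  unfolding comb_def by (rule s.map_finsum, intro Pi_I xE) simp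
 finally have "\<psi> (s x l) = \<psi> ((\<Oplus>\<^sub>(P n')i\<in>{..<m n}. s (x i \<odot>\<^sub>(P n) E n i)) l)" by (simp only:)
 also have "... = (\<Oplus>\<^sub>A i\<in>{..<m n}. \<psi> (s (x i \<odot>\<^sub>(P n) E n i) l))"
  by (rule ev.map_finsum, intro Pi_I s.map_closed xE) simp
 also have "... = (\<Oplus>\<^sub>A i\<in>{..<m n}. \<zero>\<^sub>A)"
 proof (rule VR.finsum_cong')
  fix i assume "i : {..<m n}"
  then have Ei: "E n i : carrier (P n)" using C.E_in_row by simp
  have "\<psi> (s (x i \<odot>\<^sub>(P n) E n i) l) = \<psi> (s (\<zero>\<^sub>T \<odot>\<^sub>(P n) E n i) l)"
   using second_linear_psi[OF s Ei xc, of i l] by (simp only: 0 pure_zero_left[OF WR.one_closed])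
  also have "... = \<zero>\<^sub>A"
   unfolding Pn.smult_zero_left[OF Ei] s.map_zero by (rule ev.map_zero)
  finally show "\<psi> (s (x i \<odot>\<^sub>(P n) E n i) l) = \<zero>\<^sub>A" .
 qed auto
 finally show ?thesis by simp
qed

text \<open>The entries are lifted as \<open>y l \<otimes> 1\<close>, and multiplication by
  \<open>E\<close> moves the result into the row module. Applying \<psi> undoes both steps, since
  \<open>y\<close> is fixed by the image of \<open>E\<close>.\<close>

lemma row_lift:
 assumes y: "y : vecs A (m n)" and yE: "comb (rows A (m n)) (m n) y (\<phi>E n) = y"
 obtains x where "x : carrier (P n)" "\<And>l. \<psi> (x l) = y l"
proof -
 define x0 where "x0 l = pure (y l) \<one>\<^sub>B" for l
 have yc: "y l : carrier A" for l by (rule VR.free_closed[OF y])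
 have x0: "x0 : vecs T (m n)"
  using y by (auto simp: rows_carrier_iff x0_def pure_zero_left)
 have p0: "\<psi> (x0 l) = y l" for l unfolding x0_def using yc by (simp add: psi_pure eps_one)
 have "(\<lambda>l. \<psi> (comb (rows T (m n)) (m n) x0 (E n) l)) = comb (rows A (m n)) (m n) (\<lambda>l. \<psi> (x0 l)) (\<phi>E n)"
  by (rule phi_comb_rows) (use TR.free_closed[OF x0] C.E_closed in auto)
 then have "\<psi> (comb (rows T (m n)) (m n) x0 (E n) l) = y l" for l
  using yE p0 by (simp add: fun_eq_iff)
 then show ?thesis using that C.E_row_closed[OF x0] by blast
qed

text \<open>A cycle over \<open>A\<close> lifts to some \<open>x\<close> whose differential is
  merely killed by \<psi>. Then \<open>s (d x)\<close> is killed as well, so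
  \<open>x - s (d x)\<close> is a genuine cycle with the same image, and a preimage of it maps to a
  preimage of the given cycle. In degree 0 a multiple of \<open>p\<close> with coefficient in the
  augmentation ideal plays the role of \<open>s (d x)\<close>.\<close>

theorem augmented_matrix_resolution: "matrix_resolution A M' m \<phi>E \<phi>D (\<lambda>l. \<theta> (t l))"
proof (rule base_change_resolutionI)
 fix n y
 assume y: "y : vecs A (m (Suc n))" and yE: "comb (rows A (m (Suc n))) (m (Suc n)) y (\<phi>E (Suc n)) = y"
  and yD: "comb (rows A (m n)) (m (Suc n)) y (\<phi>D n) = (\<lambda>i. \<zero>\<^sub>A)"
 obtain x where x: "x : carrier (P (Suc n))" and xy: "\<And>l. \<psi> (x l) = y l" using row_lift[OF y yE] by blast
 interpret Pm: left_module T "P (Suc n)" by (rule C.row_left_module)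
 interpret d: additive_hom "P (Suc n)" "P n" "dP n"
  by (rule linear_hom[OF C.row_left_module C.row_left_module res_facts(1)])
 obtain \<rho> where \<rho>: "\<rho> : second_linear (P n) (P n)"
  and im: "\<And>x. x : carrier (P n) ==> \<rho> x : dP n ` carrier (P (Suc n))"
  and idem: "\<And>z. z : dP n ` carrier (P (Suc n)) ==> \<rho> z = z" using retraction_exists[of n] by auto
 obtain s where s: "s : second_linear (P n) (P (Suc n))" and ds: "\<And>x. x : carrier (P n) ==> dP n (s x) = \<rho> x"
  using row_second_lift[OF C.row_left_module C.row_left_module \<rho> linear_second_linear[OF res_facts(1)]] im by blast
 note dx = d.map_closed[OF x]
 have xr: "x : vecs T (m (Suc n))" using x C.row_sub by blast
 have "(\<lambda>l. \<psi> (dP n x l)) = comb (rows A (m n)) (m (Suc n)) (\<lambda>l. \<psi> (x l)) (\<phi>D n)"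
  unfolding row_map_def by (rule phi_comb_rows) (use TR.free_closed[OF xr] C.D_closed in auto)
 then have "\<psi> (dP n x l) = \<zero>\<^sub>A" for l using yD xy by (simp add: fun_eq_iff)
 then have sz: "\<psi> (s (dP n x) l) = \<zero>\<^sub>A" for l by (rule second_linear_kernel[OF s dx])
 have sx: "s (dP n x) : carrier (P (Suc n))" by (rule second_linearD(2)[OF s dx])
 have "dP n (x \<ominus>\<^sub>(P (Suc n)) s (dP n x)) = dP n x \<ominus>\<^sub>(P n) dP n x"
  unfolding d.map_minus[OF x sx] ds[OF dx] by (subst idem) (use x in blast)+
 also have "... = \<zero>\<^sub>(P n)"
  using dx abelian_group.minus_eq_zero_iff[OF left_module_abelian[OF C.row_left_module], of "dP n x" n "dP n x"] by (simp only:)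
 finally have "x \<ominus>\<^sub>(P (Suc n)) s (dP n x) : dP (Suc n) ` carrier (P (Suc (Suc n)))"
  unfolding res_facts(5) using Pm.M.minus_closed[OF x sx] by blast
 then obtain v where v: "v : carrier (P (Suc (Suc n)))" "x \<ominus>\<^sub>(P (Suc n)) s (dP n x) = dP (Suc n) v" by blast
 have vr: "v : vecs T (m (Suc (Suc n)))" using v C.row_sub by blast
 note dv = linear_closed[OF res_facts(1) v(1)]
 have "x = dP (Suc n) v \<oplus>\<^sub>(P (Suc n)) s (dP n x)"
  unfolding v(2)[symmetric] using x sx by (simp only: Pm.M.minus_eq Pm.M.a_assoc Pm.M.l_neg Pm.M.a_inv_closed Pm.M.r_zero)
 then have "x l = dP (Suc n) v l \<oplus>\<^sub>T s (dP n x) l" for l by (simp add: fun_eq_iff)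
 then have "y l = \<psi> (dP (Suc n) v l)" for l
  using psi_add[OF C.row_entry_closed[OF dv] C.row_entry_closed[OF sx]] sz psi_closed[OF C.row_entry_closed[OF dv]]
  by (metis VR.r_zero xy)
 then have "y = (\<lambda>l. \<psi> (dP (Suc n) v l))" by (simp add: fun_eq_iff)
 also have "... = comb (rows A (m (Suc n))) (m (Suc (Suc n))) (\<lambda>l. \<psi> (v l)) (\<phi>D (Suc n))"
  unfolding row_map_def by (rule phi_comb_rows) (use TR.free_closed[OF vr] C.D_closed in auto)
 finally show "\<exists>v\<in>vecs A (m (Suc (Suc n))). y = comb (rows A (m (Suc n))) (m (Suc (Suc n))) v (\<phi>D (Suc n))"
  using phi_row[OF vr] by blast
next
 fix y
 assume y: "y : vecs A (m 0)" and yE: "comb (rows A (m 0)) (m 0) y (\<phi>E 0) = y"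
  and yt: "comb M' (m 0) y (\<lambda>l. \<theta> (t l)) = \<zero>\<^sub>M'"
 obtain x where x: "x : carrier (P 0)" and xy: "\<And>l. \<psi> (x l) = y l" using row_lift[OF y yE] by blast
 interpret P0: left_module T "P 0" by (rule C.row_left_module)
 interpret e: additive_hom "P 0" M eP by (rule linear_hom[OF C.row_left_module C.left_module_axioms res_facts(2)])
 have xr: "x : vecs T (m 0)" using x C.row_sub by blast
 have ex: "eP x : carrier M" by (rule e.map_closed[OF x])
 have "\<theta> (eP x) = comb M' (m 0) (\<lambda>l. \<psi> (x l)) (\<lambda>l. \<theta> (t l))"
  by (rule tau_comb) (use TR.free_closed[OF xr] C.t_closed in auto)
 then have es: "\<epsilon> (\<sigma> (eP x)) = \<zero>\<^sub>k" using yt xy \<theta>_zero[OF ex] by simp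
 obtain p where p: "p : carrier (P 0)" "eP p = w" using generator_lift by (elim bexE)
 have sx: "\<sigma> (eP x) : carrier B" by (rule additive_closed[OF \<sigma>_additive ex])
 let ?p = "j (\<sigma> (eP x)) \<odot>\<^sub>(P 0) p"
 have pp: "?p : carrier (P 0)" by (rule P0.smult_closed[OF j_closed[OF sx] p(1)])
 have pz: "\<psi> (?p l) = \<zero>\<^sub>A" for l
  using psi_mult[OF j_closed[OF sx] C.row_entry_closed[OF p(1)]] psi_closed[OF C.row_entry_closed[OF p(1)]]
  by (simp add: psi_j[OF sx] es)
 have "eP (x \<ominus>\<^sub>(P 0) ?p) = \<zero>\<^sub>M"
  unfolding e.map_minus[OF x pp] linear_smult[OF res_facts(2) j_closed[OF sx] p(1)] p(2) \<sigma>_generator[OF ex]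
  using ex by (simp add: C.M.minus_eq_zero_iff)
 then have "x \<ominus>\<^sub>(P 0) ?p : dP 0 ` carrier (P (Suc 0))"
  unfolding res_facts(4) using P0.M.minus_closed[OF x pp] by blast
 then obtain v where v: "v : carrier (P (Suc 0))" "x \<ominus>\<^sub>(P 0) ?p = dP 0 v" by blast
 have vr: "v : vecs T (m (Suc 0))" using v C.row_sub by blast
 note dv = linear_closed[OF res_facts(1) v(1)]
 have "x = dP 0 v \<oplus>\<^sub>(P 0) ?p"
  unfolding v(2)[symmetric] using x pp by (simp only: P0.M.minus_eq P0.M.a_assoc P0.M.l_neg P0.M.a_inv_closed P0.M.r_zero)
 then have "x l = dP 0 v l \<oplus>\<^sub>T ?p l" for l by (simp add: fun_eq_iff)
 then have "y l = \<psi> (dP 0 v l)" for l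
  using psi_add[OF C.row_entry_closed[OF dv] C.row_entry_closed[OF pp]] pz psi_closed[OF C.row_entry_closed[OF dv]]
  by (metis VR.r_zero xy)
 then have "y = (\<lambda>l. \<psi> (dP 0 v l))" by (simp add: fun_eq_iff)
 also have "... = comb (rows A (m 0)) (m (Suc 0)) (\<lambda>l. \<psi> (v l)) (\<phi>D 0)"
  unfolding row_map_def by (rule phi_comb_rows) (use TR.free_closed[OF vr] C.D_closed in auto)
 finally show "\<exists>v\<in>vecs A (m (Suc 0)). y = comb (rows A (m 0)) (m (Suc 0)) v (\<phi>D 0)"
  using phi_row[OF vr] by blast
next
 fix z assume "z : carrier M'"
 then obtain u where u: "u : carrier M" "z = \<theta> u" using \<theta>_onto by blast
 obtain x where x: "x : vecs T (m 0)" "comb M (m 0) x t = u" using C.onto[OF u(1)] by blast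
 have "\<theta> (comb M (m 0) x t) = comb M' (m 0) (\<lambda>l. \<psi> (x l)) (\<lambda>l. \<theta> (t l))"
  by (rule tau_comb) (use TR.free_closed[OF x(1)] C.t_closed in auto)
 then show "\<exists>x\<in>vecs A (m 0). comb M' (m 0) x (\<lambda>l. \<theta> (t l)) = z"
  using phi_row[OF x(1)] u x(2) by auto
qed

end

section \<open>Identities of cogroupoids in Sweedler notation\<close>

section \<open>Sweedler calculus in cogroupoids\<close>

text \<open>Both sides sum over the same chosen representative, so the integrands may be arbitrary
  functions agreeing on the carriers.\<close>

lemma (in tensor_product) tensor_lift_cong:
 assumes t: "t : carrier T" and eq: "\<And>v w. v : carrier V ==> w : carrier W ==> f v w = g v w"
 shows "tensor_lift N f t = tensor_lift N g t"
proof -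
 obtain ps where ps: "ps : pairs" "t = cls ps" using t by (rule tensor_cases)
 have "(SOME qs. qs : t) : t" unfolding ps(2) using class_self[OF ps(1)] by (rule someI)
 then have qs: "(SOME qs. qs : t) : pairs" using class_member ps(2) by blast
 have "qs : pairs ==> foldr (\<lambda>(v, w) s. f v w \<oplus>\<^sub>N s) qs \<zero>\<^sub>N = foldr (\<lambda>(v, w) s. g v w \<oplus>\<^sub>N s) qs \<zero>\<^sub>N" for qs
 proof (induction qs)
  case (Cons q qs)
  then show ?case by (cases q) (auto simp: eq)
 qed simp
 from this[OF qs] show ?thesis by (simp add: tensor_lift_def)
qed

text \<open>Two independent sums commute: both sides are linear in \<open>s\<close>, and on a pure
  tensor the sum over \<open>s\<close> disappears.\<close>

lemma tensor_lift_swap: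
 assumes st: "tensor_product k V W" "tensor_product k V' W'" and N: "module k N"
  and f1: "\<And>a b. a : carrier V ==> b : carrier W ==> f a b : bilinear_maps k V' W' N"
  and f2: "\<And>c d. c : carrier V' ==> d : carrier W' ==> (\<lambda>a b. f a b c d) : bilinear_maps k V W N"
  and s: "s : carrier (tensor k V W)" and t: "t : carrier (tensor k V' W')"
 shows "tensor_lift N (\<lambda>a b. tensor_lift N (f a b) t) s =
  tensor_lift N (\<lambda>c d. tensor_lift N (\<lambda>a b. f a b c d) s) t"
proof -
 interpret VW: tensor_product k V W by fact
 interpret VW': tensor_product k V' W' by fact
 have b1: "(\<lambda>a b. tensor_lift N (f a b) t) : bilinear_maps k V W N"
  by (intro bilinearI VW'.lift_parametric_linear[OF _ N f1 _ t] VW.V.module_axioms VW.W.module_axioms)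
   (use bilinearD[OF f2] in auto)
 have l2: "(\<lambda>s. tensor_lift N (\<lambda>c d. tensor_lift N (\<lambda>a b. f a b c d) s) t) : linear_maps k (tensor k V W) N"
 proof (rule VW'.lift_parametric_linear[OF VW.tensor_module N _ _ t])
  fix s assume s: "s : carrier (tensor k V W)"
  show "(\<lambda>c d. tensor_lift N (\<lambda>a b. f a b c d) s) : bilinear_maps k V' W' N"
   by (intro bilinearI VW.lift_parametric_linear[OF _ N f2 _ s] VW'.V.module_axioms VW'.W.module_axioms)
    (use bilinearD[OF f1] in auto)
 next
  fix c d assume "c : carrier V'" "d : carrier W'"
  then show "(\<lambda>s. tensor_lift N (\<lambda>a b. f a b c d) s) : linear_maps k (tensor k V W) N"
   using VW.lift_linear[OF N f2] by simp
 qed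
 show ?thesis
 proof (rule VW.tensor_linear_eq[OF N VW.lift_linear[OF N b1] l2 _ s])
  fix a b assume ab: "a : carrier V" "b : carrier W"
  have "tensor_lift N (\<lambda>c d. tensor_lift N (\<lambda>a b. f a b c d) (pure_tensor k V W a b)) t = tensor_lift N (f a b) t"
   by (rule VW'.tensor_lift_cong[OF t]) (simp add: VW.lift_pure[OF N f2 ab])
  then show "tensor_lift N (\<lambda>a b. tensor_lift N (f a b) t) (pure_tensor k V W a b) =
    tensor_lift N (\<lambda>c d. tensor_lift N (\<lambda>a b. f a b c d) (pure_tensor k V W a b)) t"
   by (simp add: VW.lift_pure[OF N b1 ab])
 qed
qed

lemma lin_mult_right:
 "unital_algebra k A ==> g : linear_maps k V A ==> c : carrier A ==> (\<lambda>x. g x \<otimes>\<^sub>A c) : linear_maps k V A"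
 by (rule linear_comp[OF mult_right_linear])

lemma lin_mult_left:
 "unital_algebra k A ==> c : carrier A ==> g : linear_maps k V A ==> (\<lambda>x. c \<otimes>\<^sub>A g x) : linear_maps k V A"
 by (rule linear_comp[OF mult_left_linear])

lemma lin_smult_right:
 assumes "module k N" "c : carrier k" "g : linear_maps k V N"
 shows "(\<lambda>x. c \<odot>\<^sub>N g x) : linear_maps k V N"
proof -
 interpret module k N by fact
 have "(\<lambda>n. c \<odot>\<^sub>N n) : linear_maps k N N"
  by (rule linear_mapsI) (use assms(2) in "auto simp: smult_r_distr smult_assoc1[symmetric] R.m_comm")
 from linear_comp[OF this assms(3)] show ?thesis .
qed

lemma lin_smult_left:
 assumes "module k N" "g : linear_maps k V (ground k)" "n : carrier N"
 shows "(\<lambda>x. g x \<odot>\<^sub>N n) : linear_maps k V N"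
proof -
 interpret module k N by fact
 have "(\<lambda>c. c \<odot>\<^sub>N n) : linear_maps k (ground k) N"
  by (rule linear_mapsI) (use assms(3) in "auto simp: smult_l_distr smult_assoc1")
 from linear_comp[OF this assms(2)] show ?thesis .
qed

lemma lin_pure_left:
 assumes "module k V" "module k W" "g : linear_maps k U V" "w : carrier W"
 shows "(\<lambda>x. pure_tensor k V W (g x) w) : linear_maps k U (tensor k V W)"
proof -
 interpret tensor_product k V W by (rule tensor_product.intro[OF assms(1,2)])
 show ?thesis by (rule linear_comp[OF bilinearD(1)[OF pure_bilinear assms(4)] assms(3)])
qed

lemma lin_pure_right:
 assumes "module k V" "module k W" "g : linear_maps k U W" "v : carrier V"
 shows "(\<lambda>x. pure_tensor k V W v (g x)) : linear_maps k U (tensor k V W)"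
proof -
 interpret tensor_product k V W by (rule tensor_product.intro[OF assms(1,2)])
 show ?thesis by (rule linear_comp[OF bilinearD(2)[OF pure_bilinear assms(4)] assms(3)])
qed

context cogroupoid
begin

text \<open>\<open>f\<close> applied to the two Sweedler components of \<open>x\<close>, the first
  in \<open>C X Z\<close> and the second in \<open>C Z Y\<close>, with values in
  \<open>N\<close>.\<close>

abbreviation sw :: "'o => 'o => 'o => ('k, 'n) module => ('a => 'a => 'n) => 'a => 'n" where
 "sw X Z Y N f x \<equiv> tensor_lift N f (\<Delta> X Z Y x)"

sublocale k: field k by (rule ground_field)

lemma alg [simp]: "X : Ob ==> Y : Ob ==> unital_algebra k (C X Y)"
 by (rule algebra)

lemma mod [simp]: "X : Ob ==> Y : Ob ==> module k (C X Y)"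
 by (rule unital_algebraD(1)[OF alg])

lemma ring_C: "X : Ob ==> Y : Ob ==> ring (C X Y)"
 by (rule unital_algebraD(2)[OF alg])

lemma tensor_C: "X : Ob ==> Y : Ob ==> X' : Ob ==> Y' : Ob ==> tensor_algebra k (C X Y) (C X' Y')"
 by (simp add: tensor_algebra_def)

lemma tensor_CP: "X : Ob ==> Y : Ob ==> X' : Ob ==> Y' : Ob ==> tensor_product k (C X Y) (C X' Y')"
 by (simp add: tensor_product_def)

lemma tensor_mod [simp]: "X : Ob ==> Y : Ob ==> X' : Ob ==> Y' : Ob ==> module k (tensor k (C X Y) (C X' Y'))"
 by (rule tensor_product.tensor_module[OF tensor_CP])

lemma ground_alg [simp]: "unital_algebra k (ground k)"
 by (rule ground_algebra[OF k.is_cring])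

lemma ground_mod [simp]: "module k (ground k)"
 by (rule unital_algebraD(1)[OF ground_alg])

lemma mult_C [simp]: "X : Ob ==> Y : Ob ==> a : carrier (C X Y) ==> b : carrier (C X Y) ==> a \<otimes>\<^sub>(C X Y) b : carrier (C X Y)"
 by (rule ring.ring_simprules(5)[OF ring_C])

lemma one_C [simp]: "X : Ob ==> Y : Ob ==> \<one>\<^sub>(C X Y) : carrier (C X Y)"
 by (rule ring.ring_simprules(6)[OF ring_C])

lemma smult_C [simp]: "X : Ob ==> Y : Ob ==> c : carrier k ==> b : carrier (C X Y) ==> c \<odot>\<^sub>(C X Y) b : carrier (C X Y)"
 by (rule module.smult_closed[OF mod])

lemma assoc_C: "X : Ob ==> Y : Ob ==> a : carrier (C X Y) ==> b : carrier (C X Y) ==> c : carrier (C X Y) ==>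
  a \<otimes>\<^sub>(C X Y) b \<otimes>\<^sub>(C X Y) c = a \<otimes>\<^sub>(C X Y) (b \<otimes>\<^sub>(C X Y) c)"
 by (rule ring.ring_simprules(11)[OF ring_C])

lemma one_l_C [simp]: "X : Ob ==> Y : Ob ==> a : carrier (C X Y) ==> \<one>\<^sub>(C X Y) \<otimes>\<^sub>(C X Y) a = a"
 by (rule ring.ring_simprules(12)[OF ring_C])

lemma one_r_C [simp]: "X : Ob ==> Y : Ob ==> a : carrier (C X Y) ==> a \<otimes>\<^sub>(C X Y) \<one>\<^sub>(C X Y) = a"
 by (rule monoid.r_one[OF ring.is_monoid[OF ring_C]])

lemma smult_mult_l: "X : Ob ==> Y : Ob ==> c : carrier k ==> a : carrier (C X Y) ==> b : carrier (C X Y) ==>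
  (c \<odot>\<^sub>(C X Y) a) \<otimes>\<^sub>(C X Y) b = c \<odot>\<^sub>(C X Y) (a \<otimes>\<^sub>(C X Y) b)"
 by (rule unital_algebraD(3)[OF alg])

lemma smult_mult_r: "X : Ob ==> Y : Ob ==> c : carrier k ==> a : carrier (C X Y) ==> b : carrier (C X Y) ==>
  a \<otimes>\<^sub>(C X Y) (c \<odot>\<^sub>(C X Y) b) = c \<odot>\<^sub>(C X Y) (a \<otimes>\<^sub>(C X Y) b)"
 by (rule unital_algebraD(4)[OF alg])

lemma comult_linear: "X : Ob ==> Y : Ob ==> Z : Ob ==> \<Delta> X Z Y : linear_maps k (C X Y) (tensor k (C X Z) (C Z Y))"
 using comult_hom by (simp add: algebra_homs_def)

lemma comult_ring_hom: "X : Ob ==> Y : Ob ==> Z : Ob ==> \<Delta> X Z Y : ring_hom (C X Y) (tensor k (C X Z) (C Z Y))"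
 using comult_hom by (simp add: algebra_homs_def)

lemma comult_closed [simp]: "X : Ob ==> Y : Ob ==> Z : Ob ==> x : carrier (C X Y) ==>
  \<Delta> X Z Y x : carrier (tensor k (C X Z) (C Z Y))"
 by (rule linear_closed[OF comult_linear])

lemma eps_linear: "X : Ob ==> \<epsilon> X : linear_maps k (C X X) (ground k)"
 using counit_hom by (simp add: algebra_homs_def)

lemma eps_closed [simp]: "X : Ob ==> x : carrier (C X X) ==> \<epsilon> X x : carrier k"
 using linear_closed[OF eps_linear] by simp

lemma eps_mult: "X : Ob ==> x : carrier (C X X) ==> y : carrier (C X X) ==>
  \<epsilon> X (x \<otimes>\<^sub>(C X X) y) = \<epsilon> X x \<otimes>\<^sub>k \<epsilon> X y"
 and eps_one: "X : Ob ==> \<epsilon> X \<one>\<^sub>(C X X) = \<one>\<^sub>k"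
 using counit_hom[of X] by (auto simp: algebra_homs_def ring_hom_def)

lemma S_closed [simp]: "X : Ob ==> Y : Ob ==> x : carrier (C X Y) ==> S X Y x : carrier (C Y X)"
 by (rule linear_closed[OF antipode_linear])

lemma S_smult: "X : Ob ==> Y : Ob ==> c : carrier k ==> x : carrier (C X Y) ==>
  S X Y (c \<odot>\<^sub>(C X Y) x) = c \<odot>\<^sub>(C Y X) S X Y x"
 by (rule linear_smult[OF antipode_linear])

lemma lin_S: "X : Ob ==> Y : Ob ==> g : linear_maps k V (C X Y) ==> (\<lambda>x. S X Y (g x)) : linear_maps k V (C Y X)"
 by (rule linear_comp[OF antipode_linear])

lemma lin_eps: "X : Ob ==> g : linear_maps k V (C X X) ==> (\<lambda>x. \<epsilon> X (g x)) : linear_maps k V (ground k)"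
 by (rule linear_comp[OF eps_linear])

lemma sw_linear: "X : Ob ==> Y : Ob ==> Z : Ob ==> module k N ==> f : bilinear_maps k (C X Z) (C Z Y) N ==>
  sw X Z Y N f : linear_maps k (C X Y) N"
 by (rule linear_comp[OF tensor_product.lift_linear[OF tensor_CP[of X Z Z Y]] comult_linear])

lemma lin_sw_arg: "X : Ob ==> Y : Ob ==> Z : Ob ==> module k N ==> f : bilinear_maps k (C X Z) (C Z Y) N ==>
  g : linear_maps k V (C X Y) ==> (\<lambda>x. sw X Z Y N f (g x)) : linear_maps k V N"
 by (rule linear_comp[OF sw_linear])

lemma lin_sw_param: "X : Ob ==> Y : Ob ==> Z : Ob ==> module k N ==> module k U ==> x : carrier (C X Y) ==>
  (\<And>u. u : carrier U ==> f u : bilinear_maps k (C X Z) (C Z Y) N) ==>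
  (\<And>v w. v : carrier (C X Z) ==> w : carrier (C Z Y) ==> (\<lambda>u. f u v w) : linear_maps k U N) ==>
  (\<lambda>u. sw X Z Y N (f u) x) : linear_maps k U N"
 by (rule tensor_product.lift_parametric_linear[OF tensor_CP[of X Z Z Y]]) simp_all

text \<open>Introduction rules for linearity in a single Sweedler variable; multilinear expressions
  are dealt with one variable at a time.\<close>

lemmas lin_rules = linear_id lin_sw_arg lin_sw_param lin_mult_right lin_mult_left lin_smult_left lin_smult_right
 lin_S lin_eps lin_pure_left lin_pure_right

lemma sw_cong: "X : Ob ==> Y : Ob ==> Z : Ob ==> x : carrier (C X Y) ==>
  (\<And>v w. v : carrier (C X Z) ==> w : carrier (C Z Y) ==> f v w = g v w) ==> sw X Z Y N f x = sw X Z Y N g x"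
 by (rule tensor_product.tensor_lift_cong[OF tensor_CP[of X Z Z Y]]) simp_all

lemma sw_map: "X : Ob ==> Y : Ob ==> Z : Ob ==> module k N ==> module k L ==>
  f : bilinear_maps k (C X Z) (C Z Y) N ==> g : linear_maps k N L ==> x : carrier (C X Y) ==>
  sw X Z Y L (\<lambda>a b. g (f a b)) x = g (sw X Z Y N f x)"
 by (rule tensor_product.linear_lift[OF tensor_CP[of X Z Z Y], symmetric]) simp_all

lemma sw_one: "X : Ob ==> Y : Ob ==> Z : Ob ==> module k N ==> f : bilinear_maps k (C X Z) (C Z Y) N ==>
  sw X Z Y N f \<one>\<^sub>(C X Y) = f \<one>\<^sub>(C X Z) \<one>\<^sub>(C Z Y)"
 using tensor_product.lift_pure[OF tensor_CP, of X Z Z Y N f "\<one>\<^sub>(C X Z)" "\<one>\<^sub>(C Z Y)"]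
 by (simp add: ring_hom_one[OF comult_ring_hom] tensor_product.tensor_one[OF tensor_CP])

lemma sw_mult:
 assumes Ob: "X : Ob" "Y : Ob" "Z : Ob" and N: "module k N" and f: "f : bilinear_maps k (C X Z) (C Z Y) N"
  and x: "x : carrier (C X Y)" and y: "y : carrier (C X Y)"
 shows "sw X Z Y N f (x \<otimes>\<^sub>(C X Y) y) =
  sw X Z Y N (\<lambda>a b. sw X Z Y N (\<lambda>a' b'. f (a \<otimes>\<^sub>(C X Z) a') (b \<otimes>\<^sub>(C Z Y) b')) y) x"
proof -
 interpret T: tensor_algebra k "C X Z" "C Z Y" by (rule tensor_C) (use Ob in auto)
 note cl = comult_closed[OF Ob x] comult_closed[OF Ob y]
 note nl = T.lift_linear[OF N f]
 have "sw X Z Y N f (x \<otimes>\<^sub>(C X Y) y) = tensor_lift N f (tensor_lift T.T (\<lambda>v w. tensor_lift T.T (T.prod_map v w) (\<Delta> X Z Y y)) (\<Delta> X Z Y x))"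
  by (simp add: ring_hom_mult[OF comult_ring_hom[OF Ob] x y] T.tensor_mult[OF cl])
 also have "... = tensor_lift N (\<lambda>v w. tensor_lift N f (tensor_lift T.T (T.prod_map v w) (\<Delta> X Z Y y))) (\<Delta> X Z Y x)"
  by (rule T.linear_lift[OF T.tensor_module N T.prod_map_bilinear'[OF cl(2)] nl cl(1)])
 also have "... = tensor_lift N (\<lambda>v w. tensor_lift N (\<lambda>a' b'. tensor_lift N f (T.prod_map v w a' b')) (\<Delta> X Z Y y)) (\<Delta> X Z Y x)"
  by (rule T.tensor_lift_cong[OF cl(1)]) (rule T.linear_lift[OF T.tensor_module N T.prod_map_bilinear nl cl(2)])
 also have "... = sw X Z Y N (\<lambda>a b. sw X Z Y N (\<lambda>a' b'. f (a \<otimes>\<^sub>(C X Z) a') (b \<otimes>\<^sub>(C Z Y) b')) y) x"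
  by (intro T.tensor_lift_cong cl) (simp add: T.prod_map_def T.lift_pure[OF N f])
 finally show ?thesis .
qed

text \<open>A trilinear \<open>f\<close> induces a linear map \<open>F\<close> on the threefold
  tensor product, and applying \<open>F\<close> to both sides of the axiom \<open>coassoc\<close>
  gives the two iterated sums.\<close>

lemma sw_coassoc:
 assumes Ob: "X : Ob" "Y : Ob" "Z : Ob" "T : Ob" and N: "module k N" and x: "x : carrier (C X Y)"
  and f1: "\<And>v w. v : carrier (C T Z) ==> w : carrier (C Z Y) ==> (\<lambda>u. f u v w) : linear_maps k (C X T) N"
  and f2: "\<And>u w. u : carrier (C X T) ==> w : carrier (C Z Y) ==> (\<lambda>v. f u v w) : linear_maps k (C T Z) N"
  and f3: "\<And>u v. u : carrier (C X T) ==> v : carrier (C T Z) ==> (\<lambda>w. f u v w) : linear_maps k (C Z Y) N"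
 shows "sw X Z Y N (\<lambda>a b. sw X T Z N (\<lambda>a1 a2. f a1 a2 b) a) x = sw X T Y N (\<lambda>a c. sw T Z Y N (\<lambda>c1 c2. f a c1 c2) c) x"
proof -
 let ?U = "C X T" and ?V = "C T Z" and ?W = "C Z Y"
 interpret UV: tensor_product k ?U ?V by (rule tensor_CP) (use Ob in auto)
 interpret VW: tensor_product k ?V ?W by (rule tensor_CP) (use Ob in auto)
 interpret U_VW: tensor_product k ?U VW.T by (rule tensor_product.intro[OF mod[OF Ob(1,4)] VW.tensor_module])
 interpret UV_W: tensor_product k UV.T ?W by (rule tensor_product.intro[OF UV.tensor_module mod[OF Ob(3,2)]])
 interpret XZ: tensor_product k "C X Z" ?W by (rule tensor_CP) (use Ob in auto)
 interpret TY: tensor_product k ?U "C T Y" by (rule tensor_CP) (use Ob in auto)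
 have m: "module k ?U" "module k ?V" "module k ?W" using Ob by simp_all
 have dx: "\<Delta> X Z Y x : carrier XZ.T" "\<Delta> X T Y x : carrier TY.T" using Ob x by auto
 have b1: "f u : bilinear_maps k ?V ?W N" if "u : carrier ?U" for u
  by (intro bilinearI f2 f3 that)
 define F where "F = tensor_lift N (\<lambda>u t. tensor_lift N (f u) t)"
 have bF: "(\<lambda>u t. tensor_lift N (f u) t) : bilinear_maps k ?U VW.T N"
  by (intro bilinearI VW.lift_parametric_linear[OF m(1) N b1 f1] VW.lift_linear[OF N b1])
 have Fl: "F : linear_maps k U_VW.T N" unfolding F_def by (rule U_VW.lift_linear[OF N bF])
 have Fp: "F (pure_tensor k ?U VW.T u t) = tensor_lift N (f u) t" if "u : carrier ?U" "t : carrier VW.T" for u t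
  unfolding F_def by (rule U_VW.lift_pure[OF N bF that])
 have dl: "\<Delta> X T Z : linear_maps k (C X Z) UV.T" "\<Delta> T Z Y : linear_maps k (C T Y) VW.T"
  using Ob by (auto intro: comult_linear)
 let ?g = "\<lambda>w u v. pure_tensor k ?U VW.T u (pure_tensor k ?V ?W v w)"
 have bg: "?g w : bilinear_maps k ?U ?V U_VW.T" if "w : carrier ?W" for w
  using that by (intro bilinearI lin_pure_left lin_pure_right linear_id) (auto simp: m(1) m(2) m(3) VW.tensor_module)
 have ba: "(\<lambda>t w. tensor_lift U_VW.T (?g w) t) : bilinear_maps k UV.T ?W U_VW.T"
 proof (rule bilinearI)
  show "(\<lambda>t. tensor_lift U_VW.T (?g w) t) : linear_maps k UV.T U_VW.T" if "w : carrier ?W" for w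
   by (rule UV.lift_linear[OF U_VW.tensor_module bg[OF that]])
  show "(\<lambda>w. tensor_lift U_VW.T (?g w) t) : linear_maps k ?W U_VW.T" if "t : carrier UV.T" for t
   by (rule UV.lift_parametric_linear[OF m(3) U_VW.tensor_module bg _ that])
    (auto intro!: lin_pure_right linear_id m VW.tensor_module)
 qed
 have bm1: "(\<lambda>a b. pure_tensor k UV.T ?W (\<Delta> X T Z a) (id b)) : bilinear_maps k (C X Z) ?W UV_W.T"
  using Ob by (intro bilinearI lin_pure_left lin_pure_right dl) (auto simp: id_def linear_id UV.tensor_module m(3))
 have bm2: "(\<lambda>a b. pure_tensor k ?U VW.T (id a) (\<Delta> T Z Y b)) : bilinear_maps k ?U (C T Y) U_VW.T"
  using Ob by (intro bilinearI lin_pure_left lin_pure_right dl) (auto simp: id_def linear_id VW.tensor_module m(1))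
 note al = UV_W.lift_linear[OF U_VW.tensor_module ba]
 have "F (tensor_assoc k ?U ?V ?W (tensor_map k UV.T ?W (\<Delta> X T Z) id (\<Delta> X Z Y x))) =
   tensor_lift N (\<lambda>a b. F (tensor_assoc k ?U ?V ?W (pure_tensor k UV.T ?W (\<Delta> X T Z a) (id b)))) (\<Delta> X Z Y x)"
  unfolding tensor_map_def tensor_assoc_def
  by (rule XZ.linear_lift[OF UV_W.tensor_module N bm1 linear_comp[OF Fl al] dx(1)])
 also have "... = tensor_lift N (\<lambda>a b. sw X T Z N (\<lambda>a1 a2. f a1 a2 b) a) (\<Delta> X Z Y x)"
 proof (rule XZ.tensor_lift_cong[OF dx(1)])
  fix a b assume a: "a : carrier (C X Z)" and b: "b : carrier ?W"
  have da: "\<Delta> X T Z a : carrier UV.T" using Ob a by simp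
  have "tensor_assoc k ?U ?V ?W (pure_tensor k UV.T ?W (\<Delta> X T Z a) (id b)) = tensor_lift U_VW.T (?g b) (\<Delta> X T Z a)"
   unfolding tensor_assoc_def id_apply by (rule UV_W.lift_pure[OF U_VW.tensor_module ba da b])
  then have "F (tensor_assoc k ?U ?V ?W (pure_tensor k UV.T ?W (\<Delta> X T Z a) (id b))) =
    tensor_lift N (\<lambda>u v. F (?g b u v)) (\<Delta> X T Z a)"
   using UV.linear_lift[OF U_VW.tensor_module N bg[OF b] Fl da] by simp
  also have "... = sw X T Z N (\<lambda>a1 a2. f a1 a2 b) a"
   by (rule UV.tensor_lift_cong[OF da]) (use b in "simp add: Fp VW.lift_pure[OF N b1]")
  finally show "F (tensor_assoc k ?U ?V ?W (pure_tensor k UV.T ?W (\<Delta> X T Z a) (id b))) = sw X T Z N (\<lambda>a1 a2. f a1 a2 b) a" .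
 qed
 finally have 1: "F (tensor_assoc k ?U ?V ?W (tensor_map k UV.T ?W (\<Delta> X T Z) id (\<Delta> X Z Y x))) =
   sw X Z Y N (\<lambda>a b. sw X T Z N (\<lambda>a1 a2. f a1 a2 b) a) x" .
 have "F (tensor_map k ?U VW.T id (\<Delta> T Z Y) (\<Delta> X T Y x)) = tensor_lift N (\<lambda>a b. F (pure_tensor k ?U VW.T (id a) (\<Delta> T Z Y b))) (\<Delta> X T Y x)"
  unfolding tensor_map_def by (rule TY.linear_lift[OF U_VW.tensor_module N bm2 Fl dx(2)])
 also have "... = sw X T Y N (\<lambda>a c. sw T Z Y N (\<lambda>c1 c2. f a c1 c2) c) x"
  by (rule TY.tensor_lift_cong[OF dx(2)]) (use Ob in "simp add: Fp")
 finally show ?thesis using 1 coassoc[OF Ob x] by simp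
qed

text \<open>The linear map \<open>g\<close> allows the contraction to take place inside a larger
  expression; the same form is used for the left counit and for both antipode laws.\<close>

lemma sw_counit_right:
 assumes "X : Ob" "Y : Ob" "module k N" "g : linear_maps k (C X Y) N" "x : carrier (C X Y)"
 shows "sw X Y Y N (\<lambda>a b. \<epsilon> Y b \<odot>\<^sub>N g a) x = g x"
proof -
 have b: "(\<lambda>a b. \<epsilon> Y b \<odot>\<^sub>(C X Y) a) : bilinear_maps k (C X Y) (C Y Y) (C X Y)"
  by (intro bilinearI lin_rules) (use assms in auto)
 have "sw X Y Y N (\<lambda>a b. \<epsilon> Y b \<odot>\<^sub>N g a) x = sw X Y Y N (\<lambda>a b. g (\<epsilon> Y b \<odot>\<^sub>(C X Y) a)) x"
  by (rule sw_cong) (use assms in "auto simp: linear_smult[OF assms(4)]")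
 also have "... = g (sw X Y Y (C X Y) (\<lambda>a b. \<epsilon> Y b \<odot>\<^sub>(C X Y) a) x)"
  by (rule sw_map[OF _ _ _ _ _ b]) (use assms in auto)
 finally show ?thesis using counit_right[OF assms(1,2,5)] by simp
qed

lemma sw_counit_left:
 assumes "X : Ob" "Y : Ob" "module k N" "g : linear_maps k (C X Y) N" "x : carrier (C X Y)"
 shows "sw X X Y N (\<lambda>a b. \<epsilon> X a \<odot>\<^sub>N g b) x = g x"
proof -
 have b: "(\<lambda>a b. \<epsilon> X a \<odot>\<^sub>(C X Y) b) : bilinear_maps k (C X X) (C X Y) (C X Y)"
  by (intro bilinearI lin_rules) (use assms in auto)
 have "sw X X Y N (\<lambda>a b. \<epsilon> X a \<odot>\<^sub>N g b) x = sw X X Y N (\<lambda>a b. g (\<epsilon> X a \<odot>\<^sub>(C X Y) b)) x"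
  by (rule sw_cong) (use assms in "auto simp: linear_smult[OF assms(4)]")
 also have "... = g (sw X X Y (C X Y) (\<lambda>a b. \<epsilon> X a \<odot>\<^sub>(C X Y) b) x)"
  by (rule sw_map[OF _ _ _ _ _ b]) (use assms in auto)
 finally show ?thesis using counit_left[OF assms(1,2,5)] by simp
qed

lemma sw_antipode_right:
 assumes "X : Ob" "Y : Ob" "module k N" "g : linear_maps k (C X Y) N" "x : carrier (C X X)"
 shows "sw X Y X N (\<lambda>a b. g (a \<otimes>\<^sub>(C X Y) S Y X b)) x = \<epsilon> X x \<odot>\<^sub>N g \<one>\<^sub>(C X Y)"
proof -
 have b: "(\<lambda>a b. a \<otimes>\<^sub>(C X Y) S Y X b) : bilinear_maps k (C X Y) (C Y X) (C X Y)"
  by (intro bilinearI lin_rules) (use assms in auto)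
 have "sw X Y X N (\<lambda>a b. g (a \<otimes>\<^sub>(C X Y) S Y X b)) x = g (sw X Y X (C X Y) (\<lambda>a b. a \<otimes>\<^sub>(C X Y) S Y X b) x)"
  by (rule sw_map[OF _ _ _ _ _ b]) (use assms in auto)
 then show ?thesis using antipode_right[OF assms(1,2,5)] assms by (simp add: linear_smult[OF assms(4)])
qed

lemma sw_antipode_left:
 assumes "X : Ob" "Y : Ob" "module k N" "g : linear_maps k (C Y X) N" "x : carrier (C X X)"
 shows "sw X Y X N (\<lambda>a b. g (S X Y a \<otimes>\<^sub>(C Y X) b)) x = \<epsilon> X x \<odot>\<^sub>N g \<one>\<^sub>(C Y X)"
proof -
 have b: "(\<lambda>a b. S X Y a \<otimes>\<^sub>(C Y X) b) : bilinear_maps k (C X Y) (C Y X) (C Y X)"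
  by (intro bilinearI lin_rules) (use assms in auto)
 have "sw X Y X N (\<lambda>a b. g (S X Y a \<otimes>\<^sub>(C Y X) b)) x = g (sw X Y X (C Y X) (\<lambda>a b. S X Y a \<otimes>\<^sub>(C Y X) b) x)"
  by (rule sw_map[OF _ _ _ _ _ b]) (use assms in auto)
 then show ?thesis using antipode_left[OF assms(1,2,5)] assms by (simp add: linear_smult[OF assms(4)])
qed

lemma smult_one_C [simp]: "X : Ob ==> Y : Ob ==> x : carrier (C X Y) ==> \<one>\<^sub>k \<odot>\<^sub>(C X Y) x = x"
 by (rule module.smult_one[OF mod])

lemma S_one:
 assumes "X : Ob" "Y : Ob"
 shows "S X Y \<one>\<^sub>(C X Y) = \<one>\<^sub>(C Y X)"
proof -
 have b: "(\<lambda>a b. S X Y a \<otimes>\<^sub>(C Y X) b) : bilinear_maps k (C X Y) (C Y X) (C Y X)"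
  by (intro bilinearI lin_rules) (use assms in auto)
 have "sw X Y X (C Y X) (\<lambda>a b. S X Y a \<otimes>\<^sub>(C Y X) b) \<one>\<^sub>(C X X) = \<one>\<^sub>(C Y X)"
  using antipode_left[OF assms, of "\<one>\<^sub>(C X X)"] assms by (simp add: eps_one)
 then show ?thesis using sw_one[OF _ _ _ _ b] assms by simp
qed

text \<open>Both sides arise by contracting \<open>S(a\<^sub>1 b\<^sub>1) a\<^sub>2 b\<^sub>2 S(b\<^sub>3) S(a\<^sub>3)\<close>, once from the right and once from the left.\<close>

lemma S_mult:
 assumes Ob: "X : Ob" "Y : Ob" and a: "a : carrier (C X Y)" and b: "b : carrier (C X Y)"
 shows "S X Y (a \<otimes>\<^sub>(C X Y) b) = S X Y b \<otimes>\<^sub>(C Y X) S X Y a"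
proof -
 let ?N = "C Y X"
 have N: "module k ?N" using Ob by simp
 let ?f = "\<lambda>a1 p q b1 r s. S X Y (a1 \<otimes>\<^sub>(C X Y) b1) \<otimes>\<^sub>?N (p \<otimes>\<^sub>?N r) \<otimes>\<^sub>?N S X Y s \<otimes>\<^sub>?N S X Y q"
 let ?g = "\<lambda>a1 p q. sw X Y Y ?N (\<lambda>b1 b'. sw Y X Y ?N (\<lambda>r s. ?f a1 p q b1 r s) b') b"
 have g1: "?g a1 p q = S X Y (a1 \<otimes>\<^sub>(C X Y) b) \<otimes>\<^sub>?N (p \<otimes>\<^sub>?N S X Y q)"
  if "a1 : carrier (C X Y)" "p : carrier ?N" "q : carrier (C X Y)" for a1 p q
 proof -
  have "?g a1 p q = sw X Y Y ?N (\<lambda>b1 b'. \<epsilon> Y b' \<odot>\<^sub>?N (S X Y (a1 \<otimes>\<^sub>(C X Y) b1) \<otimes>\<^sub>?N (p \<otimes>\<^sub>?N S X Y q))) b"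
  proof (rule sw_cong[OF Ob Ob(2) b])
   fix b1 b' assume bb: "b1 : carrier (C X Y)" "b' : carrier (C Y Y)"
   have "sw Y X Y ?N (\<lambda>r s. ?f a1 p q b1 r s) b' =
     sw Y X Y ?N (\<lambda>r s. S X Y (a1 \<otimes>\<^sub>(C X Y) b1) \<otimes>\<^sub>?N (p \<otimes>\<^sub>?N ((r \<otimes>\<^sub>?N S X Y s) \<otimes>\<^sub>?N S X Y q))) b'"
    by (rule sw_cong) (use Ob bb that in "simp_all add: assoc_C")
   also have "... = \<epsilon> Y b' \<odot>\<^sub>?N (S X Y (a1 \<otimes>\<^sub>(C X Y) b1) \<otimes>\<^sub>?N (p \<otimes>\<^sub>?N (\<one>\<^sub>?N \<otimes>\<^sub>?N S X Y q)))"
    by (rule sw_antipode_right[OF Ob(2,1) N _ bb(2)], intro lin_rules) (use Ob bb that in auto)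
   finally show "sw Y X Y ?N (\<lambda>r s. ?f a1 p q b1 r s) b' = \<epsilon> Y b' \<odot>\<^sub>?N (S X Y (a1 \<otimes>\<^sub>(C X Y) b1) \<otimes>\<^sub>?N (p \<otimes>\<^sub>?N S X Y q))"
    using Ob that by simp
  qed
  also have "... = S X Y (a1 \<otimes>\<^sub>(C X Y) b) \<otimes>\<^sub>?N (p \<otimes>\<^sub>?N S X Y q)"
   by (rule sw_counit_right[OF Ob N _ b], intro lin_rules) (use Ob that in auto)
  finally show ?thesis .
 qed
 have g2: "?g a1 p q = sw X X Y ?N (\<lambda>b'' s. sw X Y X ?N (\<lambda>b1 r. ?f a1 p q b1 r s) b'') b"
  if "a1 : carrier (C X Y)" "p : carrier ?N" "q : carrier (C X Y)" for a1 p q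
  by (rule sw_coassoc[symmetric, where f = "\<lambda>b1 r s. ?f a1 p q b1 r s"], (intro lin_rules)?)
   (use Ob that b in "auto intro!: lin_rules")
 have "sw X Y Y ?N (\<lambda>a1 a'. sw Y X Y ?N (\<lambda>p q. ?g a1 p q) a') a =
   sw X Y Y ?N (\<lambda>a1 a'. \<epsilon> Y a' \<odot>\<^sub>?N (S X Y (a1 \<otimes>\<^sub>(C X Y) b))) a"
 proof (rule sw_cong[OF Ob Ob(2) a])
  fix a1 a' assume aa: "a1 : carrier (C X Y)" "a' : carrier (C Y Y)"
  have "sw Y X Y ?N (\<lambda>p q. ?g a1 p q) a' = sw Y X Y ?N (\<lambda>p q. S X Y (a1 \<otimes>\<^sub>(C X Y) b) \<otimes>\<^sub>?N (p \<otimes>\<^sub>?N S X Y q)) a'"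
   by (rule sw_cong) (use Ob aa g1 in auto)
  also have "... = \<epsilon> Y a' \<odot>\<^sub>?N (S X Y (a1 \<otimes>\<^sub>(C X Y) b) \<otimes>\<^sub>?N \<one>\<^sub>?N)"
   by (rule sw_antipode_right[OF Ob(2,1) N _ aa(2)], intro lin_rules) (use Ob aa b in auto)
  finally show "sw Y X Y ?N (\<lambda>p q. ?g a1 p q) a' = \<epsilon> Y a' \<odot>\<^sub>?N (S X Y (a1 \<otimes>\<^sub>(C X Y) b))" using Ob aa b by simp
 qed
 also have "... = S X Y (a \<otimes>\<^sub>(C X Y) b)"
  by (rule sw_counit_right[OF Ob N _ a], intro lin_rules) (use Ob b in auto)
 finally have 1: "sw X Y Y ?N (\<lambda>a1 a'. sw Y X Y ?N (\<lambda>p q. ?g a1 p q) a') a = S X Y (a \<otimes>\<^sub>(C X Y) b)" .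
 have "sw X Y Y ?N (\<lambda>a1 a'. sw Y X Y ?N (\<lambda>p q. ?g a1 p q) a') a = sw X X Y ?N (\<lambda>a'' q. sw X Y X ?N (\<lambda>a1 p. ?g a1 p q) a'') a"
  by (rule sw_coassoc[symmetric, where f = ?g], (intro lin_rules)?) (use Ob b a in "auto intro!: lin_rules bilinearI")
 also have "... = sw X X Y ?N (\<lambda>a'' q. \<epsilon> X a'' \<odot>\<^sub>?N (S X Y b \<otimes>\<^sub>?N S X Y q)) a"
 proof (rule sw_cong[OF Ob Ob(1) a])
  fix a'' q assume aq: "a'' : carrier (C X X)" "q : carrier (C X Y)"
  have "sw X Y X ?N (\<lambda>a1 p. ?g a1 p q) a'' = sw X Y X ?N (\<lambda>a1 p. sw X X Y ?N (\<lambda>b'' s. sw X Y X ?N (\<lambda>b1 r. ?f a1 p q b1 r s) b'') b) a''"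
   by (rule sw_cong) (use Ob aq g2 in auto)
  also have "... = sw X X Y ?N (\<lambda>b'' s. sw X Y X ?N (\<lambda>a1 p. sw X Y X ?N (\<lambda>b1 r. ?f a1 p q b1 r s) b'') a'') b"
   by (rule tensor_lift_swap[OF tensor_CP[of X Y Y X] tensor_CP[of X X X Y] N]) (use Ob aq b in "auto intro!: bilinearI lin_rules")
  also have "... = sw X X Y ?N (\<lambda>b'' s. \<epsilon> X b'' \<odot>\<^sub>?N (\<epsilon> X a'' \<odot>\<^sub>?N (S X Y s \<otimes>\<^sub>?N S X Y q))) b"
  proof (rule sw_cong[OF Ob Ob(1) b])
   fix b'' s assume bs: "b'' : carrier (C X X)" "s : carrier (C X Y)"
   \<comment> \<open>The two comultiplications combine into that of the product of
     \<open>a''\<close> and \<open>b''\<close>, to which the antipode law applies.\<close>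
   have "sw X Y X ?N (\<lambda>a1 p. sw X Y X ?N (\<lambda>b1 r. ?f a1 p q b1 r s) b'') a'' =
     sw X Y X ?N (\<lambda>u v. S X Y u \<otimes>\<^sub>?N v \<otimes>\<^sub>?N S X Y s \<otimes>\<^sub>?N S X Y q) (a'' \<otimes>\<^sub>(C X X) b'')"
    by (rule sw_mult[symmetric]) (use Ob aq bs in "auto intro!: bilinearI lin_rules")
   also have "... = \<epsilon> X (a'' \<otimes>\<^sub>(C X X) b'') \<odot>\<^sub>?N (\<one>\<^sub>?N \<otimes>\<^sub>?N S X Y s \<otimes>\<^sub>?N S X Y q)"
    by (rule sw_antipode_left[OF Ob N, where g = "\<lambda>z. z \<otimes>\<^sub>?N S X Y s \<otimes>\<^sub>?N S X Y q"], intro lin_rules)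
     (use Ob aq bs in auto)
   also have "... = \<epsilon> X b'' \<odot>\<^sub>?N (\<epsilon> X a'' \<odot>\<^sub>?N (S X Y s \<otimes>\<^sub>?N S X Y q))"
    using Ob aq bs by (simp add: eps_mult module.smult_assoc1[OF mod, symmetric] k.m_comm)
   finally show "sw X Y X ?N (\<lambda>a1 p. sw X Y X ?N (\<lambda>b1 r. ?f a1 p q b1 r s) b'') a'' =
     \<epsilon> X b'' \<odot>\<^sub>?N (\<epsilon> X a'' \<odot>\<^sub>?N (S X Y s \<otimes>\<^sub>?N S X Y q))" .
  qed
  also have "... = \<epsilon> X a'' \<odot>\<^sub>?N (S X Y b \<otimes>\<^sub>?N S X Y q)"
   by (rule sw_counit_left[OF Ob N _ b], intro lin_rules) (use Ob aq in auto)
  finally show "sw X Y X ?N (\<lambda>a1 p. ?g a1 p q) a'' = \<epsilon> X a'' \<odot>\<^sub>?N (S X Y b \<otimes>\<^sub>?N S X Y q)" .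
 qed
 also have "... = S X Y b \<otimes>\<^sub>?N S X Y a"
  by (rule sw_counit_left[OF Ob N _ a], intro lin_rules) (use Ob b in auto)
 finally show ?thesis using 1 by simp
qed

end

section \<open>The enveloping algebra over \<open>H\<close> from both sides, and the automorphism
  \<mu>\<close>

section \<open>The bimodule algebra of a cogroupoid\<close>

locale cogroupoid_pair = cogroupoid k Ob C \<Delta> \<epsilon> S
 for k :: "'k ring" and Ob :: "'o set" and C :: "'o => 'o => ('k, 'a) module"
  and \<Delta> :: "'o => 'o => 'o => 'a => ('a \<times> 'a) list set" and \<epsilon> :: "'o => 'a => 'k" and S :: "'o => 'o => 'a => 'a" +
 fixes X Y :: 'o and \<xi> :: "'a => 'k"
 assumes X [simp]: "X : Ob" and Y [simp]: "Y : Ob"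
  and S_bij: "bij_betw (S X Y) (carrier (C X Y)) (carrier (C Y X))"
  and S_bij': "bij_betw (S Y X) (carrier (C Y X)) (carrier (C X Y))"
  and \<xi>: "\<xi> : algebra_homs k (C X X) (ground k)"
begin

abbreviation "H \<equiv> C X X"
abbreviation "B \<equiv> C X Y"
abbreviation "G \<equiv> C Y X"
abbreviation "R \<equiv> tensor k B (opposite B)"
abbreviation "BH \<equiv> tensor k B H"
abbreviation "pr \<equiv> pure_tensor k B (opposite B)"
abbreviation "pB \<equiv> pure_tensor k B H"
abbreviation "S2 x \<equiv> S Y X (S X Y x)"

sublocale R: tensor_algebra k B "opposite B"
 by (simp add: tensor_algebra_def opposite_algebra)

sublocale BH: tensor_algebra k B H
 by (simp add: tensor_algebra_def)

lemma R_alg [simp]: "unital_algebra k R" by (rule R.tensor_unital_algebra)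
lemma R_mod [simp]: "module k R" by (rule R.tensor_module)
lemma pB_closed [simp]: "a : carrier B ==> h : carrier H ==> pB a h : carrier BH" by (rule BH.pure_closed)

lemma pr_mult: "a : carrier B ==> b : carrier B ==> a' : carrier B ==> b' : carrier B ==>
  pr a b \<otimes>\<^sub>R pr a' b' = pr (a \<otimes>\<^sub>B a') (b' \<otimes>\<^sub>B b)"
 using R.pure_mult[of a b a' b'] by simp

lemma lin_pr_left: "g : linear_maps k U B ==> w : carrier B ==> (\<lambda>x. pr (g x) w) : linear_maps k U R"
 by (rule lin_pure_left) (simp_all add: opposite_module)

lemma lin_pr_right: "g : linear_maps k U B ==> v : carrier B ==> (\<lambda>x. pr v (g x)) : linear_maps k U R"
 by (rule lin_pure_right) (simp_all add: opposite_module)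

lemma xi_linear: "\<xi> : linear_maps k H (ground k)"
 using \<xi> by (simp add: algebra_homs_def)

lemma xi_closed [simp]: "h : carrier H ==> \<xi> h : carrier k"
 using linear_closed[OF xi_linear] by simp

lemma xi_mult: "h : carrier H ==> h' : carrier H ==> \<xi> (h \<otimes>\<^sub>H h') = \<xi> h \<otimes>\<^sub>k \<xi> h'"
 and xi_one: "\<xi> \<one>\<^sub>H = \<one>\<^sub>k"
 using \<xi> by (auto simp: algebra_homs_def ring_hom_def)

lemma lin_xi: "g : linear_maps k U H ==> (\<lambda>x. \<xi> (g x)) : linear_maps k U (ground k)"
 by (rule linear_comp[OF xi_linear])

lemmas lins = lin_pr_left lin_pr_right lin_xi lin_rules

definition Sinv where "Sinv = inv_into (carrier G) (S Y X)"

lemma Sinv_closed [simp]: "b : carrier B ==> Sinv b : carrier G"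
 unfolding Sinv_def using S_bij' by (metis bij_betw_def inv_into_into)

lemma S_Sinv [simp]: "b : carrier B ==> S Y X (Sinv b) = b"
 unfolding Sinv_def using S_bij' by (metis bij_betw_def f_inv_into_f)

lemma Sinv_S [simp]: "g : carrier G ==> Sinv (S Y X g) = g"
 unfolding Sinv_def using S_bij' by (metis bij_betw_def inv_into_f_f)

lemma Sinv_linear: "Sinv : linear_maps k B G"
proof (rule linear_mapsI)
 interpret B: module k B by simp
 interpret G: module k G by simp
 fix x y assume xy: "x : carrier B" "y : carrier B"
 have "S Y X (Sinv x \<oplus>\<^sub>G Sinv y) = x \<oplus>\<^sub>B y"
  using xy linear_add[OF antipode_linear[of Y X]] by simp
 then show "Sinv (x \<oplus>\<^sub>B y) = Sinv x \<oplus>\<^sub>G Sinv y" using xy Sinv_S by (metis G.a_closed Sinv_closed)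
next
 interpret G: module k G by simp
 fix c x assume cx: "c : carrier k" "x : carrier B"
 have "S Y X (c \<odot>\<^sub>G Sinv x) = c \<odot>\<^sub>B x"
  using cx S_smult by simp
 then show "Sinv (c \<odot>\<^sub>B x) = c \<odot>\<^sub>G Sinv x" using cx Sinv_S by (metis G.smult_closed Sinv_closed)
qed simp

lemma Sinv_mult: "h : carrier G ==> b : carrier B ==> Sinv (S Y X h \<otimes>\<^sub>B b) = Sinv b \<otimes>\<^sub>G h"
 using Sinv_S[of "Sinv b \<otimes>\<^sub>G h"] S_mult[of Y X "Sinv b" h] by simp

lemma sigma_mult: "a : carrier B ==> b : carrier B ==> S2 (a \<otimes>\<^sub>B b) = S2 a \<otimes>\<^sub>B S2 b"
 by (simp add: S_mult)

lemma S_one' [simp]: "S Y X \<one>\<^sub>G = \<one>\<^sub>B" "S X Y \<one>\<^sub>B = \<one>\<^sub>G"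
 by (simp_all add: S_one)

subsection \<open>The homomorphism from \<open>H\<close> to the enveloping algebra\<close>

definition \<delta> where "\<delta> h = sw X Y X R (\<lambda>a g. pr a (S Y X g)) h"

lemma delta_bilinear: "(\<lambda>a g. pr a (S Y X g)) : bilinear_maps k B G R"
 by (auto intro!: bilinearI lins)

lemma delta_linear: "\<delta> : linear_maps k H R"
 unfolding \<delta>_def by (rule sw_linear[OF X X Y R_mod delta_bilinear])

lemma delta_closed [simp]: "h : carrier H ==> \<delta> h : carrier R"
 by (rule linear_closed[OF delta_linear])

lemma delta_one: "\<delta> \<one>\<^sub>H = \<one>\<^sub>R"
 unfolding \<delta>_def using sw_one[OF X X Y R_mod delta_bilinear] by (simp add: R.tensor_one)

lemma delta_smult_one: "c : carrier k ==> \<delta> (c \<odot>\<^sub>H \<one>\<^sub>H) = c \<odot>\<^sub>R \<one>\<^sub>R"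
 using linear_smult[OF delta_linear] by (simp add: delta_one)

lemma pr_delta:
 assumes a: "a : carrier B" and b: "b : carrier B" and h: "h : carrier H"
 shows "pr a b \<otimes>\<^sub>R \<delta> h = sw X Y X R (\<lambda>h1 h2. pr (a \<otimes>\<^sub>B h1) (S Y X h2 \<otimes>\<^sub>B b)) h"
proof -
 have "pr a b \<otimes>\<^sub>R \<delta> h = sw X Y X R (\<lambda>h1 h2. pr a b \<otimes>\<^sub>R pr h1 (S Y X h2)) h"
  unfolding \<delta>_def by (rule sw_map[OF X X Y R_mod R_mod delta_bilinear R.tensor_mult_left_linear h, symmetric]) (use a b in simp)
 also have "... = sw X Y X R (\<lambda>h1 h2. pr (a \<otimes>\<^sub>B h1) (S Y X h2 \<otimes>\<^sub>B b)) h"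
  by (rule sw_cong) (use a b h in "simp_all add: pr_mult")
 finally show ?thesis .
qed

lemma delta_pr:
 assumes a: "a : carrier B" and b: "b : carrier B" and h: "h : carrier H"
 shows "\<delta> h \<otimes>\<^sub>R pr a b = sw X Y X R (\<lambda>h1 h2. pr (h1 \<otimes>\<^sub>B a) (b \<otimes>\<^sub>B S Y X h2)) h"
proof -
 have "\<delta> h \<otimes>\<^sub>R pr a b = sw X Y X R (\<lambda>h1 h2. pr h1 (S Y X h2) \<otimes>\<^sub>R pr a b) h"
  unfolding \<delta>_def by (rule sw_map[OF X X Y R_mod R_mod delta_bilinear R.tensor_mult_right_linear h, symmetric]) (use a b in simp)
 also have "... = sw X Y X R (\<lambda>h1 h2. pr (h1 \<otimes>\<^sub>B a) (b \<otimes>\<^sub>B S Y X h2)) h"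
  by (rule sw_cong) (use a b h in "simp_all add: pr_mult")
 finally show ?thesis .
qed

lemma delta_ring_hom: "\<delta> : ring_hom H R"
proof (rule ring_hom_memI)
 fix h h' assume h: "h : carrier H" and h': "h' : carrier H"
 show "\<delta> h : carrier R" using h by simp
 show "\<delta> (h \<oplus>\<^sub>H h') = \<delta> h \<oplus>\<^sub>R \<delta> h'" by (rule linear_add[OF delta_linear h h'])
 have "\<delta> (h \<otimes>\<^sub>H h') = sw X Y X R (\<lambda>a g. sw X Y X R (\<lambda>a' g'. pr (a \<otimes>\<^sub>B a') (S Y X (g \<otimes>\<^sub>G g'))) h') h"
  unfolding \<delta>_def by (rule sw_mult[OF X X Y R_mod delta_bilinear h h'])
 also have "... = sw X Y X R (\<lambda>a g. pr a (S Y X g) \<otimes>\<^sub>R \<delta> h') h"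
 proof (rule sw_cong[OF X X Y h])
  fix a g assume ag: "a : carrier B" "g : carrier G"
  show "sw X Y X R (\<lambda>a' g'. pr (a \<otimes>\<^sub>B a') (S Y X (g \<otimes>\<^sub>G g'))) h' = pr a (S Y X g) \<otimes>\<^sub>R \<delta> h'"
   using ag h' by (simp add: pr_delta) (rule sw_cong, auto simp: S_mult)
 qed
 also have "... = \<delta> h \<otimes>\<^sub>R \<delta> h'"
  unfolding \<delta>_def[of h] by (rule sw_map[OF X X Y R_mod R_mod delta_bilinear R.tensor_mult_right_linear h]) (use h' in simp)
 finally show "\<delta> (h \<otimes>\<^sub>H h') = \<delta> h \<otimes>\<^sub>R \<delta> h'" .
qed (rule delta_one)

subsection \<open>Freeness on the right\<close>

lemma right_bilinear: "a : carrier B ==> (\<lambda>g1 g2. pB (a \<otimes>\<^sub>B S Y X g1) g2) : bilinear_maps k G H BH"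
 by (auto intro!: bilinearI lins)

text \<open>The inverse antipode enters because \<open>b\<close> has to be written as
  \<open>S(g)\<close>. The coordinates are then dictated by
  \<open>a \<otimes> S(g) = (a S(g_1) \<otimes> 1) \<delta>(g_2)\<close>.\<close>

definition \<Phi> where "\<Phi> = tensor_lift BH (\<lambda>a b. sw Y X X BH (\<lambda>g1 g2. pB (a \<otimes>\<^sub>B S Y X g1) g2) (Sinv b))"

lemma Phi_bilinear: "(\<lambda>a b. sw Y X X BH (\<lambda>g1 g2. pB (a \<otimes>\<^sub>B S Y X g1) g2) (Sinv b)) : bilinear_maps k B (opposite B) BH"
 by (intro bilinearI) (auto intro!: lin_sw_arg lin_sw_param Sinv_linear right_bilinear lins)

lemma Phi_linear: "\<Phi> : linear_maps k R BH"
 unfolding \<Phi>_def by (rule R.lift_linear[OF BH.tensor_module Phi_bilinear])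

lemma Phi_pr: "a : carrier B ==> b : carrier B ==>
  \<Phi> (pr a b) = sw Y X X BH (\<lambda>g1 g2. pB (a \<otimes>\<^sub>B S Y X g1) g2) (Sinv b)"
 unfolding \<Phi>_def by (rule R.lift_pure[OF BH.tensor_module Phi_bilinear]) simp_all

text \<open>With \<open>b = S(g)\<close> the left side is
  \<open>a h_1 S(h_2) S(g_1) \<otimes> g_2 h_3\<close> on a pure tensor, and
  \<open>h_1 S(h_2)\<close> contracts to the counit.\<close>

lemma Phi_right:
 assumes r: "r : carrier R" and h: "h : carrier H"
 shows "\<Phi> (r \<otimes>\<^sub>R \<delta> h) = \<Phi> r \<otimes>\<^sub>BH pB \<one>\<^sub>B h"
proof (rule R.tensor_linear_eq[OF BH.tensor_module linear_comp[OF Phi_linear R.tensor_mult_right_linear]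
   linear_comp[OF BH.tensor_mult_right_linear Phi_linear] _ r])
 show "\<delta> h : carrier R" "pB \<one>\<^sub>B h : carrier BH" using h by simp_all
 fix a b assume a: "a : carrier B" and "b : carrier (opposite B)"
 then have b: "b : carrier B" by simp
 let ?g = "Sinv b"
 have g: "?g : carrier G" using b by simp
 let ?f = "\<lambda>h1 k1 k2 g1 g2. pB (a \<otimes>\<^sub>B (h1 \<otimes>\<^sub>B S Y X k1) \<otimes>\<^sub>B S Y X g1) (g2 \<otimes>\<^sub>H k2)"
 have "\<Phi> (pr a b \<otimes>\<^sub>R \<delta> h) = sw X Y X BH (\<lambda>h1 h2. \<Phi> (pr (a \<otimes>\<^sub>B h1) (S Y X h2 \<otimes>\<^sub>B b))) h"
  unfolding pr_delta[OF a b h]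
  by (rule sw_map[OF X X Y R_mod BH.tensor_module _ Phi_linear h, symmetric]) (use a b in "auto intro!: bilinearI lins")
 also have "... = sw X Y X BH (\<lambda>h1 h2. sw Y X X BH (\<lambda>g1 g2. sw Y X X BH (\<lambda>k1 k2. ?f h1 k1 k2 g1 g2) h2) ?g) h"
 proof (rule sw_cong[OF X X Y h])
  fix h1 h2 assume hh: "h1 : carrier B" "h2 : carrier G"
  have "\<Phi> (pr (a \<otimes>\<^sub>B h1) (S Y X h2 \<otimes>\<^sub>B b)) =
    sw Y X X BH (\<lambda>g1 g2. pB (a \<otimes>\<^sub>B h1 \<otimes>\<^sub>B S Y X g1) g2) (?g \<otimes>\<^sub>G h2)"
   using a b hh by (simp add: Phi_pr Sinv_mult)
  also have "... = sw Y X X BH (\<lambda>g1 g2. sw Y X X BH (\<lambda>k1 k2. pB (a \<otimes>\<^sub>B h1 \<otimes>\<^sub>B S Y X (g1 \<otimes>\<^sub>G k1)) (g2 \<otimes>\<^sub>H k2)) h2) ?g"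
   by (rule sw_mult[OF Y X X BH.tensor_module right_bilinear]) (use a hh g in simp_all)
  also have "... = sw Y X X BH (\<lambda>g1 g2. sw Y X X BH (\<lambda>k1 k2. ?f h1 k1 k2 g1 g2) h2) ?g"
   by (intro sw_cong) (use a b hh in "simp_all add: S_mult assoc_C")
  finally show "\<Phi> (pr (a \<otimes>\<^sub>B h1) (S Y X h2 \<otimes>\<^sub>B b)) = sw Y X X BH (\<lambda>g1 g2. sw Y X X BH (\<lambda>k1 k2. ?f h1 k1 k2 g1 g2) h2) ?g" .
 qed
 also have "... = sw Y X X BH (\<lambda>g1 g2. sw X Y X BH (\<lambda>h1 h2. sw Y X X BH (\<lambda>k1 k2. ?f h1 k1 k2 g1 g2) h2) h) ?g"
  by (rule tensor_lift_swap[OF tensor_CP[of X Y Y X] tensor_CP[of Y X X X] BH.tensor_module])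
   (use a b h in "auto intro!: bilinearI lins")
 also have "... = sw Y X X BH (\<lambda>g1 g2. pB (a \<otimes>\<^sub>B S Y X g1) g2 \<otimes>\<^sub>BH pB \<one>\<^sub>B h) ?g"
 proof (rule sw_cong[OF Y X X g])
  fix g1 g2 assume gg: "g1 : carrier G" "g2 : carrier H"
  have "sw X Y X BH (\<lambda>h1 h2. sw Y X X BH (\<lambda>k1 k2. ?f h1 k1 k2 g1 g2) h2) h =
    sw X X X BH (\<lambda>h' k2. sw X Y X BH (\<lambda>h1 k1. ?f h1 k1 k2 g1 g2) h') h"
   by (rule sw_coassoc[symmetric, where f = "\<lambda>h1 k1 k2. ?f h1 k1 k2 g1 g2"]) (use a gg h in "auto intro!: lins")
  also have "... = sw X X X BH (\<lambda>h' k2. \<epsilon> X h' \<odot>\<^sub>BH pB (a \<otimes>\<^sub>B \<one>\<^sub>B \<otimes>\<^sub>B S Y X g1) (g2 \<otimes>\<^sub>H k2)) h"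
  proof (rule sw_cong[OF X X X h])
   fix h' k2 assume "h' : carrier H" "k2 : carrier H"
   then show "sw X Y X BH (\<lambda>h1 k1. ?f h1 k1 k2 g1 g2) h' = \<epsilon> X h' \<odot>\<^sub>BH pB (a \<otimes>\<^sub>B \<one>\<^sub>B \<otimes>\<^sub>B S Y X g1) (g2 \<otimes>\<^sub>H k2)"
    by (intro sw_antipode_right[OF X Y BH.tensor_module, where g = "\<lambda>z. pB (a \<otimes>\<^sub>B z \<otimes>\<^sub>B S Y X g1) (g2 \<otimes>\<^sub>H k2)"]) (use a gg in "auto intro!: lins")
  qed
  also have "... = pB (a \<otimes>\<^sub>B \<one>\<^sub>B \<otimes>\<^sub>B S Y X g1) (g2 \<otimes>\<^sub>H h)"
   by (rule sw_counit_left[OF X X BH.tensor_module _ h]) (use a gg in "auto intro!: lins")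
  also have "... = pB (a \<otimes>\<^sub>B S Y X g1) g2 \<otimes>\<^sub>BH pB \<one>\<^sub>B h"
   using a gg h by (simp add: BH.pure_mult)
  finally show "sw X Y X BH (\<lambda>h1 h2. sw Y X X BH (\<lambda>k1 k2. ?f h1 k1 k2 g1 g2) h2) h = pB (a \<otimes>\<^sub>B S Y X g1) g2 \<otimes>\<^sub>BH pB \<one>\<^sub>B h" .
 qed
 also have "... = \<Phi> (pr a b) \<otimes>\<^sub>BH pB \<one>\<^sub>B h"
  unfolding Phi_pr[OF a b]
  by (rule sw_map[OF Y X X BH.tensor_module BH.tensor_module right_bilinear[OF a] BH.tensor_mult_right_linear g]) (use h in simp)
 finally show "\<Phi> (pr a b \<otimes>\<^sub>R \<delta> h) = \<Phi> (pr a b) \<otimes>\<^sub>BH pB \<one>\<^sub>B h" .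
qed

definition \<Theta> where "\<Theta> = tensor_lift R (\<lambda>b h. pr b \<one>\<^sub>B \<otimes>\<^sub>R \<delta> h)"

lemma Theta_bilinear: "(\<lambda>b h. pr b \<one>\<^sub>B \<otimes>\<^sub>R \<delta> h) : bilinear_maps k B H R"
 by (auto intro!: bilinearI lins delta_linear)

lemma Theta_linear: "\<Theta> : linear_maps k BH R"
 unfolding \<Theta>_def by (rule BH.lift_linear[OF R_mod Theta_bilinear])

lemma Theta_pB: "b : carrier B ==> h : carrier H ==> \<Theta> (pB b h) = pr b \<one>\<^sub>B \<otimes>\<^sub>R \<delta> h"
 unfolding \<Theta>_def by (rule BH.lift_pure[OF R_mod Theta_bilinear])

text \<open>The sum \<open>a S(g_1) g_2 \<otimes> S(g_3)\<close> contracts to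
  \<open>a \<otimes> S(g)\<close>. This turns expansions of \<open>\<Phi> r\<close> in
  \<open>B \<otimes> H\<close> into expansions of \<open>r\<close>.\<close>

lemma Theta_Phi:
 assumes r: "r : carrier R"
 shows "\<Theta> (\<Phi> r) = r"
proof (rule R.tensor_linear_eq[OF R_mod linear_comp[OF Theta_linear Phi_linear] linear_id _ r])
 fix a b assume a: "a : carrier B" and "b : carrier (opposite B)"
 then have b: "b : carrier B" by simp
 let ?g = "Sinv b"
 have g: "?g : carrier G" using b by simp
 let ?f = "\<lambda>g1 p q. pr (a \<otimes>\<^sub>B (S Y X g1 \<otimes>\<^sub>B p)) (S Y X q)"
 have "\<Theta> (\<Phi> (pr a b)) = sw Y X X R (\<lambda>g1 g2. \<Theta> (pB (a \<otimes>\<^sub>B S Y X g1) g2)) ?g"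
  unfolding Phi_pr[OF a b]
  by (rule sw_map[OF Y X X BH.tensor_module R_mod right_bilinear[OF a] Theta_linear g, symmetric])
 also have "... = sw Y X X R (\<lambda>g1 g2. sw X Y X R (\<lambda>p q. ?f g1 p q) g2) ?g"
 proof (rule sw_cong[OF Y X X g])
  fix g1 g2 assume gg: "g1 : carrier G" "g2 : carrier H"
  show "\<Theta> (pB (a \<otimes>\<^sub>B S Y X g1) g2) = sw X Y X R (\<lambda>p q. ?f g1 p q) g2"
   using a gg by (simp add: Theta_pB pr_delta) (rule sw_cong, auto simp: assoc_C)
 qed
 also have "... = sw Y Y X R (\<lambda>a' q. sw Y X Y R (\<lambda>g1 p. ?f g1 p q) a') ?g"
  by (rule sw_coassoc[symmetric, where f = ?f]) (use a g in "auto intro!: lins")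
 also have "... = sw Y Y X R (\<lambda>a' q. \<epsilon> Y a' \<odot>\<^sub>R pr (a \<otimes>\<^sub>B \<one>\<^sub>B) (S Y X q)) ?g"
 proof (rule sw_cong[OF Y X Y g])
  fix a' q assume "a' : carrier (C Y Y)" "q : carrier G"
  then show "sw Y X Y R (\<lambda>g1 p. ?f g1 p q) a' = \<epsilon> Y a' \<odot>\<^sub>R pr (a \<otimes>\<^sub>B \<one>\<^sub>B) (S Y X q)"
   by (intro sw_antipode_left[OF Y X R_mod, where g = "\<lambda>z. pr (a \<otimes>\<^sub>B z) (S Y X q)"]) (use a in "auto intro!: lins")
 qed
 also have "... = pr (a \<otimes>\<^sub>B \<one>\<^sub>B) (S Y X ?g)"
  by (rule sw_counit_left[OF Y X R_mod _ g]) (use a in "auto intro!: lins")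
 also have "... = pr a b" using a b by simp
 finally show "\<Theta> (\<Phi> (pr a b)) = pr a b" .
qed

subsection \<open>Freeness on the left\<close>

lemma left_bilinear: "b : carrier B ==> (\<lambda>a1 a2. pB (b \<otimes>\<^sub>B S2 a2) a1) : bilinear_maps k H B BH"
 by (auto intro!: bilinearI lins)

text \<open>Read off from \<open>a \<otimes> b = \<delta>(a_1) (1 \<otimes> b S(S(a_2)))\<close>,
  where multiplication in the second factor is reversed.\<close>

definition \<Phi>' where "\<Phi>' = tensor_lift BH (\<lambda>a b. sw X X Y BH (\<lambda>a1 a2. pB (b \<otimes>\<^sub>B S2 a2) a1) a)"

lemma Phi'_bilinear: "(\<lambda>a b. sw X X Y BH (\<lambda>a1 a2. pB (b \<otimes>\<^sub>B S2 a2) a1) a) : bilinear_maps k B (opposite B) BH"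
 by (intro bilinearI) (auto intro!: lin_sw_arg lin_sw_param left_bilinear lins)

lemma Phi'_linear: "\<Phi>' : linear_maps k R BH"
 unfolding \<Phi>'_def by (rule R.lift_linear[OF BH.tensor_module Phi'_bilinear])

lemma Phi'_pr: "a : carrier B ==> b : carrier B ==> \<Phi>' (pr a b) = sw X X Y BH (\<lambda>a1 a2. pB (b \<otimes>\<^sub>B S2 a2) a1) a"
 unfolding \<Phi>'_def by (rule R.lift_pure[OF BH.tensor_module Phi'_bilinear]) simp_all

text \<open>The left side is \<open>b S(h_3) S(S(h_2 a_2)) \<otimes> h_1 a_1\<close> on a pure
  tensor. Here \<open>S(h_3) S(S(h_2)) = S(S(h_2) h_3)\<close> contracts to the counit.\<close>

lemma Phi'_left:
 assumes r: "r : carrier R" and h: "h : carrier H"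
 shows "\<Phi>' (\<delta> h \<otimes>\<^sub>R r) = pB \<one>\<^sub>B h \<otimes>\<^sub>BH \<Phi>' r"
proof (rule R.tensor_linear_eq[OF BH.tensor_module linear_comp[OF Phi'_linear R.tensor_mult_left_linear]
   linear_comp[OF BH.tensor_mult_left_linear Phi'_linear] _ r])
 show "\<delta> h : carrier R" "pB \<one>\<^sub>B h : carrier BH" using h by simp_all
 fix a b assume a: "a : carrier B" and "b : carrier (opposite B)"
 then have b: "b : carrier B" by simp
 let ?s = "\<lambda>z k1. sw X X Y BH (\<lambda>a1 a2. pB (b \<otimes>\<^sub>B S Y X z \<otimes>\<^sub>B S2 a2) (k1 \<otimes>\<^sub>H a1)) a"
 let ?f = "\<lambda>k1 k2 h2. ?s (S X Y k2 \<otimes>\<^sub>G h2) k1"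
 have "\<Phi>' (\<delta> h \<otimes>\<^sub>R pr a b) = sw X Y X BH (\<lambda>h1 h2. \<Phi>' (pr (h1 \<otimes>\<^sub>B a) (b \<otimes>\<^sub>B S Y X h2))) h"
  unfolding delta_pr[OF a b h]
  by (rule sw_map[OF X X Y R_mod BH.tensor_module _ Phi'_linear h, symmetric]) (use a b in "auto intro!: bilinearI lins")
 also have "... = sw X Y X BH (\<lambda>h1 h2. sw X X Y BH (\<lambda>k1 k2. ?f k1 k2 h2) h1) h"
 proof (rule sw_cong[OF X X Y h])
  fix h1 h2 assume hh: "h1 : carrier B" "h2 : carrier G"
  have "\<Phi>' (pr (h1 \<otimes>\<^sub>B a) (b \<otimes>\<^sub>B S Y X h2)) =
    sw X X Y BH (\<lambda>k1 k2. sw X X Y BH (\<lambda>a1 a2. pB (b \<otimes>\<^sub>B S Y X h2 \<otimes>\<^sub>B S2 (k2 \<otimes>\<^sub>B a2)) (k1 \<otimes>\<^sub>H a1)) a) h1"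
   using a b hh by (simp add: Phi'_pr) (rule sw_mult[OF X Y X BH.tensor_module left_bilinear], simp_all)
  also have "... = sw X X Y BH (\<lambda>k1 k2. ?f k1 k2 h2) h1"
   by (intro sw_cong) (use a b hh in "simp_all add: S_mult assoc_C")
  finally show "\<Phi>' (pr (h1 \<otimes>\<^sub>B a) (b \<otimes>\<^sub>B S Y X h2)) = sw X X Y BH (\<lambda>k1 k2. ?f k1 k2 h2) h1" .
 qed
 also have "... = sw X X X BH (\<lambda>k1 c. sw X Y X BH (\<lambda>k2 h2. ?f k1 k2 h2) c) h"
  by (rule sw_coassoc[where f = ?f]) (use a b h in "auto intro!: bilinearI lins")
 also have "... = sw X X X BH (\<lambda>k1 c. \<epsilon> X c \<odot>\<^sub>BH ?s \<one>\<^sub>G k1) h"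
 proof (rule sw_cong[OF X X X h])
  fix k1 c assume "k1 : carrier H" "c : carrier H"
  then show "sw X Y X BH (\<lambda>k2 h2. ?f k1 k2 h2) c = \<epsilon> X c \<odot>\<^sub>BH ?s \<one>\<^sub>G k1"
   by (intro sw_antipode_left[OF X Y BH.tensor_module, where g = "\<lambda>z. ?s z k1"]) (use a b in "auto intro!: bilinearI lins")
 qed
 also have "... = ?s \<one>\<^sub>G h"
  by (rule sw_counit_right[OF X X BH.tensor_module _ h]) (use a b in "auto intro!: bilinearI lins")
 also have "... = sw X X Y BH (\<lambda>a1 a2. pB \<one>\<^sub>B h \<otimes>\<^sub>BH pB (b \<otimes>\<^sub>B S2 a2) a1) a"
  by (rule sw_cong) (use a b h in "simp_all add: BH.pure_mult")
 also have "... = pB \<one>\<^sub>B h \<otimes>\<^sub>BH \<Phi>' (pr a b)"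
  unfolding Phi'_pr[OF a b]
  by (rule sw_map[OF X Y X BH.tensor_module BH.tensor_module left_bilinear[OF b] BH.tensor_mult_left_linear a]) (use h in simp)
 finally show "\<Phi>' (\<delta> h \<otimes>\<^sub>R pr a b) = pB \<one>\<^sub>B h \<otimes>\<^sub>BH \<Phi>' (pr a b)" .
qed

definition \<Theta>' where "\<Theta>' = tensor_lift R (\<lambda>b h. \<delta> h \<otimes>\<^sub>R pr \<one>\<^sub>B b)"

lemma Theta'_bilinear: "(\<lambda>b h. \<delta> h \<otimes>\<^sub>R pr \<one>\<^sub>B b) : bilinear_maps k B H R"
 by (auto intro!: bilinearI lins delta_linear)

lemma Theta'_linear: "\<Theta>' : linear_maps k BH R"
 unfolding \<Theta>'_def by (rule BH.lift_linear[OF R_mod Theta'_bilinear])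

lemma Theta'_pB: "b : carrier B ==> h : carrier H ==> \<Theta>' (pB b h) = \<delta> h \<otimes>\<^sub>R pr \<one>\<^sub>B b"
 unfolding \<Theta>'_def by (rule BH.lift_pure[OF R_mod Theta'_bilinear])

text \<open>The expansion \<open>a_1 \<otimes> b S(a_2 S(a_3))\<close> contracts to
  \<open>a \<otimes> b\<close>.\<close>

lemma Theta'_Phi':
 assumes r: "r : carrier R"
 shows "\<Theta>' (\<Phi>' r) = r"
proof (rule R.tensor_linear_eq[OF R_mod linear_comp[OF Theta'_linear Phi'_linear] linear_id _ r])
 fix a b assume a: "a : carrier B" and "b : carrier (opposite B)"
 then have b: "b : carrier B" by simp
 let ?f = "\<lambda>p q a2. pr p (b \<otimes>\<^sub>B S Y X (q \<otimes>\<^sub>G S X Y a2))"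
 have "\<Theta>' (\<Phi>' (pr a b)) = sw X X Y R (\<lambda>a1 a2. \<Theta>' (pB (b \<otimes>\<^sub>B S2 a2) a1)) a"
  unfolding Phi'_pr[OF a b]
  by (rule sw_map[OF X Y X BH.tensor_module R_mod left_bilinear[OF b] Theta'_linear a, symmetric])
 also have "... = sw X X Y R (\<lambda>a1 a2. sw X Y X R (\<lambda>p q. ?f p q a2) a1) a"
 proof (rule sw_cong[OF X Y X a])
  fix a1 a2 assume aa: "a1 : carrier H" "a2 : carrier B"
  show "\<Theta>' (pB (b \<otimes>\<^sub>B S2 a2) a1) = sw X Y X R (\<lambda>p q. ?f p q a2) a1"
   using b aa by (simp add: Theta'_pB delta_pr) (rule sw_cong, auto simp: assoc_C S_mult)
 qed
 also have "... = sw X Y Y R (\<lambda>p c. sw Y X Y R (\<lambda>q a2. ?f p q a2) c) a"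
  by (rule sw_coassoc[where f = ?f]) (use a b in "auto intro!: lins")
 also have "... = sw X Y Y R (\<lambda>p c. \<epsilon> Y c \<odot>\<^sub>R pr p (b \<otimes>\<^sub>B S Y X \<one>\<^sub>G)) a"
 proof (rule sw_cong[OF X Y Y a])
  fix p c assume "p : carrier B" "c : carrier (C Y Y)"
  then show "sw Y X Y R (\<lambda>q a2. ?f p q a2) c = \<epsilon> Y c \<odot>\<^sub>R pr p (b \<otimes>\<^sub>B S Y X \<one>\<^sub>G)"
   by (intro sw_antipode_right[OF Y X R_mod, where g = "\<lambda>z. pr p (b \<otimes>\<^sub>B S Y X z)"]) (use b in "auto intro!: lins")
 qed
 also have "... = pr a (b \<otimes>\<^sub>B S Y X \<one>\<^sub>G)"
  by (rule sw_counit_right[OF X Y R_mod _ a]) (use b in "auto intro!: lins")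
 also have "... = pr a b" using b by simp
 finally show "\<Theta>' (\<Phi>' (pr a b)) = pr a b" .
qed

subsection \<open>The Nakayama automorphism\<close>

definition \<mu> where "\<mu> x = sw X X Y B (\<lambda>x1 x2. \<xi> x1 \<odot>\<^sub>B S2 x2) x"

lemma mu_bilinear: "(\<lambda>x1 x2. \<xi> x1 \<odot>\<^sub>B S2 x2) : bilinear_maps k H B B"
 by (auto intro!: bilinearI lins)

lemma mu_linear: "\<mu> : linear_maps k B B"
 unfolding \<mu>_def by (rule sw_linear[OF X Y X _ mu_bilinear]) simp

lemma mu_closed [simp]: "x : carrier B ==> \<mu> x : carrier B"
 by (rule linear_closed[OF mu_linear])

lemma mu_one: "\<mu> \<one>\<^sub>B = \<one>\<^sub>B"
 unfolding \<mu>_def using sw_one[OF X Y X _ mu_bilinear] by (simp add: xi_one)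

lemma mu_mult:
 assumes x: "x : carrier B" and y: "y : carrier B"
 shows "\<mu> (x \<otimes>\<^sub>B y) = \<mu> x \<otimes>\<^sub>B \<mu> y"
proof -
 have m: "module k B" by simp
 have "\<mu> (x \<otimes>\<^sub>B y) = sw X X Y B (\<lambda>a b. sw X X Y B (\<lambda>a' b'. \<xi> (a \<otimes>\<^sub>H a') \<odot>\<^sub>B S2 (b \<otimes>\<^sub>B b')) y) x"
  unfolding \<mu>_def by (rule sw_mult[OF X Y X m mu_bilinear x y])
 also have "... = sw X X Y B (\<lambda>a b. (\<xi> a \<odot>\<^sub>B S2 b) \<otimes>\<^sub>B \<mu> y) x"
 proof (rule sw_cong[OF X Y X x])
  fix a b assume ab: "a : carrier H" "b : carrier B"
  have "sw X X Y B (\<lambda>a' b'. \<xi> (a \<otimes>\<^sub>H a') \<odot>\<^sub>B S2 (b \<otimes>\<^sub>B b')) y =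
    sw X X Y B (\<lambda>a' b'. (\<xi> a \<odot>\<^sub>B S2 b) \<otimes>\<^sub>B (\<xi> a' \<odot>\<^sub>B S2 b')) y"
   by (rule sw_cong)
    (use ab y in "simp_all add: xi_mult sigma_mult smult_mult_l smult_mult_r module.smult_assoc1[OF m, symmetric] k.m_comm")
  also have "... = (\<xi> a \<odot>\<^sub>B S2 b) \<otimes>\<^sub>B \<mu> y"
   unfolding \<mu>_def by (rule sw_map[OF X Y X m m mu_bilinear mult_left_linear y]) (use ab in simp_all)
  finally show "sw X X Y B (\<lambda>a' b'. \<xi> (a \<otimes>\<^sub>H a') \<odot>\<^sub>B S2 (b \<otimes>\<^sub>B b')) y = (\<xi> a \<odot>\<^sub>B S2 b) \<otimes>\<^sub>B \<mu> y" .
 qed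
 also have "... = \<mu> x \<otimes>\<^sub>B \<mu> y"
  unfolding \<mu>_def[of x] by (rule sw_map[OF X Y X m m mu_bilinear mult_right_linear x]) (use y in simp_all)
 finally show ?thesis .
qed

lemma mu_hom: "\<mu> : algebra_homs k B B"
 unfolding algebra_homs_def using mu_linear
 by (auto intro!: ring_hom_memI simp: mu_one mu_mult linear_add[OF mu_linear])

text \<open>The left winding map of \<chi>. The map \<mu> is \<open>twist \<xi>\<close> followed by
  two antipodes, which separates bijectivity into two questions.\<close>

definition twist where "twist \<chi> x = sw X X Y B (\<lambda>a b. \<chi> a \<odot>\<^sub>B b) x"

lemma twist_bilinear: "\<chi> : linear_maps k H (ground k) ==> (\<lambda>a b. \<chi> a \<odot>\<^sub>B b) : bilinear_maps k H B B"
 using linear_closed[of \<chi> k H "ground k"] by (auto intro!: bilinearI lins)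

lemma twist_linear: "\<chi> : linear_maps k H (ground k) ==> twist \<chi> : linear_maps k B B"
 unfolding twist_def by (rule sw_linear[OF X Y X _ twist_bilinear]) simp_all

text \<open>By coassociativity winding maps compose according to the convolution product of
  functionals, and \<open>inv\<close> says that this product is the counit.\<close>

lemma twist_twist:
 assumes \<chi>: "\<chi> : linear_maps k H (ground k)" and \<chi>': "\<chi>' : linear_maps k H (ground k)"
  and inv: "\<And>h b. h : carrier H ==> b : carrier B ==>
   sw X X X B (\<lambda>a a'. (\<chi> a \<otimes>\<^sub>k \<chi>' a') \<odot>\<^sub>B b) h = \<epsilon> X h \<odot>\<^sub>B b"
  and x: "x : carrier B"
 shows "twist \<chi>' (twist \<chi> x) = x"
proof -
 have m: "module k B" by simp
 have cl: "\<chi> h : carrier k" "\<chi>' h : carrier k" if "h : carrier H" for h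
  using linear_closed[OF \<chi> that] linear_closed[OF \<chi>' that] by auto
 have l1: "(\<lambda>x. c \<otimes>\<^sub>k g x) : linear_maps k H (ground k)" "(\<lambda>x. g x \<otimes>\<^sub>k c) : linear_maps k H (ground k)"
  if "g : linear_maps k H (ground k)" "c : carrier k" for g c
  using lin_mult_left[OF ground_alg, of c g H] lin_mult_right[OF ground_alg that(1), of c] that by simp_all
 have "twist \<chi>' (twist \<chi> x) = sw X X Y B (\<lambda>a b. twist \<chi>' (\<chi> a \<odot>\<^sub>B b)) x"
  unfolding twist_def[of \<chi>]
  by (rule sw_map[OF X Y X m m twist_bilinear[OF \<chi>] twist_linear[OF \<chi>'] x, symmetric])
 also have "... = sw X X Y B (\<lambda>a b. sw X X Y B (\<lambda>a' b'. (\<chi> a \<otimes>\<^sub>k \<chi>' a') \<odot>\<^sub>B b') b) x"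
 proof (rule sw_cong[OF X Y X x])
  fix a b assume ab: "a : carrier H" "b : carrier B"
  have l: "(\<lambda>z. \<chi> a \<odot>\<^sub>B z) : linear_maps k B B" by (rule lin_smult_right[OF m cl(1)[OF ab(1)] linear_id])
  have "twist \<chi>' (\<chi> a \<odot>\<^sub>B b) = \<chi> a \<odot>\<^sub>B twist \<chi>' b"
   by (rule linear_smult[OF twist_linear[OF \<chi>'] cl(1)[OF ab(1)] ab(2)])
  also have "... = sw X X Y B (\<lambda>a' b'. \<chi> a \<odot>\<^sub>B (\<chi>' a' \<odot>\<^sub>B b')) b"
   unfolding twist_def by (rule sw_map[OF X Y X m m twist_bilinear[OF \<chi>'] l ab(2), symmetric])
  also have "... = sw X X Y B (\<lambda>a' b'. (\<chi> a \<otimes>\<^sub>k \<chi>' a') \<odot>\<^sub>B b') b"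
   by (rule sw_cong) (use ab cl in "simp_all add: module.smult_assoc1[OF m, symmetric] k.m_comm")
  finally show "twist \<chi>' (\<chi> a \<odot>\<^sub>B b) = sw X X Y B (\<lambda>a' b'. (\<chi> a \<otimes>\<^sub>k \<chi>' a') \<odot>\<^sub>B b') b" .
 qed
 also have "... = sw X X Y B (\<lambda>c b. sw X X X B (\<lambda>a a'. (\<chi> a \<otimes>\<^sub>k \<chi>' a') \<odot>\<^sub>B b) c) x"
  by (rule sw_coassoc[symmetric, where f = "\<lambda>a a' b. (\<chi> a \<otimes>\<^sub>k \<chi>' a') \<odot>\<^sub>B b"])
   (use x cl \<chi> \<chi>' in "auto intro!: lin_smult_left lin_smult_right linear_id l1")
 also have "... = sw X X Y B (\<lambda>c b. \<epsilon> X c \<odot>\<^sub>B b) x"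
  by (rule sw_cong[OF X Y X x]) (rule inv)
 also have "... = x" by (rule counit_left[OF X Y x])
 finally show ?thesis .
qed

text \<open>For a character \<xi> the functional \<xi> after the antipode of \<open>H\<close> is its
  convolution inverse, so winding by \<xi> is bijective; the two antipodes are bijective by
  hypothesis.\<close>

lemma mu_bij: "bij_betw \<mu> (carrier B) (carrier B)"
proof -
 let ?\<xi>' = "\<lambda>h. \<xi> (S X X h)"
 have l: "?\<xi>' : linear_maps k H (ground k)" by (auto intro!: lins)
 have m: "module k B" by simp
 have 1: "twist \<xi> (twist ?\<xi>' x) = x" if "x : carrier B" for x
 proof (rule twist_twist[OF l xi_linear _ that])
  fix h b assume h: "h : carrier H" and b: "b : carrier B"
  have "sw X X X B (\<lambda>a a'. (\<xi> (S X X a) \<otimes>\<^sub>k \<xi> a') \<odot>\<^sub>B b) h = sw X X X B (\<lambda>a a'. \<xi> (S X X a \<otimes>\<^sub>H a') \<odot>\<^sub>B b) h"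
   by (rule sw_cong) (use h in "simp_all add: xi_mult")
  also have "... = \<epsilon> X h \<odot>\<^sub>B (\<xi> \<one>\<^sub>H \<odot>\<^sub>B b)"
   by (rule sw_antipode_left[OF X X m _ h, where g = "\<lambda>z. \<xi> z \<odot>\<^sub>B b"]) (use b in "auto intro!: lins")
  finally show "sw X X X B (\<lambda>a a'. (\<xi> (S X X a) \<otimes>\<^sub>k \<xi> a') \<odot>\<^sub>B b) h = \<epsilon> X h \<odot>\<^sub>B b"
   using b by (simp add: xi_one)
 qed
 have 2: "twist ?\<xi>' (twist \<xi> x) = x" if "x : carrier B" for x
 proof (rule twist_twist[OF xi_linear l _ that])
  fix h b assume h: "h : carrier H" and b: "b : carrier B"
  have "sw X X X B (\<lambda>a a'. (\<xi> a \<otimes>\<^sub>k \<xi> (S X X a')) \<odot>\<^sub>B b) h = sw X X X B (\<lambda>a a'. \<xi> (a \<otimes>\<^sub>H S X X a') \<odot>\<^sub>B b) h"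
   by (rule sw_cong) (use h in "simp_all add: xi_mult")
  also have "... = \<epsilon> X h \<odot>\<^sub>B (\<xi> \<one>\<^sub>H \<odot>\<^sub>B b)"
   by (rule sw_antipode_right[OF X X m _ h, where g = "\<lambda>z. \<xi> z \<odot>\<^sub>B b"]) (use b in "auto intro!: lins")
  finally show "sw X X X B (\<lambda>a a'. (\<xi> a \<otimes>\<^sub>k \<xi> (S X X a')) \<odot>\<^sub>B b) h = \<epsilon> X h \<odot>\<^sub>B b"
   using b by (simp add: xi_one)
 qed
 have "bij_betw (twist \<xi>) (carrier B) (carrier B)"
  by (rule bij_betw_byWitness[where f' = "twist ?\<xi>'"])
   (use 1 2 linear_closed[OF twist_linear[OF l]] linear_closed[OF twist_linear[OF xi_linear]] in auto)
 then have "bij_betw (\<lambda>x. S2 (twist \<xi> x)) (carrier B) (carrier B)"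
  using bij_betw_trans[OF bij_betw_trans[OF _ S_bij] S_bij'] by (auto simp: comp_def)
 moreover have "S2 (twist \<xi> x) = \<mu> x" if x: "x : carrier B" for x
 proof -
  have sl: "(\<lambda>x. S2 x) : linear_maps k B B" by (auto intro!: lins)
  have "S2 (twist \<xi> x) = sw X X Y B (\<lambda>a b. S2 (\<xi> a \<odot>\<^sub>B b)) x"
   unfolding twist_def by (rule sw_map[OF X Y X m m twist_bilinear[OF xi_linear] sl x, symmetric])
  also have "... = \<mu> x" unfolding \<mu>_def by (rule sw_cong) (use x in "simp_all add: S_smult")
  finally show ?thesis .
 qed
 ultimately show ?thesis by (subst bij_betw_cong[symmetric]) auto
qed

definition \<pi> where "\<pi> = tensor_lift B (\<lambda>a b. b \<otimes>\<^sub>B \<mu> a)"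

lemma lin_mu: "g : linear_maps k U B ==> (\<lambda>x. \<mu> (g x)) : linear_maps k U B"
 by (rule linear_comp[OF mu_linear])

lemma pi_bilinear: "(\<lambda>a b. b \<otimes>\<^sub>B \<mu> a) : bilinear_maps k B (opposite B) B"
 by (intro bilinearI) (auto intro!: lins lin_mu)

lemma pi_linear: "\<pi> : linear_maps k R B"
 unfolding \<pi>_def by (rule R.lift_linear[OF _ pi_bilinear]) simp

lemma pi_pr: "a : carrier B ==> b : carrier B ==> \<pi> (pr a b) = b \<otimes>\<^sub>B \<mu> a"
 unfolding \<pi>_def by (rule R.lift_pure[OF _ pi_bilinear]) simp_all

text \<open>On a pure tensor the left side is \<open>\<xi>(h_1) b S(S(h_2) h_3) \<mu>(a)\<close>,
  once \<mu> is expanded at the first component of \<open>h\<close>. This is the relation that makes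
  \<pi> factor through the tensor product with \<xi> over \<open>H\<close>.\<close>

lemma pi_delta:
 assumes r: "r : carrier R" and h: "h : carrier H"
 shows "\<pi> (\<delta> h \<otimes>\<^sub>R r) = \<xi> h \<odot>\<^sub>B \<pi> r"
proof -
 have m: "module k B" by simp
 have l: "(\<lambda>r. \<xi> h \<odot>\<^sub>B \<pi> r) : linear_maps k R B"
  by (rule lin_smult_right[OF m _ pi_linear]) (use h in simp)
 show ?thesis
 proof (rule R.tensor_linear_eq[OF m linear_comp[OF pi_linear R.tensor_mult_left_linear] l _ r])
  show "\<delta> h : carrier R" using h by simp
  fix a b assume a: "a : carrier B" and "b : carrier (opposite B)"
  then have b: "b : carrier B" by simp
  let ?f = "\<lambda>k1 k2 h2. \<xi> k1 \<odot>\<^sub>B (b \<otimes>\<^sub>B S Y X (S X Y k2 \<otimes>\<^sub>G h2) \<otimes>\<^sub>B \<mu> a)"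
  have "\<pi> (\<delta> h \<otimes>\<^sub>R pr a b) = sw X Y X B (\<lambda>h1 h2. \<pi> (pr (h1 \<otimes>\<^sub>B a) (b \<otimes>\<^sub>B S Y X h2))) h"
   unfolding delta_pr[OF a b h]
   by (rule sw_map[OF X X Y R_mod m _ pi_linear h, symmetric]) (use a b in "auto intro!: bilinearI lins")
  also have "... = sw X Y X B (\<lambda>h1 h2. sw X X Y B (\<lambda>k1 k2. ?f k1 k2 h2) h1) h"
  proof (rule sw_cong[OF X X Y h])
   fix h1 h2 assume hh: "h1 : carrier B" "h2 : carrier G"
   have lg: "(\<lambda>z. b \<otimes>\<^sub>B S Y X h2 \<otimes>\<^sub>B z \<otimes>\<^sub>B \<mu> a) : linear_maps k B B"
    using a b hh by (auto intro!: lins)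
   have "\<pi> (pr (h1 \<otimes>\<^sub>B a) (b \<otimes>\<^sub>B S Y X h2)) = b \<otimes>\<^sub>B S Y X h2 \<otimes>\<^sub>B \<mu> h1 \<otimes>\<^sub>B \<mu> a"
    using a b hh by (simp add: pi_pr mu_mult assoc_C)
   also have "... = sw X X Y B (\<lambda>k1 k2. b \<otimes>\<^sub>B S Y X h2 \<otimes>\<^sub>B (\<xi> k1 \<odot>\<^sub>B S2 k2) \<otimes>\<^sub>B \<mu> a) h1"
    unfolding \<mu>_def[of h1] by (rule sw_map[OF X Y X m m mu_bilinear lg hh(1), symmetric])
   also have "... = sw X X Y B (\<lambda>k1 k2. ?f k1 k2 h2) h1"
    by (rule sw_cong) (use a b hh in "simp_all add: smult_mult_l smult_mult_r S_mult assoc_C")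
   finally show "\<pi> (pr (h1 \<otimes>\<^sub>B a) (b \<otimes>\<^sub>B S Y X h2)) = sw X X Y B (\<lambda>k1 k2. ?f k1 k2 h2) h1" .
  qed
  also have "... = sw X X X B (\<lambda>k1 c. sw X Y X B (\<lambda>k2 h2. ?f k1 k2 h2) c) h"
   by (rule sw_coassoc[where f = ?f]) (use a b h in "auto intro!: lins")
  also have "... = sw X X X B (\<lambda>k1 c. \<epsilon> X c \<odot>\<^sub>B (\<xi> k1 \<odot>\<^sub>B (b \<otimes>\<^sub>B S Y X \<one>\<^sub>G \<otimes>\<^sub>B \<mu> a))) h"
  proof (rule sw_cong[OF X X X h])
   fix k1 c assume "k1 : carrier H" "c : carrier H"
   then show "sw X Y X B (\<lambda>k2 h2. ?f k1 k2 h2) c = \<epsilon> X c \<odot>\<^sub>B (\<xi> k1 \<odot>\<^sub>B (b \<otimes>\<^sub>B S Y X \<one>\<^sub>G \<otimes>\<^sub>B \<mu> a))"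
    by (intro sw_antipode_left[OF X Y m, where g = "\<lambda>z. \<xi> k1 \<odot>\<^sub>B (b \<otimes>\<^sub>B S Y X z \<otimes>\<^sub>B \<mu> a)"]) (use a b in "auto intro!: lins")
  qed
  also have "... = \<xi> h \<odot>\<^sub>B (b \<otimes>\<^sub>B S Y X \<one>\<^sub>G \<otimes>\<^sub>B \<mu> a)"
   by (rule sw_counit_right[OF X X m _ h]) (use a b in "auto intro!: lins")
  also have "... = \<xi> h \<odot>\<^sub>B \<pi> (pr a b)" using a b by (simp add: pi_pr)
  finally show "\<pi> (\<delta> h \<otimes>\<^sub>R pr a b) = \<xi> h \<odot>\<^sub>B \<pi> (pr a b)" .
 qed
qed

end

section \<open>The trivial module of an augmented algebra and its resolution\<close>

section \<open>Bimodules and characters\<close>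

lemma smult_linear_fun:
 assumes A: "module k A" and a: "a : carrier A"
 shows "(\<lambda>c. c \<odot>\<^sub>A a) : linear_maps k (ground k) A"
proof -
 interpret module k A by fact
 show ?thesis using a by (intro linear_mapsI) (simp_all add: smult_l_distr smult_assoc1)
qed

locale bimodule_algebra =
 fixes k :: "'k ring" and A :: "('k, 'a) module"
 assumes algebra: "unital_algebra k A"
begin

sublocale T: tensor_algebra k A "opposite A"
 by (simp add: tensor_algebra_def algebra opposite_algebra)

abbreviation "pure \<equiv> pure_tensor k A (opposite A)"

definition act where "act r x = tensor_lift A (\<lambda>a b. a \<otimes>\<^sub>A x \<otimes>\<^sub>A b) r"

lemma act_bilinear: "x : carrier A ==> (\<lambda>a b. a \<otimes>\<^sub>A x \<otimes>\<^sub>A b) : bilinear_maps k A (opposite A) A"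
 by (intro bilinearI) (auto intro!: lin_mult_left[OF algebra] lin_mult_right[OF algebra] linear_id)

lemma act_linear: "x : carrier A ==> (\<lambda>r. act r x) : linear_maps k T.T A"
 unfolding act_def by (rule T.lift_linear[OF T.V.module_axioms act_bilinear])

lemma act_linear_right: "r : carrier T.T ==> act r : linear_maps k A A"
 unfolding act_def[abs_def]
 by (rule T.lift_parametric_linear[OF T.V.module_axioms T.V.module_axioms])
  (auto intro!: act_bilinear lin_mult_left[OF algebra] lin_mult_right[OF algebra] linear_id)

lemma act_closed [simp]: "r : carrier T.T ==> x : carrier A ==> act r x : carrier A"
 by (rule linear_closed[OF act_linear_right])

lemma act_pure: "a : carrier A ==> b : carrier A ==> x : carrier A ==> act (pure a b) x = a \<otimes>\<^sub>A x \<otimes>\<^sub>A b"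
 unfolding act_def by (rule T.lift_pure[OF T.V.module_axioms act_bilinear]) simp_all

lemma act_mult:
 assumes r: "r : carrier T.T" and s: "s : carrier T.T" and x: "x : carrier A"
 shows "act (r \<otimes>\<^sub>T.T s) x = act r (act s x)"
proof (rule T.tensor_linear_eq[OF T.V.module_axioms linear_comp[OF act_linear T.tensor_mult_right_linear] act_linear _ r])
 fix a b assume a: "a : carrier A" and "b : carrier (opposite A)"
 then have b: "b : carrier A" by simp
 show "act (pure a b \<otimes>\<^sub>T.T s) x = act (pure a b) (act s x)"
 proof (rule T.tensor_linear_eq[OF T.V.module_axioms linear_comp[OF act_linear T.tensor_mult_left_linear]
    linear_comp[OF act_linear_right act_linear] _ s])
  fix a' b' assume a': "a' : carrier A" and "b' : carrier (opposite A)"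
  then have b': "b' : carrier A" by simp
  show "act (pure a b \<otimes>\<^sub>T.T pure a' b') x = act (pure a b) (act (pure a' b') x)"
   using a b a' b' x T.pure_mult[of a b a' b'] by (simp add: act_pure T.VR.m_assoc)
 qed (use a b x in simp_all)
qed (use s x in simp_all)

lemma regular_bimodule_simps [simp]:
 "carrier (regular_bimodule A) = carrier A" "add (regular_bimodule A) = add A"
 "zero (regular_bimodule A) = zero A" "smult (regular_bimodule A) = act"
 by (simp_all add: regular_bimodule_def act_def fun_eq_iff)

lemma regular_bimodule_additive [simp]:
 "additive_maps (regular_bimodule A) N = additive_maps A N"
 "additive_maps M (regular_bimodule A) = additive_maps M A"
 by (simp_all add: regular_bimodule_def)

lemma regular_bimodule_module: "left_module T.T (regular_bimodule A)"
proof (intro left_module.intro left_module_axioms.intro T.tensor_ring)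
 show "abelian_group (regular_bimodule A)"
  unfolding regular_bimodule_def by (rule with_action_abelian) (rule T.VR.is_abelian_group)
qed (simp_all add: act_mult linear_add[OF act_linear] linear_add[OF act_linear_right] T.tensor_one act_pure)

end

lemma character_left_module:
 assumes k: "field k" and A: "unital_algebra k A" and \<chi>: "\<chi> : algebra_homs k A (ground k)"
 shows "left_module A (character_module k \<chi>)"
proof -
 interpret k: field k by fact
 have c: "\<chi> : carrier A \<rightarrow> carrier k" "\<chi> : ring_hom A (ground k)" using \<chi> by (auto simp: algebra_homs_def linear_maps_def)
 have "\<chi> \<one>\<^sub>A = \<one>\<^sub>k" using ring_hom_one[OF c(2)] by simp
 moreover have "\<chi> (x \<otimes>\<^sub>A y) = \<chi> x \<otimes>\<^sub>k \<chi> y" "\<chi> (x \<oplus>\<^sub>A y) = \<chi> x \<oplus>\<^sub>k \<chi> y" if "x : carrier A" "y : carrier A" for x y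
  using ring_hom_mult[OF c(2) that] ring_hom_add[OF c(2) that] by simp_all
 ultimately show ?thesis unfolding character_module_def using c(1)
  by (intro left_module.intro left_module_axioms.intro with_action_abelian unital_algebraD(2)[OF A] k.is_abelian_group)
   (auto simp: Pi_iff k.l_distr k.r_distr k.m_assoc)
qed

locale augmented_algebra = bimodule_algebra k A
 for k :: "'k ring" and A :: "('k, 'a) module" +
 fixes \<epsilon> :: "'a => 'k"
 assumes ground: "field k" and augmentation: "\<epsilon> : algebra_homs k A (ground k)"
begin

text \<open>The field is commutative, so reversing the product of \<open>A\<close> does not affect a
  character.\<close>

lemma augmentation_opposite: "\<epsilon> : algebra_homs k (opposite A) (ground k)"
 using augmentation by (auto simp: algebra_homs_def ring_hom_def T.V.R.m_comm Pi_iff)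

sublocale T: augmented_tensor k A "opposite A" \<epsilon>
 by (intro augmented_tensor.intro T.tensor_algebra_axioms augmented_tensor_axioms.intro ground augmentation_opposite)

lemma aug_linear: "\<epsilon> : linear_maps k A (ground k)"
 using augmentation by (simp add: algebra_homs_def)

lemma aug_smult_one: "c : carrier k ==> \<epsilon> (c \<odot>\<^sub>A \<one>\<^sub>A) = c"
 using linear_smult[OF aug_linear, of c "\<one>\<^sub>A"] T.eps_one by simp

text \<open>Both sides are linear in \<open>r\<close>, and on \<open>a \<otimes> b\<close>
  multiplicativity of \<epsilon> separates the three factors of \<open>a x b\<close>. This makes
  \<epsilon> semilinear over \<open>id \<otimes> \<epsilon>\<close>.\<close>

lemma aug_act:
 assumes r: "r : carrier T.T" and x: "x : carrier A"
 shows "\<epsilon> (act r x) = \<epsilon> (T.\<psi> r) \<otimes>\<^sub>k \<epsilon> x"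
proof (rule T.tensor_linear_eq[OF _ linear_comp[OF aug_linear act_linear] _ _ r])
 show g: "module k (ground k)" using unital_algebraD(1)[OF ground_algebra[OF T.V.R.is_cring]] .
 show "(\<lambda>r. \<epsilon> (T.\<psi> r) \<otimes>\<^sub>k \<epsilon> x) : linear_maps k T.T (ground k)"
  using linear_closed[OF aug_linear] x T.eps_closed linear_closed[OF linear_comp[OF aug_linear T.psi_linear]]
   linear_add[OF linear_comp[OF aug_linear T.psi_linear]] linear_smult[OF linear_comp[OF aug_linear T.psi_linear]]
  by (intro linear_mapsI) (simp_all add: T.V.R.l_distr T.V.R.m_assoc)
 fix a b assume "a : carrier A" "b : carrier (opposite A)"
 then show "\<epsilon> (act (pure a b) x) = \<epsilon> (T.\<psi> (pure a b)) \<otimes>\<^sub>k \<epsilon> x"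
  using x T.eps_closed T.eps_mult linear_smult[OF aug_linear]
  by (simp add: act_pure T.psi_pure T.V.R.m_ac)
qed (use x in simp)

lemma character_resolution:
 assumes "matrix_resolution T.T (regular_bimodule A) m E D t"
 shows "matrix_resolution A (character_module k \<epsilon>) m (\<lambda>n l i. T.\<psi> (E n l i)) (\<lambda>n l i. T.\<psi> (D n l i)) (\<lambda>l. \<epsilon> (t l))"
proof -
 interpret C: matrix_resolution T.T "regular_bimodule A" m E D t by fact
 \<comment> \<open>Over the second factor the regular bimodule is \<open>A\<close> itself: the unit
   generates it, the coordinate map is the identity, and the reduction is \<epsilon>.\<close>
 interpret R: augmented_resolution k A "opposite A" \<epsilon> "regular_bimodule A" m E D t "character_module k \<epsilon>" \<epsilon> id "\<one>\<^sub>A"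
 proof (intro augmented_resolution.intro augmented_resolution_axioms.intro T.augmented_tensor_axioms assms
   character_left_module[OF ground algebra augmentation])
  show "\<epsilon> : additive_maps (regular_bimodule A) (character_module k \<epsilon>)"
   using linear_additive[OF aug_linear] by (simp add: character_module_def additive_maps_def)
  show "\<epsilon> ` carrier (regular_bimodule A) = carrier (character_module k \<epsilon>)"
  proof
   show "\<epsilon> ` carrier (regular_bimodule A) \<subseteq> carrier (character_module k \<epsilon>)"
    using T.eps_closed by (auto simp: character_module_def)
   show "carrier (character_module k \<epsilon>) \<subseteq> \<epsilon> ` carrier (regular_bimodule A)"
   proof
    fix c assume "c : carrier (character_module k \<epsilon>)"
    then have "c = \<epsilon> (c \<odot>\<^sub>A \<one>\<^sub>A)" "c \<odot>\<^sub>A \<one>\<^sub>A : carrier A"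
     using aug_smult_one T.V.smult_closed by (simp_all add: character_module_def)
    then show "c : \<epsilon> ` carrier (regular_bimodule A)" by (intro image_eqI[of _ \<epsilon>]) simp_all
   qed
  qed
  show "id : additive_maps (regular_bimodule A) (opposite A)"
   by (simp add: additive_maps_def)
 qed (auto simp: character_module_def aug_act T.j_def act_pure T.eps_closed)
 show ?thesis by (rule R.augmented_matrix_resolution)
qed

end

section \<open>The cogroupoid as an instance of both changes of rings\<close>

section \<open>Base change from \<open>H\<close> to the enveloping algebra\<close>

context cogroupoid
begin

text \<open>Inserting the counit gives
  \<open>\<epsilon>(h_1) \<epsilon>(S(h_2)) = \<epsilon>(h_1 S(h_2))\<close>, and the antipode law
  evaluates the argument.\<close>

lemma eps_S:
 assumes X: "X : Ob" and h: "h : carrier (C X X)"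
 shows "\<epsilon> X (S X X h) = \<epsilon> X h"
proof -
 have b: "(\<lambda>a b. a \<otimes>\<^sub>(C X X) S X X b) : bilinear_maps k (C X X) (C X X) (C X X)"
  by (intro bilinearI) (use X in "auto intro!: lin_rules")
 have "\<epsilon> X (S X X h) = sw X X X (ground k) (\<lambda>a b. \<epsilon> X a \<odot>\<^sub>(ground k) \<epsilon> X (S X X b)) h"
  by (rule sw_counit_left[OF X X ground_mod _ h, symmetric]) (use X in "auto intro!: lin_rules")
 also have "... = sw X X X (ground k) (\<lambda>a b. \<epsilon> X (a \<otimes>\<^sub>(C X X) S X X b)) h"
  by (rule sw_cong[OF X X X h]) (use X in "simp add: eps_mult")
 also have "... = \<epsilon> X (sw X X X (C X X) (\<lambda>a b. a \<otimes>\<^sub>(C X X) S X X b) h)"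
  by (rule sw_map[OF X X X _ ground_mod b eps_linear[OF X] h]) (use X in simp)
 also have "... = \<epsilon> X h"
  unfolding antipode_right[OF X X h] using X h linear_smult[OF eps_linear[OF X]] counit_hom[OF X]
  by (simp add: algebra_homs_def ring_hom_def)
 finally show ?thesis .
qed

lemma augmented: "X : Ob ==> augmented_algebra k (C X X) (\<epsilon> X)"
 by (intro augmented_algebra.intro augmented_algebra_axioms.intro bimodule_algebra.intro ground_field counit_hom) simp_all

end

context cogroupoid_pair
begin

sublocale bim: bimodule_algebra k B
 by (simp add: bimodule_algebra_def)

lemma B_abelian [simp]: "abelian_group B" and H_abelian [simp]: "abelian_group H"
 using unital_algebraD(2)[OF alg] by (simp_all add: ring.is_abelian_group)

lemma pr_smult_left: "c : carrier k ==> a : carrier B ==> b : carrier B ==> pr (c \<odot>\<^sub>B a) b = c \<odot>\<^sub>R pr a b"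
 using linear_smult[OF bilinearD(1)[OF R.pure_bilinear]] by simp

lemma pr_smult_right: "c : carrier k ==> a : carrier B ==> b : carrier B ==> pr a (c \<odot>\<^sub>B b) = c \<odot>\<^sub>R pr a b"
 using linear_smult[OF bilinearD(2)[OF R.pure_bilinear]] by simp

lemma R_one [simp]: "r : carrier R ==> \<one>\<^sub>R \<otimes>\<^sub>R r = r" "r : carrier R ==> r \<otimes>\<^sub>R \<one>\<^sub>R = r" "\<one>\<^sub>R : carrier R"
 using ring.ring_simprules(6,12)[OF R.tensor_ring] monoid.r_one[OF ring.is_monoid[OF R.tensor_ring]] by auto

lemma delta_scalar_left: "c : carrier k ==> r : carrier R ==> \<delta> (c \<odot>\<^sub>H \<one>\<^sub>H) \<otimes>\<^sub>R r = c \<odot>\<^sub>R r"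
 by (simp add: delta_smult_one unital_algebraD(3)[OF R_alg])

lemma delta_scalar_right: "c : carrier k ==> r : carrier R ==> r \<otimes>\<^sub>R \<delta> (c \<odot>\<^sub>H \<one>\<^sub>H) = c \<odot>\<^sub>R r"
 by (simp add: delta_smult_one unital_algebraD(4)[OF R_alg])

text \<open>Under the bimodule action \<open>\<delta> h\<close> takes 1 to
  \<open>h_1 S(h_2)\<close>. Hence \<open>c \<mapsto> c 1\<close> is semilinear from the trivial
  module to \<open>B\<close>.\<close>

lemma act_delta:
 assumes h: "h : carrier H" and c: "c : carrier k"
 shows "bim.act (\<delta> h) (c \<odot>\<^sub>B \<one>\<^sub>B) = (\<epsilon> X h \<otimes>\<^sub>k c) \<odot>\<^sub>B \<one>\<^sub>B"
proof -
 have m: "module k B" by simp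
 have "bim.act (\<delta> h) (c \<odot>\<^sub>B \<one>\<^sub>B) = sw X Y X B (\<lambda>a g. bim.act (pr a (S Y X g)) (c \<odot>\<^sub>B \<one>\<^sub>B)) h"
  unfolding \<delta>_def by (rule sw_map[OF X X Y R_mod m delta_bilinear bim.act_linear h, symmetric]) (use c in simp)
 also have "... = sw X Y X B (\<lambda>a g. c \<odot>\<^sub>B (a \<otimes>\<^sub>B S Y X g)) h"
  by (rule sw_cong[OF X X Y h]) (use c in "simp add: bim.act_pure smult_mult_l smult_mult_r")
 also have "... = \<epsilon> X h \<odot>\<^sub>B (c \<odot>\<^sub>B \<one>\<^sub>B)"
  by (rule sw_antipode_right[OF X Y m _ h]) (use c in "auto intro!: lins")
 finally show ?thesis using h c by (simp add: module.smult_assoc1[OF m])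
qed

text \<open>This is \<open>\<beta> \<otimes> id\<close>; with \<beta> a coordinate function of
  \<open>B\<close> it extracts one \<open>H\<close>-coordinate of an element of
  \<open>B \<otimes> H\<close>.\<close>

definition contract where "contract \<beta> = tensor_lift H (\<lambda>b h. \<beta> b \<odot>\<^sub>H h)"

context
 fixes \<beta> assumes \<beta>: "\<beta> : linear_maps k B (ground k)"
begin

lemma beta_closed [simp]: "b : carrier B ==> \<beta> b : carrier k"
 using linear_closed[OF \<beta>] by simp

lemma contract_bilinear: "(\<lambda>b h. \<beta> b \<odot>\<^sub>H h) : bilinear_maps k B H H"
 by (intro bilinearI) (auto intro!: lins \<beta>)

lemma contract_linear: "contract \<beta> : linear_maps k BH H"
 unfolding contract_def by (rule BH.lift_linear[OF _ contract_bilinear]) simp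

lemma contract_pB: "b : carrier B ==> h : carrier H ==> contract \<beta> (pB b h) = \<beta> b \<odot>\<^sub>H h"
 unfolding contract_def by (rule BH.lift_pure[OF _ contract_bilinear]) simp_all

lemma contract_mult_right:
 assumes t: "t : carrier BH" and h: "h : carrier H"
 shows "contract \<beta> (t \<otimes>\<^sub>BH pB \<one>\<^sub>B h) = contract \<beta> t \<otimes>\<^sub>H h"
 by (rule BH.tensor_linear_eq[OF _ linear_comp[OF contract_linear BH.tensor_mult_right_linear]
    lin_mult_right[OF _ contract_linear] _ t])
  (use h in "simp_all add: BH.pure_mult contract_pB smult_mult_l")

lemma contract_mult_left:
 assumes t: "t : carrier BH" and h: "h : carrier H"
 shows "contract \<beta> (pB \<one>\<^sub>B h \<otimes>\<^sub>BH t) = h \<otimes>\<^sub>H contract \<beta> t"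
 by (rule BH.tensor_linear_eq[OF _ linear_comp[OF contract_linear BH.tensor_mult_left_linear]
    lin_mult_left[OF _ _ contract_linear] _ t])
  (use h in "simp_all add: BH.pure_mult contract_pB smult_mult_r")

lemma contract_Phi_right_linear: "(\<lambda>r. contract \<beta> (\<Phi> r)) : right_linear_maps H R \<delta>"
 unfolding right_linear_maps_def
 using linear_additive[OF linear_comp[OF contract_linear Phi_linear]] linear_closed[OF Phi_linear]
 by (simp add: Phi_right contract_mult_right)

lemma contract_Phi'_left_linear: "(\<lambda>r. contract \<beta> (\<Phi>' r)) : left_linear_maps H R \<delta>"
 unfolding left_linear_maps_def
 using linear_additive[OF linear_comp[OF contract_linear Phi'_linear]] linear_closed[OF Phi'_linear]
 by (simp add: Phi'_left contract_mult_left)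

end

text \<open>The elements \<open>f r\<close> are expanded in \<open>B \<otimes> H\<close> with the
  help of finitely many elements of \<open>B\<close>, and \<open>g\<close> carries the expansion
  back. The formulation serves the left and the right structure at once.\<close>

lemma tensor_basis:
 assumes W: "finite W" "W \<subseteq> carrier R" and f: "f : linear_maps k R BH" and g: "g : linear_maps k BH R"
  and gf: "\<forall>r\<in>carrier R. g (f r) = r"
 shows "\<exists>n b \<beta>. (\<forall>i<n::nat. b i : carrier B \<and> \<beta> i : linear_maps k B (ground k)) \<and>
  (\<forall>r\<in>W. r = (\<Oplus>\<^sub>R i\<in>{..<n}. g (pB (b i) (contract (\<beta> i) (f r)))))"
proof -
 have "finite (f ` W)" "f ` W \<subseteq> carrier BH" using W linear_closed[OF f] by blast+
 from BH.local_tensor_basis[OF ground_field this] obtain n :: nat and b \<beta>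
  where b\<beta>: "\<forall>i<n. b i : carrier B \<and> \<beta> i : linear_maps k B (ground k)"
   and e: "\<forall>t\<in>f ` W. t = (\<Oplus>\<^sub>BH i\<in>{..<n}. pB (b i) (tensor_lift H (\<lambda>b h. \<beta> i b \<odot>\<^sub>H h) t))"
  by (elim exE conjE) (rule that)
 have b: "b i : carrier B" and \<beta>: "\<beta> i : linear_maps k B (ground k)" if "i < n" for i
  using b\<beta> that by simp_all
 have "r = (\<Oplus>\<^sub>R i\<in>{..<n}. g (pB (b i) (contract (\<beta> i) (f r))))" if r: "r : W" for r
 proof -
  have "r : carrier R" using r W by blast
  then have "r = g (f r)" using gf by simp
  also have "... = g (\<Oplus>\<^sub>BH i\<in>{..<n}. pB (b i) (contract (\<beta> i) (f r)))" 
   using e r unfolding contract_def by (intro arg_cong[of _ _ g]) (rule bspec, simp_all)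
  also have "... = (\<Oplus>\<^sub>R i\<in>{..<n}. g (pB (b i) (contract (\<beta> i) (f r))))"
   by (rule additive_hom.map_finsum[OF additive_homI[OF BH.tensor_abelian_group R.tensor_abelian_group linear_additive[OF g]]])
    (rule funcsetI, rule pB_closed[OF b linear_closed[OF contract_linear[OF \<beta>] linear_closed[OF f \<open>r : carrier R\<close>]]], simp_all)
  finally show ?thesis .
 qed
 with b\<beta> show ?thesis by (intro exI[of _ n] exI[of _ b] exI[of _ \<beta>] conjI ballI)
qed

text \<open>The basis elements are \<open>b i \<otimes> 1\<close>. Acting on a scalar multiple of 1
  they give that multiple of \<open>b i\<close>, so \<open>b \<mapsto> b \<otimes> 1\<close>
  recovers them, as required of \<rho> in the flat base change.\<close>

lemma right_basis:
 assumes W: "finite W" "W \<subseteq> carrier R"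
 shows "\<exists>n u \<kappa>. (\<forall>i<n::nat. u i : carrier R \<and> \<kappa> i : right_linear_maps H R \<delta> \<and>
   (\<forall>z\<in>carrier k. pr (bim.act (u i) (z \<odot>\<^sub>B \<one>\<^sub>B)) \<one>\<^sub>B = u i \<otimes>\<^sub>R \<delta> (z \<odot>\<^sub>H \<one>\<^sub>H))) \<and>
  (\<forall>r\<in>W. r = (\<Oplus>\<^sub>R i\<in>{..<n}. u i \<otimes>\<^sub>R \<delta> (\<kappa> i r)))"
proof -
 have "\<forall>r\<in>carrier R. \<Theta> (\<Phi> r) = r" by (simp add: Theta_Phi)
 from tensor_basis[OF W Phi_linear Theta_linear this] obtain n :: nat and b \<beta>
  where b\<beta>: "\<forall>i<n. b i : carrier B \<and> \<beta> i : linear_maps k B (ground k)"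
   and e: "\<forall>r\<in>W. r = (\<Oplus>\<^sub>R i\<in>{..<n}. \<Theta> (pB (b i) (contract (\<beta> i) (\<Phi> r))))"
  by (elim exE conjE) (rule that)
 have b: "b i : carrier B" and \<beta>: "\<beta> i : linear_maps k B (ground k)" if "i < n" for i
  using b\<beta> that by simp_all
 have "r = (\<Oplus>\<^sub>R i\<in>{..<n}. pr (b i) \<one>\<^sub>B \<otimes>\<^sub>R \<delta> (contract (\<beta> i) (\<Phi> r)))" if r: "r : W" for r
 proof -
  have rR: "r : carrier R" using r W by blast
  have cl: "contract (\<beta> i) (\<Phi> r) : carrier H" if "i < n" for i
   using linear_closed[OF linear_comp[OF contract_linear[OF \<beta>[OF that]] Phi_linear] rR] .
  have "(\<Oplus>\<^sub>R i\<in>{..<n}. \<Theta> (pB (b i) (contract (\<beta> i) (\<Phi> r)))) =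
    (\<Oplus>\<^sub>R i\<in>{..<n}. pr (b i) \<one>\<^sub>B \<otimes>\<^sub>R \<delta> (contract (\<beta> i) (\<Phi> r)))"
   by (rule abelian_monoid.finsum_cong'[OF abelian_group.axioms(1)[OF R.tensor_abelian_group]])
    (use b cl in "simp_all add: Theta_pB R.tensor_mult_closed")
  with bspec[OF e r] show ?thesis by (rule HOL.trans)
 qed
 moreover have "pr (bim.act (pr (b i) \<one>\<^sub>B) (z \<odot>\<^sub>B \<one>\<^sub>B)) \<one>\<^sub>B = pr (b i) \<one>\<^sub>B \<otimes>\<^sub>R \<delta> (z \<odot>\<^sub>H \<one>\<^sub>H)"
  if "i < n" "z : carrier k" for i z
  using that b[OF that(1)] by (simp add: bim.act_pure delta_scalar_right pr_smult_left smult_mult_r)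
 ultimately show ?thesis
  by (intro exI[of _ n] exI[of _ "\<lambda>i. pr (b i) \<one>\<^sub>B"] exI[of _ "\<lambda>i r. contract (\<beta> i) (\<Phi> r)"])
   (simp add: b contract_Phi_right_linear[OF \<beta>])
qed

text \<open>The basis elements are \<open>1 \<otimes> b i\<close>. As \<open>\<mu>(1) = 1\<close>,
  the map \<pi> sends them to \<open>b i\<close>, and \<open>b \<mapsto> 1 \<otimes> b\<close>
  recovers them together with their scalar multiples.\<close>

lemma left_basis:
 assumes W: "finite W" "W \<subseteq> carrier R"
 shows "\<exists>n v \<kappa>. (\<forall>i<n::nat. v i : carrier R \<and> \<kappa> i : left_linear_maps H R \<delta> \<and>
   (\<forall>z\<in>carrier k. pr \<one>\<^sub>B (\<pi> (\<delta> (z \<odot>\<^sub>H \<one>\<^sub>H) \<otimes>\<^sub>R v i)) = \<delta> (z \<odot>\<^sub>H \<one>\<^sub>H) \<otimes>\<^sub>R v i)) \<and>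
  (\<forall>r\<in>W. r = (\<Oplus>\<^sub>R i\<in>{..<n}. \<delta> (\<kappa> i r) \<otimes>\<^sub>R v i))"
proof -
 have "\<forall>r\<in>carrier R. \<Theta>' (\<Phi>' r) = r" by (simp add: Theta'_Phi')
 from tensor_basis[OF W Phi'_linear Theta'_linear this] obtain n :: nat and b \<beta>
  where b\<beta>: "\<forall>i<n. b i : carrier B \<and> \<beta> i : linear_maps k B (ground k)"
   and e: "\<forall>r\<in>W. r = (\<Oplus>\<^sub>R i\<in>{..<n}. \<Theta>' (pB (b i) (contract (\<beta> i) (\<Phi>' r))))"
  by (elim exE conjE) (rule that)
 have b: "b i : carrier B" and \<beta>: "\<beta> i : linear_maps k B (ground k)" if "i < n" for i
  using b\<beta> that by simp_all
 have "r = (\<Oplus>\<^sub>R i\<in>{..<n}. \<delta> (contract (\<beta> i) (\<Phi>' r)) \<otimes>\<^sub>R pr \<one>\<^sub>B (b i))" if r: "r : W" for r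
 proof -
  have rR: "r : carrier R" using r W by blast
  have cl: "contract (\<beta> i) (\<Phi>' r) : carrier H" if "i < n" for i
   using linear_closed[OF linear_comp[OF contract_linear[OF \<beta>[OF that]] Phi'_linear] rR] .
  have "(\<Oplus>\<^sub>R i\<in>{..<n}. \<Theta>' (pB (b i) (contract (\<beta> i) (\<Phi>' r)))) =
    (\<Oplus>\<^sub>R i\<in>{..<n}. \<delta> (contract (\<beta> i) (\<Phi>' r)) \<otimes>\<^sub>R pr \<one>\<^sub>B (b i))"
   by (rule abelian_monoid.finsum_cong'[OF abelian_group.axioms(1)[OF R.tensor_abelian_group]])
    (use b cl in "simp_all add: Theta'_pB R.tensor_mult_closed")
  with bspec[OF e r] show ?thesis by (rule HOL.trans)
 qed
 moreover have "pr \<one>\<^sub>B (\<pi> (\<delta> (z \<odot>\<^sub>H \<one>\<^sub>H) \<otimes>\<^sub>R pr \<one>\<^sub>B (b i))) = \<delta> (z \<odot>\<^sub>H \<one>\<^sub>H) \<otimes>\<^sub>R pr \<one>\<^sub>B (b i)"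
  if "i < n" "z : carrier k" for i z
  using that b[OF that(1)]
  by (simp add: delta_scalar_left linear_smult[OF pi_linear] pi_pr mu_one pr_smult_right)
 ultimately show ?thesis
  by (intro exI[of _ n] exI[of _ "\<lambda>i. pr \<one>\<^sub>B (b i)"] exI[of _ "\<lambda>i r. contract (\<beta> i) (\<Phi>' r)"])
   (simp add: b contract_Phi'_left_linear[OF \<beta>])
qed


text \<open>Both sides are linear in \<open>r\<close> and in \<open>s\<close>; on pure tensors the
  claim is multiplicativity of \<mu>. It says that \<pi> is a map of right modules to the twisted
  bimodule.\<close>

lemma pi_mult:
 assumes r: "r : carrier R" and s: "s : carrier R"
 shows "\<pi> (r \<otimes>\<^sub>R s) = tensor_lift B (\<lambda>a b. b \<otimes>\<^sub>B \<pi> r \<otimes>\<^sub>B \<mu> a) s"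
proof -
 have m: "module k B" by simp
 have bil: "(\<lambda>a b. b \<otimes>\<^sub>B x \<otimes>\<^sub>B \<mu> a) : bilinear_maps k B (opposite B) B" if "x : carrier B" for x
  by (intro bilinearI) (use that in "auto intro!: lins lin_mu")
 have pc: "\<pi> r : carrier B" if "r : carrier R" for r using linear_closed[OF pi_linear that] .
 have lin: "(\<lambda>x. tensor_lift B (\<lambda>a b. b \<otimes>\<^sub>B x \<otimes>\<^sub>B \<mu> a) s) : linear_maps k B B"
  by (rule R.lift_parametric_linear[OF m m bil]) (use s in "auto intro!: lins")
 show ?thesis
 proof (rule R.tensor_linear_eq[OF m linear_comp[OF pi_linear R.tensor_mult_right_linear[OF s]] linear_comp[OF lin pi_linear] _ r])
  fix a b assume a: "a : carrier B" and "b : carrier (opposite B)"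
  then have b: "b : carrier B" by simp
  have p: "\<pi> (pr a b) : carrier B" using a b by (simp add: pc)
  show "\<pi> (pr a b \<otimes>\<^sub>R s) = tensor_lift B (\<lambda>a' b'. b' \<otimes>\<^sub>B \<pi> (pr a b) \<otimes>\<^sub>B \<mu> a') s"
  proof (rule R.tensor_linear_eq[OF m linear_comp[OF pi_linear R.tensor_mult_left_linear] R.lift_linear[OF m bil[OF p]] _ s])
   show "pr a b : carrier R" using a b by simp
   fix a' b' assume a': "a' : carrier B" and "b' : carrier (opposite B)"
   then have b': "b' : carrier B" by simp
   show "\<pi> (pr a b \<otimes>\<^sub>R pr a' b') = tensor_lift B (\<lambda>a' b'. b' \<otimes>\<^sub>B \<pi> (pr a b) \<otimes>\<^sub>B \<mu> a') (pr a' b')"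
    using a b a' b' p by (simp add: R.lift_pure[OF m bil] pr_mult pi_pr mu_mult assoc_C)
  qed
 qed
qed

lemma enveloping_R: "enveloping k B = R"
 by (simp add: enveloping_def)

lemma base_change:
 assumes "matrix_resolution H (character_module k (\<epsilon> X)) m E D t"
 shows "matrix_base_change H (character_module k (\<epsilon> X)) m E D t R \<delta> (regular_bimodule B) (\<lambda>c. c \<odot>\<^sub>B \<one>\<^sub>B)"
 using assms
proof (intro matrix_base_change.intro matrix_base_change_axioms.intro bim.regular_bimodule_module delta_ring_hom)
 show "(\<lambda>c. c \<odot>\<^sub>B \<one>\<^sub>B) : additive_maps (character_module k (\<epsilon> X)) (regular_bimodule B)"
  using linear_additive[OF smult_linear_fun[of k B]] by (simp add: character_module_def additive_maps_def)
qed (simp_all add: character_module_def act_delta)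

theorem bimodule_resolution:
 assumes Q: "matrix_resolution H (character_module k (\<epsilon> X)) m E D t"
 shows "matrix_resolution R (regular_bimodule B) m (\<lambda>n l i. \<delta> (E n l i)) (\<lambda>n l i. \<delta> (D n l i)) (\<lambda>l. t l \<odot>\<^sub>B \<one>\<^sub>B)"
proof -
 \<comment> \<open>Here \<open>b \<mapsto> b \<otimes> 1\<close> plays the role of \<rho>, the
   trivial module is generated by 1, and scalars are lifted to multiples of the unit of
   \<open>H\<close>.\<close>
 have "flat_base_change H (character_module k (\<epsilon> X)) m E D t R \<delta> (regular_bimodule B) (\<lambda>c. c \<odot>\<^sub>B \<one>\<^sub>B)
   (\<lambda>b. pr b \<one>\<^sub>B) (\<lambda>c. c \<odot>\<^sub>H \<one>\<^sub>H) \<one>\<^sub>k"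
 proof (intro flat_base_change.intro flat_base_change_axioms.intro base_change[OF Q])
  show "(\<lambda>b. pr b \<one>\<^sub>B) : additive_maps (regular_bimodule B) R"
   using linear_additive[OF bilinearD(1)[OF R.pure_bilinear]] by simp
  fix n assume "n : carrier (regular_bimodule B)"
  then show "\<exists>r\<in>carrier R. n = r \<odot>\<^sub>(regular_bimodule B) (\<one>\<^sub>k \<odot>\<^sub>B \<one>\<^sub>B)"
   by (intro bexI[of _ "pr n \<one>\<^sub>B"]) (simp_all add: bim.act_pure)
 next
  fix W assume "finite W" "W \<subseteq> carrier R"
  from right_basis[OF this] show "\<exists>n u \<kappa>. (\<forall>i<n::nat. u i : carrier R \<and> \<kappa> i : right_linear_maps H R \<delta> \<and>
     (\<forall>z\<in>carrier (character_module k (\<epsilon> X)). pr (u i \<odot>\<^sub>(regular_bimodule B) (z \<odot>\<^sub>B \<one>\<^sub>B)) \<one>\<^sub>B = u i \<otimes>\<^sub>R \<delta> (z \<odot>\<^sub>H \<one>\<^sub>H))) \<and>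
   (\<forall>r\<in>W. r = (\<Oplus>\<^sub>R i\<in>{..<n}. u i \<otimes>\<^sub>R \<delta> (\<kappa> i r)))"
   by (simp add: character_module_def)
 next
  fix z assume z: "z : carrier (character_module k (\<epsilon> X))"
  then show "z \<odot>\<^sub>H \<one>\<^sub>H : carrier H" by (simp add: character_module_def)
  show "(z \<odot>\<^sub>H \<one>\<^sub>H) \<odot>\<^sub>(character_module k (\<epsilon> X)) \<one>\<^sub>k = z"
   using z augmented_algebra.aug_smult_one[OF augmented[OF X]] by (simp add: character_module_def)
 qed (simp add: character_module_def)
 then show ?thesis by (rule flat_base_change.base_change_resolution)
qed

text \<open>The cohomology \<open>L\<close> is the character module of \<xi>, generated by 1, and
  \<open>Q\<close> is the bimodule twisted by \<mu>. The map
  \<open>b \<mapsto> 1 \<otimes> b\<close> is a section of \<pi>. Since \<open>h\<close> acts on the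
  generator as \<open>\<xi> h\<close>, the condition \<open>\<pi>_phi\<close> is
  \<open>pi_delta\<close>.\<close>

theorem dual_change:
 assumes Q: "matrix_resolution H (character_module k (\<epsilon> X)) m E D t"
 shows "dual_base_change H (character_module k (\<epsilon> X)) m E D t R \<delta> (regular_bimodule B) (\<lambda>c. c \<odot>\<^sub>B \<one>\<^sub>B)
  (character_module k \<xi>) (twisted_bimodule B \<mu>) \<one>\<^sub>k (\<lambda>c. c \<odot>\<^sub>H \<one>\<^sub>H) \<pi> (\<lambda>b. pr \<one>\<^sub>B b)"
proof (intro dual_base_change.intro dual_base_change_axioms.intro base_change[OF Q] bimodule_resolution[OF Q])
 show "left_module H (character_module k \<xi>)"
  by (rule character_left_module[OF ground_field _ \<xi>]) simp
 show "abelian_group (twisted_bimodule B \<mu>)"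
  unfolding twisted_bimodule_def by (rule with_action_abelian) simp
 show "(\<lambda>c. c \<odot>\<^sub>H \<one>\<^sub>H) : additive_maps (character_module k \<xi>) H"
  using linear_additive[OF smult_linear_fun[of k H]] by (simp add: character_module_def additive_maps_def)
 show "\<pi> : additive_maps R (twisted_bimodule B \<mu>)"
  using linear_additive[OF pi_linear] by (simp add: twisted_bimodule_def)
 show "(\<lambda>b. pr \<one>\<^sub>B b) : additive_maps (twisted_bimodule B \<mu>) R"
  using linear_additive[OF bilinearD(2)[OF R.pure_bilinear]] by (simp add: twisted_bimodule_def additive_maps_def)
next
 fix W assume "finite W" "W \<subseteq> carrier R"
 from left_basis[OF this] show "\<exists>n v \<kappa>. (\<forall>i<n::nat. v i : carrier R \<and> \<kappa> i : left_linear_maps H R \<delta> \<and>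
   (\<forall>z\<in>carrier (character_module k \<xi>). pr \<one>\<^sub>B (\<pi> (\<delta> (z \<odot>\<^sub>H \<one>\<^sub>H) \<otimes>\<^sub>R v i)) = \<delta> (z \<odot>\<^sub>H \<one>\<^sub>H) \<otimes>\<^sub>R v i)) \<and>
  (\<forall>r\<in>W. r = (\<Oplus>\<^sub>R i\<in>{..<n}. \<delta> (\<kappa> i r) \<otimes>\<^sub>R v i))"
  by (simp add: character_module_def)
next
 fix r s assume "r : carrier R" "s : carrier R"
 then show "\<pi> (r \<otimes>\<^sub>R s) = s \<odot>\<^sub>(twisted_bimodule B \<mu>) \<pi> r"
  by (simp add: twisted_bimodule_def pi_mult)
next
 fix h r assume "h : carrier H" "r : carrier R"
 then show "\<pi> (\<delta> h \<otimes>\<^sub>R r) = \<pi> (\<delta> ((h \<odot>\<^sub>(character_module k \<xi>) \<one>\<^sub>k) \<odot>\<^sub>H \<one>\<^sub>H) \<otimes>\<^sub>R r)"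
  by (simp add: character_module_def pi_delta delta_scalar_left linear_smult[OF pi_linear])
next
 fix z assume "z : carrier (character_module k \<xi>)"
 then show "(z \<odot>\<^sub>H \<one>\<^sub>H) \<odot>\<^sub>(character_module k \<xi>) \<one>\<^sub>k = z"
  using linear_smult[OF xi_linear, of z "\<one>\<^sub>H"] by (simp add: character_module_def xi_one)
next
 fix q assume "q : carrier (twisted_bimodule B \<mu>)"
 then show "\<pi> (pr \<one>\<^sub>B q) = q" by (simp add: twisted_bimodule_def pi_pr mu_one)
qed (simp add: character_module_def)

end

section \<open>Ext read off an arbitrary matrix resolution, and the conclusion\<close>

section \<open>Ext over the enveloping algebra\<close>

context matrix_resolution
begin

lemma chosen_resolution_projective_if_nontrivial:
 assumes two: "\<exists>a b :: 'r. a \<noteq> b"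
 obtains P' d' e' where "chosen_resolution R M = (P', d')" "projective_resolution R M P' d' e'"
proof -
 obtain Q :: "('r, 'm) res_modules" and d e where "projective_resolution R M Q d e"
  by (rule resolution_in_syzygies[OF two]) (rule that)
 then show ?thesis by (rule chosen_resolution_projective) (rule that)
qed

text \<open>The resolution behind \<open>Ext_regular\<close> is unknown. The transfer theorem, used
  in both directions, replaces it by the given one, where cohomology is a matter of columns.\<close>

lemma Ext_trivial_iff:
 assumes two: "\<exists>a b :: 'r. a \<noteq> b"
 shows "carrier (Ext_regular R M i) = {\<zero>\<^sub>(Ext_regular R M i)} \<longleftrightarrow>
  col_cocycles R m E D i \<subseteq> col_coboundaries R m D i"
proof -
 obtain P' d' e' where c: "chosen_resolution R M = (P', d')" "projective_resolution R M P' d' e'"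
  using chosen_resolution_projective_if_nontrivial[OF two] .
 have M: "left_module R M" by (rule left_module_axioms)
 have "carrier (Ext_regular R M i) = {\<zero>\<^sub>(Ext_regular R M i)} \<longleftrightarrow>
   dual_cocycles R P' d' i \<subseteq> dual_coboundaries R P' d' i"
  using module_complex.dual_cohomology_trivial_iff[OF resolution_complex[OF c(2)]]
  by (simp add: Ext_regular_def c(1))
 also have "... \<longleftrightarrow> dual_cocycles R P dP i \<subseteq> dual_coboundaries R P dP i"
  using cohomology_vanish_transfer[OF c(2) row_resolution[OF two] M]
   cohomology_vanish_transfer[OF row_resolution[OF two] c(2) M] by blast
 finally show ?thesis by (simp add: col_vanish_iff)
qed

lemma Ext_iso_iff:
 assumes two: "\<exists>a b :: 'r. a \<noteq> b" and N: "abelian_group N"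
 shows "module_iso R (Ext_regular R M i) N \<longleftrightarrow> (\<exists>l. col_onto R m E D i N l)"
proof -
 obtain P' d' e' where c: "chosen_resolution R M = (P', d')" "projective_resolution R M P' d' e'"
  using chosen_resolution_projective_if_nontrivial[OF two] .
 have M: "left_module R M" by (rule left_module_axioms)
 have "module_iso R (Ext_regular R M i) N \<longleftrightarrow> (\<exists>l. cohomology_onto R P' d' i N l)"
  using module_complex.module_iso_dual_cohomology_iff[OF resolution_complex[OF c(2)] N]
  by (simp add: Ext_regular_def c(1))
 also have "... \<longleftrightarrow> (\<exists>l. cohomology_onto R P dP i N l)"
  using cohomology_onto_transfer[OF c(2) row_resolution[OF two] M N]
   cohomology_onto_transfer[OF row_resolution[OF two] c(2) M N] by blast
 also have "... \<longleftrightarrow> (\<exists>l. col_onto R m E D i N l)"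
  using col_onto_if_cohomology_onto cohomology_onto_if_col_onto[OF two] by blast
 finally show ?thesis .
qed

end

text \<open>Tensors are sets of lists, so their type has two elements whatever the algebras
  are.\<close>

lemma tensor_two: "\<exists>a b :: ('a \<times> 'b) list set. a \<noteq> b"
 by (rule exI[of _ "{}"], rule exI[of _ UNIV]) simp

text \<open>Applying \<open>id \<otimes> \<epsilon>\<close> to \<open>h_1 \<otimes> S(h_2)\<close>
  gives \<open>\<epsilon>(S(h_2)) h_1\<close>, where the antipode drops out under \<epsilon>. So
  \<psi> is a retraction of \<delta> for the pair of equal objects.\<close>

lemma (in cogroupoid) psi_delta:
 assumes X: "X : Ob" and h: "h : carrier (C X X)"
 shows "augmented_tensor.\<psi> (C X X) (\<epsilon> X) (sw X X X (tensor k (C X X) (opposite (C X X)))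
  (\<lambda>a g. pure_tensor k (C X X) (opposite (C X X)) a (S X X g)) h) = h"
proof -
 interpret A: augmented_algebra k "C X X" "\<epsilon> X" by (rule augmented[OF X])
 have b: "(\<lambda>a g. pure_tensor k (C X X) (opposite (C X X)) a (S X X g)) \<in>
   bilinear_maps k (C X X) (C X X) (tensor k (C X X) (opposite (C X X)))"
  by (intro bilinearI) (use X in "auto intro!: lin_rules lin_pure_left lin_pure_right opposite_module")
 have "A.T.\<psi> (sw X X X (tensor k (C X X) (opposite (C X X)))
   (\<lambda>a g. pure_tensor k (C X X) (opposite (C X X)) a (S X X g)) h) =
  sw X X X (C X X) (\<lambda>a g. A.T.\<psi> (pure_tensor k (C X X) (opposite (C X X)) a (S X X g))) h"
  by (rule sw_map[OF X X X A.T.tensor_module _ b A.T.psi_linear h, symmetric]) (use X in simp)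
 also have "... = sw X X X (C X X) (\<lambda>a g. \<epsilon> X g \<odot>\<^sub>(C X X) a) h"
  by (rule sw_cong[OF X X X h]) (use X in "simp add: A.T.psi_pure eps_S")
 also have "... = h" by (rule counit_right[OF X X h])
 finally show ?thesis .
qed

theorem theorem0p1:
  fixes k :: "'k ring"
    and Ob :: "'o set"
    and C :: "'o \<Rightarrow> 'o \<Rightarrow> ('k, 'a) module"
    and \<Delta> :: "'o \<Rightarrow> 'o \<Rightarrow> 'o \<Rightarrow> 'a \<Rightarrow> ('a \<times> 'a) list set"
    and \<epsilon> :: "'o \<Rightarrow> 'a \<Rightarrow> 'k"
    and S :: "'o \<Rightarrow> 'o \<Rightarrow> 'a \<Rightarrow> 'a"
    and X :: 'o and d :: nat and \<xi> :: "'a \<Rightarrow> 'k"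
  assumes "cogroupoid k Ob C \<Delta> \<epsilon> S"
    and "connected_cocategory Ob C"
    and "\<forall>Y\<in>Ob. \<forall>Z\<in>Ob. bij_betw (S Y Z) (carrier (C Y Z)) (carrier (C Z Y))"
    and "X \<in> Ob"
    and "twisted_CY k (C X X) d"
    and "\<xi> \<in> algebra_homs k (C X X) (ground k)"
    and "module_iso (C X X) (left_homological_integral k (C X X) (\<epsilon> X) d) (character_module k \<xi>)"
  shows "\<forall>Y\<in>Ob. twisted_CY_with_Nakayama k (C X Y) d
           (\<lambda>x. tensor_lift (C X Y) (\<lambda>x\<^sub>1 x\<^sub>2. \<xi> x\<^sub>1 \<odot>\<^bsub>C X Y\<^esub> S Y X (S X Y x\<^sub>2)) (\<Delta> X X Y x))"
proof
 fix Y assume Y: "Y : Ob"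
 interpret cogroupoid k Ob C \<Delta> \<epsilon> S by fact
 note X = \<open>X : Ob\<close>
 \<comment> \<open>The construction is used at two objects: at \<open>Y\<close> for the conclusion,
   and at \<open>X\<close> to bring the Calabi-Yau hypothesis down to \<open>H\<close>.\<close>
 have pair: "cogroupoid_pair k Ob C \<Delta> \<epsilon> S X Z \<xi>" if "Z : Ob" for Z
  using assms that by (intro cogroupoid_pair.intro cogroupoid_pair_axioms.intro cogroupoid_axioms) simp_all
 let ?H = "C X X" and ?K = "character_module k (\<epsilon> X)"
 let ?He = "tensor k ?H (opposite ?H)"
 interpret P: cogroupoid_pair k Ob C \<Delta> \<epsilon> S X Y \<xi> by (rule pair[OF Y])
 interpret A: augmented_algebra k ?H "\<epsilon> X" by (rule augmented[OF X])
 from \<open>twisted_CY k ?H d\<close> obtain \<mu> where CY: "twisted_CY_with_Nakayama k ?H d \<mu>"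
  by (auto simp: twisted_CY_def)
 then have "homologically_smooth k ?H" by (simp add: twisted_CY_with_Nakayama_def)
 then obtain P :: "(('a \<times> 'a) list set, 'a) res_modules" and dP eP N
  where res: "projective_resolution ?He (regular_bimodule ?H) P dP eP"
   and fg': "\<forall>n. fin_gen_module ?He (P n)" and bd: "\<forall>n>N. carrier (P n) = {\<zero>\<^sub>(P n)}"
  unfolding homologically_smooth_def enveloping_def by (elim exE conjE) (rule that)
 have fg: "fin_gen_module ?He (P n)" for n using fg' by simp
 from matrix_resolution_exists[OF A.regular_bimodule_module res fg] obtain m E D t
  where mr: "matrix_resolution ?He (regular_bimodule ?H) m E D t"
   and E0': "\<forall>n. carrier (P n) = {\<zero>\<^sub>(P n)} \<longrightarrow> (\<forall>l<m n. \<forall>i. E n l i = \<zero>\<^sub>?He)"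
  by (elim exE conjE) (rule that)
 have E0: "E n l i = \<zero>\<^sub>?He" if "n > N" "l < m n" for n l i
  using mp[OF spec[OF E0'] mp[OF spec[OF bd] that(1)]] that(2) by simp
 \<comment> \<open>The bimodule resolution of \<open>H\<close>, reduced along
   \<open>id \<otimes> \<epsilon>\<close>, resolves the trivial module over
   \<open>H\<close>.\<close>
 define E' D' t' where "E' = (\<lambda>n l i. A.T.\<psi> (E n l i))" and "D' = (\<lambda>n l i. A.T.\<psi> (D n l i))" and "t' l = \<epsilon> X (t l)" for l
 have Q: "matrix_resolution ?H ?K m E' D' t'"
  using A.character_resolution[OF mr] by (simp add: E'_def D'_def t'_def[abs_def])
 have E'0: "E' n l i = \<zero>\<^sub>?H" if "n > N" "l < m n" for n l i
  using E0[OF that] additive_hom.map_zero[OF additive_homI[OF A.T.tensor_abelian_group _ linear_additive[OF A.T.psi_linear]]]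
   P.H_abelian by (simp add: E'_def)
 interpret Q: matrix_resolution ?H ?K m E' D' t' by (rule Q)
 \<comment> \<open>The counit sends 1 to 1, which is nonzero in the field, so \<open>H\<close> has
   two distinct elements.\<close>
 have twoH: "\<exists>a b :: 'a. a \<noteq> b"
 proof (intro exI notI)
  assume "\<one>\<^sub>?H = \<zero>\<^sub>?H"
  moreover have "abelian_group (ground k)"
   unfolding ground_def by (rule with_action_abelian) (rule k.is_abelian_group)
  ultimately have "\<one>\<^sub>k = \<zero>\<^sub>k"
   using A.T.eps_one additive_hom.map_zero[OF additive_homI[OF P.H_abelian _ linear_additive[OF A.aug_linear]]]
   by simp
  then show False by simp
 qed

 \<comment> \<open>Base change along \<delta> at the object \<open>X\<close> leads back to a
   bimodule resolution of \<open>H\<close>, possibly different from the original one. The assumed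
   vanishing of Ext holds for it too, and the retraction \<psi> carries it down to
   \<open>H\<close>.\<close>
 have van: "col_cocycles ?H m E' D' i \<subseteq> col_coboundaries ?H m D' i" if i: "i \<noteq> d" for i
 proof -
  interpret PX: cogroupoid_pair k Ob C \<Delta> \<epsilon> S X X \<xi> by (rule pair[OF X])
  interpret QX: matrix_resolution ?He "regular_bimodule ?H" m "\<lambda>n l i. PX.\<delta> (E' n l i)" "\<lambda>n l i. PX.\<delta> (D' n l i)"
   "\<lambda>l. t' l \<odot>\<^sub>?H \<one>\<^sub>?H"
   by (rule PX.bimodule_resolution[OF Q])
  have "carrier (Ext_regular ?He (regular_bimodule ?H) i) = {\<zero>\<^sub>(Ext_regular ?He (regular_bimodule ?H) i)}"
   using CY i by (simp add: twisted_CY_with_Nakayama_def enveloping_def)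
  then have v: "col_cocycles ?He m (\<lambda>n l i. PX.\<delta> (E' n l i)) (\<lambda>n l i. PX.\<delta> (D' n l i)) i \<subseteq>
    col_coboundaries ?He m (\<lambda>n l i. PX.\<delta> (D' n l i)) i"
   unfolding QX.Ext_trivial_iff[OF tensor_two] .
  show ?thesis
   by (rule matrix_base_change.vanish_descent[OF PX.base_change[OF Q] A.T.psi_ring_hom _ v])
    (use psi_delta[OF X] in "simp add: PX.\<delta>_def")
 qed
 have \<xi>_group: "abelian_group (character_module k \<xi>)"
  unfolding character_module_def by (rule with_action_abelian) (rule k.is_abelian_group)
 \<comment> \<open>The hypothesis on the homological integral, turned into a statement about
   columns; it is the input for degree \<open>d\<close>.\<close>
 obtain l where l: "col_onto ?H m E' D' d (character_module k \<xi>) l"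
  using assms(7) unfolding left_homological_integral_def Q.Ext_iso_iff[OF twoH \<xi>_group] by blast

 interpret B: matrix_resolution P.R "regular_bimodule P.B" m "\<lambda>n l i. P.\<delta> (E' n l i)" "\<lambda>n l i. P.\<delta> (D' n l i)"
  "\<lambda>l. t' l \<odot>\<^sub>P.B \<one>\<^sub>P.B"
  by (rule P.bimodule_resolution[OF Q])
 have smooth: "homologically_smooth k P.B"
 proof (rule B.resolution_in_syzygies[OF tensor_two])
  fix M :: "(('a \<times> 'a) list set, 'a) res_modules" and f e
  assume M: "projective_resolution P.R (regular_bimodule P.B) M f e" "\<And>n. fin_gen_module P.R (M n)"
   "\<And>n. (\<And>l i. l < m n ==> P.\<delta> (E' n l i) = \<zero>\<^sub>P.R) ==> carrier (M n) = {\<zero>\<^sub>(M n)}"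
  \<comment> \<open>Boundedness: beyond \<open>N\<close> the idempotents over the enveloping algebra
    of \<open>H\<close> are zero, and they remain zero under both ring homomorphisms.\<close>
  have "carrier (M n) = {\<zero>\<^sub>(M n)}" if n: "n > N" for n
   by (rule M(3)) (use E'0[OF n] matrix_base_change.phi_zero[OF P.base_change[OF Q]] in simp)
  then show "homologically_smooth k P.B" unfolding homologically_smooth_def enveloping_def using M(1,2) by blast
 qed
 have Ext0: "carrier (Ext_regular P.R (regular_bimodule P.B) i) = {\<zero>\<^sub>(Ext_regular P.R (regular_bimodule P.B) i)}"
  if "i \<noteq> d" for i
  unfolding B.Ext_trivial_iff[OF tensor_two]
  by (rule dual_base_change.vanish_base_change[OF P.dual_change[OF Q] van[OF that]])
 have twisted_group: "abelian_group (twisted_bimodule P.B P.\<mu>)"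
  unfolding twisted_bimodule_def by (rule with_action_abelian) simp
 have Extd: "module_iso P.R (Ext_regular P.R (regular_bimodule P.B) d) (twisted_bimodule P.B P.\<mu>)"
  unfolding B.Ext_iso_iff[OF tensor_two twisted_group]
  by (intro dual_base_change.col_onto_base_change[OF P.dual_change[OF Q] l])
 have "twisted_CY_with_Nakayama k P.B d P.\<mu>"
  unfolding twisted_CY_with_Nakayama_def P.enveloping_R
  using smooth P.mu_hom P.mu_bij Ext0 Extd Y X by simp
 then show "twisted_CY_with_Nakayama k (C X Y) d
   (\<lambda>x. tensor_lift (C X Y) (\<lambda>x\<^sub>1 x\<^sub>2. \<xi> x\<^sub>1 \<odot>\<^sub>(C X Y) S Y X (S X Y x\<^sub>2)) (\<Delta> X X Y x))"
  unfolding P.\<mu>_def[abs_def] .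
qed

end
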